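(* Let $n\geq 8$ be a power of $2$ and let $q\geq 5$ be an integer. Let $L$ be an $m$-component link in $S^3$, and let $\lambda_i$ be its $i$th longitude word $(1\leq i\leq m)$ obtained from a diagram of $L$. Fix $i\in\{1,\ldots,m\}$ and write $$E^{(2)}\left(\left[\alpha_i,\eta_q(\lambda_i)\right]\right)=1+\sum_{j\geq 1}\ \sum_{k_1,\ldots,k_j\in\{1,\ldots,m\}} c(k_1,\ldots,k_j)\,X_{k_1}\cdots X_{k_j}$$ with coefficients $c(k_1,\ldots,k_j)\in\mathbb{Z}_2$. If $L$ is $4$-equivalent to the trivial $m$-component link, then the following hold (all indices range over $\{1,\ldots,m\}$). (1) $c(k)=c(k,k)=c(k,k,k)=c(k,k,k,k)=0$ for any $k$. (2) $c(k,l,l)=c(l,k,k)=c(k,k,l)=c(l,l,k)$ for any $k\neq l$. (3) $c(k,l,k,l)=c(l,k,l,k)$, $c(k,k,l,l)=c(l,l,k,k)$, and $c(k,k,k,l)=c(k,k,l,k)=c(k,l,k,k)=c(l,k,k,k)$ for any $k\neq l$. (4) For any $k_1,k_2,k_3,k_4$: if $c(k_1,k_2,k_3,k_4)\neq 0$ and the cardinality $|\{k_1,k_2,k_3,k_4\}|=3$, then $k_1=k_2$, $k_2=k_3$, or $k_3=k_4$. (5) $c(k_1,\ldots,k_j)=0$ for any pairwise distinct indices $k_1,\ldots,k_j$ with $j<\min\{n,q\}$.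
   Context: All links are ordered and oriented links in $S^3$. A $4$-move on a link is the local move which, inside a ball, replaces two parallel strands without crossings by the two strands twisted around each other with four half-twists (four crossings all of the same twisting direction), or the reverse; the move is applied irrespective of the orientations of the strands. Two links are $4$-equivalent if they are related by a finite sequence of $4$-moves and isotopies. For a set $X$, $F(X)$ denotes the free group on $X$. Commutators are $[a,b]=a^{-1}b^{-1}ab$. Longitude words and the maps $\eta_q$. Take a diagram of the $m$-component link $L$. For each $i$, choose one arc of the $i$th component and call it $x_{i1}$; let $x_{i2},\ldots,x_{ir_i}$ be the other arcs of the $i$th component met in turn following the orientation, where $r_i$ is the number of arcs of the $i$th component (an arc goes from one under-crossing to the next). Let $X=\{x_{ij}\mid 1\le i\le m,\ 1\le j\le r_i\}$. Let $u_{ij}\in X$ be the over-passing arc at the crossing separating $x_{ij}$ and $x_{i\,j+1}$ (with $x_{i\,r_i+1}=x_{i1}$), and let $\varepsilon_{ij}\in\{1,-1\}$ be the sign of that crossing. Put $v_{ij}=u_{i1}^{\varepsilon_{i1}}u_{i2}^{\varepsilon_{i2}}\cdots u_{ij}^{\varepsilon_{ij}}\in F(X)$. The $i$th longitude word is $\lambda_i=v_{ir_i}$ (if the $i$th component has no under-crossing, then it is a single arc and $\lambda_i$ is the empty word). Let $A=\{\alpha_1,\ldots,\alpha_m\}$. Homomorphisms $\eta_q:F(X)\to F(A)$, $q\ge1$, are defined inductively by $\eta_1(x_{ij})=\alpha_i$, and $\eta_{q+1}(x_{i1})=\alpha_i$, $\eta_{q+1}(x_{i\,j+1})=\eta_q(v_{ij}^{-1})\,\alpha_i\,\eta_q(v_{ij})$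 for $1\le j\le r_i-1$. Magnus $\mathbb{Z}_2$-expansion. $\mathbb{Z}_2=\mathbb{Z}/2\mathbb{Z}$. $E^{(2)}$ is the homomorphism from $F(A)$ to (the group of units of) the ring of formal power series in non-commutative variables $X_1,\ldots,X_m$ with coefficients in $\mathbb{Z}_2$ defined by $E^{(2)}(\alpha_i)=1+X_i$ and $E^{(2)}(\alpha_i^{-1})=1+X_i+X_i^2+X_i^3+\cdots$ for $1\le i\le m$. *)

theory Defs
  imports "HOL-Analysis.Analysis" "HOL-Algebra.Group" "HOL-Library.Z2"
begin

section \<open>Links in the 3-sphere, isotopy, and 4-moves\<close>

text \<open>
  The 3-sphere is the unit sphere of \<open>\<complex>\<^sup>2\<close>, and Euclidean 3-space is \<open>\<complex> \<times> \<real>\<close>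
  (horizontal plane and height).
\<close>

definition S3 :: "(complex \<times> complex) set" where
  "S3 = sphere 0 1"

text \<open>
  An ordered oriented link with components \<open>1, \<dots>, m\<close>: each component is a simple closed curve
  given by a parametrization \<open>L i\<close> of period 1. The values \<open>L i\<close> for \<open>i\<close> outside \<open>{1..m}\<close> are
  irrelevant. Tameness is not built in: it follows for every link that has a
  diagram, and it is preserved by the isotopies and moves below.
\<close>

definition is_link :: "'a::topological_space set \<Rightarrow> nat \<Rightarrow> (nat \<Rightarrow> real \<Rightarrow> 'a) \<Rightarrow> bool" where
  "is_link S m L \<longleftrightarrow>
     (\<forall>i\<in>{1..m}. continuous_on UNIV (L i) \<and> range (L i) \<subseteq> S \<and> (\<forall>t. L i (t + 1) = L i t)) \<and>
     (\<forall>i\<in>{1..m}. \<forall>j\<in>{1..m}. \<forall>s t. L i s = L j t \<longrightarrow> i = j \<and> s - t \<in> \<int>)"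

text \<open>
  Ambient isotopy. Since a link is an oriented submanifold, not a parametrized one, the
  components are compared up to orientation preserving reparametrizations \<open>\<rho>\<close> of the circle.
\<close>

definition isotopic_links ::
  "nat \<Rightarrow> (nat \<Rightarrow> real \<Rightarrow> complex \<times> complex) \<Rightarrow> (nat \<Rightarrow> real \<Rightarrow> complex \<times> complex) \<Rightarrow> bool" where
  "isotopic_links m L L' \<longleftrightarrow>
     (\<exists>H :: real \<Rightarrow> complex \<times> complex \<Rightarrow> complex \<times> complex.
        continuous_on ({0..1} \<times> S3) (\<lambda>(s, x). H s x) \<and>
        (\<forall>s\<in>{0..1}. \<exists>g. homeomorphism S3 S3 (H s) g) \<and>
        (\<forall>x\<in>S3. H 0 x = x) \<and>
        (\<forall>i\<in>{1..m}. \<exists>\<rho> :: real \<Rightarrow> real.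
           continuous_on UNIV \<rho> \<and> strict_mono \<rho> \<and> (\<forall>t. \<rho> (t + 1) = \<rho> t + 1) \<and>
           (\<forall>t. H 1 (L i t) = L' i (\<rho> t))))"

text \<open>
  The model ball is the solid cylinder. It contains two parallel vertical strands, and the
  twist rotates the disc at height \<open>z\<close> by the angle \<open>2 \<pi> (z + 1)\<close>. The rotation angle grows from 0
  at the bottom to \<open>4 \<pi>\<close> at the top, which amounts to four half-twists (of angle \<open>\<pi>\<close>) in the same
  direction.
\<close>

definition model_ball :: "(complex \<times> real) set" where
  "model_ball = cball 0 1 \<times> {-1..1}"

definition model_strands :: "(complex \<times> real) set" where
  "model_strands = {1/2, -1/2} \<times> {-1..1}"

definition four_half_twists :: "complex \<times> real \<Rightarrow> complex \<times> real" where
  "four_half_twists = (\<lambda>(w, z). (cis (2 * pi * (z + 1)) * w, z))"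

text \<open>
  \<open>L'\<close> is obtained from \<open>L\<close> by replacing two parallel strands by four half-twists, inside the ball
  \<open>\<phi> ` model_ball\<close>. The map \<open>\<phi>\<close> is defined on all of 3-space, so the ball is tame, and it may reverse
  the orientation, so both twisting directions occur. The directions in which \<open>L\<close> runs through
  the two strands are not constrained.
\<close>

definition adds_four_half_twists ::
  "nat \<Rightarrow> (nat \<Rightarrow> real \<Rightarrow> complex \<times> complex) \<Rightarrow> (nat \<Rightarrow> real \<Rightarrow> complex \<times> complex) \<Rightarrow> bool" where
  "adds_four_half_twists m L L' \<longleftrightarrow>
     (\<exists>\<phi> :: complex \<times> real \<Rightarrow> complex \<times> complex.
        continuous_on UNIV \<phi> \<and> inj \<phi> \<and> range \<phi> \<subseteq> S3 \<and>
        {x \<in> model_ball. \<phi> x \<in> (\<Union>i\<in>{1..m}. range (L i))} = model_strands \<and>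
        (\<forall>i\<in>{1..m}. \<forall>t.
           (\<forall>x\<in>model_ball. L i t = \<phi> x \<longrightarrow> L' i t = \<phi> (four_half_twists x)) \<and>
           (L i t \<notin> \<phi> ` model_ball \<longrightarrow> L' i t = L i t)))"

definition four_move ::
  "nat \<Rightarrow> (nat \<Rightarrow> real \<Rightarrow> complex \<times> complex) \<Rightarrow> (nat \<Rightarrow> real \<Rightarrow> complex \<times> complex) \<Rightarrow> bool" where
  "four_move m L L' \<longleftrightarrow> adds_four_half_twists m L L' \<or> adds_four_half_twists m L' L"

definition four_equivalent ::
  "nat \<Rightarrow> (nat \<Rightarrow> real \<Rightarrow> complex \<times> complex) \<Rightarrow> (nat \<Rightarrow> real \<Rightarrow> complex \<times> complex) \<Rightarrow> bool" where
  "four_equivalent m =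
     (\<lambda>L L'. is_link S3 m L \<and> is_link S3 m L' \<and> (isotopic_links m L L' \<or> four_move m L L'))\<^sup>*\<^sup>*"

text \<open>Inverse of the stereographic projection from the point \<open>(0, \<i>)\<close>.\<close>

definition inv_stereographic :: "complex \<times> real \<Rightarrow> complex \<times> complex" where
  "inv_stereographic = (\<lambda>(w, z). let n = (cmod w)\<^sup>2 + z\<^sup>2 in
     ((2 / (n + 1)) *\<^sub>R w, Complex (2 * z / (n + 1)) ((n - 1) / (n + 1))))"

lemma inv_stereographic_in_S3: "inv_stereographic p \<in> S3"
proof -
  obtain w z where p: "p = (w, z)" by (cases p)
  define n where "n = (cmod w)\<^sup>2 + z\<^sup>2"
  have n: "n + 1 > 0" unfolding n_def by (smt (verit) zero_le_power2)
  have sq: "(2 / (n + 1))\<^sup>2 * (cmod w)\<^sup>2 + ((2 * z / (n + 1))\<^sup>2 + ((n - 1) / (n + 1))\<^sup>2)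
      = (4 * ((cmod w)\<^sup>2 + z\<^sup>2) + (n - 1)\<^sup>2) / (n + 1)\<^sup>2"
    by (simp add: power_divide power_mult_distrib add_divide_distrib)
  also have "\<dots> = (4 * n + (n - 1)\<^sup>2) / (n + 1)\<^sup>2" by (simp add: n_def)
  also have "4 * n + (n - 1)\<^sup>2 = (n + 1)\<^sup>2" by (simp add: power2_eq_square algebra_simps)
  finally have "(2 / (n + 1))\<^sup>2 * (cmod w)\<^sup>2 + ((2 * z / (n + 1))\<^sup>2 + ((n - 1) / (n + 1))\<^sup>2) = 1"
    using n by simp
  then have "(cmod ((2 / (n + 1)) *\<^sub>R w))\<^sup>2 +
      (cmod (Complex (2 * z / (n + 1)) ((n - 1) / (n + 1))))\<^sup>2 = 1"
    unfolding norm_scaleR power_mult_distrib power2_abs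
    by (simp only: cmod_power2 complex.sel)
  then show ?thesis
    by (simp only: p S3_def inv_stereographic_def n_def[symmetric] norm_Pair Let_def prod.case
        mem_sphere_0 real_sqrt_one)
qed

definition trivial_link :: "nat \<Rightarrow> real \<Rightarrow> complex \<times> complex" where
  "trivial_link i t = inv_stereographic (of_nat (3 * i) + cis (2 * pi * t), 0)"

section \<open>Diagrams\<close>

text \<open>
  Regular projection of a link in 3-space to the horizontal plane: the projected curves are
  \<open>C\<^sup>1\<close> immersions, and the only multiple points are transverse double points
  (\<open>Im (cnj a * b)\<close> is the determinant of the pair of plane vectors \<open>a, b\<close>). By compactness there
  are only finitely many double points.
\<close>

definition regular_projection :: "nat \<Rightarrow> (nat \<Rightarrow> real \<Rightarrow> complex \<times> real) \<Rightarrow> bool" where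
  "regular_projection m K \<longleftrightarrow>
     is_link UNIV m K \<and>
     (\<forall>i\<in>{1..m}. K i C1_differentiable_on UNIV \<and>
        (\<forall>t. fst (vector_derivative (K i) (at t)) \<noteq> 0)) \<and>
     (\<forall>i\<in>{1..m}. \<forall>j\<in>{1..m}. \<forall>s t.
        fst (K i s) = fst (K j t) \<and> K i s \<noteq> K j t \<longrightarrow>
        Im (cnj (fst (vector_derivative (K i) (at s))) * fst (vector_derivative (K j) (at t))) \<noteq> 0) \<and>
     (\<forall>i\<in>{1..m}. \<forall>j\<in>{1..m}. \<forall>k\<in>{1..m}. \<forall>r s t.
        fst (K i r) = fst (K j s) \<and> fst (K j s) = fst (K k t) \<longrightarrow>
        K i r = K j s \<or> K j s = K k t \<or> K i r = K k t)"

text \<open>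
  The data of an oriented diagram, with a chosen first arc on each component, that enter
  the longitude words: the number of components, the number of under-crossings of each
  component, and the over-passing arc \<open>u\<^bsub>ij\<^esub>\<close> and the sign \<open>\<epsilon>\<^bsub>ij\<^esub>\<close> at the \<open>j\<close>-th under-crossing
  met along component \<open>i\<close>. The arc \<open>x\<^bsub>ij\<^esub>\<close> is represented by the pair \<open>(i, j)\<close>.
\<close>

record link_diagram =
  components :: nat
  under_crossings :: "nat \<Rightarrow> nat"
  over_arc :: "nat \<Rightarrow> nat \<Rightarrow> nat \<times> nat"
  crossing_sign :: "nat \<Rightarrow> nat \<Rightarrow> int"

definition passes_over :: "(nat \<Rightarrow> real \<Rightarrow> complex \<times> real) \<Rightarrow> nat \<Rightarrow> real \<Rightarrow> nat \<Rightarrow> real \<Rightarrow> bool" where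
  "passes_over K k s i t \<longleftrightarrow> fst (K k s) = fst (K i t) \<and> snd (K k s) > snd (K i t)"

text \<open>
  The base parameter \<open>b i\<close> selects the first arc of component \<open>i\<close>; the component is traversed
  once, for parameters from \<open>b i\<close> to \<open>b i + 1\<close>.
\<close>

definition under_params ::
  "nat \<Rightarrow> (nat \<Rightarrow> real \<Rightarrow> complex \<times> real) \<Rightarrow> (nat \<Rightarrow> real) \<Rightarrow> nat \<Rightarrow> real set" where
  "under_params m K b i = {t \<in> {b i..<b i + 1}. \<exists>k\<in>{1..m}. \<exists>s. passes_over K k s i t}"

definition under_param ::
  "nat \<Rightarrow> (nat \<Rightarrow> real \<Rightarrow> complex \<times> real) \<Rightarrow> (nat \<Rightarrow> real) \<Rightarrow> nat \<Rightarrow> nat \<Rightarrow> real" where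
  "under_param m K b i j = sorted_list_of_set (under_params m K b i) ! (j - 1)"

definition over_point ::
  "nat \<Rightarrow> (nat \<Rightarrow> real \<Rightarrow> complex \<times> real) \<Rightarrow> (nat \<Rightarrow> real) \<Rightarrow> nat \<Rightarrow> nat \<Rightarrow> nat \<times> real" where
  "over_point m K b i j = (THE p. fst p \<in> {1..m} \<and> snd p \<in> {b (fst p)..<b (fst p) + 1} \<and>
     passes_over K (fst p) (snd p) i (under_param m K b i j))"

text \<open>
  The remainder accounts for the points behind the last under-crossing, which lie on the first
  arc again. If there is no under-crossing, the index is 1, as \<open>0 mod 0 = 0\<close>.
\<close>

definition arc_index ::
  "nat \<Rightarrow> (nat \<Rightarrow> real \<Rightarrow> complex \<times> real) \<Rightarrow> (nat \<Rightarrow> real) \<Rightarrow> nat \<Rightarrow> real \<Rightarrow> nat" where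
  "arc_index m K b k s =
     card {t \<in> under_params m K b k. t < s} mod card (under_params m K b k) + 1"

definition projection_diagram ::
  "nat \<Rightarrow> (nat \<Rightarrow> real \<Rightarrow> complex \<times> real) \<Rightarrow> (nat \<Rightarrow> real) \<Rightarrow> link_diagram" where
  "projection_diagram m K b =
     \<lparr> components = m,
       under_crossings = (\<lambda>i. card (under_params m K b i)),
       over_arc = (\<lambda>i j. let (k, s) = over_point m K b i j in (k, arc_index m K b k s)),
       crossing_sign = (\<lambda>i j. let (k, s) = over_point m K b i j in
         if Im (cnj (fst (vector_derivative (K k) (at s))) *
                fst (vector_derivative (K i) (at (under_param m K b i j)))) > 0
         then 1 else -1) \<rparr>"

definition is_diagram_of :: "link_diagram \<Rightarrow> nat \<Rightarrow> (nat \<Rightarrow> real \<Rightarrow> complex \<times> complex) \<Rightarrow> bool" where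
  "is_diagram_of D m L \<longleftrightarrow>
     (\<exists>K b. regular_projection m K \<and>
        isotopic_links m (\<lambda>i t. inv_stereographic (K i t)) L \<and>
        (\<forall>i\<in>{1..m}. b i \<notin> under_params m K b i) \<and>
        D = projection_diagram m K b)"

section \<open>Free groups\<close>

text \<open>The letter \<open>(x, True)\<close> stands for \<open>x\<close>, and \<open>(x, False)\<close> for its inverse.\<close>

type_synonym 'a letter = "'a \<times> bool"

definition letter_inv :: "'a letter \<Rightarrow> 'a letter" where
  "letter_inv a = (fst a, \<not> snd a)"

definition reduced :: "'a letter list \<Rightarrow> bool" where
  "reduced = successively (\<lambda>a b. b \<noteq> letter_inv a)"

definition cons_reduce :: "'a letter \<Rightarrow> 'a letter list \<Rightarrow> 'a letter list" where
  "cons_reduce a w = (if w \<noteq> [] \<and> hd w = letter_inv a then tl w else a # w)"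

definition reduce :: "'a letter list \<Rightarrow> 'a letter list" where
  "reduce w = foldr cons_reduce w []"

definition free_group :: "'a set \<Rightarrow> 'a letter list monoid" where
  "free_group X =
     \<lparr> carrier = {w. fst ` set w \<subseteq> X \<and> reduced w}, mult = (\<lambda>u v. reduce (u @ v)), one = [] \<rparr>"

definition gen :: "'a \<Rightarrow> 'a letter list" where
  "gen x = [(x, True)]"

definition free_lift :: "('g, 'r) monoid_scheme \<Rightarrow> ('a \<Rightarrow> 'g) \<Rightarrow> 'a letter list \<Rightarrow> 'g" where
  "free_lift G f w =
     foldr (\<lambda>(x, e) g. (if e then f x else inv\<^bsub>G\<^esub> (f x)) \<otimes>\<^bsub>G\<^esub> g) w \<one>\<^bsub>G\<^esub>"

definition commutator :: "('g, 'r) monoid_scheme \<Rightarrow> 'g \<Rightarrow> 'g \<Rightarrow> 'g" where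
  "commutator G a b = inv\<^bsub>G\<^esub> a \<otimes>\<^bsub>G\<^esub> inv\<^bsub>G\<^esub> b \<otimes>\<^bsub>G\<^esub> a \<otimes>\<^bsub>G\<^esub> b"

lemma letter_inv_invol [simp]: "letter_inv (letter_inv a) = a"
  by (simp add: letter_inv_def)

lemma reduced_Nil [simp]: "reduced []"
  by (simp add: reduced_def)

lemma reduced_Cons: "reduced (a # w) \<longleftrightarrow> (w = [] \<or> hd w \<noteq> letter_inv a) \<and> reduced w"
  by (auto simp: reduced_def successively_Cons)

lemma reduced_cons_reduce: "reduced w \<Longrightarrow> reduced (cons_reduce a w)"
  by (cases w) (auto simp: cons_reduce_def reduced_Cons)

lemma cons_reduce_reduced: "reduced (a # w) \<Longrightarrow> cons_reduce a w = a # w"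
  by (auto simp: cons_reduce_def reduced_Cons)

lemma cons_reduce_inv:
  assumes "reduced w" shows "cons_reduce (letter_inv a) (cons_reduce a w) = w"
  using assms
  by (cases w) (auto simp: cons_reduce_def reduced_Cons neq_Nil_conv)

lemma reduced_foldr: "reduced w \<Longrightarrow> reduced (foldr cons_reduce u w)"
  by (induction u) (auto simp: reduced_cons_reduce)

lemma reduced_reduce: "reduced (reduce w)"
  by (simp add: reduce_def reduced_foldr)

lemma reduce_id: "reduced w \<Longrightarrow> reduce w = w"
  by (induction w) (auto simp: reduce_def reduced_Cons cons_reduce_def)

lemma foldr_cons_reduce:
  assumes "reduced w"
  shows "foldr cons_reduce (cons_reduce a u) w = cons_reduce a (foldr cons_reduce u w)"
proof (cases "u \<noteq> [] \<and> hd u = letter_inv a")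
  case True
  then obtain u' where u: "u = letter_inv a # u'" by (cases u) auto
  have "cons_reduce (letter_inv (letter_inv a)) (cons_reduce (letter_inv a) (foldr cons_reduce u' w))
      = foldr cons_reduce u' w"
    by (rule cons_reduce_inv) (simp add: reduced_foldr assms)
  then show ?thesis by (simp add: u cons_reduce_def)
next
  case False
  then show ?thesis by (auto simp: cons_reduce_def)
qed

lemma foldr_reduce: "reduced w \<Longrightarrow> foldr cons_reduce (reduce u) w = foldr cons_reduce u w"
  by (induction u) (auto simp: reduce_def foldr_cons_reduce)

lemma reduce_append1: "reduce (reduce u @ v) = reduce (u @ v)"
  by (simp add: reduce_def foldr_reduce[unfolded reduce_def] reduced_foldr)

lemma reduce_append2: "reduce (u @ reduce v) = reduce (u @ v)"
  using reduce_id[OF reduced_reduce, of v] by (simp add: reduce_def)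

lemma set_reduce: "set (reduce w) \<subseteq> set w"
proof (induction w)
  case (Cons a w)
  then show ?case
    using list.set_sel(2)[of "reduce w"] by (auto simp: reduce_def cons_reduce_def)
qed (simp add: reduce_def)

lemma inverse_word_cancel:
  "reduced u \<Longrightarrow> reduce (rev (map letter_inv u) @ u) = []"
proof (induction u)
  case (Cons a u)
  then have u: "reduced u" by (simp add: reduced_Cons)
  have "foldr cons_reduce u [] = u" using reduce_id[OF u] by (simp add: reduce_def)
  then show ?case
    using Cons u cons_reduce_inv[OF u, of a] by (simp add: reduce_def)
qed (simp add: reduce_def)

lemma group_free_group: "group (free_group X)"
proof (rule groupI)
  fix u assume u: "u \<in> carrier (free_group X)"
  let ?v = "reduce (rev (map letter_inv u))"
  have "fst ` set ?v \<subseteq> fst ` set (rev (map letter_inv u))"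
    by (intro image_mono set_reduce)
  also have "\<dots> = fst ` set u" by (force simp: letter_inv_def)
  finally have "?v \<in> carrier (free_group X)"
    using u by (auto simp: free_group_def reduced_reduce)
  moreover have "?v \<otimes>\<^bsub>free_group X\<^esub> u = \<one>\<^bsub>free_group X\<^esub>"
    using u by (simp add: free_group_def reduce_append1 inverse_word_cancel)
  ultimately show "\<exists>v\<in>carrier (free_group X). v \<otimes>\<^bsub>free_group X\<^esub> u = \<one>\<^bsub>free_group X\<^esub>"
    by blast
next
  fix u v assume "u \<in> carrier (free_group X)" "v \<in> carrier (free_group X)"
  then show "u \<otimes>\<^bsub>free_group X\<^esub> v \<in> carrier (free_group X)"
    using set_reduce[of "u @ v"] by (force simp: free_group_def reduced_reduce)
qed (auto simp: free_group_def reduce_append1 reduce_append2 reduce_id)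

lemma free_lift_closed:
  assumes "group G" "f \<in> X \<rightarrow> carrier G" "fst ` set w \<subseteq> X"
  shows "free_lift G f w \<in> carrier G"
proof -
  interpret group G by fact
  show ?thesis using assms(2,3)
    by (induction w) (auto simp: free_lift_def Pi_iff)
qed

lemma free_lift_cons_reduce:
  assumes "group G" "f \<in> X \<rightarrow> carrier G" "fst ` set (a # w) \<subseteq> X"
  shows "free_lift G f (cons_reduce a w) = free_lift G f (a # w)"
proof (cases "w \<noteq> [] \<and> hd w = letter_inv a")
  case True
  interpret group G by fact
  from True obtain w' where w: "w = letter_inv a # w'" by (cases w) auto
  have cl: "free_lift G f w' \<in> carrier G" "f (fst a) \<in> carrier G"
    using assms free_lift_closed[OF assms(1,2), of w'] by (auto simp: w)
  then show ?thesis
    by (cases a) (auto simp: w cons_reduce_def free_lift_def letter_inv_def m_assoc[symmetric])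
qed (auto simp: cons_reduce_def)

lemma free_lift_reduce:
  assumes "group G" "f \<in> X \<rightarrow> carrier G" "fst ` set w \<subseteq> X"
  shows "free_lift G f (reduce w) = free_lift G f w"
  using assms(3)
proof (induction w)
  case (Cons a w)
  have "fst ` set (a # reduce w) \<subseteq> X"
    using Cons.prems set_reduce[of w] by auto
  from free_lift_cons_reduce[OF assms(1,2) this] Cons show ?case
    by (simp add: reduce_def free_lift_def split: prod.splits)
qed (simp add: reduce_def)

lemma free_lift_append:
  assumes "group G" "f \<in> X \<rightarrow> carrier G" "fst ` set u \<subseteq> X" "fst ` set v \<subseteq> X"
  shows "free_lift G f (u @ v) = free_lift G f u \<otimes>\<^bsub>G\<^esub> free_lift G f v"
proof -
  interpret group G by fact
  have v: "free_lift G f v \<in> carrier G" by (rule free_lift_closed) (use assms in auto)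
  show ?thesis using assms(3)
  proof (induction u)
    case Nil
    then show ?case using v by (simp add: free_lift_def)
  next
    case (Cons a u)
    have "free_lift G f u \<in> carrier G"
      by (rule free_lift_closed) (use assms Cons in auto)
    moreover have "f (fst a) \<in> carrier G" using assms Cons by auto
    ultimately show ?case
      using Cons v by (auto simp: free_lift_def m_assoc split: prod.splits)
  qed
qed

lemma free_lift_hom:
  assumes "group G" "f \<in> X \<rightarrow> carrier G"
  shows "free_lift G f \<in> hom (free_group X) G"
proof (rule homI)
  fix u v assume "u \<in> carrier (free_group X)" "v \<in> carrier (free_group X)"
  then have uv: "fst ` set u \<subseteq> X" "fst ` set v \<subseteq> X" by (auto simp: free_group_def)
  then have "free_lift G f (reduce (u @ v)) = free_lift G f (u @ v)"
    by (intro free_lift_reduce[OF assms]) auto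
  with uv free_lift_append[OF assms]
  show "free_lift G f (u \<otimes>\<^bsub>free_group X\<^esub> v) = free_lift G f u \<otimes>\<^bsub>G\<^esub> free_lift G f v"
    by (simp add: free_group_def)
qed (auto simp: free_group_def intro!: free_lift_closed[OF assms])

lemma free_lift_gen:
  assumes "group G" "f x \<in> carrier G"
  shows "free_lift G f (gen x) = f x"
proof -
  interpret group G by fact
  show ?thesis using assms by (simp add: free_lift_def gen_def)
qed

section \<open>Longitude words and the homomorphisms \<open>\<eta>\<^sub>q\<close>\<close>

text \<open>A component without under-crossings still consists of one arc.\<close>

definition arcs :: "link_diagram \<Rightarrow> (nat \<times> nat) set" where
  "arcs D = {(i, j). i \<in> {1..components D} \<and> j \<in> {1..max 1 (under_crossings D i)}}"

primrec partial_longitude :: "link_diagram \<Rightarrow> nat \<Rightarrow> nat \<Rightarrow> (nat \<times> nat) letter list" where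
  "partial_longitude D i 0 = \<one>\<^bsub>free_group (arcs D)\<^esub>"
| "partial_longitude D i (Suc j) =
     partial_longitude D i j \<otimes>\<^bsub>free_group (arcs D)\<^esub>
     (gen (over_arc D i (Suc j)) [^]\<^bsub>free_group (arcs D)\<^esub> crossing_sign D i (Suc j))"

definition longitude :: "link_diagram \<Rightarrow> nat \<Rightarrow> (nat \<times> nat) letter list" where
  "longitude D i = partial_longitude D i (under_crossings D i)"

abbreviation meridian_group :: "link_diagram \<Rightarrow> nat letter list monoid" where
  "meridian_group D \<equiv> free_group {1..components D}"

text \<open>
  The generator \<open>\<alpha>\<^sub>i\<close> is \<open>gen i\<close>. The homomorphisms \<open>\<eta>\<^sub>q\<close> are indexed by \<open>q \<ge> 1\<close>; the value at 0 is
  a dummy. In the last equation, the case \<open>j = 1\<close> gives \<open>\<alpha>\<^sub>i\<close>, since the word \<open>v\<^bsub>i0\<^esub>\<close> is empty.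
\<close>

fun eta :: "link_diagram \<Rightarrow> nat \<Rightarrow> (nat \<times> nat) letter list \<Rightarrow> nat letter list" where
  "eta D 0 = (\<lambda>_. \<one>\<^bsub>meridian_group D\<^esub>)"
| "eta D (Suc 0) = free_lift (meridian_group D) (\<lambda>(i, j). gen i)"
| "eta D (Suc (Suc q)) = free_lift (meridian_group D) (\<lambda>(i, j).
     eta D (Suc q) (inv\<^bsub>free_group (arcs D)\<^esub> partial_longitude D i (j - 1)) \<otimes>\<^bsub>meridian_group D\<^esub>
     gen i \<otimes>\<^bsub>meridian_group D\<^esub>
     eta D (Suc q) (partial_longitude D i (j - 1)))"

section \<open>The Magnus expansion over the integers modulo 2\<close>

text \<open>
  A formal power series in non-commuting variables \<open>X\<^sub>k\<close> is the function that maps a word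
  \<open>[k\<^sub>1, \<dots>, k\<^sub>j]\<close> to the coefficient of \<open>X\<^bsub>k\<^sub>1\<^esub> \<cdots> X\<^bsub>k\<^sub>j\<^esub>\<close>.
\<close>

type_synonym nc_series = "nat list \<Rightarrow> bit"

definition nc_one :: nc_series where
  "nc_one w = (if w = [] then 1 else 0)"

definition nc_mult :: "nc_series \<Rightarrow> nc_series \<Rightarrow> nc_series" where
  "nc_mult f g w = (\<Sum>k\<le>length w. f (take k w) * g (drop k w))"

text \<open>\<open>\<alpha>\<^sub>i\<close> is mapped to \<open>1 + X\<^sub>i\<close>, and its inverse to \<open>1 + X\<^sub>i + X\<^sub>i\<^sup>2 + \<cdots>\<close>.\<close>

definition magnus_letter :: "nat letter \<Rightarrow> nc_series" where
  "magnus_letter = (\<lambda>(i, e) w.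
     if e then (if w = [] \<or> w = [i] then 1 else 0)
     else (if set w \<subseteq> {i} then 1 else 0))"

definition magnus2 :: "nat letter list \<Rightarrow> nc_series" where
  "magnus2 w = foldr (\<lambda>a. nc_mult (magnus_letter a)) w nc_one"

lemma nc_mult_one_left: "nc_mult nc_one f = f"
proof
  fix w :: "nat list"
  have "nc_mult nc_one f w = (\<Sum>k\<in>{0}. nc_one (take k w) * f (drop k w))"
    unfolding nc_mult_def by (rule sum.mono_neutral_right) (auto simp: nc_one_def)
  then show "nc_mult nc_one f w = f w" by (simp add: nc_one_def)
qed

lemma nc_mult_assoc: "nc_mult (nc_mult f g) h = nc_mult f (nc_mult g h)"
proof
  fix w :: "nat list"
  let ?n = "length w"
  have "nc_mult (nc_mult f g) h w =
      (\<Sum>k\<le>?n. \<Sum>j\<le>k. f (take j w) * g (take (k - j) (drop j w)) * h (drop k w))"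
    unfolding nc_mult_def sum_distrib_right
  proof (rule sum.cong[OF refl], rule sum.cong)
    fix k j assume "k \<in> {..?n}" and j: "j \<in> {..k}"
    then show "f (take j (take k w)) * g (drop j (take k w)) * h (drop k w) =
        f (take j w) * g (take (k - j) (drop j w)) * h (drop k w)"
      unfolding take_take drop_take by (simp only: min_absorb1 atMost_iff)
  qed (simp only: length_take min_absorb2 atMost_iff)
  also have "\<dots> = (\<Sum>(k, j)\<in>(SIGMA k:{..?n}. {..k}).
      f (take j w) * g (take (k - j) (drop j w)) * h (drop k w))"
    by (rule sum.Sigma) auto
  also have "\<dots> = (\<Sum>(j, k)\<in>(SIGMA j:{..?n}. {..?n - j}).
      f (take j w) * (g (take k (drop j w)) * h (drop k (drop j w))))"
    by (rule sum.reindex_bij_witness[where i = "\<lambda>(j, k). (j + k, j)" and j = "\<lambda>(k, j). (j, k - j)"])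
       (auto simp: mult.assoc add.commute)
  also have "\<dots> = nc_mult f (nc_mult g h) w"
    unfolding nc_mult_def sum_distrib_left length_drop by (rule sum.Sigma[symmetric]) auto
  finally show "nc_mult (nc_mult f g) h w = nc_mult f (nc_mult g h) w" .
qed

lemma magnus2_append: "magnus2 (u @ v) = nc_mult (magnus2 u) (magnus2 v)"
  by (induction u) (auto simp: magnus2_def nc_mult_one_left nc_mult_assoc)

lemma sum_two: "a \<noteq> b \<Longrightarrow> sum t {a, b} = t a + t b" for t :: "'b \<Rightarrow> bit"
  by simp

lemma magnus_letter_inverse:
  "nc_mult (magnus_letter a) (magnus_letter (letter_inv a)) = nc_one"
proof
  fix w :: "nat list"
  obtain i e where a: "a = (i, e)" by (cases a)
  let ?t = "\<lambda>k. magnus_letter a (take k w) * magnus_letter (letter_inv a) (drop k w)"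
  show "nc_mult (magnus_letter a) (magnus_letter (letter_inv a)) w = nc_one w"
  proof (cases "w = []")
    case True
    have "{..length w} = {0}" using True by auto
    then have "sum ?t {..length w} = ?t 0" by simp
    then show ?thesis
      unfolding nc_mult_def by (simp only:) (simp add: True a nc_one_def magnus_letter_def letter_inv_def)
  next
    case w: False
    have "sum ?t {..length w} = 0"
    proof (cases e)
      case True
      obtain x w' where x: "w = x # w'" using w by (cases w) auto
      have "sum ?t {..length w} = sum ?t {0, 1}"
        by (rule sum.mono_neutral_right)
           (auto simp: x a True magnus_letter_def letter_inv_def take_Cons split: nat.splits)
      also have "\<dots> = ?t 0 + ?t 1" by (rule sum_two) simp
      also have "\<dots> = 0"
        by (auto simp: x a True magnus_letter_def letter_inv_def)
      finally show ?thesis .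
    next
      case False
      obtain w' x where x: "w = w' @ [x]" using w by (cases w rule: rev_cases) auto
      have "sum ?t {..length w} = sum ?t {length w', Suc (length w')}"
      proof (rule sum.mono_neutral_right)
        show "\<forall>k\<in>{..length w} - {length w', Suc (length w')}. ?t k = 0"
        proof
          fix k assume "k \<in> {..length w} - {length w', Suc (length w')}"
          then have "length (drop k w) \<ge> 2" by (auto simp: x)
          then have "drop k w \<noteq> []" "drop k w \<noteq> [i]" by (auto simp del: length_drop)
          then show "?t k = 0" by (simp add: a False magnus_letter_def letter_inv_def)
        qed
      qed (auto simp: x)
      also have "\<dots> = ?t (length w') + ?t (Suc (length w'))" by (rule sum_two) simp
      also have "\<dots> = 0"
        by (auto simp: x a False magnus_letter_def letter_inv_def)
      finally show ?thesis .
    qed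
    then show ?thesis using w by (simp add: nc_mult_def nc_one_def)
  qed
qed

lemma magnus2_reduce: "magnus2 (reduce w) = magnus2 w"
proof (induction w)
  case (Cons a w)
  have "magnus2 (cons_reduce a u) = magnus2 (a # u)" for u
  proof (cases "u \<noteq> [] \<and> hd u = letter_inv a")
    case True
    then obtain u' where "u = letter_inv a # u'" by (cases u) auto
    then show ?thesis
      by (simp add: cons_reduce_def magnus2_def nc_mult_assoc[symmetric] magnus_letter_inverse
          nc_mult_one_left)
  qed (auto simp: cons_reduce_def)
  then show ?case using Cons by (simp add: reduce_def magnus2_def)
qed (simp add: reduce_def)

lemma magnus2_mult:
  "magnus2 (u \<otimes>\<^bsub>free_group X\<^esub> v) = nc_mult (magnus2 u) (magnus2 v)"
  by (simp add: free_group_def magnus2_reduce magnus2_append)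

end

theory Submission
  imports Defs
begin

text \<open>
 Let \<open>G\<close> be the group of power series over the integers modulo 2 with constant term 1, modulo the normal subgroup \<open>N\<close> of the
 series that vanish on words with distinct letters and whose coefficients of degree at most 4 satisfy the
 relations of the theorem. In \<open>G\<close>, conjugates \<open>a\<close> of series in \<open>X\<^sub>i\<close> and \<open>b\<close> of series in \<open>X\<^sub>j\<close> satisfy
 \<open>(a b)\<^sup>2 a = a (a b)\<^sup>2\<close>, which is what four half-twists of two strands require of their meridians. Hence the
 representation that sends the meridians of the trivial link to the \<open>1 + X\<^sub>i\<close> is carried along isotopies and 4-moves.
 To avoid fundamental groups, a representation is a \<open>G\<close>-valued function on pairs of points of the complement that is a
 cocycle locally, considered up to gauge. On a diagram it becomes a colouring of the arcs that obeys the
 Wirtinger relations. By Milnor's argument, evaluating \<open>[\<alpha>\<^sub>i, \<eta>\<^sub>q(\<lambda>\<^sub>i)]\<close> on the colours of the first arcs gives an element of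
 \<open>N\<close> up to degree \<open>q\<close>. These colours are conjugates of \<open>1 + X\<^sub>i + \<cdots>\<close>, and substituting them into the
 Magnus expansion changes the coefficients in question only by combinations satisfying the same relations.
\<close>

section \<open>Local cocycles\<close>

text \<open>Four half-twists conjugate the meridians \<open>a\<close> and \<open>b\<close> of the
  two strands by the square of the loop around both strands. The old representation therefore fits
  the twisted strands if that square commutes with \<open>a\<close> and with \<open>b\<close>. For
  conjugates of series in one variable, letters repeat in the commutator of \<open>a\<close> with
  the square. Over the integers modulo 2, moreover, the square of 1 + M is 1 + M^2, so the
  commutator begins in degree 3. The relations of the theorem are symmetries of its terms of degree
  3 and 4. The obstacle is that isotopies and the balls of the moves are merely continuous, so no
  smooth meridian or tubular neighbourhood is available. A meridian is therefore described by two
  local conditions at a point of the link that survive every homeomorphism: up to gauge the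
  transport has values in a subgroup attached to the component, and its degree 1 coefficient has no
  local primitive. Reading this coefficient modulo 2 also makes it blind to orientations, as the
  moves demand. Derivatives enter only with the regular projection, where sides of a strand and
  signs of crossings must be told apart.\<close>

definition locally2 :: "'a::topological_space set => ('a => 'a => bool) => bool" where
 "locally2 X R \<longleftrightarrow> (\<forall>x\<in>X. \<exists>N. open N \<and> x \<in> N \<and> (\<forall>y\<in>N Int X. \<forall>z\<in>N Int X. R y z))"

text \<open>Parallel transport of a flat bundle between nearby points. It plays the role of a
  homomorphism of the fundamental group up to conjugacy, without base points or paths. Values at
  distant pairs carry no information, and a gauge is an arbitrary function, with no
  continuity.\<close>

definition local_cocycle :: "'a::topological_space set => ('a => 'a => 'g::group_add) => bool" where
 "local_cocycle X \<tau> \<longleftrightarrow> (\<forall>x\<in>X. \<exists>N. open N \<and> x \<in> N \<and>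
  (\<forall>u\<in>N Int X. \<forall>v\<in>N Int X. \<forall>w\<in>N Int X. \<tau> u v + \<tau> v w = \<tau> u w))"

text \<open>The groups are written additively without being commutative. These rules produce
  right-nested sums in which neighbouring terms cancel.\<close>

lemmas gnorm = diff_conv_add_uminus minus_add add.assoc

lemma locally2I:
 assumes "!!x. x \<in> X ==> \<exists>N. open N \<and> x \<in> N \<and> (\<forall>y\<in>N Int X. \<forall>z\<in>N Int X. R y z)"
 shows "locally2 X R"
 using assms by (simp add: locally2_def)

lemma locally2D:
 assumes "locally2 X R" "x \<in> X"
 shows "\<exists>N. open N \<and> x \<in> N \<and> (\<forall>y\<in>N Int X. \<forall>z\<in>N Int X. R y z)"
 using assms unfolding locally2_def by blast

lemma locally2_mono:
 assumes "locally2 X R" "Y \<subseteq> X" "!!y z. y \<in> Y ==> z \<in> Y ==> R y z ==> Q y z"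
 shows "locally2 Y Q"
proof (rule locally2I)
 fix x assume "x \<in> Y"
 then have x: "x \<in> X" using assms(2) by blast
 obtain N where "open N" "x \<in> N" "\<forall>y\<in>N Int X. \<forall>z\<in>N Int X. R y z"
  using locally2D[OF assms(1) x] by blast
 then show "\<exists>N. open N \<and> x \<in> N \<and> (\<forall>y\<in>N Int Y. \<forall>z\<in>N Int Y. Q y z)"
  using assms(2,3) by (intro exI[of _ N]) blast
qed

lemma locally2_conj:
 assumes "locally2 X R" "locally2 X Q"
 shows "locally2 X (\<lambda>y z. R y z \<and> Q y z)"
proof (rule locally2I)
 fix x assume x: "x \<in> X"
 obtain N where N: "open N" "x \<in> N" "\<forall>y\<in>N Int X. \<forall>z\<in>N Int X. R y z"
  using locally2D[OF assms(1) x] by blast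
 obtain M where M: "open M" "x \<in> M" "\<forall>y\<in>M Int X. \<forall>z\<in>M Int X. Q y z"
  using locally2D[OF assms(2) x] by blast
 show "\<exists>N. open N \<and> x \<in> N \<and> (\<forall>y\<in>N Int X. \<forall>z\<in>N Int X. R y z \<and> Q y z)"
  using N M by (intro exI[of _ "N Int M"]) auto
qed

lemma locally2_pullback:
 assumes "locally2 X R" "continuous_on Y f" "f ` Y \<subseteq> X"
 shows "locally2 Y (\<lambda>y z. R (f y) (f z))"
proof (rule locally2I)
 fix x assume x: "x \<in> Y"
 then have fx: "f x \<in> X" using assms(3) by auto
 obtain N where N: "open N" "f x \<in> N" "\<forall>y\<in>N Int X. \<forall>z\<in>N Int X. R y z"
  using locally2D[OF assms(1) fx] by blast
 obtain M where M: "open M" "M Int Y = f -` N Int Y"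
  using assms(2) N(1) unfolding continuous_on_open_invariant by blast
 show "\<exists>N. open N \<and> x \<in> N \<and> (\<forall>y\<in>N Int Y. \<forall>z\<in>N Int Y. R (f y) (f z))"
 proof (intro exI[of _ M] conjI ballI)
  fix y z assume "y \<in> M Int Y" "z \<in> M Int Y"
  then have "f y \<in> N Int X" "f z \<in> N Int X" using M(2) assms(3) by auto
  then show "R (f y) (f z)" using N(3) by blast
 qed (use M N x in auto)
qed

lemma local_cocycleD:
 assumes "local_cocycle X \<tau>" "x \<in> X"
 shows "\<exists>N. open N \<and> x \<in> N \<and>
  (\<forall>u\<in>N Int X. \<forall>v\<in>N Int X. \<forall>w\<in>N Int X. \<tau> u v + \<tau> v w = \<tau> u w)"
 using assms unfolding local_cocycle_def by blast

lemma local_cocycleI: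
 assumes "!!x. x \<in> X ==> \<exists>N. open N \<and> x \<in> N \<and>
  (\<forall>u\<in>N Int X. \<forall>v\<in>N Int X. \<forall>w\<in>N Int X. \<tau> u v + \<tau> v w = \<tau> u w)"
 shows "local_cocycle X \<tau>"
 using assms by (simp add: local_cocycle_def)

lemma local_cocycle_subset:
 assumes "local_cocycle X \<tau>" "Y \<subseteq> X"
 shows "local_cocycle Y \<tau>"
proof (rule local_cocycleI)
 fix x assume "x \<in> Y"
 then have "x \<in> X" using assms(2) by auto
 from local_cocycleD[OF assms(1) this] assms(2)
 show "\<exists>N. open N \<and> x \<in> N \<and>
  (\<forall>u\<in>N Int Y. \<forall>v\<in>N Int Y. \<forall>w\<in>N Int Y. \<tau> u v + \<tau> v w = \<tau> u w)"
  by (elim ex_forward) auto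
qed

lemma local_cocycle_pullback:
 assumes "local_cocycle X \<tau>" "continuous_on Y f" "f ` Y \<subseteq> X"
 shows "local_cocycle Y (\<lambda>y z. \<tau> (f y) (f z))"
proof (rule local_cocycleI)
 fix x assume x: "x \<in> Y"
 then have fx: "f x \<in> X" using assms(3) by auto
 obtain N where N: "open N" "f x \<in> N"
  "\<forall>u\<in>N Int X. \<forall>v\<in>N Int X. \<forall>w\<in>N Int X. \<tau> u v + \<tau> v w = \<tau> u w"
  using local_cocycleD[OF assms(1) fx] by blast
 obtain M where M: "open M" "M Int Y = f -` N Int Y"
  using assms(2) N(1) unfolding continuous_on_open_invariant by blast
 have f: "f y \<in> N \<and> f y \<in> X" if "y \<in> M Int Y" for y
  using that M(2) assms(3) by auto
 have "x \<in> M" using M(2) x N(2) by auto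
 then show "\<exists>N. open N \<and> x \<in> N \<and>
  (\<forall>u\<in>N Int Y. \<forall>v\<in>N Int Y. \<forall>w\<in>N Int Y. \<tau> (f u) (f v) + \<tau> (f v) (f w) = \<tau> (f u) (f w))"
  using M(1) f N(3) by (intro exI[of _ M]) simp
qed

lemma cocycle_rules:
 fixes \<tau> :: "'a => 'a => 'g::group_add"
 assumes "!!u v w. u \<in> N ==> v \<in> N ==> w \<in> N ==> \<tau> u v + \<tau> v w = \<tau> u w"
 shows "u \<in> N ==> \<tau> u u = 0" "u \<in> N ==> v \<in> N ==> \<tau> v u = - \<tau> u v"
proof -
 show *: "\<tau> u u = 0" if "u \<in> N" for u
  using assms[OF that that that] by (metis add_left_cancel add.right_neutral)
 show "\<tau> v u = - \<tau> u v" if "u \<in> N" "v \<in> N"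
  using assms[OF that(1,2,1)] *[OF that(1)] by (metis add_eq_0_iff minus_minus)
qed

lemma local_cocycle_gauge:
 assumes "local_cocycle X \<tau>" "locally2 X (\<lambda>y z. \<sigma> y z = k y + \<tau> y z - k z)"
 shows "local_cocycle X \<sigma>"
proof (rule local_cocycleI)
 fix x assume x: "x \<in> X"
 obtain N where N: "open N" "x \<in> N"
  "\<forall>u\<in>N Int X. \<forall>v\<in>N Int X. \<forall>w\<in>N Int X. \<tau> u v + \<tau> v w = \<tau> u w"
  using local_cocycleD[OF assms(1) x] by blast
 obtain M where M: "open M" "x \<in> M"
  "\<forall>y\<in>M Int X. \<forall>z\<in>M Int X. \<sigma> y z = k y + \<tau> y z - k z"
  using locally2D[OF assms(2) x] by blast
 have "\<sigma> u v + \<sigma> v w = \<sigma> u w" if "u \<in> N Int M Int X" "v \<in> N Int M Int X" "w \<in> N Int M Int X" for u v w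
 proof -
  have "\<sigma> u v + \<sigma> v w = (k u + \<tau> u v - k v) + (k v + \<tau> v w - k w)"
   using that M(3) by simp
  also have "\<dots> = k u + (\<tau> u v + \<tau> v w) - k w"
   by (simp add: gnorm del: add_uminus_conv_diff)
  also have "\<dots> = \<sigma> u w" using that M(3) N(3) by simp
  finally show ?thesis .
 qed
 then show "\<exists>N. open N \<and> x \<in> N \<and>
  (\<forall>u\<in>N Int X. \<forall>v\<in>N Int X. \<forall>w\<in>N Int X. \<sigma> u v + \<sigma> v w = \<sigma> u w)"
  using N M by (intro exI[of _ "N Int M"]) blast
qed

section \<open>Primitives of local cocycles\<close>

lemma locally2_const:
 assumes "connected Z" "locally2 Z (\<lambda>y z. f y = f z)" "y \<in> Z" "z \<in> Z"
 shows "f y = f z"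
proof -
 have "f constant_on Z"
 proof (rule locally_constant_imp_constant[OF assms(1)])
  fix a assume a: "a \<in> Z"
  obtain N where "open N" "a \<in> N" "\<forall>y\<in>N Int Z. \<forall>z\<in>N Int Z. f y = f z"
   using locally2D[OF assms(2) a] by blast
  then show "\<exists>T. openin (top_of_set Z) T \<and> a \<in> T \<and> (\<forall>x\<in>T. f x = f a)"
   using a by (intro exI[of _ "Z Int N"] conjI) (blast intro: openin_open_Int)+
 qed
 then show ?thesis using assms(3,4) by (auto simp: constant_on_def)
qed

text \<open>With the cocycle identity on all of \<open>Z\<close>, the function
  \<open>\<tau> y\<close> is a primitive. It is locally constant, hence equal to its value 0 at
  \<open>y\<close>.\<close>

lemma cocycle_zero_on_connected:
 fixes \<tau> :: "'a::topological_space => 'a => 'g::group_add"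
 assumes Z: "connected Z"
  and coc: "!!u v w. u \<in> Z ==> v \<in> Z ==> w \<in> Z ==> \<tau> u v + \<tau> v w = \<tau> u w"
  and zero: "locally2 Z (\<lambda>y z. \<tau> y z = 0)"
  and yz: "y \<in> Z" "z \<in> Z"
 shows "\<tau> y z = 0"
proof -
 have "\<tau> y y = \<tau> y z"
 proof (rule locally2_const[OF Z _ yz])
  show "locally2 Z (\<lambda>u v. \<tau> y u = \<tau> y v)"
   by (rule locally2_mono[OF zero order_refl]) (metis coc yz(1) add.right_neutral)
 qed
 then show ?thesis using cocycle_rules(1)[of Z \<tau> y] coc yz by simp
qed

text \<open>On a short interval around \<open>x\<close> the function \<open>\<sigma> x\<close> is a
  primitive, and primitives on adjacent intervals can be glued, so Bolzano's bisection principle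
  applies. The implication in \<open>?P\<close> makes the property vacuous for intervals that leave
  \<open>{a..b}\<close>.\<close>

lemma interval_coboundary:
 fixes \<sigma> :: "real => real => 'g::group_add"
 assumes "local_cocycle {a..b} \<sigma>" "a \<le> b"
 shows "\<exists>e. locally2 {a..b} (\<lambda>s t. \<sigma> s t = - e s + e t)"
proof -
 let ?P = "\<lambda>p q. {p..q} \<subseteq> {a..b} --> (\<exists>e. locally2 {p..q} (\<lambda>s t. \<sigma> s t = - e s + e t))"
 have "?P a b"
  using \<open>a \<le> b\<close>
 proof (rule Bolzano[where P = ?P])
  fix p q r assume pq: "?P p q" and qr: "?P q r" and le: "p \<le> q" "q \<le> r"
  show "?P p r"
  proof
   assume sub: "{p..r} \<subseteq> {a..b}"
   obtain e where e: "locally2 {p..q} (\<lambda>s t. \<sigma> s t = - e s + e t)" using pq sub le by fastforce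
   obtain f where f: "locally2 {q..r} (\<lambda>s t. \<sigma> s t = - f s + f t)" using qr sub le by fastforce
   \<comment> \<open>Primitives may be translated from the left, so \<open>f\<close> is translated
     to take the value \<open>e q\<close> at \<open>q\<close>.\<close>
   define h where "h s = (if s \<le> q then e s else e q + - f q + f s)" for s
   have hf: "h s = e q + - f q + f s" if "s \<ge> q" for s
    using that by (auto simp: h_def add.assoc)
   have "locally2 {p..r} (\<lambda>s t. \<sigma> s t = - h s + h t)"
   proof (rule locally2I)
    fix x assume x: "x \<in> {p..r}"
    consider "x < q" | "x > q" | "x = q" by linarith
    then show "\<exists>N. open N \<and> x \<in> N \<and> (\<forall>s\<in>N Int {p..r}. \<forall>t\<in>N Int {p..r}. \<sigma> s t = - h s + h t)"
    proof cases
     case 1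
     then have x': "x \<in> {p..q}" using x by auto
     obtain N where N: "open N" "x \<in> N" "\<forall>y\<in>N Int {p..q}. \<forall>z\<in>N Int {p..q}. \<sigma> y z = - e y + e z"
      using locally2D[OF e x'] by blast
     have "\<sigma> s t = - h s + h t" if "s \<in> N Int {..<q} Int {p..r}" "t \<in> N Int {..<q} Int {p..r}" for s t
      using that N(3)[rule_format, of s t] by (simp add: h_def)
     then show ?thesis using 1 N(1,2) by (intro exI[of _ "N Int {..<q}"]) (simp add: open_Int)
    next
     case 2
     then have x': "x \<in> {q..r}" using x by auto
     obtain N where N: "open N" "x \<in> N" "\<forall>y\<in>N Int {q..r}. \<forall>z\<in>N Int {q..r}. \<sigma> y z = - f y + f z"
      using locally2D[OF f x'] by blast
     have "\<sigma> s t = - h s + h t" if "s \<in> N Int {q<..} Int {p..r}" "t \<in> N Int {q<..} Int {p..r}" for s t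
      using that N(3)[rule_format, of s t] by (simp add: hf gnorm del: add_uminus_conv_diff)
     then show ?thesis using 2 N(1,2) by (intro exI[of _ "N Int {q<..}"]) (simp add: open_Int)
    next
     case 3
     have xx: "x \<in> {p..q}" "x \<in> {q..r}" "x \<in> {a..b}" using 3 le sub x by auto
     obtain N where N: "open N" "x \<in> N" "\<forall>y\<in>N Int {p..q}. \<forall>z\<in>N Int {p..q}. \<sigma> y z = - e y + e z"
      using locally2D[OF e xx(1)] by blast
     obtain M where M: "open M" "x \<in> M" "\<forall>y\<in>M Int {q..r}. \<forall>z\<in>M Int {q..r}. \<sigma> y z = - f y + f z"
      using locally2D[OF f xx(2)] by blast
     obtain O' where O: "open O'" "x \<in> O'"
      "\<forall>u\<in>O' Int {a..b}. \<forall>v\<in>O' Int {a..b}. \<forall>w\<in>O' Int {a..b}. \<sigma> u v + \<sigma> v w = \<sigma> u w"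
      using local_cocycleD[OF assms(1) xx(3)] by blast
     \<comment> \<open>Near \<open>q\<close> a pair may lie on different sides, where neither
       primitive speaks about it. Both points are compared with \<open>q\<close> instead.\<close>
     have q: "\<sigma> s q = - h s + h q \<and> \<sigma> q s = - h q + h s" if s: "s \<in> N Int M Int O' Int {p..r}" for s
     proof (cases "s \<le> q")
      case True
      then show ?thesis
       using s N(3)[rule_format, of s q] N(3)[rule_format, of q s] N(2) 3 le by (simp add: h_def)
     next
      case False
      then show ?thesis
       using s M(3)[rule_format, of s q] M(3)[rule_format, of q s] M(2) 3 le hf[of s] hf[of q]
       by (simp add: gnorm del: add_uminus_conv_diff)
     qed
     have "\<sigma> s t = - h s + h t" if "s \<in> N Int M Int O' Int {p..r}" "t \<in> N Int M Int O' Int {p..r}" for s t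
     proof -
      have "\<sigma> s q + \<sigma> q t = \<sigma> s t"
       using that sub 3 O(2) x by (intro O(3)[rule_format]) auto
      then show ?thesis using q[OF that(1)] q[OF that(2)]
       by (simp add: gnorm del: add_uminus_conv_diff)
     qed
     then show ?thesis using N(1,2) M(1,2) O(1,2) by (intro exI[of _ "N Int M Int O'"]) blast
    qed
   qed
   then show "\<exists>e. locally2 {p..r} (\<lambda>s t. \<sigma> s t = - e s + e t)" by blast
  qed
 next
  fix x assume x: "a \<le> x" "x \<le> b"
  then have "x \<in> {a..b}" by auto
  from local_cocycleD[OF assms(1) this] obtain N where N: "open N" "x \<in> N"
   "\<forall>u\<in>N Int {a..b}. \<forall>v\<in>N Int {a..b}. \<forall>w\<in>N Int {a..b}. \<sigma> u v + \<sigma> v w = \<sigma> u w"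
   by blast
  obtain d where d: "d > 0" "ball x d \<subseteq> N" using N(1,2) open_contains_ball by metis
  have "?P p q" if "p \<le> x" "x \<le> q" "q - p < d" for p q
  proof
   assume sub: "{p..q} \<subseteq> {a..b}"
   have N': "{p..q} \<subseteq> N" using d that by (auto simp: dist_real_def subset_iff)
   have "\<sigma> s t = - \<sigma> x s + \<sigma> x t" if "s \<in> {p..q}" "t \<in> {p..q}" for s t
   proof -
    have "\<sigma> x s + \<sigma> s t = \<sigma> x t"
     using N' sub that N(2) x by (intro N(3)[rule_format]) auto
    then show ?thesis by (metis add.assoc left_minus add.left_neutral)
   qed
   then show "\<exists>e. locally2 {p..q} (\<lambda>s t. \<sigma> s t = - e s + e t)"
    by (intro exI[of _ "\<sigma> x"] locally2I exI[of _ UNIV]) auto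
  qed
  then show "\<exists>d>0. \<forall>p q. p \<le> x \<and> x \<le> q \<and> q - p < d --> ?P p q" using d(1) by blast
 qed
 then show ?thesis by simp
qed

text \<open>The track of each \<open>x\<close> under the contraction carries a primitive, normalized
  to 0 at the end. All tracks end in \<open>p\<close>, so the primitive at the start of the track is
  the transport from \<open>p\<close> to \<open>x\<close>. It remains to see that neighbouring
  tracks fit together.\<close>

lemma contractible_coboundary:
 fixes \<tau> :: "'a::topological_space => 'a => 'g::group_add"
 assumes coc: "local_cocycle U \<tau>"
  and F: "continuous_on ({0..1} \<times> U) (\<lambda>(s::real, x). F s x)" "!!s x. s \<in> {0..1} ==> x \<in> U ==> F s x \<in> U"
   "!!x. x \<in> U ==> F 0 x = x" "!!x. x \<in> U ==> F 1 x = p"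
 shows "\<exists>h. locally2 U (\<lambda>y z. \<tau> y z = - h y + h z)"
proof -
 define T where "T y z = \<tau> (F (fst y) (snd y)) (F (fst z) (snd z))" for y z :: "real \<times> 'a"
 have cT: "local_cocycle ({0..1} \<times> U) T"
  using local_cocycle_pullback[OF coc F(1)] F(2) by (auto simp: T_def[abs_def] case_prod_unfold image_subset_iff)
 have slice: "\<exists>e. locally2 {0..1} (\<lambda>s t. T (s,x) (t,x) = - e s + e t) \<and> e 1 = 0" if x: "x \<in> U" for x
 proof -
  have "local_cocycle {0..1} (\<lambda>s t. T (s,x) (t,x))"
   by (rule local_cocycle_pullback[OF cT]) (auto intro!: continuous_intros simp: x)
  from interval_coboundary[OF this zero_le_one]
  obtain e where e: "locally2 {0..1} (\<lambda>s t. T (s,x) (t,x) = - e s + e t)" by blast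
  have "locally2 {0..1} (\<lambda>s t. T (s,x) (t,x) = - (- e 1 + e s) + (- e 1 + e t))"
   by (rule locally2_mono[OF e order_refl]) (simp add: minus_add add.assoc)
  then show ?thesis by (intro exI[of _ "\<lambda>s. - e 1 + e s"]) auto
 qed
 then have "\<forall>x\<in>U. \<exists>e. locally2 {0..1} (\<lambda>s t. T (s,x) (t,x) = - e s + e t) \<and> e 1 = 0" by blast
 from bchoice[OF this] obtain e where
  "\<forall>x\<in>U. locally2 {0..1} (\<lambda>s t. T (s,x) (t,x) = - e x s + e x t) \<and> e x 1 = 0" by blast
 then have e: "!!x. x \<in> U ==> locally2 {0..1} (\<lambda>s t. T (s,x) (t,x) = - e x s + e x t)"
  "!!x. x \<in> U ==> e x 1 = 0" by simp_all
 have "locally2 U (\<lambda>y z. \<tau> y z = - e y 0 + e z 0)"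
 proof (rule locally2I)
  fix x0 assume x0: "x0 \<in> U"
  have "\<forall>s\<in>{0..1}. \<exists>I N. open I \<and> s \<in> I \<and> open N \<and> x0 \<in> N \<and>
   (\<forall>u\<in>(I\<times>N) Int ({0..1} \<times> U). \<forall>v\<in>(I\<times>N) Int ({0..1} \<times> U). \<forall>w\<in>(I\<times>N) Int ({0..1} \<times> U). T u v + T v w = T u w)"
  proof
   fix s :: real assume s: "s \<in> {0..1}"
   obtain M where M: "open M" "(s,x0) \<in> M" "\<forall>u\<in>M Int ({0..1} \<times> U). \<forall>v\<in>M Int ({0..1} \<times> U). \<forall>w\<in>M Int ({0..1} \<times> U). T u v + T v w = T u w"
    using local_cocycleD[OF cT, of "(s,x0)"] s x0 by (metis SigmaI)
   obtain I N where "open I" "open N" "(s,x0) \<in> I \<times> N" "I \<times> N \<subseteq> M"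
    using open_prod_elim[OF M(1,2)] by blast
   then show "\<exists>I N. open I \<and> s \<in> I \<and> open N \<and> x0 \<in> N \<and>
   (\<forall>u\<in>(I\<times>N) Int ({0..1} \<times> U). \<forall>v\<in>(I\<times>N) Int ({0..1} \<times> U). \<forall>w\<in>(I\<times>N) Int ({0..1} \<times> U). T u v + T v w = T u w)"
    using M(3) by (intro exI[of _ I] exI[of _ N]) blast
  qed
  from bchoice[OF this] obtain I where "\<forall>s\<in>{0..1}. \<exists>N. open (I s) \<and> s \<in> I s \<and> open N \<and> x0 \<in> N \<and>
   (\<forall>u\<in>(I s\<times>N) Int ({0..1} \<times> U). \<forall>v\<in>(I s\<times>N) Int ({0..1} \<times> U). \<forall>w\<in>(I s\<times>N) Int ({0..1} \<times> U). T u v + T v w = T u w)" by blast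
  from bchoice[OF this] obtain N where IN0: "\<forall>s\<in>{0..1}. open (I s) \<and> s \<in> I s \<and> open (N s) \<and> x0 \<in> N s \<and>
   (\<forall>u\<in>(I s\<times>N s) Int ({0..1} \<times> U). \<forall>v\<in>(I s\<times>N s) Int ({0..1} \<times> U). \<forall>w\<in>(I s\<times>N s) Int ({0..1} \<times> U). T u v + T v w = T u w)" by blast
  have IN: "!!s. s \<in> {0..1} ==> open (I s) \<and> s \<in> I s \<and> open (N s) \<and> x0 \<in> N s"
   "!!s u v w. s \<in> {0..1} ==> u \<in> (I s\<times>N s) Int ({0..1} \<times> U) ==> v\<in>(I s\<times>N s) Int ({0..1} \<times> U) ==> w\<in>(I s\<times>N s) Int ({0..1} \<times> U) ==> T u v + T v w = T u w"
   using IN0 by simp_all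
  \<comment> \<open>Tube argument: finitely many product neighbourhoods cover the segment over
    \<open>x0\<close>, so one neighbourhood \<open>M\<close> of \<open>x0\<close> serves all
    times.\<close>
  have "{0..1} \<subseteq> (\<Union>s\<in>{0..1}. I s)" using IN(1) by blast
  from compactE_image[OF compact_Icc _ this] IN(1)
  obtain S where S: "S \<subseteq> {0..1}" "finite S" "{0..1} \<subseteq> (\<Union>s\<in>S. I s)" by blast
  define M where "M = (\<Inter>s\<in>S. N s)"
  have "open M" "x0 \<in> M" unfolding M_def using S IN(1) by (auto intro!: open_INT)
  moreover have "\<tau> y z = - e y 0 + e z 0" if y: "y \<in> M Int U" and z: "z \<in> M Int U" for y z
  proof -
   \<comment> \<open>Transport from \<open>p\<close> along the track of \<open>y\<close> back to
     time \<open>s\<close>, across to the track of \<open>z\<close>, and along that track to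
     \<open>p\<close>. It is locally constant in \<open>s\<close> by the two triangles of a small
     square, and trivial at time 1.\<close>
   define D where "D s = e y s + T (s,y) (s,z) - e z s" for s
   have "D 0 = D 1"
   proof (rule locally2_const[of "{0..1}"])
    show "locally2 {0..1} (\<lambda>s t. D s = D t)"
    proof (rule locally2I)
     fix s :: real assume s: "s \<in> {0..1}"
     then obtain r where r: "r \<in> S" "s \<in> I r" using S(3) by blast
     obtain A where A: "open A" "s \<in> A" "\<forall>p\<in>A Int {0..1}. \<forall>q\<in>A Int {0..1}. T (p,y) (q,y) = - e y p + e y q"
      using locally2D[OF e(1)[OF IntD2[OF y]] s] by blast
     obtain B where B: "open B" "s \<in> B" "\<forall>p\<in>B Int {0..1}. \<forall>q\<in>B Int {0..1}. T (p,z) (q,z) = - e z p + e z q"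
      using locally2D[OF e(1)[OF IntD2[OF z]] s] by blast
     have "D p = D q" if p: "p \<in> A Int B Int I r Int {0..1}" and q: "q \<in> A Int B Int I r Int {0..1}" for p q
     proof -
      have r01: "r \<in> {0..1}" using r S by blast
      have yz: "y \<in> N r Int U" "z \<in> N r Int U" using y z r by (auto simp: M_def)
      have 1: "T (p,y) (q,y) + T (q,y) (q,z) = T (p,y) (q,z)"
       by (rule IN(2)[OF r01]) (use p q yz in auto)
      have 2: "T (p,y) (p,z) + T (p,z) (q,z) = T (p,y) (q,z)"
       by (rule IN(2)[OF r01]) (use p q yz in auto)
      have "- e y p + e y q + T (q,y) (q,z) = T (p,y) (p,z) + (- e z p + e z q)"
       using 1 2 A(3)[rule_format, of p q] B(3)[rule_format, of p q] p q by simp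
      then have "e y p + (- e y p + e y q + T (q,y) (q,z)) - e z q = e y p + (T (p,y) (p,z) + (- e z p + e z q)) - e z q"
       by simp
      then show ?thesis
       by (simp add: D_def gnorm del: add_uminus_conv_diff)
     qed
     then show "\<exists>N. open N \<and> s \<in> N \<and> (\<forall>p\<in>N Int {0..1}. \<forall>q\<in>N Int {0..1}. D p = D q)"
      using A(1,2) B(1,2) r s S(1) IN(1)[of r] by (intro exI[of _ "A Int B Int I r"]) blast
    qed
   qed auto
   moreover have "T (0,y) (0,z) = \<tau> y z" using y z F(3) by (simp add: T_def)
   moreover have "T (1,y) (1,z) = 0"
   proof -
    obtain r where r: "r \<in> S" "1 \<in> I r" using S(3) by (metis UN_E atLeastAtMost_iff order_refl subsetD zero_le_one)
    have "T (1,y) (1,y) + T (1,y) (1,y) = T (1,y) (1,y)"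
     by (rule IN(2)[of r]) (use r S y in \<open>auto simp: M_def\<close>)
    moreover have "T (1,y) (1,y) = T (1,y) (1,z)" using y z F(4) by (simp add: T_def)
    ultimately show ?thesis by (metis add_left_cancel add.right_neutral)
   qed
   ultimately have "e y 0 + \<tau> y z - e z 0 = 0" using e(2) y z by (simp add: D_def)
   then show ?thesis by (metis add.assoc add_minus_cancel diff_add_cancel minus_add_cancel add.left_neutral)
  qed
  ultimately show "\<exists>N. open N \<and> x0 \<in> N \<and> (\<forall>y\<in>N Int U. \<forall>z\<in>N Int U. \<tau> y z = - e y 0 + e z 0)"
   by blast
 qed
 then show ?thesis by (rule exI[of _ "\<lambda>x. e x 0"])
qed

text \<open>A gauge transformation between two cocycles that is known on a dense subset
  \<open>V\<close> extends, since transport to a nearby point of \<open>V\<close> forces its value.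
  The identity on \<open>V\<close> must hold near every point of \<open>W\<close>, not only near the
  points of \<open>V\<close>.\<close>

lemma gauge_extend:
 fixes \<tau> \<sigma> :: "'a::topological_space => 'a => 'g::group_add"
 assumes \<tau>: "local_cocycle W \<tau>" and \<sigma>: "local_cocycle W \<sigma>"
  and h: "!!x. x \<in> W ==> \<exists>N. open N \<and> x \<in> N \<and> (\<forall>y\<in>N Int V. \<forall>z\<in>N Int V. \<sigma> y z = h y + \<tau> y z - h z)"
  and V: "V \<subseteq> W" "!!N x. open N ==> x \<in> N Int W ==> N Int V \<noteq> {}"
 shows "\<exists>k. locally2 W (\<lambda>y z. \<sigma> y z = k y + \<tau> y z - k z)"
proof -
 have "\<exists>N. open N \<and> x \<in> N \<and> (\<forall>u\<in>N\<inter>W. \<forall>v\<in>N\<inter>W. \<forall>w\<in>N\<inter>W. \<tau> u v + \<tau> v w = \<tau> u w \<and> \<sigma> u v + \<sigma> v w = \<sigma> u w)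
  \<and> (\<forall>y\<in>N Int V. \<forall>z\<in>N Int V. \<sigma> y z = h y + \<tau> y z - h z)" if x: "x \<in> W" for x
 proof -
  obtain A where A: "open A" "x \<in> A"
   "\<forall>u\<in>A Int W. \<forall>v\<in>A Int W. \<forall>w\<in>A Int W. \<tau> u v + \<tau> v w = \<tau> u w"
   using local_cocycleD[OF \<tau> x] by blast
  obtain B where B: "open B" "x \<in> B"
   "\<forall>u\<in>B Int W. \<forall>v\<in>B Int W. \<forall>w\<in>B Int W. \<sigma> u v + \<sigma> v w = \<sigma> u w"
   using local_cocycleD[OF \<sigma> x] by blast
  obtain C where "open C" "x \<in> C" "\<forall>y\<in>C Int V. \<forall>z\<in>C Int V. \<sigma> y z = h y + \<tau> y z - h z"
   using h[OF x] by blast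
  with A B show ?thesis by (intro exI[of _ "A Int B Int C"]) blast
 qed
 then have "\<forall>x\<in>W. \<exists>N. open N \<and> x \<in> N \<and> (\<forall>u\<in>N\<inter>W. \<forall>v\<in>N\<inter>W. \<forall>w\<in>N\<inter>W. \<tau> u v + \<tau> v w = \<tau> u w \<and> \<sigma> u v + \<sigma> v w = \<sigma> u w)
  \<and> (\<forall>y\<in>N Int V. \<forall>z\<in>N Int V. \<sigma> y z = h y + \<tau> y z - h z)" by blast
 from bchoice[OF this] obtain N where NN: "\<forall>x\<in>W. open (N x) \<and> x \<in> N x \<and> (\<forall>u\<in>N x\<inter>W. \<forall>v\<in>N x\<inter>W. \<forall>w\<in>N x\<inter>W. \<tau> u v + \<tau> v w = \<tau> u w \<and> \<sigma> u v + \<sigma> v w = \<sigma> u w)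
  \<and> (\<forall>y\<in>N x Int V. \<forall>z\<in>N x Int V. \<sigma> y z = h y + \<tau> y z - h z)" by blast
 have N: "!!x. x \<in> W ==> open (N x) \<and> x \<in> N x"
  and coc: "!!x u v w. x \<in> W ==> u \<in> N x Int W ==> v \<in> N x Int W ==> w \<in> N x Int W ==> \<tau> u v + \<tau> v w = \<tau> u w"
   "!!x u v w. x \<in> W ==> u \<in> N x Int W ==> v \<in> N x Int W ==> w \<in> N x Int W ==> \<sigma> u v + \<sigma> v w = \<sigma> u w"
  and hN: "!!x y z. x \<in> W ==> y \<in> N x Int V ==> z \<in> N x Int V ==> \<sigma> y z = h y + \<tau> y z - h z"
  using NN by simp_all
 have "\<exists>y. y \<in> N x Int V" if "x \<in> W" for x using V(2)[of "N x" x] N[OF that] that by blast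
 then obtain g where g: "!!x. x \<in> W ==> g x \<in> N x Int V" by metis
 \<comment> \<open>The value forced at \<open>x\<close> by \<open>y\<close>: go to \<open>y\<close>
   with \<open>\<sigma>\<close>, apply the known gauge, return with \<open>\<tau>\<close>.\<close>
 define P where "P x y = \<sigma> x y + h y + \<tau> y x" for x y
 have Pind: "P u y = P u z" if "x \<in> W" "u \<in> N x Int W" "y \<in> N x Int V" "z \<in> N x Int V" for x u y z
 proof -
  have yz: "y \<in> N x Int W" "z \<in> N x Int W" using that V(1) by auto
  have "P u z = (\<sigma> u y + \<sigma> y z) + h z + \<tau> z u"
   using coc(2)[OF that(1,2) yz] by (simp add: P_def)
  also have "\<dots> = \<sigma> u y + h y + (\<tau> y z + \<tau> z u)"
   using hN[of x y z] that by (simp add: gnorm del: add_uminus_conv_diff)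
  also have "\<dots> = P u y" using coc(1)[OF that(1) yz that(2)] by (simp add: P_def)
  finally show ?thesis by simp
 qed
 define k where "k x = P x (g x)" for x
 have k: "k u = P u (g x)" if x: "x \<in> W" and u: "u \<in> N x Int W" for x u
 proof -
  have "N x Int N u Int V \<noteq> {}" using V(2)[of "N x Int N u" u] N[OF x] N[of u] u by (simp add: open_Int)
  then obtain y where y: "y \<in> N x Int N u Int V" by blast
  have "k u = P u y" unfolding k_def by (rule Pind[of u]) (use u y g N in auto)
  also have "\<dots> = P u (g x)" by (rule Pind[of x]) (use x u y g N in auto)
  finally show ?thesis .
 qed
 have "locally2 W (\<lambda>y z. \<sigma> y z = k y + \<tau> y z - k z)"
 proof (rule locally2I)
  fix x assume x: "x \<in> W"
  have "\<sigma> y z = k y + \<tau> y z - k z" if y: "y \<in> N x Int W" and z: "z \<in> N x Int W" for y z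
  proof -
   let ?g = "g x"
   have g': "?g \<in> N x Int W" using g[OF x] V by auto
   have 1: "\<tau> ?g y + \<tau> y z = \<tau> ?g z" by (rule coc(1)[OF x g' y z])
   have 2: "\<sigma> y z + \<sigma> z ?g = \<sigma> y ?g" by (rule coc(2)[OF x y z g'])
   have "k y + \<tau> y z = \<sigma> y ?g + h ?g + (\<tau> ?g y + \<tau> y z)"
    by (simp add: k[OF x y] P_def add.assoc)
   also have "\<dots> = \<sigma> y z + k z"
    unfolding 1 2[symmetric] by (simp add: k[OF x z] P_def add.assoc)
   finally show ?thesis by (metis add_diff_cancel)
  qed
  then show "\<exists>N. open N \<and> x \<in> N \<and> (\<forall>y\<in>N Int W. \<forall>z\<in>N Int W. \<sigma> y z = k y + \<tau> y z - k z)"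
   using N[OF x] by blast
 qed
 then show ?thesis by blast
qed

section \<open>Representations of link complements\<close>

lemma is_linkD:
 assumes "is_link S m L" "i \<in> {1..m}"
 shows "continuous_on UNIV (L i)" "range (L i) \<subseteq> S" "L i (t + 1) = L i t"
 using assms unfolding is_link_def by blast+

lemma is_link_inj:
 assumes "is_link S m L" "i \<in> {1..m}" "j \<in> {1..m}" "L i s = L j t"
 shows "i = j" "s - t \<in> \<int>"
 using assms unfolding is_link_def by blast+

lemma bit_rearrange: "a + b = c + t + d ==> t = (a + c) + (b + d)" for a b c d t :: bit
 by (cases a; cases b; cases c; cases d; cases t) simp_all

text \<open>What the topology asks of the target group. Meridians of component \<open>i\<close> are
  conjugates of elements of the subgroup \<open>H i\<close> on which the parity
  \<open>\<theta> i\<close> is 1. In multiplicative notation \<open>four_commute\<close> says that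
  (a b)^2 commutes with a, for conjugates a and b of elements of these subgroups.\<close>

locale meridian_data =
 fixes H :: "nat => 'g::group_add set" and \<theta> :: "nat => 'g => bit"
 assumes H_zero: "0 \<in> H i"
  and H_add: "x \<in> H i ==> y \<in> H i ==> x + y \<in> H i"
  and H_minus: "x \<in> H i ==> - x \<in> H i"
  and \<theta>_add: "\<theta> i (x + y) = \<theta> i x + \<theta> i y"
  and ex_meridian: "\<exists>g\<in>H i. \<theta> i g = 1"
  and four_commute: "a \<in> H i ==> b \<in> H j ==>
   (- x + a + x) + (- y + b + y) + (- x + a + x) + (- y + b + y) + (- x + a + x) =
   (- x + a + x) + ((- x + a + x) + (- y + b + y) + (- x + a + x) + (- y + b + y))"
begin

definition conj_class :: "nat => 'g set" where
 "conj_class i = {- x + h + x | x h. h \<in> H i}"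

definition meridional :: "nat => 'a::topological_space set => ('a => 'a => 'g) => 'a => bool" where
 "meridional i X \<tau> p \<longleftrightarrow>
  (\<exists>W k. open W \<and> p \<in> W \<and> locally2 (W Int X) (\<lambda>y z. k y + \<tau> y z - k z \<in> H i)) \<and>
  (\<forall>W k. open W --> p \<in> W --> \<not> locally2 (W Int X) (\<lambda>y z. \<theta> i (\<tau> y z) = k y + k z))"

text \<open>Only the point sets of the components enter. Orientations return when a diagram is
  coloured.\<close>

definition link_rep :: "'a::topological_space set => nat => (nat => 'a set) => ('a => 'a => 'g) => bool" where
 "link_rep S m A \<tau> \<longleftrightarrow> local_cocycle (S - (\<Union>i\<in>{1..m}. A i)) \<tau> \<and>
  (\<forall>i\<in>{1..m}. \<forall>p\<in>A i. meridional i (S - (\<Union>i\<in>{1..m}. A i)) \<tau> p)"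

lemma \<theta>_zero [simp]: "\<theta> i 0 = 0"
 using \<theta>_add[of i 0 0] by simp

lemma \<theta>_minus [simp]: "\<theta> i (- x) = \<theta> i x"
proof -
 have "\<theta> i x + \<theta> i (- x) = 0" using \<theta>_add[of i x "- x"] by simp
 then show ?thesis by (cases "\<theta> i x"; cases "\<theta> i (- x)") auto
qed

lemma \<theta>_diff [simp]: "\<theta> i (x - y) = \<theta> i x + \<theta> i y"
 using \<theta>_add[of i x "- y"] by simp

lemma four_commute':
 assumes "a \<in> conj_class i" "b \<in> conj_class j"
 shows "a + b + a + b + a = a + (a + b + a + b)"
 using assms four_commute by (auto simp: conj_class_def)

text \<open>The first condition is pulled back along \<open>f\<close>. The second is a negation, so
  a primitive near \<open>p\<close> is pulled back along the inverse \<open>g\<close> to contradict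
  it at \<open>f p\<close>. The ambient spaces \<open>S\<close> and \<open>S'\<close> may differ,
  which covers charts of the sphere as well as homeomorphisms.\<close>

lemma meridional_transfer:
 assumes mer: "meridional i X' \<tau> (f p)"
  and W: "open W" "p \<in> W" "p \<in> S" and W': "open W'" "f p \<in> W'" "f p \<in> S'"
  and f: "continuous_on (W Int S) f" "f ` (W Int X) \<subseteq> X'"
  and g: "continuous_on (W' Int S') g" "g ` (W' Int X') \<subseteq> X" "g (f p) = p"
  and fg: "!!y. y \<in> W' Int X' ==> f (g y) = y"
  and X: "X \<subseteq> S" "X' \<subseteq> S'"
  and eq: "locally2 (W Int X) (\<lambda>y z. \<tau>' y z = k y + \<tau> (f y) (f z) - k z)"
 shows "meridional i X \<tau>' p"
 unfolding meridional_def
proof (intro conjI allI impI)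
 obtain W1 k1 where 1: "open W1" "f p \<in> W1" "locally2 (W1 Int X') (\<lambda>y z. k1 y + \<tau> y z - k1 z \<in> H i)"
  using mer unfolding meridional_def by blast
 obtain V where V: "open V" "V Int (W Int S) = f -` W1 Int (W Int S)"
  using f(1) 1(1) unfolding continuous_on_open_invariant by blast
 let ?W = "W Int V"
 have "locally2 (?W Int X) (\<lambda>y z. k1 (f y) + \<tau> (f y) (f z) - k1 (f z) \<in> H i)"
 proof (rule locally2_pullback[OF 1(3)])
  show "continuous_on (?W Int X) f" by (rule continuous_on_subset[OF f(1)]) (use X in auto)
  show "f ` (?W Int X) \<subseteq> W1 Int X'" using f(2) V X by auto
 qed
 moreover have "locally2 (?W Int X) (\<lambda>y z. \<tau>' y z = k y + \<tau> (f y) (f z) - k z)"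
  by (rule locally2_mono[OF eq]) auto
 ultimately have "locally2 (?W Int X) (\<lambda>y z. k1 (f y) + \<tau> (f y) (f z) - k1 (f z) \<in> H i \<and> \<tau>' y z = k y + \<tau> (f y) (f z) - k z)"
  by (rule locally2_conj)
 then have "locally2 (?W Int X) (\<lambda>y z. (k1 (f y) - k y) + \<tau>' y z - (k1 (f z) - k z) \<in> H i)"
  by (rule locally2_mono) (simp_all add: gnorm del: add_uminus_conv_diff)
 then show "\<exists>W k. open W \<and> p \<in> W \<and> locally2 (W Int X) (\<lambda>y z. k y + \<tau>' y z - k z \<in> H i)"
  using V 1 W by (intro exI[of _ ?W] exI[of _ "\<lambda>y. k1 (f y) - k y"]) auto
next
 fix W1 k1 assume W1: "open W1" "p \<in> W1"
 show "\<not> locally2 (W1 Int X) (\<lambda>y z. \<theta> i (\<tau>' y z) = k1 y + k1 z)"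
 proof
  assume *: "locally2 (W1 Int X) (\<lambda>y z. \<theta> i (\<tau>' y z) = k1 y + k1 z)"
  have "locally2 (W1 Int W Int X) (\<lambda>y z. \<theta> i (\<tau>' y z) = k1 y + k1 z)"
   by (rule locally2_mono[OF *]) auto
  moreover have "locally2 (W1 Int W Int X) (\<lambda>y z. \<tau>' y z = k y + \<tau> (f y) (f z) - k z)"
   by (rule locally2_mono[OF eq]) auto
  ultimately have 2: "locally2 (W1 Int W Int X) (\<lambda>y z. \<theta> i (\<tau>' y z) = k1 y + k1 z \<and> \<tau>' y z = k y + \<tau> (f y) (f z) - k z)"
   by (rule locally2_conj)
  obtain V where V: "open V" "V Int (W' Int S') = g -` (W1 Int W) Int (W' Int S')"
   using g(1) open_Int[OF W1(1) W(1)] unfolding continuous_on_open_invariant by blast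
  let ?W = "W' Int V"
  have "locally2 (?W Int X') (\<lambda>y z. \<theta> i (\<tau>' (g y) (g z)) = k1 (g y) + k1 (g z) \<and> \<tau>' (g y) (g z) = k (g y) + \<tau> (f (g y)) (f (g z)) - k (g z))"
  proof (rule locally2_pullback[OF 2])
   show "continuous_on (?W Int X') g" by (rule continuous_on_subset[OF g(1)]) (use X in auto)
   show "g ` (?W Int X') \<subseteq> W1 Int W Int X" using g(2) V X by auto
  qed
  then have "locally2 (?W Int X') (\<lambda>y z. \<theta> i (\<tau> y z) = (k1 (g y) + \<theta> i (k (g y))) + (k1 (g z) + \<theta> i (k (g z))))"
  proof (rule locally2_mono)
   fix y z assume yz: "y \<in> ?W Int X'" "z \<in> ?W Int X'"
    and e: "\<theta> i (\<tau>' (g y) (g z)) = k1 (g y) + k1 (g z) \<and> \<tau>' (g y) (g z) = k (g y) + \<tau> (f (g y)) (f (g z)) - k (g z)"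
   have "\<theta> i (\<tau>' (g y) (g z)) = \<theta> i (k (g y)) + \<theta> i (\<tau> y z) + \<theta> i (k (g z))"
    using e fg yz by (simp only: \<theta>_add \<theta>_diff Int_iff)
   with e have "k1 (g y) + k1 (g z) = \<theta> i (k (g y)) + \<theta> i (\<tau> y z) + \<theta> i (k (g z))"
    by (metis (no_types))
   then show "\<theta> i (\<tau> y z) = (k1 (g y) + \<theta> i (k (g y))) + (k1 (g z) + \<theta> i (k (g z)))"
    by (rule bit_rearrange)
  qed simp
  moreover have "open ?W" "f p \<in> ?W" using V W W' W1 g(3) by auto
  moreover have "open ?W --> f p \<in> ?W -->
    \<not> locally2 (?W Int X') (\<lambda>y z. \<theta> i (\<tau> y z) = (k1 (g y) + \<theta> i (k (g y))) + (k1 (g z) + \<theta> i (k (g z))))"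
   using mer unfolding meridional_def by (elim conjE allE)
  ultimately show False by blast
 qed
qed

lemma meridional_cong:
 assumes "meridional i X \<tau> p" "open W" "p \<in> W" "W Int X = W Int X'"
  and "locally2 (W Int X') (\<lambda>y z. \<tau>' y z = k y + \<tau> y z - k z)"
 shows "meridional i X' \<tau>' p"
proof (rule meridional_transfer[where f = "\<lambda>x. x" and g = "\<lambda>x. x" and W = W and W' = W and S = UNIV and S' = UNIV and X = X' and X' = X and \<tau> = \<tau> and k = k])
qed (use assms in auto)

lemma link_rep_gauge:
 assumes "link_rep S m A \<tau>"
 shows "link_rep S m A (\<lambda>y z. k y + \<tau> y z - k z)"
proof -
 have l: "locally2 X (\<lambda>y z. k y + \<tau> y z - k z = k y + \<tau> y z - k z)" for X
  by (rule locally2I) auto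
 show ?thesis
  unfolding link_rep_def
 proof (intro conjI ballI)
  show "local_cocycle (S - (\<Union>i\<in>{1..m}. A i)) (\<lambda>y z. k y + \<tau> y z - k z)"
   by (rule local_cocycle_gauge[where k = k and \<tau> = \<tau>, OF _ l]) (use assms in \<open>simp add: link_rep_def\<close>)
  fix i p assume "i \<in> {1..m}" "p \<in> A i"
  then have "meridional i (S - (\<Union>i\<in>{1..m}. A i)) \<tau> p" using assms by (simp add: link_rep_def)
  then show "meridional i (S - (\<Union>i\<in>{1..m}. A i)) (\<lambda>y z. k y + \<tau> y z - k z) p"
   by (rule meridional_cong[where W = UNIV and k = k]) (use l in auto)
 qed
qed

lemma link_rep_homeomorphism:
 assumes rep: "link_rep S' m A \<tau>" and A: "!!i. i \<in> {1..m} ==> A i \<subseteq> S'"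
  and hom: "homeomorphism S' S f g"
 shows "link_rep S m (\<lambda>i. f ` A i) (\<lambda>y z. \<tau> (g y) (g z))"
proof -
 let ?X' = "S' - (\<Union>i\<in>{1..m}. A i)" and ?X = "S - (\<Union>i\<in>{1..m}. f ` A i)"
 have fg: "f (g y) = y" "g y \<in> S'" if "y \<in> S" for y
  using hom that by (auto simp: homeomorphism_def)
 have gf: "g (f x) = x" "f x \<in> S" if "x \<in> S'" for x
  using hom that by (auto simp: homeomorphism_def)
 have gX: "g ` ?X \<subseteq> ?X'" using fg by force
 have fX: "f ` ?X' \<subseteq> ?X"
 proof
  fix y assume "y \<in> f ` ?X'"
  then obtain x where x: "x \<in> ?X'" "y = f x" by auto
  have "f x \<noteq> f a" if "i \<in> {1..m}" "a \<in> A i" for i a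
   using that x gf A by (metis Diff_iff UN_I subsetD)
  then have "f x \<notin> (\<Union>i\<in>{1..m}. f ` A i)" by blast
  moreover have "f x \<in> S" using x gf(2) by auto
  ultimately show "y \<in> ?X" using x(2) by simp
 qed
 have cont: "continuous_on S g" "continuous_on S' f" using hom by (auto simp: homeomorphism_def)
 show ?thesis
  unfolding link_rep_def
 proof (intro conjI ballI)
  show "local_cocycle ?X (\<lambda>y z. \<tau> (g y) (g z))"
  proof (rule local_cocycle_pullback[OF _ _ gX])
   show "local_cocycle ?X' \<tau>" using rep by (simp add: link_rep_def)
   show "continuous_on ?X g" by (rule continuous_on_subset[OF cont(1)]) blast
  qed
  fix i p assume i: "i \<in> {1..m}" and "p \<in> f ` A i"
  then obtain a where a: "a \<in> A i" "p = f a" by auto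
  have aS: "a \<in> S'" using a A i by blast
  have l: "locally2 (UNIV Int ?X) (\<lambda>y z. \<tau> (g y) (g z) = 0 + \<tau> (g y) (g z) - 0)"
   by (rule locally2I) auto
  have mer: "meridional i ?X' \<tau> (g p)"
   using rep a gf[OF aS] i by (simp add: link_rep_def)
  show "meridional i ?X (\<lambda>y z. \<tau> (g y) (g z)) p"
  proof (rule meridional_transfer[OF mer open_UNIV _ _ open_UNIV _ _ _ _ _ _ _ _ _ _ l])
   show "continuous_on (UNIV Int S) g" "continuous_on (UNIV Int S') f" using cont by auto
   show "p \<in> S" "g p \<in> S'" "f (g p) = p" using a gf aS by auto
   show "g ` (UNIV Int ?X) \<subseteq> ?X'" "f ` (UNIV Int ?X') \<subseteq> ?X" using gX fX by auto
   show "g (f y) = y" if "y \<in> UNIV Int ?X'" for y using gf that by auto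
  qed auto
 qed
qed

lemma link_rep_cong:
 assumes "link_rep S m A \<tau>" "!!i. i \<in> {1..m} ==> A i = B i"
 shows "link_rep S m B \<tau>"
proof -
 have "(\<Union>i\<in>{1..m}. A i) = (\<Union>i\<in>{1..m}. B i)" using assms(2) by auto
 then show ?thesis using assms by (simp add: link_rep_def)
qed

text \<open>The end map of the isotopy is a homeomorphism of the sphere that matches the components
  as sets, and the representation is pulled back along it.\<close>

lemma isotopic_rep:
 assumes rep: "\<exists>\<tau>. link_rep S3 m (\<lambda>i. range (L' i)) \<tau>" and iso: "isotopic_links m L L'"
  and L: "is_link S3 m L" "is_link S3 m L'"
 shows "\<exists>\<tau>. link_rep S3 m (\<lambda>i. range (L i)) \<tau>"
proof -
 obtain Hh :: "real => complex \<times> complex => complex \<times> complex"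
  where h: "\<forall>s\<in>{0..1}. \<exists>g. homeomorphism S3 S3 (Hh s) g"
   and r: "\<forall>i\<in>{1..m}. \<exists>\<rho> :: real => real. continuous_on UNIV \<rho> \<and> strict_mono \<rho> \<and>
    (\<forall>t. \<rho> (t + 1) = \<rho> t + 1) \<and> (\<forall>t. Hh 1 (L i t) = L' i (\<rho> t))"
  using iso unfolding isotopic_links_def by (elim exE conjE) (rule that)
 obtain g where g: "homeomorphism S3 S3 (Hh 1) g" using h by (metis atLeastAtMost_iff order_refl zero_le_one)
 from rep obtain \<tau> where \<tau>: "link_rep S3 m (\<lambda>i. range (L' i)) \<tau>" by blast
 have "link_rep S3 m (\<lambda>i. g ` range (L' i)) (\<lambda>y z. \<tau> (Hh 1 y) (Hh 1 z))"
 proof (rule link_rep_homeomorphism[OF \<tau> _ homeomorphism_symD[OF g]])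
  show "range (L' i) \<subseteq> S3" if "i \<in> {1..m}" for i
   by (rule is_linkD(2)[OF L(2) that])
 qed
 moreover have "g ` range (L' i) = range (L i)" if i: "i \<in> {1..m}" for i
 proof -
  obtain \<rho> :: "real => real" where \<rho>: "continuous_on UNIV \<rho>" "!!t. \<rho> (t + 1) = \<rho> t + 1" "!!t. Hh 1 (L i t) = L' i (\<rho> t)"
   using r i by blast
  have per: "L' i (t + 1) = L' i t" for t by (rule is_linkD(3)[OF L(2) i])
  have gL: "g (L' i (\<rho> t)) = L i t" for t
   using g \<rho>(3)[of t] is_linkD(2)[OF L(1) i] by (metis homeomorphism_apply1 rangeI subsetD)
  \<comment> \<open>The reparametrization covers every point: an integer shift brings
    \<open>t\<close> between \<open>\<rho> 0\<close> and \<open>\<rho> 1\<close>, where the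
    intermediate value theorem applies.\<close>
  have "\<exists>s. L' i t = L' i (\<rho> s)" for t
  proof -
   have pern: "L' i (t + real n) = L' i t" for n t
   proof (induction n)
    case (Suc n)
    then show ?case using per[of "t + real n"] by (simp add: algebra_simps)
   qed simp
   have perz: "L' i (t + of_int n) = L' i t" for n t
   proof (cases "n \<ge> 0")
    case True
    then show ?thesis using pern[of t "nat n"] by simp
   next
    case False
    then show ?thesis using pern[of "t + of_int n" "nat (- n)"] by simp
   qed
   define n where "n = \<lfloor>t - \<rho> 0\<rfloor>"
   have "\<rho> 0 \<le> t - of_int n" "t - of_int n \<le> \<rho> 1"
    using \<rho>(2)[of 0] unfolding n_def by (simp_all, linarith+)
   moreover have "continuous_on {0..1} \<rho>" using \<rho>(1) continuous_on_subset by blast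
   ultimately obtain s where "\<rho> s = t - of_int n" using IVT'[of \<rho> 0 "t - of_int n" 1] by auto
   then show ?thesis using perz[of "t - of_int n" n] by (intro exI[of _ s]) simp
  qed note ex = this
  show ?thesis
  proof (intro equalityI subsetI)
   fix x assume "x \<in> g ` range (L' i)"
   then obtain t where "x = g (L' i t)" by blast
   moreover obtain s where "L' i t = L' i (\<rho> s)" using ex by blast
   ultimately have "x = L i s" using gL by simp
   then show "x \<in> range (L i)" by simp
  next
   fix x assume "x \<in> range (L i)"
   then obtain s where "x = L i s" by blast
   then have "x = g (L' i (\<rho> s))" using gL by simp
   then show "x \<in> g ` range (L' i)" by blast
  qed
 qed
 ultimately have "link_rep S3 m (\<lambda>i. range (L i)) (\<lambda>y z. \<tau> (Hh 1 y) (Hh 1 z))"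
  using link_rep_cong[of S3 m "\<lambda>i. g ` range (L' i)" _ "\<lambda>i. range (L i)"] by blast
 then show ?thesis by blast
qed

end

text \<open>Invariance of domain is available for vector spaces. A ball misses the image
  \<open>b\<close> of a point outside it, and the sphere without \<open>b\<close> is homeomorphic to
  a hyperplane of dimension 3. This shows that images of balls are open, and \<open>U\<close> is a
  union of balls.\<close>

lemma continuous_injective_S3_open:
 fixes \<phi> :: "complex \<times> real => complex \<times> complex"
 assumes \<phi>: "continuous_on UNIV \<phi>" "inj \<phi>" "range \<phi> \<subseteq> S3" and U: "open U"
 shows "openin (top_of_set S3) (\<phi> ` U)"
proof -
 have "\<exists>r>0. ball x r \<subseteq> U \<and> openin (top_of_set S3) (\<phi> ` ball x r)" if x: "x \<in> U" for x
 proof -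
  obtain r where r: "r > 0" "ball x r \<subseteq> U" using U x open_contains_ball by metis
  have "\<not> bounded (UNIV :: (complex \<times> real) set)" by (metis not_bounded_UNIV)
  then obtain y where y: "y \<notin> ball x r" using bounded_ball bounded_subset by (metis subsetI)
  define b where "b = \<phi> y"
  have b: "b \<in> S3" "b \<notin> \<phi> ` ball x r"
   using \<phi>(3) apply (auto simp: b_def)[1] using \<phi>(2) y unfolding b_def by (metis imageE injD)
  have "(S3 - {b}) homeomorphic {z :: complex \<times> complex. (1,0) \<bullet> z = 0}"
   unfolding S3_def by (rule homeomorphic_punctured_sphere_hyperplane) (use b in \<open>auto simp: S3_def zero_prod_def\<close>)
  then obtain h k where hk: "homeomorphism (S3 - {b}) {z :: complex \<times> complex. (1,0) \<bullet> z = 0} h k"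
   by (auto simp: homeomorphic_def)
  have hc: "continuous_on (S3 - {b}) h" "inj_on h (S3 - {b})"
   using hk by (auto simp: homeomorphism_def intro: inj_on_inverseI)
  have sub: "\<phi> ` ball x r \<subseteq> S3 - {b}" using \<phi> b by auto
  have "openin (top_of_set {z :: complex \<times> complex. (1,0) \<bullet> z = 0}) ((h \<circ> \<phi>) ` ball x r)"
  proof (rule invariance_of_domain_subspaces[where U = UNIV])
   show "dim {z :: complex \<times> complex. (1,0) \<bullet> z = 0} \<le> dim (UNIV :: (complex \<times> real) set)"
    by (subst dim_hyperplane) (auto simp: zero_prod_def)
   show "continuous_on (ball x r) (h \<circ> \<phi>)"
    using \<phi>(1) hc(1) sub by (intro continuous_on_compose) (auto intro: continuous_on_subset)
   show "(h \<circ> \<phi>) \<in> ball x r \<rightarrow> {z :: complex \<times> complex. (1,0) \<bullet> z = 0}"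
   proof
    fix z assume "z \<in> ball x r"
    then have "\<phi> z \<in> S3 - {b}" using sub by blast
    then show "(h \<circ> \<phi>) z \<in> {z :: complex \<times> complex. (1,0) \<bullet> z = 0}"
     using homeomorphism_image1[OF hk] unfolding comp_def by blast
   qed
   show "inj_on (h \<circ> \<phi>) (ball x r)"
    using \<phi>(2) hc(2) sub by (intro comp_inj_on) (auto intro: inj_on_subset)
   show "subspace {z :: complex \<times> complex. (1,0) \<bullet> z = 0}" by (rule subspace_hyperplane)
  qed auto
  then have "openin (top_of_set (S3 - {b})) (k ` ((h \<circ> \<phi>) ` ball x r))"
   using homeomorphism_imp_open_map[OF homeomorphism_symD[OF hk]] by blast
  moreover have "k ` ((h \<circ> \<phi>) ` ball x r) = \<phi> ` ball x r"
  proof -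
   have "k (h z) = z" if "z \<in> \<phi> ` ball x r" for z
    using hk sub that by (auto simp: homeomorphism_def)
   then have "(\<lambda>z. k ((h \<circ> \<phi>) z)) ` ball x r = \<phi> ` ball x r"
    by (intro image_cong) auto
   then show ?thesis by (simp add: image_image)
  qed
  moreover have "openin (top_of_set S3) (S3 - {b})"
   by (simp add: openin_delete)
  ultimately have "openin (top_of_set S3) (\<phi> ` ball x r)"
   by (metis openin_trans)
  then show ?thesis using r by blast
 qed
 then have "\<forall>x\<in>U. \<exists>r. r > 0 \<and> ball x r \<subseteq> U \<and> openin (top_of_set S3) (\<phi> ` ball x r)" by simp
 from bchoice[OF this] obtain r where
  r: "\<forall>x\<in>U. r x > 0 \<and> ball x (r x) \<subseteq> U \<and> openin (top_of_set S3) (\<phi> ` ball x (r x))" by blast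
 have "U = (\<Union>x\<in>U. ball x (r x))"
 proof
  show "U \<subseteq> (\<Union>x\<in>U. ball x (r x))"
  proof
   fix x assume x: "x \<in> U"
   then have "x \<in> ball x (r x)" using bspec[OF r x, THEN conjunct1] by simp
   then show "x \<in> (\<Union>x\<in>U. ball x (r x))" using x by blast
  qed
  show "(\<Union>x\<in>U. ball x (r x)) \<subseteq> U" by (rule UN_least) (rule bspec[OF r, THEN conjunct2, THEN conjunct1])
 qed
 then have "\<phi> ` U = (\<Union>x\<in>U. \<phi> ` ball x (r x))" by (metis image_UN)
 moreover have "openin (top_of_set S3) (\<Union>x\<in>U. \<phi> ` ball x (r x))"
 proof (rule openin_Union)
  fix S assume "S \<in> (\<lambda>x. \<phi> ` ball x (r x)) ` U"
  then obtain x where x: "x \<in> U" "S = \<phi> ` ball x (r x)" by (rule imageE)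
  show "openin (top_of_set S3) S" unfolding x(2) by (rule bspec[OF r x(1), THEN conjunct2, THEN conjunct2])
 qed
 ultimately show ?thesis by simp
qed

section \<open>The trivial link\<close>

lemma S3_chart:
 fixes \<phi> :: "complex \<times> real => complex \<times> complex"
 assumes \<phi>: "continuous_on UNIV \<phi>" "inj \<phi>" "range \<phi> \<subseteq> S3"
 obtains \<psi> :: "complex \<times> complex => complex \<times> real" and V where "open V" "range \<phi> = V Int S3" "continuous_on (V Int S3) \<psi>" "!!x. \<psi> (\<phi> x) = x"
proof -
 have op: "openin (top_of_set (range \<phi>)) (\<phi> ` U)" if "open U" for U
  by (rule openin_subset_trans[OF continuous_injective_S3_open[OF \<phi> that] _ \<phi>(3)]) (rule image_mono, rule subset_UNIV)
 obtain V where V: "open V" "range \<phi> = S3 Int V"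
  using continuous_injective_S3_open[OF \<phi> open_UNIV] unfolding openin_open by blast
 have "continuous_on (range \<phi>) (the_inv \<phi>)"
 proof (rule continuous_on_inverse_open_map[where f = \<phi> and S = UNIV])
  fix U assume "openin (top_of_set (UNIV :: (complex \<times> real) set)) U"
  then show "openin (top_of_set (range \<phi>)) (\<phi> ` U)" by (intro op) (simp only: open_openin subtopology_UNIV)
 qed (use \<phi> in \<open>auto simp: the_inv_f_f\<close>)
 then show ?thesis
  using V \<phi>(2) by (intro that[of V "the_inv \<phi>"]) (simp_all add: Int_commute the_inv_f_f)
qed

context meridian_data begin

lemma link_rep_pullback:
 fixes \<phi> :: "complex \<times> real => complex \<times> complex"
 assumes \<phi>: "continuous_on UNIV \<phi>" "inj \<phi>" "range \<phi> \<subseteq> S3" and rep: "link_rep S3 m A \<tau>"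
 shows "link_rep UNIV m (\<lambda>i. \<phi> -` A i) (\<lambda>y z. \<tau> (\<phi> y) (\<phi> z))"
proof -
 obtain \<psi> V where V: "open V" "range \<phi> = V Int S3" "continuous_on (V Int S3) \<psi>" "!!x. \<psi> (\<phi> x) = x"
  using S3_chart[OF \<phi>] by metis
 let ?X = "UNIV - (\<Union>i\<in>{1..m}. \<phi> -` A i)" and ?X' = "S3 - (\<Union>i\<in>{1..m}. A i)"
 have im: "\<phi> ` ?X \<subseteq> ?X'" using \<phi>(3) by auto
 show ?thesis unfolding link_rep_def
 proof (intro conjI ballI)
  show "local_cocycle ?X (\<lambda>y z. \<tau> (\<phi> y) (\<phi> z))"
  proof (rule local_cocycle_pullback[OF _ _ im])
   show "local_cocycle ?X' \<tau>" using rep by (simp add: link_rep_def)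
   show "continuous_on ?X \<phi>" by (rule continuous_on_subset[OF \<phi>(1)]) simp
  qed
  fix i p assume i: "i \<in> {1..m}" and p: "p \<in> \<phi> -` A i"
  have mer: "meridional i ?X' \<tau> (\<phi> p)" using rep i p by (simp add: link_rep_def)
  have l: "locally2 (UNIV Int ?X) (\<lambda>y z. \<tau> (\<phi> y) (\<phi> z) = 0 + \<tau> (\<phi> y) (\<phi> z) - 0)"
   by (rule locally2I) auto
  have pV: "\<phi> p \<in> V" "\<phi> p \<in> S3" using V(2) by auto
  show "meridional i ?X (\<lambda>y z. \<tau> (\<phi> y) (\<phi> z)) p"
  proof (rule meridional_transfer[OF mer open_UNIV _ _ V(1) pV _ _ V(3) _ _ _ _ _ l])
   have *: "\<exists>x. y = \<phi> x" if "y \<in> V Int ?X'" for y using that V(2) by blast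
   show "\<psi> ` (V Int ?X') \<subseteq> ?X"
   proof
    fix x assume "x \<in> \<psi> ` (V Int ?X')"
    then obtain y where y: "y \<in> V Int ?X'" "x = \<psi> y" by blast
    obtain x' where "y = \<phi> x'" using *[OF y(1)] by blast
    then show "x \<in> ?X" using y V(4) by simp
   qed
   show "\<phi> (\<psi> y) = y" if "y \<in> V Int ?X'" for y using V(4) *[OF that] by auto
   show "\<phi> ` (UNIV Int ?X) \<subseteq> ?X'" using im by simp
   show "continuous_on (UNIV Int UNIV) \<phi>" using \<phi>(1) by simp
  qed (use V(4) in auto)
 qed
qed

lemma link_rep_extend:
 fixes \<phi> :: "complex \<times> real => complex \<times> complex"
 assumes \<phi>: "continuous_on UNIV \<phi>" "inj \<phi>" "range \<phi> \<subseteq> S3" and rep: "link_rep UNIV m A \<sigma>"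
  and \<Delta>: "compact \<Delta>" "!!x y. x \<notin> \<Delta> \<or> y \<notin> \<Delta> ==> \<sigma> x y = 0"
 shows "\<exists>\<tau>. link_rep S3 m (\<lambda>i. \<phi> ` A i) \<tau>"
proof -
 obtain \<psi> V where V: "open V" "range \<phi> = V Int S3" "continuous_on (V Int S3) \<psi>" "!!x. \<psi> (\<phi> x) = x"
  using S3_chart[OF \<phi>] by metis
 define \<tau> where "\<tau> x y = (if x \<in> V Int S3 \<and> y \<in> V Int S3 then \<sigma> (\<psi> x) (\<psi> y) else 0)" for x y
 let ?X = "UNIV - (\<Union>i\<in>{1..m}. A i)" and ?X' = "S3 - (\<Union>i\<in>{1..m}. \<phi> ` A i)"
 have VX: "\<exists>x. y = \<phi> x \<and> x \<in> ?X" if "y \<in> V Int ?X'" for y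
 proof -
  have "y \<in> range \<phi>" unfolding V(2) using that by simp
  then obtain x where "y = \<phi> x" by (rule rangeE)
  then show ?thesis using that by (intro exI[of _ x]) auto
 qed
 have im: "\<psi> ` (V Int ?X') \<subseteq> ?X"
 proof
  fix x assume "x \<in> \<psi> ` (V Int ?X')"
  then obtain y where y: "y \<in> V Int ?X'" "x = \<psi> y" by blast
  obtain x' where "y = \<phi> x'" "x' \<in> ?X" using VX[OF y(1)] by blast
  then show "x \<in> ?X" using y V(4) by simp
 qed
 have cont: "continuous_on (V Int ?X') \<psi>" by (rule continuous_on_subset[OF V(3)]) auto
 have cX: "local_cocycle ?X \<sigma>" using rep by (simp add: link_rep_def)
 have cV: "local_cocycle (V Int ?X') \<tau>"
  by (rule local_cocycle_gauge[where k = "\<lambda>_. 0", OF local_cocycle_pullback[OF cX cont im]])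
   (auto intro!: locally2I simp: \<tau>_def)
 have "link_rep S3 m (\<lambda>i. \<phi> ` A i) \<tau>"
  unfolding link_rep_def
 proof (intro conjI ballI)
  show "local_cocycle ?X' \<tau>"
  proof (rule local_cocycleI)
   fix x assume x: "x \<in> ?X'"
   show "\<exists>N. open N \<and> x \<in> N \<and> (\<forall>u\<in>N Int ?X'. \<forall>v\<in>N Int ?X'. \<forall>w\<in>N Int ?X'. \<tau> u v + \<tau> v w = \<tau> u w)"
   proof (cases "x \<in> V")
    case True
    then have xV: "x \<in> V Int ?X'" using x by simp
    obtain N where "open N" "x \<in> N"
     "\<forall>u\<in>N Int (V Int ?X'). \<forall>v\<in>N Int (V Int ?X'). \<forall>w\<in>N Int (V Int ?X'). \<tau> u v + \<tau> v w = \<tau> u w"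
     using local_cocycleD[OF cV xV] by blast
    then show ?thesis using True V(1)
     by (intro exI[of _ "N Int V"]) (simp add: open_Int Int_assoc)
   next
    case False
    have "compact (\<phi> ` \<Delta>)"
     by (rule compact_continuous_image[OF continuous_on_subset[OF \<phi>(1)] \<Delta>(1)]) simp
    then have "open (- (\<phi> ` \<Delta>))" by (intro open_Compl compact_imp_closed)
    moreover have "x \<in> - (\<phi> ` \<Delta>)" using False V(2) by blast
    moreover have "\<tau> u v = 0" if "u \<in> - (\<phi> ` \<Delta>)" for u v
    proof (cases "u \<in> V Int S3 \<and> v \<in> V Int S3")
     case True
     then obtain a where "u = \<phi> a" using V(2) by blast
     then have "\<psi> u \<notin> \<Delta>" using that V(4) by auto
     then show ?thesis by (simp add: \<tau>_def \<Delta>(2))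
    qed (auto simp: \<tau>_def)
    ultimately show ?thesis by (intro exI[of _ "- (\<phi> ` \<Delta>)"]) simp
   qed
  qed
  fix i p assume i: "i \<in> {1..m}" and "p \<in> \<phi> ` A i"
  then obtain a where a: "a \<in> A i" "p = \<phi> a" by blast
  have pV: "p \<in> V" "p \<in> S3" using a V(2) by auto
  have mer: "meridional i ?X \<sigma> (\<psi> p)" using rep i a V(4) by (simp add: link_rep_def)
  have l: "locally2 (V Int ?X') (\<lambda>y z. \<tau> y z = 0 + \<sigma> (\<psi> y) (\<psi> z) - 0)"
   by (rule locally2I) (auto simp: \<tau>_def)
  show "meridional i ?X' \<tau> p"
  proof (rule meridional_transfer[OF mer V(1) pV open_UNIV _ _ V(3) im _ _ _ _ _ _ l])
   show "continuous_on (UNIV Int UNIV) \<phi>" using \<phi>(1) by simp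
   show "\<phi> ` (UNIV Int ?X) \<subseteq> ?X'"
   proof
    fix y assume "y \<in> \<phi> ` (UNIV Int ?X)"
    then obtain x where x: "y = \<phi> x" "x \<in> ?X" by blast
    have "y \<noteq> \<phi> z" if "z \<in> A j" "j \<in> {1..m}" for z j
     using x that \<phi>(2) by (auto dest: injD)
    then have "y \<notin> (\<Union>j\<in>{1..m}. \<phi> ` A j)" by blast
    moreover have "y \<in> S3" using x \<phi>(3) by auto
    ultimately show "y \<in> ?X'" by simp
   qed
  qed (use V(4) a in auto)
 qed
 then show ?thesis by blast
qed

end

lemma bit_eq_iff_diff: "0 = a + b \<longleftrightarrow> a = b" for a b :: bit
 by (cases a; cases b) simp_all

lemma inv_stereographic_chart:
 "continuous_on UNIV inv_stereographic" "inj inv_stereographic" "range inv_stereographic \<subseteq> S3"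
proof -
 have pos: "(cmod (fst x))\<^sup>2 + (snd x)\<^sup>2 + 1 \<noteq> 0" for x :: "complex \<times> real"
  by (smt (verit) zero_le_power2)
 have eq: "inv_stereographic = (\<lambda>x. ((2 / ((cmod (fst x))\<^sup>2 + (snd x)\<^sup>2 + 1)) *\<^sub>R fst x,
  complex_of_real (2 * snd x / ((cmod (fst x))\<^sup>2 + (snd x)\<^sup>2 + 1)) +
  \<i> * complex_of_real (((cmod (fst x))\<^sup>2 + (snd x)\<^sup>2 - 1) / ((cmod (fst x))\<^sup>2 + (snd x)\<^sup>2 + 1))))"
  by (auto simp: inv_stereographic_def Let_def Complex_eq fun_eq_iff)
 show "continuous_on UNIV inv_stereographic"
  unfolding eq by (intro continuous_intros) (use pos in auto)
 show "range inv_stereographic \<subseteq> S3" using inv_stereographic_in_S3 by auto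
 show "inj inv_stereographic"
 proof (rule injI)
  fix x y :: "complex \<times> real" assume xy: "inv_stereographic x = inv_stereographic y"
  define a where "a = (cmod (fst x))\<^sup>2 + (snd x)\<^sup>2"
  define b where "b = (cmod (fst y))\<^sup>2 + (snd y)\<^sup>2"
  have ab: "a \<ge> 0" "b \<ge> 0" by (auto simp: a_def b_def)
  have e: "(2 / (a + 1)) *\<^sub>R fst x = (2 / (b + 1)) *\<^sub>R fst y" "2 * snd x / (a + 1) = 2 * snd y / (b + 1)"
   "(a - 1) / (a + 1) = (b - 1) / (b + 1)"
   using xy by (simp_all add: inv_stereographic_def Let_def case_prod_unfold a_def b_def)
  have "a = b" using e(3) ab by (simp add: field_simps)
  then show "x = y" using e(1,2) ab by (auto simp: prod_eq_iff)
 qed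
qed

text \<open>The centres are at least 3 apart. Hence the unit discs are disjoint, and a point within
  distance 2 of one centre has distance over 1 from all others.\<close>

lemma circle_center_distance:
 assumes "i \<noteq> j"
 shows "3 \<le> cmod (w - of_nat (3 * i)) + cmod (w - of_nat (3 * j))"
proof -
 have "(of_nat (3 * j) :: complex) - of_nat (3 * i) = of_int (3 * (int j - int i))" by simp
 then have "cmod (of_nat (3 * j) - of_nat (3 * i)) = real_of_int \<bar>3 * (int j - int i)\<bar>"
  by (simp only: norm_of_int)
 moreover have "\<bar>3 * (int j - int i)\<bar> \<ge> 3" using assms by auto
 ultimately have "3 \<le> cmod (of_nat (3 * j) - of_nat (3 * i))" by linarith
 also have "of_nat (3 * j) - of_nat (3 * i) = (w - of_nat (3 * i)) - (w - of_nat (3 * j))" by simp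
 also have "cmod \<dots> \<le> cmod (w - of_nat (3 * i)) + cmod (w - of_nat (3 * j))" by (rule norm_triangle_ineq4)
 finally show ?thesis .
qed

lemma open_vertical:
 fixes N :: "(complex \<times> real) set"
 assumes "open N" "(w, z) \<in> N"
 shows "\<exists>d>0. \<forall>s. \<bar>s - z\<bar> < d --> (w, s) \<in> N"
proof -
 obtain d where d: "d > 0" "ball (w, z) d \<subseteq> N" using assms open_contains_ball by metis
 show ?thesis
 proof (intro exI[of _ d] conjI allI impI d(1))
  fix s assume "\<bar>s - z\<bar> < d"
  then have "(w, s) \<in> ball (w, z) d" by (simp add: dist_Pair_Pair dist_real_def abs_minus_commute)
  then show "(w, s) \<in> N" using d(2) by blast
 qed
qed

context meridian_data begin

text \<open>Each circle bounds a flat disc. Passing downwards through the disc \<open>j\<close>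
  contributes \<open>g j\<close>, and all other short moves contribute 0.\<close>

lemma trivial_link_coordinates:
 "\<exists>\<sigma>. link_rep UNIV m (\<lambda>i. {x :: complex \<times> real. cmod (fst x - of_nat (3 * i)) = 1 \<and> snd x = 0}) \<sigma> \<and>
  (\<exists>\<Delta>. compact \<Delta> \<and> (\<forall>x y. x \<notin> \<Delta> \<or> y \<notin> \<Delta> --> \<sigma> x y = 0))"
proof -
 obtain g where g: "!!i. g i \<in> H i \<and> \<theta> i (g i) = 1" using ex_meridian by metis
 \<comment> \<open>The open cylinder of height 2 over the disc \<open>j\<close>. Pairs outside a
   common cylinder get 0, and this provides the compact support.\<close>
 define Q where "Q j = {x :: complex \<times> real. cmod (fst x - of_nat (3 * j)) < 1 \<and> \<bar>snd x\<bar> < 1}" for j :: nat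
 define e where "e j x = (if snd x > 0 then g j else 0)" for j and x :: "complex \<times> real"
 define \<sigma> where "\<sigma> x y = (if \<exists>j\<in>{1..m}. x \<in> Q j \<and> y \<in> Q j then e (THE j. x \<in> Q j) x - e (THE j. x \<in> Q j) y else 0)" for x y
 define T where "T i = {x :: complex \<times> real. cmod (fst x - of_nat (3 * i)) = 1 \<and> snd x = 0}" for i :: nat
 have disj: "i = j" if "x \<in> Q i" "x \<in> Q j" for x i j
  using circle_center_distance[of i j "fst x"] that by (force simp: Q_def)
 have \<sigma>1: "\<sigma> x y = e j x - e j y" if "j \<in> {1..m}" "x \<in> Q j" "y \<in> Q j" for x y j
 proof -
  have "(THE j. x \<in> Q j) = j" using disj that by blast
  then show ?thesis using that by (auto simp: \<sigma>_def)
 qed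
 have \<sigma>0: "\<sigma> x y = 0" if "\<not> (\<exists>j\<in>{1..m}. x \<in> Q j \<and> y \<in> Q j)" for x y
  unfolding \<sigma>_def by (rule if_not_P[OF that])
 have \<sigma>same: "\<sigma> x y = 0" if "snd x > 0 \<longleftrightarrow> snd y > 0" for x y
  using that by (simp add: \<sigma>_def e_def)
 have openQ: "open (Q j)" for j unfolding Q_def
  by (intro open_Collect_conj open_Collect_less continuous_intros)
 let ?X = "UNIV - (\<Union>i\<in>{1..m}. T i)"
 have far: "open {y :: complex \<times> real. \<forall>j\<in>{1..m}. 1 < cmod (fst y - of_nat (3 * j))}"
 proof -
  have "{y :: complex \<times> real. \<forall>j\<in>{1..m}. 1 < cmod (fst y - of_nat (3 * j))} = (\<Inter>j\<in>{1..m}. {y. 1 < cmod (fst y - of_nat (3 * j))})"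
   by auto
  moreover have "open {y :: complex \<times> real. 1 < cmod (fst y - of_nat (3 * j))}" for j :: nat
   by (intro open_Collect_less continuous_intros)
  ultimately show ?thesis by (simp add: open_INT)
 qed
 have \<sigma>far: "\<sigma> x y = 0" if "\<forall>j\<in>{1..m}. 1 < cmod (fst x - of_nat (3 * j))" for x y
  using that by (intro \<sigma>0) (force simp: Q_def)
 have coc: "local_cocycle ?X \<sigma>"
 proof (rule local_cocycleI)
  fix x assume x: "x \<in> ?X"
  have "\<exists>N. open N \<and> x \<in> N \<and> (\<forall>u\<in>N. \<forall>v\<in>N. \<forall>w\<in>N. \<sigma> u v + \<sigma> v w = \<sigma> u w)"
  proof -
   consider "snd x > 0" | "snd x < 0" | j where "j \<in> {1..m}" "x \<in> Q j" |
    "snd x = 0" "\<forall>j\<in>{1..m}. x \<notin> Q j" by force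
   then show ?thesis
   proof cases
    case 1
    have "open {y :: complex \<times> real. snd y > 0}" by (intro open_Collect_less continuous_intros)
    then show ?thesis using 1 \<sigma>same by (intro exI[of _ "{y. snd y > 0}"]) auto
   next
    case 2
    have "open {y :: complex \<times> real. snd y < 0}" by (intro open_Collect_less continuous_intros)
    then show ?thesis using 2 \<sigma>same by (intro exI[of _ "{y. snd y < 0}"]) auto
   next
    case 3
    then show ?thesis using \<sigma>1[OF 3(1)] openQ[of j]
     by (intro exI[of _ "Q j"]) (simp add: gnorm del: add_uminus_conv_diff)
   next
    case 4
    have "1 < cmod (fst x - of_nat (3 * j))" if "j \<in> {1..m}" for j
     using 4 x that by (force simp: Q_def T_def)
    then show ?thesis using far \<sigma>far
     by (intro exI[of _ "{y. \<forall>j\<in>{1..m}. 1 < cmod (fst y - of_nat (3 * j))}"]) auto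
   qed
  qed
  then obtain N where "open N" "x \<in> N" "\<forall>u\<in>N. \<forall>v\<in>N. \<forall>w\<in>N. \<sigma> u v + \<sigma> v w = \<sigma> u w"
   by (elim exE conjE) (rule that)
  then show "\<exists>N. open N \<and> x \<in> N \<and> (\<forall>u\<in>N Int ?X. \<forall>v\<in>N Int ?X. \<forall>w\<in>N Int ?X. \<sigma> u v + \<sigma> v w = \<sigma> u w)"
   by (intro exI[of _ N]) blast
 qed
 have mer: "meridional i ?X \<sigma> p" if i: "i \<in> {1..m}" and p: "p \<in> T i" for i p
  unfolding meridional_def
 proof (intro conjI allI impI)
  \<comment> \<open>Radius 2 keeps the neighbourhood away from the other discs, so the only values
    there are 0, \<open>g i\<close> and its inverse.\<close>
  let ?W = "{y :: complex \<times> real. cmod (fst y - of_nat (3 * i)) < 2}"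
  have "open ?W" by (intro open_Collect_less continuous_intros)
  moreover have "p \<in> ?W" using p by (simp add: T_def)
  moreover have "\<sigma> y z \<in> H i" if y: "y \<in> ?W" for y z
  proof (cases "\<exists>j\<in>{1..m}. y \<in> Q j \<and> z \<in> Q j")
   case True
   then obtain j where j: "j \<in> {1..m}" "y \<in> Q j" "z \<in> Q j" by blast
   have "j = i" using circle_center_distance[of i j "fst y"] y j by (force simp: Q_def)
   then show ?thesis
    using \<sigma>1[OF j] g[of i] H_zero[of i] H_minus[of "g i" i] by (auto simp: e_def)
  qed (simp add: \<sigma>0 H_zero)
  then have "locally2 (?W Int ?X) (\<lambda>y z. 0 + \<sigma> y z - 0 \<in> H i)"
   by (intro locally2I exI[of _ UNIV]) simp
  ultimately show "\<exists>W k. open W \<and> p \<in> W \<and> locally2 (W Int ?X) (\<lambda>y z. k y + \<sigma> y z - k z \<in> H i)"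
   by (intro exI[of _ ?W] exI[of _ "\<lambda>_. 0"]) simp
 next
  fix W and k :: "complex \<times> real => bit" assume W: "open W" "p \<in> W"
  show "\<not> locally2 (W Int ?X) (\<lambda>y z. \<theta> i (\<sigma> y z) = k y + k z)"
  proof
   assume k: "locally2 (W Int ?X) (\<lambda>y z. \<theta> i (\<sigma> y z) = k y + k z)"
   define c :: complex where "c = of_nat (3 * i)"
   obtain w where w: "p = (w, 0)" "cmod (w - c) = 1" using p by (cases p) (auto simp: T_def c_def)
   obtain A B where AB: "open A" "open B" "(w, 0) \<in> A \<times> B" "A \<times> B \<subseteq> W"
    using open_prod_elim[OF W(1)] W(2) w(1) by metis
   obtain d1 where d1: "d1 > 0" "ball w d1 \<subseteq> A" using AB open_contains_ball by (metis mem_Sigma_iff)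
   obtain d2 where d2: "d2 > 0" "ball 0 d2 \<subseteq> B" using AB open_contains_ball by (metis mem_Sigma_iff)
   define d where "d = min 1 (min d1 d2)"
   have d: "d > 0" "d \<le> 1" "ball w d \<subseteq> A" "!!s. \<bar>s\<bar> < d ==> s \<in> B"
    using d1 d2 by (auto simp: d_def subset_iff dist_real_def)
   have box: "(v, s) \<in> W" if "v \<in> ball w d" "\<bar>s\<bar> < d" for v s
   proof -
    have "(v, s) \<in> A \<times> B" using that d(3,4) by auto
    then show ?thesis using AB(4) by (rule subsetD[rotated])
   qed
   have kconst: "k y = k z" if "connected Z" "Z \<subseteq> ball w d \<times> {-d<..<d}" "!!x y. x \<in> Z ==> y \<in> Z ==> \<sigma> x y = 0" "Z \<subseteq> ?X" "y \<in> Z" "z \<in> Z" for Z y z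
   proof (rule locally2_const[OF that(1) _ that(5,6)])
    have "ball w d \<times> {-d<..<d} \<subseteq> W" using box by (auto simp: abs_less_iff)
    then have "Z \<subseteq> W Int ?X" using that(2,4) by (meson Int_greatest order_trans)
    then show "locally2 Z (\<lambda>y z. k y = k z)"
     by (rule locally2_mono[OF k]) (metis that(3) \<theta>_zero bit_eq_iff_diff)
   qed
   have up: "k y = k z" if "y \<in> ball w d \<times> {0<..<d}" "z \<in> ball w d \<times> {0<..<d}" for y z
    by (rule kconst[of "ball w d \<times> {0<..<d}"])
     (use that d \<sigma>same in \<open>auto intro!: connected_Times convex_connected simp: T_def\<close>)
   have down: "k y = k z" if "y \<in> ball w d \<times> {-d<..<0}" "z \<in> ball w d \<times> {-d<..<0}" for y z
    by (rule kconst[of "ball w d \<times> {-d<..<0}"])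
     (use that d \<sigma>same in \<open>auto intro!: connected_Times convex_connected simp: T_def\<close>)
   have cross: "\<exists>s. 0 < s \<and> s < d \<and> \<theta> i (\<sigma> (v, s) (v, -s)) = k (v, s) + k (v, -s)"
    if v: "v \<in> ball w d" "(v, 0) \<in> ?X" for v
   proof -
    have v0: "(v, 0) \<in> W Int ?X" using v d(1) box[of v 0] by simp
    obtain N where N: "open N" "(v, 0) \<in> N" "\<forall>y\<in>N Int (W Int ?X). \<forall>z\<in>N Int (W Int ?X). \<theta> i (\<sigma> y z) = k y + k z"
     using locally2D[OF k v0] by blast
    obtain \<delta> where \<delta>: "\<delta> > 0" "\<forall>s. \<bar>s - 0\<bar> < \<delta> --> (v, s) \<in> N" using open_vertical[OF N(1,2)] by blast
    define s where "s = min d \<delta> / 2"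
    have s: "0 < s" "s < d" "s < \<delta>" using d \<delta> by (auto simp: s_def)
    have "(v, s) \<in> N Int (W Int ?X)" "(v, -s) \<in> N Int (W Int ?X)"
     using s \<delta>(2)[rule_format, of s] \<delta>(2)[rule_format, of "-s"] box[of v s] box[of v "-s"] v(1) by (simp_all add: T_def)
    then show ?thesis using N(3) s by blast
   qed
   \<comment> \<open>Points just outside and just inside the circle. A primitive is constant above
     and below the plane; crossing outside gives 0 and crossing inside gives 1, so it cannot close
     up around the meridian loop.\<close>
   define vo where "vo = w + (d / 2) *\<^sub>R (w - c)"
   define vi where "vi = w - (d / 2) *\<^sub>R (w - c)"
   have "vo - c = (1 + d / 2) *\<^sub>R (w - c)" "vi - c = (1 - d / 2) *\<^sub>R (w - c)"
    by (simp_all add: vo_def vi_def algebra_simps)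
   then have norms: "cmod (vo - c) = 1 + d / 2" "cmod (vi - c) = 1 - d / 2"
    using w(2) d by simp_all
   have balls: "vo \<in> ball w d" "vi \<in> ball w d"
    using w(2) d by (simp_all add: vo_def vi_def dist_norm)
   have farj: "1 < cmod (v - of_nat (3 * j))" if "j \<noteq> i" "cmod (v - c) < 2" for v j
    using circle_center_distance[of i j v] that by (simp add: c_def)
   have voj: "1 < cmod (vo - of_nat (3 * j))" for j
    using farj[of j vo] norms d by (cases "j = i") (auto simp: c_def)
   then have "cmod (vo - of_nat (3 * j)) \<noteq> 1" for j by (metis less_irrefl)
   then have "(vo, 0) \<in> ?X" by (simp add: T_def)
   then obtain s where s: "0 < s" "s < d" "\<theta> i (\<sigma> (vo, s) (vo, -s)) = k (vo, s) + k (vo, -s)"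
    using cross[OF balls(1)] by blast
   have "\<sigma> (vo, s) (vo, -s) = 0" by (rule \<sigma>far) (unfold fst_conv, use voj in blast)
   then have out: "k (vo, s) = k (vo, -s)" using s(3) by (metis \<theta>_zero bit_eq_iff_diff)
   have "(vi, 0) \<in> ?X"
   proof -
    have "cmod (vi - of_nat (3 * j)) \<noteq> 1" for j
     using farj[of j vi] norms d by (cases "j = i") (auto simp: c_def)
    then show ?thesis by (simp add: T_def)
   qed
   then obtain r where r: "0 < r" "r < d" "\<theta> i (\<sigma> (vi, r) (vi, -r)) = k (vi, r) + k (vi, -r)"
    using cross[OF balls(2)] by blast
   have "(vi, r) \<in> Q i" "(vi, -r) \<in> Q i" using norms r d by (auto simp: Q_def c_def)
   then have "\<sigma> (vi, r) (vi, -r) = g i" using \<sigma>1[OF i] r by (simp add: e_def)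
   then have "k (vi, r) + k (vi, -r) = 1" using r(3) g[of i] by metis
   moreover have "k (vi, r) = k (vo, s)" using up[of "(vi, r)" "(vo, s)"] balls r s by simp
   moreover have "k (vi, -r) = k (vo, -s)" using down[of "(vi, -r)" "(vo, -s)"] balls r s by simp
   ultimately have "k (vo, s) + k (vo, s) = 1" using out by (simp only:)
   then show False by (cases "k (vo, s)") simp_all
  qed
 qed
 have "compact (\<Union>j\<in>{1..m}. cball (of_nat (3 * j) :: complex) 1 \<times> {-1..1::real})"
  by (intro compact_UN compact_Times) auto
 moreover have "\<sigma> x y = 0" if "x \<notin> (\<Union>j\<in>{1..m}. cball (of_nat (3 * j) :: complex) 1 \<times> {-1..1::real}) \<or> y \<notin> (\<Union>j\<in>{1..m}. cball (of_nat (3 * j) :: complex) 1 \<times> {-1..1::real})" for x y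
 proof (rule \<sigma>0, rule notI)
  assume "\<exists>j\<in>{1..m}. x \<in> Q j \<and> y \<in> Q j"
  then obtain j where j: "j \<in> {1..m}" "x \<in> Q j" "y \<in> Q j" by blast
  have "Q j \<subseteq> cball (of_nat (3 * j) :: complex) 1 \<times> {-1..1}"
   by (auto simp: Q_def dist_norm norm_minus_commute)
  then show False using that j by blast
 qed
 moreover have "link_rep UNIV m T \<sigma>" using coc mer by (simp add: link_rep_def)
 ultimately show ?thesis unfolding T_def[abs_def] by blast
qed

lemma trivial_link_rep: "\<exists>\<tau>. link_rep S3 m (\<lambda>i. range (trivial_link i)) \<tau>"
proof -
 let ?T = "\<lambda>i. {x :: complex \<times> real. cmod (fst x - of_nat (3 * i)) = 1 \<and> snd x = 0}"
 obtain \<sigma> \<Delta> where \<sigma>: "link_rep UNIV m ?T \<sigma>" and \<Delta>: "compact \<Delta>" "\<forall>x y. x \<notin> \<Delta> \<or> y \<notin> \<Delta> --> \<sigma> x y = 0"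
  using trivial_link_coordinates[of m] by (elim exE conjE) (rule that)
 have 0: "\<sigma> x y = 0" if "x \<notin> \<Delta> \<or> y \<notin> \<Delta>" for x y using \<Delta>(2) that by blast
 obtain \<tau> where \<tau>: "link_rep S3 m (\<lambda>i. inv_stereographic ` ?T i) \<tau>"
 proof -
  have "\<exists>\<tau>. link_rep S3 m (\<lambda>i. inv_stereographic ` ?T i) \<tau>"
   by (rule link_rep_extend[OF inv_stereographic_chart \<sigma> \<Delta>(1)]) (rule 0)
  then show ?thesis by (elim exE) (rule that)
 qed
 have "inv_stereographic ` ?T i = range (trivial_link i)" for i
 proof -
  have "\<exists>t. v = of_nat (3 * i) + cis (2 * pi * t)" if "cmod (v - of_nat (3 * i)) = 1" for v
  proof -
   have "v - of_nat (3 * i) = cis (Arg (v - of_nat (3 * i)))"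
    using that by (metis cis_Arg norm_zero sgn_div_norm scaleR_one inverse_1 zero_neq_one)
   then have "v = of_nat (3 * i) + cis (2 * pi * (Arg (v - of_nat (3 * i)) / (2 * pi)))"
    by (simp add: algebra_simps)
   then show ?thesis by blast
  qed
  then have "?T i = range (\<lambda>t. (of_nat (3 * i) + cis (2 * pi * t), 0))" by force
  then show ?thesis by (simp add: trivial_link_def[abs_def] image_image)
 qed
 then have "link_rep S3 m (\<lambda>i. range (trivial_link i)) \<tau>" by (intro link_rep_cong[OF \<tau>])
 then show ?thesis by (rule exI[of _ \<tau>])
qed

end

section \<open>Adding four half-twists\<close>

text \<open>\<open>Z\<close> is a wall with sides \<open>A\<close> and \<open>B\<close>. In a small
  neighbourhood where both sides are connected, all transports from one side to the other coincide.
  This value is locally constant along the wall, and the wall is connected.\<close>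

lemma jump_constant:
 fixes \<sigma> :: "'a::topological_space => 'a => 'g::group_add"
 assumes coc: "local_cocycle X \<sigma>" and Z: "connected Z" "Z \<subseteq> X" and UD: "A \<subseteq> X" "B \<subseteq> X"
  and zero: "locally2 A (\<lambda>y z. \<sigma> y z = 0)" "locally2 B (\<lambda>y z. \<sigma> y z = 0)"
  and nb: "!!x N0. x \<in> Z ==> open N0 ==> x \<in> N0 ==> \<exists>N. open N \<and> x \<in> N \<and> N \<subseteq> N0 \<and>
   connected (N Int A) \<and> connected (N Int B) \<and> N Int A \<noteq> {} \<and> N Int B \<noteq> {}"
 shows "\<exists>a. \<forall>x\<in>Z. \<exists>N. open N \<and> x \<in> N \<and>
  (\<forall>y\<in>N Int A. \<forall>z\<in>N Int A. \<sigma> y z = 0) \<and> (\<forall>y\<in>N Int B. \<forall>z\<in>N Int B. \<sigma> y z = 0) \<and>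
  (\<forall>y\<in>N Int A. \<forall>z\<in>N Int B. \<sigma> y z = a \<and> \<sigma> z y = - a)"
proof -
 define P where "P N a \<longleftrightarrow> (\<forall>y\<in>N Int A. \<forall>z\<in>N Int A. \<sigma> y z = 0) \<and> (\<forall>y\<in>N Int B. \<forall>z\<in>N Int B. \<sigma> y z = 0) \<and>
  (\<forall>y\<in>N Int A. \<forall>z\<in>N Int B. \<sigma> y z = a \<and> \<sigma> z y = - a)" for N a
 have ex: "\<exists>N a. open N \<and> x \<in> N \<and> P N a" if x: "x \<in> Z" for x
 proof -
  have "x \<in> X" using x Z by blast
  then obtain N0 where N0: "open N0" "x \<in> N0"
   "\<forall>u\<in>N0 Int X. \<forall>v\<in>N0 Int X. \<forall>w\<in>N0 Int X. \<sigma> u v + \<sigma> v w = \<sigma> u w"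
   using local_cocycleD[OF coc \<open>x \<in> X\<close>] by (elim exE conjE) (rule that)
  obtain N where N: "open N" "x \<in> N" "N \<subseteq> N0" "connected (N Int A)" "connected (N Int B)" "N Int A \<noteq> {}" "N Int B \<noteq> {}"
   using nb[OF x N0(1,2)] by (elim exE conjE) (rule that)
  have c: "\<sigma> u v + \<sigma> v w = \<sigma> u w" if "u \<in> N Int X" "v \<in> N Int X" "w \<in> N Int X" for u v w
   using N0(3)[rule_format, of u v w] that N(3) by blast
  have sub: "N Int A \<subseteq> N Int X" "N Int B \<subseteq> N Int X" using UD by blast+
  have zA: "\<sigma> y z = 0" if "y \<in> N Int A" "z \<in> N Int A" for y z
  proof (rule cocycle_zero_on_connected[OF N(4) _ _ that])
   show "locally2 (N Int A) (\<lambda>y z. \<sigma> y z = 0)" by (rule locally2_mono[OF zero(1)]) auto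
  qed (rule c; use sub in blast)
  have zB: "\<sigma> y z = 0" if "y \<in> N Int B" "z \<in> N Int B" for y z
  proof (rule cocycle_zero_on_connected[OF N(5) _ _ that])
   show "locally2 (N Int B) (\<lambda>y z. \<sigma> y z = 0)" by (rule locally2_mono[OF zero(2)]) auto
  qed (rule c; use sub in blast)
  obtain p q where pq: "p \<in> N Int A" "q \<in> N Int B" using N(6,7) by blast
  have "\<sigma> y z = \<sigma> p q \<and> \<sigma> z y = - \<sigma> p q" if y: "y \<in> N Int A" and z: "z \<in> N Int B" for y z
  proof -
   have X: "y \<in> N Int X" "z \<in> N Int X" "p \<in> N Int X" "q \<in> N Int X" using y z pq sub by blast+
   have "\<sigma> y z = \<sigma> y p + (\<sigma> p q + \<sigma> q z)" using c[OF X(1,3,2)] c[OF X(3,4,2)] by simp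
   then have 1: "\<sigma> y z = \<sigma> p q" using zA[OF y pq(1)] zB[OF pq(2) z] by simp
   have "\<sigma> z y = - \<sigma> y z"
    by (rule cocycle_rules(2)[where N = "N Int X", OF c X(1,2)])
   then show ?thesis using 1 by simp
  qed
  then have "P N (\<sigma> p q)" using zA zB by (simp add: P_def)
  then show ?thesis using N(1,2) by blast
 qed
 then have "\<forall>x\<in>Z. \<exists>N. \<exists>a. open N \<and> x \<in> N \<and> P N a" by blast
 from bchoice[OF this] obtain N where "\<forall>x\<in>Z. \<exists>a. open (N x) \<and> x \<in> N x \<and> P (N x) a" by (elim exE) (rule that)
 from bchoice[OF this] obtain v where v: "\<forall>x\<in>Z. open (N x) \<and> x \<in> N x \<and> P (N x) (v x)" by (elim exE) (rule that)
 have vc: "v x = v y" if "x \<in> Z" "y \<in> Z" for x y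
 proof (rule locally2_const[OF Z(1) _ that])
  show "locally2 Z (\<lambda>x y. v x = v y)"
  proof (rule locally2I)
   fix x assume x: "x \<in> Z"
   \<comment> \<open>The neighbourhoods of \<open>x\<close> and \<open>y\<close> overlap in points
     on both sides, where the two values are compared.\<close>
   have veq: "v y = v x" if y: "y \<in> N x Int Z" for y
   proof -
    have "open (N x Int N y)" "y \<in> N x Int N y" using v x y by (auto intro: open_Int)
    then obtain M where M: "y \<in> M" "M \<subseteq> N x Int N y" "M Int A \<noteq> {}" "M Int B \<noteq> {}"
     using nb[of y "N x Int N y"] IntD2[OF y] by blast
    then obtain p q where "p \<in> M Int A" "q \<in> M Int B" by blast
    then have "p \<in> N x Int A" "q \<in> N x Int B" "p \<in> N y Int A" "q \<in> N y Int B" using M(2) by blast+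
    moreover have "P (N x) (v x)" "P (N y) (v y)" using v x y by blast+
    ultimately show ?thesis unfolding P_def by metis
   qed
   then show "\<exists>N. open N \<and> x \<in> N \<and> (\<forall>y\<in>N Int Z. \<forall>z\<in>N Int Z. v y = v z)"
   proof (intro exI[of _ "N x"] conjI ballI)
    show "open (N x)" "x \<in> N x" using bspec[OF v x] by simp_all
    fix y z assume "y \<in> N x Int Z" "z \<in> N x Int Z"
    then show "v y = v z" using veq[of y] veq[of z] by simp
   qed
  qed
 qed
 show ?thesis
 proof (cases "Z = {}")
  case False
  then obtain x0 where x0: "x0 \<in> Z" by blast
  have "\<exists>M. open M \<and> x \<in> M \<and> P M (v x0)" if x: "x \<in> Z" for x
   using v vc[OF x x0] x by (intro exI[of _ "N x"]) metis
  then show ?thesis unfolding P_def by blast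
 qed simp
qed

text \<open>The model on the plane without 1/2 and -1/2, cut along the real axis to the right and to
  the left of the two points. Crossing the right slit upwards gives \<open>a\<close> and crossing
  the left slit downwards gives \<open>b\<close>: these are the values of counterclockwise loops
  around 1/2 and -1/2. The slits count as part of the upper side.\<close>

definition slit_cocycle :: "'g::group_add => 'g => complex => complex => 'g" where
 "slit_cocycle a b w w' =
  (if Im w \<ge> 0 \<longleftrightarrow> Im w' \<ge> 0 then 0
   else if Re w > 1/2 then (if Im w' \<ge> 0 then a else - a)
   else if Re w < -1/2 then (if Im w' \<ge> 0 then - b else b)
   else 0)"

lemma slit_cocycle_local:
 assumes "w0 \<noteq> 1/2" "w0 \<noteq> -1/2"
 shows "\<exists>N e. open N \<and> w0 \<in> N \<and> (\<forall>w\<in>N. \<forall>w'\<in>N. slit_cocycle a b w w' = - e w + e w')"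
proof -
 consider "Im w0 > 0" | "Im w0 < 0" | "Re w0 > 1/2" | "Re w0 < -1/2" | "\<bar>Re w0\<bar> < 1/2"
  using assms by (force simp: complex_eq_iff abs_less_iff)
 then show ?thesis
 proof cases
  case 1
  have "open {w. Im w > 0}" by (intro open_Collect_less continuous_intros)
  then show ?thesis using 1 by (intro exI[of _ "{w. Im w > 0}"] exI[of _ "\<lambda>_. 0"]) (simp add: slit_cocycle_def)
 next
  case 2
  have "open {w. Im w < 0}" by (intro open_Collect_less continuous_intros)
  then show ?thesis using 2 by (intro exI[of _ "{w. Im w < 0}"] exI[of _ "\<lambda>_. 0"]) (simp add: slit_cocycle_def)
 next
  case 3
  have "open {w. Re w > 1/2}" by (intro open_Collect_less continuous_intros)
  then show ?thesis using 3
   by (intro exI[of _ "{w. Re w > 1/2}"] exI[of _ "\<lambda>w. if Im w \<ge> 0 then a else 0"]) (simp add: slit_cocycle_def)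
 next
  case 4
  have "open {w. Re w < -1/2}" by (intro open_Collect_less continuous_intros)
  then show ?thesis using 4
   by (intro exI[of _ "{w. Re w < -1/2}"] exI[of _ "\<lambda>w. if Im w \<ge> 0 then 0 else b"]) (simp add: slit_cocycle_def)
 next
  case 5
  have "open {w. \<bar>Re w\<bar> < 1/2}" by (intro open_Collect_less continuous_intros)
  then show ?thesis using 5 by (intro exI[of _ "{w. \<bar>Re w\<bar> < 1/2}"] exI[of _ "\<lambda>_. 0"]) (simp add: slit_cocycle_def abs_less_iff)
 qed
qed

lemma local_cocycle_slit: "local_cocycle (- {1/2, -1/2}) (slit_cocycle a b)"
proof (rule local_cocycleI)
 fix x :: complex assume x: "x \<in> - {1/2, -1/2}"
 obtain N e where N: "open N" "x \<in> N" "\<forall>w\<in>N. \<forall>w'\<in>N. slit_cocycle a b w w' = - e w + e w'"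
  using slit_cocycle_local[of x a b] x by auto
 then show "\<exists>N. open N \<and> x \<in> N \<and> (\<forall>u\<in>N Int - {1/2, -1/2}. \<forall>v\<in>N Int - {1/2, -1/2}. \<forall>w\<in>N Int - {1/2, -1/2}.
   slit_cocycle a b u v + slit_cocycle a b v w = slit_cocycle a b u w)"
  by (intro exI[of _ N]) (simp add: gnorm del: add_uminus_conv_diff)
qed

text \<open>Away from the two points the model cocycle sees only the angle, so it has a primitive on
  the universal cover of a circle around both. One turn from angle 0 meets the left slit and then
  the right one, which gives \<open>b + a\<close>. Since \<open>E\<close> changes only by
  \<open>a\<close>, \<open>b\<close> and their inverses, it commutes with whatever commutes with
  both.\<close>

lemma angular_primitive:
 fixes a b :: "'g::group_add"
 obtains E :: "real => 'g" where
  "!!t. E (t + 2 * pi) = (b + a) + E t"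
  "!!c t. a + c = c + a ==> b + c = c + b ==> E t + c = c + E t"
  "!!w0 t0. cmod w0 > 3/4 ==> w0 = cmod w0 * cis t0 ==> \<exists>d>0. \<forall>w w' s s'.
   dist w w0 < d --> dist w' w0 < d --> \<bar>s - t0\<bar> < d --> \<bar>s' - t0\<bar> < d -->
   w = cmod w * cis s --> w' = cmod w' * cis s' --> slit_cocycle a b w w' = - E s + E s'"
proof -
 \<comment> \<open>A circle around both points; every radius above 1/2 encloses them, and 7/8 leaves
   room for the estimates below.\<close>
 define P where "P t = complex_of_real (7/8) * cis t" for t
 have ReP: "Re (P t) = 7/8 * cos t" and ImP: "Im (P t) = 7/8 * sin t" for t by (simp_all add: P_def)
 define S where "S s t = slit_cocycle a b (P s) (P t)" for s t
 have coc: "local_cocycle UNIV S"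
  unfolding S_def[abs_def]
 proof (rule local_cocycle_pullback[OF local_cocycle_slit])
  show "continuous_on UNIV P" unfolding P_def by (intro continuous_intros)
  have n: "cmod (P t) = 7/8" for t by (simp add: P_def norm_mult)
  have "P t \<noteq> 1/2 \<and> P t \<noteq> -1/2" for t
  proof -
   have "cmod (P t) \<noteq> cmod (1/2)" "cmod (P t) \<noteq> cmod (-1/2)" unfolding n by simp_all
   then show ?thesis by metis
  qed
  then show "P ` UNIV \<subseteq> - {1/2, -1/2}" by auto
 qed
 have "\<exists>h. locally2 UNIV (\<lambda>y z. S y z = - h y + h z)"
  by (rule contractible_coboundary[OF coc, where F = "\<lambda>s x. (1 - s) * x" and p = 0])
   (auto intro!: continuous_intros simp: case_prod_unfold)
 then obtain h where h: "locally2 UNIV (\<lambda>y z. S y z = - h y + h z)" by blast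
 define E where "E t = - h 0 + h t" for t
 have E: "locally2 UNIV (\<lambda>y z. S y z = - E y + E z)"
  by (rule locally2_mono[OF h]) (simp_all add: E_def gnorm del: add_uminus_conv_diff)
 have E0: "E 0 = 0" by (simp add: E_def)
 have near: "\<exists>d>0. \<forall>s u. \<bar>s - t\<bar> < d --> \<bar>u - t\<bar> < d --> S s u = - E s + E u" for t
 proof -
  obtain N where N: "open N" "t \<in> N" "\<forall>y\<in>N Int UNIV. \<forall>z\<in>N Int UNIV. S y z = - E y + E z"
   using locally2D[OF E UNIV_I[of t]] by (elim exE conjE) (rule that)
  obtain d where d: "d > 0" "ball t d \<subseteq> N" using N(1,2) open_contains_ball by metis
  have "s \<in> N" if "\<bar>s - t\<bar> < d" for s using d(2) that by (auto simp: dist_real_def abs_minus_commute subset_iff)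
  then show ?thesis using d(1) N(3) by (intro exI[of _ d]) simp
 qed
 have step: "E s + (- E s + g) = g" for s g by (simp add: add.assoc[symmetric])
 have upper: "E t = 0" if t: "t \<in> {0..pi}" for t
 proof -
  have "locally2 {0..pi} (\<lambda>y z. E y = E z)"
  proof (rule locally2_mono[OF E])
   fix y z assume yz: "y \<in> {0..pi}" "z \<in> {0..pi}" and e: "S y z = - E y + E z"
   have "sin y \<ge> 0" "sin z \<ge> 0" using yz by (auto intro: sin_ge_zero)
   then have "S y z = 0" by (simp add: S_def slit_cocycle_def ImP)
   then show "E y = E z" using e by (metis step add.right_neutral)
  qed simp
  from locally2_const[OF _ this t, of 0] show ?thesis using E0 by simp
 qed
 have lower: "E s = E t" if "s \<in> {pi<..<2*pi}" "t \<in> {pi<..<2*pi}" for s t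
 proof (rule locally2_const[OF _ _ that])
  show "locally2 {pi<..<2*pi} (\<lambda>y z. E y = E z)"
  proof (rule locally2_mono[OF E])
   fix y z assume yz: "y \<in> {pi<..<2*pi}" "z \<in> {pi<..<2*pi}" and e: "S y z = - E y + E z"
   have "sin y < 0" "sin z < 0" using yz sin_gt_zero[of "y - pi"] sin_gt_zero[of "z - pi"] by auto
   then have "S y z = 0" by (simp add: S_def slit_cocycle_def ImP)
   then show "E y = E z" using e by (metis step add.right_neutral)
  qed simp
 qed simp
 have Eb: "E t = b" if "t \<in> {pi<..<2*pi}" for t
 proof -
  obtain d where d: "d > 0" "!!s u. \<bar>s - pi\<bar> < d ==> \<bar>u - pi\<bar> < d ==> S s u = - E s + E u" using near by blast
  define u where "u = pi + min d pi / 2"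
  have u: "u \<in> {pi<..<2*pi}" "\<bar>u - pi\<bar> < d" using d(1) pi_gt_zero by (auto simp: u_def min_def)
  have "sin u < 0" using u sin_gt_zero[of "u - pi"] by auto
  then have "S pi u = b" by (simp add: S_def slit_cocycle_def ImP ReP)
  then have "- E pi + E u = b" using d u by simp
  then have "E u = b" using upper[of pi] by simp
  then show ?thesis using lower[OF that u(1)] by simp
 qed
 have E2pi: "E (2 * pi) = b + a"
 proof -
  obtain d where d: "d > 0" "!!s u. \<bar>s - 2*pi\<bar> < d ==> \<bar>u - 2*pi\<bar> < d ==> S s u = - E s + E u" using near by blast
  define e where "e = min d 1 / 2"
  define u where "u = 2 * pi - e"
  have e: "0 < e" "e < 1" "e < d" using d(1) by (auto simp: e_def)
  have e': "e \<le> 1/2" by (simp add: e_def)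
  have u: "u \<in> {pi<..<2*pi}" "\<bar>u - 2*pi\<bar> < d" using e pi_gt3 by (auto simp: u_def)
  have "sin u < 0" using u sin_gt_zero[of "u - pi"] by auto
  \<comment> \<open>4/7 is 1/2 divided by 7/8, so the point of the circle lies beyond the end of the
    right slit. The bound holds because \<open>e\<close> is at most 1/2, which is below
    pi/6.\<close>
  moreover have "cos u > 4/7"
  proof -
   have "cos u = cos e" by (simp add: u_def cos_diff)
   moreover have "cos (pi/6) < cos e" using e(1) e' pi_gt3 by (intro cos_monotone_0_pi) auto
   moreover have "cos (pi/6) > 4/7"
   proof -
    have "8/7 < sqrt 3" by (rule real_less_rsqrt) (simp add: power2_eq_square)
    then show ?thesis unfolding cos_30 by simp
   qed
   ultimately show ?thesis by simp
  qed
  ultimately have "S u (2*pi) = a" by (simp add: S_def slit_cocycle_def ImP ReP)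
  then have "- E u + E (2*pi) = a" using d u by simp
  then show ?thesis using Eb[OF u(1)] by (metis step)
 qed
 have per: "E (t + 2 * pi) = (b + a) + E t" for t
 proof -
  have "locally2 UNIV (\<lambda>y z. S (y + 2*pi) (z + 2*pi) = - E (y + 2*pi) + E (z + 2*pi))"
   by (rule locally2_pullback[OF E]) (auto intro!: continuous_intros)
  with E have "locally2 UNIV (\<lambda>y z. S y z = - E y + E z \<and> S (y + 2*pi) (z + 2*pi) = - E (y + 2*pi) + E (z + 2*pi))"
   by (rule locally2_conj)
  then have "locally2 UNIV (\<lambda>y z. E (y + 2*pi) - E y = E (z + 2*pi) - E z)"
  proof (rule locally2_mono)
   fix y z assume e: "S y z = - E y + E z \<and> S (y + 2*pi) (z + 2*pi) = - E (y + 2*pi) + E (z + 2*pi)"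
   have "S (y + 2*pi) (z + 2*pi) = S y z" by (simp add: S_def P_def cis.code)
   then have "- E y + E z = - E (y + 2*pi) + E (z + 2*pi)" using e by simp
   then have "E (y + 2*pi) + (- E y + E z) = E (z + 2*pi)" by (simp add: step)
   then have "E (z + 2*pi) - E z = (E (y + 2*pi) + (- E y + E z)) - E z" by simp
   then show "E (y + 2*pi) - E y = E (z + 2*pi) - E z" by (simp add: gnorm del: add_uminus_conv_diff)
  qed simp
  from locally2_const[OF connected_UNIV this, of t 0]
  have "E (t + 2*pi) - E t = b + a" using E2pi E0 by simp
  then show ?thesis by (metis diff_add_cancel)
 qed
 have comm: "E t + c = c + E t" if ac: "a + c = c + a" and bc: "b + c = c + b" for c t
 proof -
  have minus: "- x + c = c + - x" if "x + c = c + x" for x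
   using that by (metis add.assoc add.left_inverse add.right_neutral add_minus_cancel minus_add_cancel)
  have Sc: "S y z + c = c + S y z" for y z
   using ac bc minus[OF ac] minus[OF bc] by (simp add: S_def slit_cocycle_def del: add_uminus_conv_diff)
  have "locally2 UNIV (\<lambda>y z. (E y + c = c + E y) = (E z + c = c + E z))"
  proof (rule locally2_mono[OF E])
   fix y z assume e: "S y z = - E y + E z"
   have Ez: "E z = E y + S y z" using e by (simp add: step)
   show "(E y + c = c + E y) = (E z + c = c + E z)"
   proof
    assume "E y + c = c + E y"
    then show "E z + c = c + E z" using Sc[of y z] by (metis Ez add.assoc)
   next
    assume z: "E z + c = c + E z"
    have "E y + c + S y z = c + E y + S y z"
     using z Sc[of y z] unfolding Ez by (metis add.assoc)
    then show "E y + c = c + E y" by simp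
   qed
  qed simp
  from locally2_const[OF connected_UNIV this, of t 0] show ?thesis using E0 by simp
 qed
 have loc: "\<exists>d>0. \<forall>w w' s s'.
   dist w w0 < d --> dist w' w0 < d --> \<bar>s - t0\<bar> < d --> \<bar>s' - t0\<bar> < d -->
   w = cmod w * cis s --> w' = cmod w' * cis s' --> slit_cocycle a b w w' = - E s + E s'"
  if w0: "cmod w0 > 3/4" "w0 = cmod w0 * cis t0" for w0 t0
 proof -
  obtain d1 where d1: "d1 > 0" "!!s u. \<bar>s - t0\<bar> < d1 ==> \<bar>u - t0\<bar> < d1 ==> S s u = - E s + E u" using near by blast
  have side: "Im w \<ge> 0 \<longleftrightarrow> Im (P s) \<ge> 0" if "w = cmod w * cis s" "w \<noteq> 0" for w s
  proof -
   have "Im w = cmod w * sin s" using that(1) by (metis Im_complex_of_real Re_complex_of_real add.right_neutral cis.sel(2) mult_zero_left times_complex.sel(2))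
   then show ?thesis using that(2) by (simp add: ImP zero_le_mult_iff)
  qed
  have "\<exists>d>0. \<forall>w w' s s'.
   dist w w0 < d --> dist w' w0 < d --> \<bar>s - t0\<bar> < d --> \<bar>s' - t0\<bar> < d -->
   w = cmod w * cis s --> w' = cmod w' * cis s' --> slit_cocycle a b w w' = S s s'"
  proof (cases "Im w0 = 0")
   case False
   have "slit_cocycle a b w w' = S s s'"
    if "dist w w0 < \<bar>Im w0\<bar>" "dist w' w0 < \<bar>Im w0\<bar>" "w = cmod w * cis s" "w' = cmod w' * cis s'" for w w' s s'
   proof -
    have "\<bar>Im w - Im w0\<bar> < \<bar>Im w0\<bar>" "\<bar>Im w' - Im w0\<bar> < \<bar>Im w0\<bar>"
     using that(1,2) abs_Im_le_cmod[of "w - w0"] abs_Im_le_cmod[of "w' - w0"] by (simp_all add: dist_norm)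
    then have "(Im w \<ge> 0) = (Im w' \<ge> 0)" "w \<noteq> 0" "w' \<noteq> 0" by auto
    moreover then have "(Im (P s) \<ge> 0) = (Im (P s') \<ge> 0)" using side that(3,4) by blast
    ultimately show ?thesis by (simp add: S_def slit_cocycle_def)
   qed
   then show ?thesis using False by (intro exI[of _ "\<bar>Im w0\<bar>"]) auto
  next
   case True
   have Rew0: "Re w0 = cmod w0 * cos t0" using w0(2) by (metis Im_complex_of_real Re_complex_of_real cis.sel(1) diff_zero mult_zero_left times_complex.sel(1))
   have absRe: "\<bar>Re w0\<bar> = cmod w0" using True by (simp add: cmod_def)
   have "\<bar>cos t0\<bar> = 1" using Rew0 absRe w0(1) by (auto simp: abs_mult)
   have "isCont cos t0" by simp
   then obtain d2 where d2: "d2 > 0" "!!s. \<bar>s - t0\<bar> < d2 ==> \<bar>cos s - cos t0\<bar> < 1/4"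
    unfolding continuous_at_eps_delta dist_real_def by (metis zero_less_divide_1_iff zero_less_numeral)
   \<comment> \<open>On the real axis the slit in question must be the same for \<open>w\<close> and
     for the point of the circle. The margin 1/4 ensures this: 3/4 - 1/4 = 1/2, and 7/8 times 3/4
     exceeds 1/2.\<close>
   have "slit_cocycle a b w w' = S s s'"
    if "dist w w0 < 1/4" "dist w' w0 < 1/4" "\<bar>s - t0\<bar> < d2" "w = cmod w * cis s" "w' = cmod w' * cis s'" for w w' s s'
   proof -
    have "\<bar>Re w - Re w0\<bar> < 1/4" "\<bar>Re w' - Re w0\<bar> < 1/4"
     using that(1,2) abs_Re_le_cmod[of "w - w0"] abs_Re_le_cmod[of "w' - w0"] by (simp_all add: dist_norm)
    then have nz: "w \<noteq> 0" "w' \<noteq> 0" using absRe w0(1) by auto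
    have sides: "(Im w \<ge> 0) = (Im (P s) \<ge> 0)" "(Im w' \<ge> 0) = (Im (P s') \<ge> 0)"
     using side that(4,5) nz by blast+
    have "Re w > 1/2 \<longleftrightarrow> Re (P s) > 1/2" "Re w < -1/2 \<longleftrightarrow> Re (P s) < -1/2"
    proof -
     have "cos t0 = 1 \<or> cos t0 = -1" using \<open>\<bar>cos t0\<bar> = 1\<close> by linarith
     then consider "cos t0 = 1" "Re w0 = cmod w0" | "cos t0 = -1" "Re w0 = - cmod w0" using Rew0 by auto
     then have "(Re w > 1/2 \<and> Re (P s) > 1/2) \<or> (Re w < -1/2 \<and> Re (P s) < -1/2)"
     proof cases
      case 1
      then show ?thesis using d2(2)[OF that(3)] \<open>\<bar>Re w - Re w0\<bar> < 1/4\<close> w0(1) unfolding ReP by linarith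
     next
      case 2
      then show ?thesis using d2(2)[OF that(3)] \<open>\<bar>Re w - Re w0\<bar> < 1/4\<close> w0(1) unfolding ReP by linarith
     qed
     then show "Re w > 1/2 \<longleftrightarrow> Re (P s) > 1/2" "Re w < -1/2 \<longleftrightarrow> Re (P s) < -1/2" by auto
    qed
    then show ?thesis by (simp only: S_def slit_cocycle_def sides)
   qed
   then show ?thesis using d2(1) by (intro exI[of _ "min (1/4) d2"]) auto
  qed
  then obtain d where d: "d > 0" "!!w w' s s'. dist w w0 < d ==> dist w' w0 < d ==> \<bar>s - t0\<bar> < d ==> \<bar>s' - t0\<bar> < d ==>
   w = cmod w * cis s ==> w' = cmod w' * cis s' ==> slit_cocycle a b w w' = S s s'" by blast
  then show ?thesis using d1 by (intro exI[of _ "min d d1"]) auto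
 qed
 show ?thesis by (rule that[of E]) (use per comm loc in blast)+
qed

text \<open>The angle of four half-twists, concentrated between the heights -1/2 and 1/2. The twist
  is then the identity near top and bottom and not only on them.\<close>

definition ramp :: "real => real" where
 "ramp z = 2 * pi * (max (-1) (min 1 (2 * z)) + 1)"

definition twist :: "(real => real) => complex \<times> real => complex \<times> real" where
 "twist r x = (cis (r (snd x)) * fst x, snd x)"

lemma continuous_ramp: "continuous_on A ramp"
 unfolding ramp_def[abs_def] by (intro continuous_intros)

lemma ramp_low: "z \<le> -1/2 ==> ramp z = 0"
 by (simp add: ramp_def)

lemma ramp_high: "z \<ge> 1/2 ==> ramp z = 4 * pi"
 by (simp add: ramp_def)

lemma twist_simps [simp]: "snd (twist r x) = snd x" "cmod (fst (twist r x)) = cmod (fst x)"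
 by (simp_all add: twist_def norm_mult)

lemma twist_twist: "twist r (twist s x) = twist (\<lambda>z. r z + s z) x"
 by (simp add: twist_def cis_mult[symmetric] mult.assoc)

lemma twist_cancel [simp]: "twist r (twist (\<lambda>z. - r z) x) = x" "twist (\<lambda>z. - r z) (twist r x) = x"
 by (simp_all add: twist_twist) (simp_all add: twist_def)

lemma continuous_twist: "continuous_on UNIV r ==> continuous_on A (twist r)"
proof -
 assume r: "continuous_on UNIV r"
 have "continuous_on A (\<lambda>x. r (snd x))"
  by (rule continuous_on_compose2[OF r continuous_on_snd[OF continuous_on_id]]) simp
 then show ?thesis unfolding twist_def[abs_def] by (intro continuous_intros)
qed

lemma twist_ramp_ends: "\<bar>snd x\<bar> \<ge> 1/2 ==> twist ramp x = x" "\<bar>snd x\<bar> \<ge> 1/2 ==> twist (\<lambda>z. - ramp z) x = x"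
proof -
 assume x: "\<bar>snd x\<bar> \<ge> 1/2"
 have "cis (4 * pi) = 1" "cis (- (4 * pi)) = 1"
  using cis_multiple_2pi[of 2] cis_multiple_2pi[of "-2"] by (simp_all add: mult.commute)
 then have "cis (ramp (snd x)) = 1" "cis (- ramp (snd x)) = 1"
  using x ramp_low[of "snd x"] ramp_high[of "snd x"] by (cases "snd x \<ge> 0"; simp)+
 then show "twist ramp x = x" "twist (\<lambda>z. - ramp z) x = x" by (simp_all add: twist_def)
qed

lemma isCont_eventually_nhds:
 assumes "isCont f x" "e > 0" shows "\<forall>\<^sub>F y in nhds x. dist (f y) (f x) < e"
 using assms unfolding isCont_def tendsto_at_iff_tendsto_nhds by (rule tendstoD)

lemma cis_eq_imp:
 assumes "cis s = cis t" shows "\<exists>n::int. s = t + 2 * pi * n"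
proof -
 have "sin s = sin t \<and> cos s = cos t" using assms by (metis cis.sel)
 then obtain n :: int where "s = t + 2 * pi * n" using sin_cos_eq_iff[of s t] by auto
 then show ?thesis by blast
qed

text \<open>Near the boundary of the cylinder, untwisting amounts to a gauge transformation. On the
  side it is the transport back along the rotation, at the bottom it is 0, and at the top it is the
  value of two full turns. The top value is constant also over the core, and it is harmless there
  because (b a)^2 commutes with \<open>a\<close> and \<open>b\<close>.\<close>

lemma twist_gauge:
 fixes a b :: "'g::group_add"
 assumes ca: "a + (b + a + (b + a)) = b + a + (b + a) + a" and cb: "b + (b + a + (b + a)) = b + a + (b + a) + b"
 shows "\<exists>k :: complex \<times> real => 'g. \<forall>x. fst x \<noteq> 1/2 --> fst x \<noteq> -1/2 --> 3/4 < cmod (fst x) \<or> 3/4 < \<bar>snd x\<bar> -->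
  (\<exists>N. open N \<and> x \<in> N \<and> (\<forall>y\<in>N. \<forall>z\<in>N.
   slit_cocycle a b (fst y) (fst z) = k y + slit_cocycle a b (fst (twist (\<lambda>z. - ramp z) y)) (fst (twist (\<lambda>z. - ramp z) z)) - k z))"
proof -
 let ?S = "slit_cocycle a b" and ?T = "twist (\<lambda>z. - ramp z)"
 define c where "c = b + a"
 have ca': "a + (c + c) = c + c + a" and cb': "b + (c + c) = c + c + b" using ca cb by (simp_all add: c_def)
 show ?thesis
 proof (rule angular_primitive[where a = a and b = b])
 fix E :: "real => 'g"
 assume per0: "!!t. E (t + 2 * pi) = (b + a) + E t"
  and comm: "!!c t. a + c = c + a ==> b + c = c + b ==> E t + c = c + E t"
  and loc: "!!w0 t0. cmod w0 > 3/4 ==> w0 = cmod w0 * cis t0 ==> \<exists>d>0. \<forall>w w' s s'.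
   dist w w0 < d --> dist w' w0 < d --> \<bar>s - t0\<bar> < d --> \<bar>s' - t0\<bar> < d -->
   w = cmod w * cis s --> w' = cmod w' * cis s' --> ?S w w' = - E s + E s'"
 have per: "E (t + 2 * pi) = c + E t" for t unfolding c_def by (rule per0)
 \<comment> \<open>Two turns, whose value may be moved past \<open>E\<close> because it commutes
   with both generators. This matches the gauge on the side with the one at the top.\<close>
 have E4: "- E t + E (t - 4 * pi) = - (c + c)" for t
 proof -
  have e: "t - 4 * pi + 2 * pi = t - 2 * pi" "t - 2 * pi + 2 * pi = t" by simp_all
  have "E t = c + (c + E (t - 4 * pi))" using per[of "t - 4 * pi"] per[of "t - 2 * pi"] unfolding e by (simp only:)
  then have Et: "E t = (c + c) + E (t - 4 * pi)" by (simp only: add.assoc)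
  then have "E t = E (t - 4 * pi) + (c + c)" using comm[OF ca' cb', of "t - 4 * pi"] by (simp only:)
  then have "- E t = - (c + c) + - E (t - 4 * pi)" by (simp only: minus_add)
  then show ?thesis by (simp only: add.assoc left_minus add_0_right)
 qed
 \<comment> \<open>Transport from the angle \<open>t\<close> back to \<open>t - r\<close>. It does
   not depend on the choice of the angle, as a full turn translates \<open>E\<close> from the left
   and cancels.\<close>
 define k0 where "k0 t r = - E t + E (t - r)" for t r
 have k0_per: "k0 (t + 2 * pi * of_int n) r = k0 t r" for t r n
 proof -
  have 1: "k0 (t + 2 * pi) r = k0 t r" for t
  proof -
   have e: "t + 2 * pi - r = (t - r) + 2 * pi" by simp
   show ?thesis unfolding k0_def e per by (simp only: minus_add add.assoc minus_add_cancel)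
  qed
  have 2: "k0 (t + 2 * pi * real n) r = k0 t r" for t and n :: nat
  proof (induction n)
   case (Suc n)
   then show ?case using 1[of "t + 2 * pi * real n"] by (simp add: algebra_simps)
  qed simp
  show ?thesis
  proof (cases "n \<ge> 0")
   case True
   then show ?thesis using 2[of t "nat n"] by simp
  next
   case False
   then show ?thesis using 2[of "t + 2 * pi * of_int n" "nat (- n)"] by (simp add: algebra_simps)
  qed
 qed
 \<comment> \<open>The last two cases serve the core above and below the twisted part. The value 0
   in the middle of the core is a default about which nothing is claimed.\<close>
 define k :: "complex \<times> real => 'g" where
  "k x = (if cmod (fst x) > 3/4 then k0 (Arg (fst x)) (ramp (snd x)) else if snd x > 3/4 then - (c + c) else 0)" for x
 have polar: "w = cmod w * cis (Arg w)" for w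
  using rcis_cmod_Arg[of w] by (simp add: rcis_def)
 have k_eq: "k x = k0 t (ramp (snd x))" if "cmod (fst x) > 3/4" "fst x = cmod (fst x) * cis t" for x t
 proof -
  have nz: "cmod (fst x) \<noteq> 0" using that(1) by auto
  have "complex_of_real (cmod (fst x)) * cis (Arg (fst x)) = complex_of_real (cmod (fst x)) * cis t"
   using that(2) polar[of "fst x"] by simp
  then have "cis (Arg (fst x)) = cis t" using nz by simp
  then obtain n :: int where "Arg (fst x) = t + 2 * pi * n" using cis_eq_imp by blast
  then show ?thesis using that(1) k0_per[of t n] by (simp add: k_def)
 qed
 have "\<exists>N. open N \<and> x \<in> N \<and> (\<forall>y\<in>N. \<forall>z\<in>N. ?S (fst y) (fst z) = k y + ?S (fst (?T y)) (fst (?T z)) - k z)"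
  if x: "3/4 < cmod (fst x) \<or> 3/4 < \<bar>snd x\<bar>" for x
 proof -
  consider "3/4 < cmod (fst x)" | "3/4 < snd x" | "snd x < -3/4" using x by fastforce
  then show ?thesis
  proof cases
   case 1
   define w0 where "w0 = fst x"
   define t0 where "t0 = Arg w0"
   define r0 where "r0 = ramp (snd x)"
   have w0: "cmod w0 > 3/4" "w0 = cmod w0 * cis t0" using 1 polar by (auto simp: w0_def t0_def)
   have Tx: "fst (?T x) = cis (- r0) * w0" by (simp add: twist_def r0_def w0_def)
   have w1: "cmod (fst (?T x)) > 3/4" "fst (?T x) = cmod (fst (?T x)) * cis (t0 - r0)"
   proof -
    show "cmod (fst (?T x)) > 3/4" using 1 by simp
    have "fst (?T x) = cis (- r0) * (cmod w0 * cis t0)" unfolding Tx using w0(2) by metis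
    also have "\<dots> = cmod w0 * cis (t0 - r0)" by (simp add: cis_mult mult.left_commute)
    finally show "fst (?T x) = cmod (fst (?T x)) * cis (t0 - r0)" unfolding twist_simps w0_def .
   qed
   obtain d where d: "d > 0" "\<forall>w w' s s'.
    dist w w0 < d --> dist w' w0 < d --> \<bar>s - t0\<bar> < d --> \<bar>s' - t0\<bar> < d -->
    w = cmod w * cis s --> w' = cmod w' * cis s' --> ?S w w' = - E s + E s'"
    using loc[OF w0] by (elim exE conjE) (rule that)
   obtain e where e: "e > 0" "\<forall>w w' s s'.
    dist w (fst (?T x)) < e --> dist w' (fst (?T x)) < e --> \<bar>s - (t0 - r0)\<bar> < e --> \<bar>s' - (t0 - r0)\<bar> < e -->
    w = cmod w * cis s --> w' = cmod w' * cis s' --> ?S w w' = - E s + E s'"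
    using loc[OF w1] by (elim exE conjE) (rule that)
   \<comment> \<open>A continuous choice of the angle near \<open>w0\<close>: the quotient is near
     1, where \<open>Arg\<close> has no branch cut.\<close>
   define L where "L y = t0 + Arg (fst y / w0)" for y :: "complex \<times> real"
   have nz: "w0 \<noteq> 0" using w0(1) by auto
   have Lx: "L x = t0" using nz by (simp add: L_def w0_def)
   have Lpol: "fst y = cmod (fst y) * cis (L y)" for y
   proof -
    have "fst y = w0 * (fst y / w0)" using nz by simp
    also have "\<dots> = (cmod w0 * cis t0) * (cmod (fst y / w0) * cis (Arg (fst y / w0)))"
     using w0(2) polar[of "fst y / w0"] by metis
    also have "\<dots> = (cmod w0 * cmod (fst y / w0)) * cis (L y)" by (simp add: L_def cis_mult[symmetric] mult_ac)
    also have "cmod w0 * cmod (fst y / w0) = cmod (fst y)" using nz by (simp add: norm_divide)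
    finally show ?thesis by simp
   qed
   have Tpol: "fst (?T y) = cmod (fst (?T y)) * cis (L y - ramp (snd y))" for y
   proof -
    have "fst (?T y) = cis (- ramp (snd y)) * (cmod (fst y) * cis (L y))"
     using Lpol[of y] by (simp add: twist_def)
    also have "\<dots> = cmod (fst y) * cis (L y - ramp (snd y))" by (simp add: cis_mult mult.left_commute)
    finally show ?thesis unfolding twist_simps .
   qed
   have contL: "isCont L x"
   proof -
    have q: "fst x / w0 = 1" using nz by (simp add: w0_def)
    have A: "isCont Arg (fst x / w0)" unfolding q by (rule continuous_at_Arg) simp
    have c: "isCont (\<lambda>y :: complex \<times> real. fst y / w0) x"
     by (intro continuous_divide continuous_fst continuous_ident continuous_const nz)
    have "isCont (\<lambda>y :: complex \<times> real. Arg (fst y / w0)) x" by (rule isCont_o2[OF c A])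
    then show ?thesis unfolding L_def[abs_def] by (intro continuous_add continuous_const)
   qed
   have contT: "isCont (\<lambda>y. fst (?T y)) x"
   proof -
    have "continuous_on UNIV ?T" by (intro continuous_twist continuous_on_minus continuous_ramp)
    then have "isCont ?T x" unfolding continuous_on_eq_continuous_at[OF open_UNIV] by (rule bspec) simp
    then show ?thesis by (rule continuous_fst)
   qed
   have contr: "isCont (\<lambda>y :: complex \<times> real. ramp (snd y)) x"
   proof -
    have r: "isCont ramp (snd x)" using continuous_ramp[of UNIV] by (simp add: continuous_on_eq_continuous_at)
    show ?thesis by (rule isCont_o2[OF continuous_snd[OF continuous_ident] r])
   qed
   have "\<forall>\<^sub>F y in nhds x. y \<in> {y. cmod (fst y) > 3/4}"
    using 1 by (intro eventually_nhds_in_open open_Collect_less continuous_intros) simp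
   then have "\<forall>\<^sub>F y in nhds x. cmod (fst y) > 3/4" by simp
   moreover have "\<forall>\<^sub>F y in nhds x. dist (fst y) (fst x) < d"
    by (rule isCont_eventually_nhds[OF continuous_fst[OF continuous_ident] d(1)])
   moreover have "\<forall>\<^sub>F y in nhds x. dist (L y) (L x) < d"
    by (rule isCont_eventually_nhds[OF contL d(1)])
   moreover have "\<forall>\<^sub>F y in nhds x. dist (fst (?T y)) (fst (?T x)) < e"
    by (rule isCont_eventually_nhds[OF contT e(1)])
   moreover have "\<forall>\<^sub>F y in nhds x. dist (L y - ramp (snd y)) (L x - ramp (snd x)) < e"
    by (rule isCont_eventually_nhds[OF continuous_diff[OF contL contr] e(1)])
   ultimately have "\<forall>\<^sub>F y in nhds x. cmod (fst y) > 3/4 \<and> dist (fst y) w0 < d \<and> dist (L y) (L x) < d \<and>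
     dist (fst (?T y)) (fst (?T x)) < e \<and> dist (L y - ramp (snd y)) (L x - ramp (snd x)) < e"
    by eventually_elim (simp add: w0_def)
   then obtain N where N: "open N" "x \<in> N" "\<forall>y\<in>N. cmod (fst y) > 3/4 \<and> dist (fst y) w0 < d \<and> dist (L y) (L x) < d \<and>
     dist (fst (?T y)) (fst (?T x)) < e \<and> dist (L y - ramp (snd y)) (L x - ramp (snd x)) < e"
    unfolding eventually_nhds by blast
   have "?S (fst y) (fst z) = k y + ?S (fst (?T y)) (fst (?T z)) - k z" if yz: "y \<in> N" "z \<in> N" for y z
   proof -
    note Ny = bspec[OF N(3) yz(1)] and Nz = bspec[OF N(3) yz(2)]
    have 1: "?S (fst y) (fst z) = - E (L y) + E (L z)"
     using d(2)[rule_format, of "fst y" "fst z" "L y" "L z"] Ny Nz Lpol[of y] Lpol[of z] by (simp add: Lx dist_real_def)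
    have 2: "?S (fst (?T y)) (fst (?T z)) = - E (L y - ramp (snd y)) + E (L z - ramp (snd z))"
     by (rule e(2)[rule_format, OF _ _ _ _ Tpol Tpol]) (use Ny Nz in \<open>simp_all add: Lx dist_real_def r0_def\<close>)
    have 3: "k y = - E (L y) + E (L y - ramp (snd y))" "k z = - E (L z) + E (L z - ramp (snd z))"
     using k_eq[OF _ Lpol] Ny Nz by (simp_all add: k0_def)
    show ?thesis unfolding 1 2 3 by (simp add: gnorm del: add_uminus_conv_diff)
   qed
   then show ?thesis using N(1,2) by blast
  next
   case 2
   have k2: "k y = - (c + c)" if "snd y > 3/4" for y
   proof (cases "cmod (fst y) > 3/4")
    case True
    have "ramp (snd y) = 4 * pi" using that by (intro ramp_high) simp
    then show ?thesis using True E4 by (simp add: k_def k0_def del: minus_add)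
   qed (use that in \<open>simp add: k_def\<close>)
   \<comment> \<open>All values of the model are 0, \<open>a\<close>, \<open>b\<close> or their
     inverses, so conjugation by \<open>c + c\<close> fixes them.\<close>
   have Sc: "- (c + c) + ?S y z - - (c + c) = ?S y z" for y z
   proof -
    have minus: "- u + (c + c) = c + c + - u" if "u + (c + c) = c + c + u" for u
     using that by (metis add.assoc add.left_inverse add.right_neutral add_minus_cancel minus_add_cancel)
    have "?S y z + (c + c) = (c + c) + ?S y z"
     using ca' cb' minus[OF ca'] minus[OF cb'] by (simp add: slit_cocycle_def del: add_uminus_conv_diff)
    then have "- (c + c) + (?S y z + (c + c)) = ?S y z" by (simp only: minus_add_cancel)
    then show ?thesis by (simp only: diff_conv_add_uminus minus_minus add.assoc)
   qed
   have "open {y :: complex \<times> real. snd y > 3/4}" by (intro open_Collect_less continuous_intros)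
   moreover have "?S (fst y) (fst z) = k y + ?S (fst (?T y)) (fst (?T z)) - k z" if "snd y > 3/4" "snd z > 3/4" for y z
   proof -
    have T: "?T y = y" "?T z = z" using that by (auto intro!: twist_ramp_ends)
    show ?thesis by (simp only: T k2[OF that(1)] k2[OF that(2)] Sc)
   qed
   ultimately show ?thesis using 2 by (intro exI[of _ "{y. snd y > 3/4}"]) blast
  next
   case 3
   have k3: "k y = 0" if "snd y < -3/4" for y
   proof -
    have "ramp (snd y) = 0" using that by (intro ramp_low) simp
    then show ?thesis using that by (simp add: k_def k0_def)
   qed
   have "open {y :: complex \<times> real. snd y < -3/4}" by (intro open_Collect_less continuous_intros)
   moreover have "?S (fst y) (fst z) = k y + ?S (fst (?T y)) (fst (?T z)) - k z" if "snd y < -3/4" "snd z < -3/4" for y z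
   proof -
    have T: "?T y = y" "?T z = z" using that by (auto intro!: twist_ramp_ends)
    show ?thesis by (simp only: T k3[OF that(1)] k3[OF that(2)] add_0_left diff_0_right)
   qed
   ultimately show ?thesis using 3 by (intro exI[of _ "{y. snd y < -3/4}"]) blast
  qed
 qed
 then show ?thesis by (intro exI[of _ k]) blast
 qed
qed

section \<open>Normal form of a representation near two parallel strands\<close>

context meridian_data begin

text \<open>The coset of \<open>k y\<close> with respect to the subgroup \<open>H i\<close> is
  locally constant on the connected set \<open>Z\<close>. So \<open>k z\<close> differs from
  \<open>k y\<close> by a factor in \<open>H i\<close>, and conjugation by \<open>k y\<close> brings
  \<open>a\<close> into \<open>H i\<close>.\<close>

lemma conj_class_from_gauge:
 assumes Z: "connected Z" and l: "locally2 Z (\<lambda>y z. k y - k z \<in> H i)" and yz: "y \<in> Z" "z \<in> Z"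
  and a: "k y + a - k z \<in> H i"
 shows "a \<in> conj_class i"
proof -
 define f where "f y = {h + k y | h. h \<in> H i}" for y
 have "f y = f z"
 proof (rule locally2_const[OF Z _ yz])
  show "locally2 Z (\<lambda>y z. f y = f z)"
  proof (rule locally2_mono[OF l order_refl])
   fix y z assume h: "k y - k z \<in> H i"
   show "f y = f z"
   proof (intro equalityI subsetI)
    fix x assume "x \<in> f y"
    then obtain g where g: "g \<in> H i" "x = g + k y" by (auto simp: f_def)
    then have "x = (g + (k y - k z)) + k z" by (simp add: gnorm del: add_uminus_conv_diff)
    then show "x \<in> f z" using H_add[OF g(1) h] unfolding f_def by blast
   next
    fix x assume "x \<in> f z"
    then obtain g where g: "g \<in> H i" "x = g + k z" by (auto simp: f_def)
    then have "x = (g + - (k y - k z)) + k y" by (simp add: gnorm del: add_uminus_conv_diff)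
    then show "x \<in> f y" using H_add[OF g(1) H_minus[OF h]] unfolding f_def by blast
   qed
  qed
 qed
 moreover have "k z \<in> f z" using H_zero[of i] unfolding f_def by force
 ultimately obtain g where g: "g \<in> H i" "k z = g + k y" unfolding f_def by blast
 have "a = - k y + ((k y + a - k z) + g) + k y"
  by (simp add: g(2) gnorm del: add_uminus_conv_diff)
 then show ?thesis unfolding conj_class_def using H_add[OF a g(1)] by blast
qed

text \<open>Cut the cylinder along the walls over the two slits. The rest \<open>U\<close> is
  star-shaped, so a gauge makes the cocycle vanish there. Its jumps across the walls are constants
  \<open>a\<close> and \<open>b\<close>, and the gauge extends over the walls because
  \<open>U\<close> is dense. Near a strand the jump closes up a meridian loop, so it is a conjugate
  of an element of the subgroup.\<close>

lemma slit_normal_form: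
 fixes \<sigma> :: "complex \<times> real => complex \<times> real => 'g"
 defines "D \<equiv> {x :: complex \<times> real. cmod (fst x) < 1 \<and> \<bar>snd x\<bar> < 1}"
 defines "W \<equiv> {x \<in> D. fst x \<noteq> 1/2 \<and> fst x \<noteq> -1/2}"
 assumes coc: "local_cocycle W \<sigma>" and mer: "meridional i X \<sigma> (1/2, 0)" "meridional j X \<sigma> (-1/2, 0)"
  and XW: "D Int X = W"
 shows "\<exists>a b k. a \<in> conj_class i \<and> b \<in> conj_class j \<and>
  locally2 W (\<lambda>x y. slit_cocycle a b (fst x) (fst y) = k x + \<sigma> x y - k y)"
proof -
 \<comment> \<open>Star-shaped about the origin: scaling keeps the sign of the imaginary part and
   shrinks the real part.\<close>
 define U where "U = {x \<in> D. Im (fst x) \<noteq> 0 \<or> \<bar>Re (fst x)\<bar> < 1/2}"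
 define Up where "Up = {x \<in> D. Im (fst x) > 0}"
 define Dn where "Dn = {x \<in> D. Im (fst x) < 0}"
 have openD: "open D" unfolding D_def by (intro open_Collect_conj open_Collect_less continuous_intros)
 have half_eq: "Im w = 0 \<and> \<bar>Re w\<bar> = 1/2" if "w = 1/2 \<or> w = -1/2" for w :: complex
  using that by (elim disjE; hypsubst; simp)
 have UW: "U \<subseteq> W"
 proof
  fix x assume x: "x \<in> U"
  then have "fst x \<noteq> 1/2 \<and> fst x \<noteq> -1/2" using half_eq[of "fst x"] unfolding U_def by force
  then show "x \<in> W" using x by (simp add: U_def W_def)
 qed
 have UpU: "Up \<subseteq> U" "Dn \<subseteq> U" by (auto simp: U_def Up_def Dn_def)
 have "\<exists>h. locally2 U (\<lambda>y z. \<sigma> y z = - h y + h z)"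
 proof (rule contractible_coboundary[where F = "\<lambda>s x. (1 - s) *\<^sub>R x" and p = 0])
  show "local_cocycle U \<sigma>" by (rule local_cocycle_subset[OF coc UW])
  fix s :: real and x assume s: "s \<in> {0..1}" and x: "x \<in> U"
  have le: "(1 - s) * r \<le> r" if "r \<ge> 0" for r using s that by (simp add: mult_left_le_one_le)
  have "cmod ((1 - s) *\<^sub>R fst x) < 1" "\<bar>(1 - s) * snd x\<bar> < 1"
   using x s le[of "cmod (fst x)"] le[of "\<bar>snd x\<bar>"] by (auto simp: U_def D_def abs_mult)
  moreover have "(1 - s) * Im (fst x) \<noteq> 0 \<or> \<bar>(1 - s) * Re (fst x)\<bar> < 1/2"
   using x s le[of "\<bar>Re (fst x)\<bar>"] by (cases "s = 1") (auto simp: U_def abs_mult)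
  ultimately show "(1 - s) *\<^sub>R x \<in> U" by (auto simp: U_def D_def)
 qed (auto intro!: continuous_intros simp: case_prod_unfold)
 then obtain h where h: "locally2 U (\<lambda>y z. \<sigma> y z = - h y + h z)" by blast
 define s1 where "s1 x y = h x + \<sigma> x y - h y" for x y
 have coc1: "local_cocycle W s1"
  by (rule local_cocycle_gauge[where k = h and \<tau> = \<sigma>, OF coc]) (rule locally2I, auto simp: s1_def)
 have zeroU: "locally2 U (\<lambda>y z. s1 y z = 0)"
  by (rule locally2_mono[OF h order_refl]) (simp add: s1_def gnorm del: add_uminus_conv_diff)
 have zero: "locally2 Up (\<lambda>y z. s1 y z = 0)" "locally2 Dn (\<lambda>y z. s1 y z = 0)"
  by (rule locally2_mono[OF zeroU]; use UpU in blast)+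
 have ballD: "\<exists>e>0. ball x e \<subseteq> N Int D" if "open N" "x \<in> N" "x \<in> D" for x N
  using open_Int[OF that(1) openD] that open_contains_ball by blast
 have vert: "(fst x + \<i> * of_real s, snd x) \<in> ball x e" if "\<bar>s\<bar> < e" for x :: "complex \<times> real" and s e
  using that by (simp add: dist_prod_def dist_norm norm_mult)
 have half: "ball x e Int Up = ball x e Int {y. Im (fst y) > 0}" "ball x e Int Dn = ball x e Int {y. Im (fst y) < 0}"
  if "ball x e \<subseteq> D" for x e
  using that by (auto simp: Up_def Dn_def)
 have lin: "linear (\<lambda>y :: complex \<times> real. Im (fst y))" "linear (\<lambda>y :: complex \<times> real. Re (fst y))"
  by (auto intro!: linearI)
 have hs: "convex {y :: complex \<times> real. Im (fst y) > 0}" "convex {y :: complex \<times> real. Im (fst y) < 0}"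
  "convex {y :: complex \<times> real. Re (fst y) > r}" "convex {y :: complex \<times> real. Re (fst y) < r}" for r
  using convex_linear_vimage[OF lin(1) convex_real_interval(3)[of 0]] convex_linear_vimage[OF lin(1) convex_real_interval(4)[of 0]]
   convex_linear_vimage[OF lin(2) convex_real_interval(3)[of r]] convex_linear_vimage[OF lin(2) convex_real_interval(4)[of r]]
  by (simp_all add: vimage_def)
 have nb: "\<exists>N. open N \<and> x \<in> N \<and> N \<subseteq> N0 \<and> connected (N Int Up) \<and> connected (N Int Dn) \<and> N Int Up \<noteq> {} \<and> N Int Dn \<noteq> {}"
  if N0: "open N0" "x \<in> N0" and x: "x \<in> D" "Im (fst x) = 0" for x N0
 proof -
  obtain e where e: "e > 0" "ball x e \<subseteq> N0 Int D" using ballD[OF N0 x(1)] by blast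
  have eD: "ball x e \<subseteq> D" using e by blast
  have "connected (ball x e Int Up)" "connected (ball x e Int Dn)"
   unfolding half[OF eD] by (intro convex_connected convex_Int convex_ball hs)+
  moreover have "(fst x + \<i> * of_real (e/2), snd x) \<in> ball x e Int Up" "(fst x + \<i> * of_real (-e/2), snd x) \<in> ball x e Int Dn"
   unfolding half[OF eD] using vert[of "e/2" e x] vert[of "-e/2" e x] e x(2) by simp_all
  ultimately show ?thesis using e by (intro exI[of _ "ball x e"]) auto
 qed
 define Zr where "Zr = {x \<in> D. Im (fst x) = 0 \<and> Re (fst x) > 1/2}"
 define Zl where "Zl = {x \<in> D. Im (fst x) = 0 \<and> Re (fst x) < -1/2}"
 have convD: "convex D"
 proof -
  have "D = ball 0 1 \<times> {-1<..<1}" by (auto simp: D_def abs_less_iff)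
  then show ?thesis by (simp add: convex_Times)
 qed
 have conv0: "convex {y :: complex \<times> real. Im (fst y) = 0}"
  using convex_linear_vimage[OF lin(1) convex_singleton[of 0]] by (simp add: vimage_def)
 have connZ: "connected Zr" "connected Zl"
 proof -
  have "Zr = D Int ({y. Im (fst y) = 0} Int {y. Re (fst y) > 1/2})" "Zl = D Int ({y. Im (fst y) = 0} Int {y. Re (fst y) < -1/2})"
   by (auto simp: Zr_def Zl_def)
  then show "connected Zr" "connected Zl"
   by (simp_all only: convex_connected convex_Int convD conv0 hs)
 qed
 have inW: "x \<in> W" if "x \<in> D" "\<bar>Re (fst x)\<bar> \<noteq> 1/2" for x
  using that half_eq[of "fst x"] by (simp add: W_def) blast
 have ZW: "Zr \<subseteq> W" "Zl \<subseteq> W" by (auto simp: Zr_def Zl_def intro!: inW)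
 have UpW: "Up \<subseteq> W" "Dn \<subseteq> W" using UpU UW by blast+
 have "\<exists>a. \<forall>x\<in>Zr. \<exists>N. open N \<and> x \<in> N \<and>
  (\<forall>y\<in>N Int Dn. \<forall>z\<in>N Int Dn. s1 y z = 0) \<and> (\<forall>y\<in>N Int Up. \<forall>z\<in>N Int Up. s1 y z = 0) \<and>
  (\<forall>y\<in>N Int Dn. \<forall>z\<in>N Int Up. s1 y z = a \<and> s1 z y = - a)"
 proof (rule jump_constant[OF coc1 connZ(1) ZW(1) UpW(2,1) zero(2,1)])
  fix x N0 assume x: "x \<in> Zr" "open N0" "x \<in> N0"
  have "x \<in> D" "Im (fst x) = 0" using x(1) by (simp_all add: Zr_def)
  then obtain N where "open N" "x \<in> N" "N \<subseteq> N0" "connected (N Int Up)" "connected (N Int Dn)" "N Int Up \<noteq> {}" "N Int Dn \<noteq> {}"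
   using nb[OF x(2,3)] by blast
  then show "\<exists>N. open N \<and> x \<in> N \<and> N \<subseteq> N0 \<and> connected (N Int Dn) \<and> connected (N Int Up) \<and> N Int Dn \<noteq> {} \<and> N Int Up \<noteq> {}"
   by (intro exI[of _ N] conjI)
 qed
 then obtain a where a: "\<forall>x\<in>Zr. \<exists>N. open N \<and> x \<in> N \<and>
  (\<forall>y\<in>N Int Dn. \<forall>z\<in>N Int Dn. s1 y z = 0) \<and> (\<forall>y\<in>N Int Up. \<forall>z\<in>N Int Up. s1 y z = 0) \<and>
  (\<forall>y\<in>N Int Dn. \<forall>z\<in>N Int Up. s1 y z = a \<and> s1 z y = - a)" by (elim exE) (rule that)
 have "\<exists>b. \<forall>x\<in>Zl. \<exists>N. open N \<and> x \<in> N \<and>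
  (\<forall>y\<in>N Int Up. \<forall>z\<in>N Int Up. s1 y z = 0) \<and> (\<forall>y\<in>N Int Dn. \<forall>z\<in>N Int Dn. s1 y z = 0) \<and>
  (\<forall>y\<in>N Int Up. \<forall>z\<in>N Int Dn. s1 y z = b \<and> s1 z y = - b)"
 proof (rule jump_constant[OF coc1 connZ(2) ZW(2) UpW zero])
  fix x N0 assume x: "x \<in> Zl" "open N0" "x \<in> N0"
  have "x \<in> D" "Im (fst x) = 0" using x(1) by (simp_all add: Zl_def)
  then obtain N where "open N" "x \<in> N" "N \<subseteq> N0" "connected (N Int Up)" "connected (N Int Dn)" "N Int Up \<noteq> {}" "N Int Dn \<noteq> {}"
   using nb[OF x(2,3)] by blast
  then show "\<exists>N. open N \<and> x \<in> N \<and> N \<subseteq> N0 \<and> connected (N Int Up) \<and> connected (N Int Dn) \<and> N Int Up \<noteq> {} \<and> N Int Dn \<noteq> {}"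
   by (intro exI[of _ N] conjI)
 qed
 then obtain b where b: "\<forall>x\<in>Zl. \<exists>N. open N \<and> x \<in> N \<and>
  (\<forall>y\<in>N Int Up. \<forall>z\<in>N Int Up. s1 y z = 0) \<and> (\<forall>y\<in>N Int Dn. \<forall>z\<in>N Int Dn. s1 y z = 0) \<and>
  (\<forall>y\<in>N Int Up. \<forall>z\<in>N Int Dn. s1 y z = b \<and> s1 z y = - b)" by (elim exE) (rule that)
 define M where "M x y = slit_cocycle a b (fst x) (fst y)" for x y :: "complex \<times> real"
 have M0: "\<exists>N. open N \<and> x \<in> N \<and> (\<forall>y\<in>N. \<forall>z\<in>N. M y z = 0)" if xU: "x \<in> U" for x
 proof -
  consider "Im (fst x) > 0" | "Im (fst x) < 0" | "\<bar>Re (fst x)\<bar> < 1/2"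
   using xU unfolding U_def by fastforce
  then show ?thesis
  proof cases
   case 1
   have "open {y :: complex \<times> real. Im (fst y) > 0}" by (intro open_Collect_less continuous_intros)
   then show ?thesis using 1 by (intro exI[of _ "{y. Im (fst y) > 0}"]) (simp add: M_def slit_cocycle_def)
  next
   case 2
   have "open {y :: complex \<times> real. Im (fst y) < 0}" by (intro open_Collect_less continuous_intros)
   then show ?thesis using 2 by (intro exI[of _ "{y. Im (fst y) < 0}"]) (simp add: M_def slit_cocycle_def)
  next
   case 3
   have "open {y :: complex \<times> real. \<bar>Re (fst y)\<bar> < 1/2}" by (intro open_Collect_less continuous_intros)
   moreover have "M y z = 0" if "\<bar>Re (fst y)\<bar> < 1/2" for y z
   proof -
    have "\<not> Re (fst y) > 1/2" "\<not> Re (fst y) < -1/2" using that by linarith+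
    then show ?thesis by (simp only: M_def slit_cocycle_def if_False if_cancel)
   qed
   ultimately show ?thesis using 3 by (intro exI[of _ "{y. \<bar>Re (fst y)\<bar> < 1/2}"]) simp
  qed
 qed
 have cocM: "local_cocycle W M"
  unfolding M_def[abs_def]
  by (rule local_cocycle_pullback[OF local_cocycle_slit]) (auto intro!: continuous_intros simp: W_def)
 have "\<exists>k. locally2 W (\<lambda>y z. M y z = k y + s1 y z - k z)"
 proof (rule gauge_extend[OF coc1 cocM _ UW, where h = "\<lambda>_. 0"])
  fix x assume x: "x \<in> W"
  have "\<exists>N. open N \<and> x \<in> N \<and> (\<forall>y\<in>N Int U. \<forall>z\<in>N Int U. M y z = s1 y z)"
  proof -
   consider "x \<in> U" | "x \<in> Zr" | "x \<in> Zl"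
    using x by (force simp: U_def Zr_def Zl_def W_def complex_eq_iff)
   then show ?thesis
   proof cases
    case 1
    obtain N where N: "open N" "x \<in> N" "\<forall>y\<in>N. \<forall>z\<in>N. M y z = 0" using M0[OF 1] by blast
    obtain N' where N': "open N'" "x \<in> N'" "\<forall>y\<in>N' Int U. \<forall>z\<in>N' Int U. s1 y z = 0"
     using locally2D[OF zeroU 1] by blast
    show ?thesis using N N' by (intro exI[of _ "N Int N'"]) (simp add: open_Int)
   next
    case 2
    obtain N where N: "open N" "x \<in> N" "\<forall>y\<in>N Int Dn. \<forall>z\<in>N Int Dn. s1 y z = 0" "\<forall>y\<in>N Int Up. \<forall>z\<in>N Int Up. s1 y z = 0"
     "\<forall>y\<in>N Int Dn. \<forall>z\<in>N Int Up. s1 y z = a \<and> s1 z y = - a" using bspec[OF a 2] by (elim exE conjE) (rule that)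
    have o: "open {y :: complex \<times> real. Re (fst y) > 1/2}" by (intro open_Collect_less continuous_intros)
    have "M y z = s1 y z" if "y \<in> N Int {y. Re (fst y) > 1/2} Int U" "z \<in> N Int {y. Re (fst y) > 1/2} Int U" for y z
    proof -
     have "y \<in> N Int Up \<or> y \<in> N Int Dn" "z \<in> N Int Up \<or> z \<in> N Int Dn"
      using that by (auto simp: U_def Up_def Dn_def)
     then show ?thesis using that N(3-5) by (elim disjE) (auto simp: M_def slit_cocycle_def Up_def Dn_def)
    qed
    then show ?thesis using N(1,2) o 2 by (intro exI[of _ "N Int {y. Re (fst y) > 1/2}"]) (simp add: open_Int Zr_def)
   next
    case 3
    obtain N where N: "open N" "x \<in> N" "\<forall>y\<in>N Int Up. \<forall>z\<in>N Int Up. s1 y z = 0" "\<forall>y\<in>N Int Dn. \<forall>z\<in>N Int Dn. s1 y z = 0"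
     "\<forall>y\<in>N Int Up. \<forall>z\<in>N Int Dn. s1 y z = b \<and> s1 z y = - b" using bspec[OF b 3] by (elim exE conjE) (rule that)
    have o: "open {y :: complex \<times> real. Re (fst y) < -1/2}" by (intro open_Collect_less continuous_intros)
    have "M y z = s1 y z" if "y \<in> N Int {y. Re (fst y) < -1/2} Int U" "z \<in> N Int {y. Re (fst y) < -1/2} Int U" for y z
    proof -
     have "y \<in> N Int Up \<or> y \<in> N Int Dn" "z \<in> N Int Up \<or> z \<in> N Int Dn"
      using that by (auto simp: U_def Up_def Dn_def)
     then show ?thesis using that N(3-5) by (elim disjE) (auto simp: M_def slit_cocycle_def Up_def Dn_def)
    qed
    then show ?thesis using N(1,2) o 3 by (intro exI[of _ "N Int {y. Re (fst y) < -1/2}"]) (simp add: open_Int Zl_def)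
   qed
  qed
  then show "\<exists>N. open N \<and> x \<in> N \<and> (\<forall>y\<in>N Int U. \<forall>z\<in>N Int U. M y z = 0 + s1 y z - 0)" by simp
 next
  fix N x assume N: "open N" "x \<in> N Int W"
  show "N Int U \<noteq> {}"
  proof (cases "Im (fst x) = 0")
   case True
   have "x \<in> D" using N by (simp add: W_def)
   then obtain N' where "N' \<subseteq> N" "N' Int Up \<noteq> {}" using nb[OF N(1) _ _ True] N(2) by blast
   then show ?thesis using UpU by blast
  next
   case False
   then have "x \<in> U" using N(2) by (simp add: U_def W_def)
   then show ?thesis using N by blast
  qed
 qed
 then obtain k1 where k1: "locally2 W (\<lambda>y z. M y z = k1 y + s1 y z - k1 z)" by (elim exE) (rule that)
 define k where "k y = k1 y + h y" for y
 have k: "locally2 W (\<lambda>y z. M y z = k y + \<sigma> y z - k z)"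
  by (rule locally2_mono[OF k1 order_refl]) (simp add: k_def s1_def gnorm del: add_uminus_conv_diff)
 \<comment> \<open>The sign \<open>\<epsilon>\<close> treats both strands at once. They are
   exchanged by the half-turn, which also exchanges the two slits with their crossing
   directions.\<close>
 have in_class: "v \<in> conj_class i'"
  if e: "\<epsilon> = 1 \<or> \<epsilon> = -1" and m: "meridional i' X \<sigma> (of_real (\<epsilon>/2), 0)"
   and jump: "!!y z. \<epsilon> * Re (fst y) > 1/2 ==> \<epsilon> * Re (fst z) > 1/2 ==> \<epsilon> * Im (fst y) < 0 ==> \<epsilon> * Im (fst z) > 0 ==> M y z = v"
  for \<epsilon> :: real and i' v
 proof -
  obtain W1 k' where W1: "open W1" "(of_real (\<epsilon>/2), 0) \<in> W1" "locally2 (W1 Int X) (\<lambda>y z. k' y + \<sigma> y z - k' z \<in> H i')"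
   using m unfolding meridional_def by (elim exE conjE) (rule that)
  define q where "q y = k' y - k y" for y
  have "locally2 (W1 Int W) (\<lambda>y z. k' y + \<sigma> y z - k' z \<in> H i')"
   by (rule locally2_mono[OF W1(3)]) (use XW in auto)
  moreover have "locally2 (W1 Int W) (\<lambda>y z. M y z = k y + \<sigma> y z - k z)"
   by (rule locally2_mono[OF k]) auto
  ultimately have "locally2 (W1 Int W) (\<lambda>y z. k' y + \<sigma> y z - k' z \<in> H i' \<and> M y z = k y + \<sigma> y z - k z)"
   by (rule locally2_conj)
  then have q: "locally2 (W1 Int W) (\<lambda>y z. q y + M y z - q z \<in> H i')"
   by (rule locally2_mono[OF _ order_refl]) (simp add: q_def gnorm del: add_uminus_conv_diff)
  have pD: "(of_real (\<epsilon>/2), 0) \<in> D" using e by (auto simp: D_def norm_of_real)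
  obtain e0 where e0: "e0 > 0" "ball (of_real (\<epsilon>/2), 0) e0 \<subseteq> W1 Int D" using ballD[OF W1(1,2) pD] by blast
  define d where "d = min e0 (1/4)"
  define B where "B = ball (of_real (\<epsilon>/2) :: complex, 0 :: real) d"
  have d: "d > 0" "d \<le> 1/4" "B \<subseteq> W1 Int D" using e0 by (auto simp: d_def B_def)
  \<comment> \<open>A small ball around a point of the strand without the wall beyond it, as a union
    of three convex pieces. The transport is trivial on it, so the gauge to \<open>H i'\<close>
    stays in one coset.\<close>
  define Z where "Z = (B Int {y. \<epsilon> * Re (fst y) < 1/2}) \<union> (B Int {y. Im (fst y) > 0}) \<union> (B Int {y. Im (fst y) < 0})"
  have BRe: "\<epsilon> * Re (fst y) > 1/4" if "y \<in> B" for y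
  proof -
   have "cmod (fst y - of_real (\<epsilon>/2)) < 1/4"
   proof -
    have "dist (fst y) (of_real (\<epsilon>/2)) \<le> dist y (of_real (\<epsilon>/2), 0)"
     using dist_fst_le[of y "(of_real (\<epsilon>/2), 0)"] by simp
    also have "\<dots> < d" using that by (simp add: B_def dist_commute)
    finally show ?thesis using d(2) by (simp add: dist_norm)
   qed
   then have "\<bar>Re (fst y) - \<epsilon>/2\<bar> < 1/4" using abs_Re_le_cmod[of "fst y - of_real (\<epsilon>/2)"] by simp
   then have "Re (fst y) - \<epsilon>/2 < 1/4 \<and> - (Re (fst y) - \<epsilon>/2) < 1/4" by (simp only: abs_less_iff)
   then show ?thesis using e by auto
  qed
  have ZU: "Z \<subseteq> U" 
  proof
   fix y assume y: "y \<in> Z"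
   then have "y \<in> B" by (auto simp: Z_def)
   then have "y \<in> D" "\<epsilon> * Re (fst y) > 1/4" using d(3) BRe by auto
   then show "y \<in> U" using y e by (auto simp: Z_def U_def)
  qed
  have inB: "(of_real (\<epsilon>/2 + r) + \<i> * of_real s, 0) \<in> B" if "\<bar>r\<bar> + \<bar>s\<bar> < d" for r s
  proof -
   have "cmod (of_real r + \<i> * of_real s) \<le> \<bar>r\<bar> + \<bar>s\<bar>"
    by (rule order_trans[OF norm_triangle_ineq]) (simp add: norm_mult)
   then have "cmod (of_real r + \<i> * of_real s) < d" using that by simp
   moreover have "of_real (\<epsilon>/2) - (of_real (\<epsilon>/2 + r) + \<i> * of_real s) = - (of_real r + \<i> * of_real s :: complex)" by simp
   ultimately show ?thesis by (simp only: B_def mem_ball dist_prod_def dist_norm fst_conv snd_conv norm_minus_cancel) simp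
  qed
  have conn: "connected Z"
   unfolding Z_def
  proof (intro connected_Un)
   have 1: "{y :: complex \<times> real. \<epsilon> * Re (fst y) < 1/2} = {y. Re (fst y) < 1/2} \<or> {y :: complex \<times> real. \<epsilon> * Re (fst y) < 1/2} = {y. Re (fst y) > -1/2}"
    using e by auto
   show "connected (B Int {y. \<epsilon> * Re (fst y) < 1/2})" "connected (B Int {y. Im (fst y) > 0})" "connected (B Int {y. Im (fst y) < 0})"
   proof -
    have "convex {y :: complex \<times> real. \<epsilon> * Re (fst y) < 1/2}"
     using 1 hs(3)[of "-1/2"] hs(4)[of "1/2"] by (elim disjE) (simp_all only:)
    then show "connected (B Int {y. \<epsilon> * Re (fst y) < 1/2})" "connected (B Int {y. Im (fst y) > 0})" "connected (B Int {y. Im (fst y) < 0})"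
     unfolding B_def by (intro convex_connected convex_Int hs convex_ball; assumption?)+
   qed
   have sq: "\<epsilon> * \<epsilon> = 1" using e by auto
   \<comment> \<open>Points on the inner side of the strand, slightly up and down, link the three
     pieces.\<close>
   have "(of_real (\<epsilon>/2 + (- \<epsilon> * d / 4)) + \<i> * of_real (d/4), 0) \<in> B" "(of_real (\<epsilon>/2 + (- \<epsilon> * d / 4)) + \<i> * of_real (-d/4), 0) \<in> B"
    using e d(1) by (intro inB; auto simp: abs_mult)+
   moreover have "\<epsilon> * (\<epsilon>/2 + (- \<epsilon> * d / 4)) < 1/2" using e d(1) by auto
   ultimately have "(of_real (\<epsilon>/2 + (- \<epsilon> * d / 4)) + \<i> * of_real (d/4), 0) \<in> B Int {y. \<epsilon> * Re (fst y) < 1/2} Int (B Int {y. Im (fst y) > 0})"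
    "(of_real (\<epsilon>/2 + (- \<epsilon> * d / 4)) + \<i> * of_real (-d/4), 0) \<in> B Int {y. \<epsilon> * Re (fst y) < 1/2} Int (B Int {y. Im (fst y) < 0})"
    using d(1) by simp_all
   then show "B Int {y. \<epsilon> * Re (fst y) < 1/2} Int (B Int {y. Im (fst y) > 0}) \<noteq> {}"
    "(B Int {y. \<epsilon> * Re (fst y) < 1/2} \<union> B Int {y. Im (fst y) > 0}) Int (B Int {y. Im (fst y) < 0}) \<noteq> {}" by blast+
  qed
  have lZ: "locally2 Z (\<lambda>y z. q y - q z \<in> H i')"
  proof -
   have "locally2 Z (\<lambda>y z. M y z = 0)"
   proof (rule locally2I)
    fix x assume "x \<in> Z"
    then have "x \<in> U" using ZU by blast
    from M0[OF this] show "\<exists>N. open N \<and> x \<in> N \<and> (\<forall>y\<in>N Int Z. \<forall>z\<in>N Int Z. M y z = 0)" by blast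
   qed
   moreover have "locally2 Z (\<lambda>y z. q y + M y z - q z \<in> H i')"
   proof (rule locally2_mono[OF q])
    show "Z \<subseteq> W1 Int W" using ZU UW d(3) by (auto simp: Z_def)
   qed
   ultimately have "locally2 Z (\<lambda>y z. M y z = 0 \<and> q y + M y z - q z \<in> H i')" by (rule locally2_conj)
   then show ?thesis by (rule locally2_mono) auto
  qed
  \<comment> \<open>A point on the wall beyond the strand. The points \<open>y\<close> and
    \<open>z\<close> below lie on its two sides, so that transport from \<open>y\<close> to
    \<open>z\<close> is the jump.\<close>
  define p where "p = (of_real (\<epsilon>/2 + \<epsilon> * d / 2) :: complex, 0 :: real)"
  have pB: "p \<in> B" using inB[of "\<epsilon> * d / 2" 0] e d(1) by (auto simp: p_def abs_mult)
  have pRe: "\<epsilon> * Re (fst p) > 1/2" using e d(1) by (auto simp: p_def)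
  have pW: "p \<in> W1 Int W"
  proof -
   have "p \<in> W" by (rule inW) (use pB d(3) pRe e in auto)
   then show ?thesis using pB d(3) by blast
  qed
  obtain N where N: "open N" "p \<in> N" "\<forall>y\<in>N Int (W1 Int W). \<forall>z\<in>N Int (W1 Int W). q y + M y z - q z \<in> H i'"
   using locally2D[OF q pW] by (elim exE conjE) (rule that)
  have "open (N Int B)" "p \<in> N Int B" using N pB by (auto simp: B_def intro: open_Int)
  then obtain r where r: "r > 0" "ball p r \<subseteq> N Int B" using open_contains_ball by metis
  define y where "y = (fst p + \<i> * of_real (- \<epsilon> * r / 2), snd p)"
  define z where "z = (fst p + \<i> * of_real (\<epsilon> * r / 2), snd p)"
  have yz: "y \<in> N Int B" "z \<in> N Int B"
   using vert[of "- \<epsilon> * r / 2" r p] vert[of "\<epsilon> * r / 2" r p] e r by (auto simp: y_def z_def abs_mult)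
  have im: "\<epsilon> * Im (fst y) < 0" "\<epsilon> * Im (fst z) > 0" "\<epsilon> * Re (fst y) > 1/2" "\<epsilon> * Re (fst z) > 1/2"
   using e r(1) pRe by (auto simp: y_def z_def p_def)
  have yzZ: "y \<in> Z" "z \<in> Z" using yz im(1,2) e by (auto simp: Z_def)
  have yzW: "y \<in> W1 Int W" "z \<in> W1 Int W" using yzZ ZU UW yz d(3) by auto
  have "q y + M y z - q z \<in> H i'" using N(3) yz yzW by blast
  then have "q y + v - q z \<in> H i'" using jump[OF im(3,4,1,2)] by simp
  then show ?thesis by (rule conj_class_from_gauge[OF conn lZ yzZ])
 qed
 have "a \<in> conj_class i"
  by (rule in_class[of 1]) (use mer(1) in \<open>auto simp: M_def slit_cocycle_def\<close>)
 moreover have "b \<in> conj_class j"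
  by (rule in_class[of "-1"]) (use mer(2) in \<open>auto simp: M_def slit_cocycle_def\<close>)
 ultimately show ?thesis using k unfolding M_def by blast
qed

end

section \<open>The ball of a 4-move and homeomorphisms supported in it\<close>

lemma model_ball_iff: "x \<in> model_ball \<longleftrightarrow> cmod (fst x) \<le> 1 \<and> \<bar>snd x\<bar> \<le> 1"
 by (cases x) (auto simp: model_ball_def abs_le_iff)

lemma model_strands_iff: "x \<in> model_strands \<longleftrightarrow> (fst x = 1/2 \<or> fst x = -1/2) \<and> \<bar>snd x\<bar> \<le> 1"
 by (cases x) (auto simp: model_strands_def abs_le_iff)

lemma four_half_twists_eq: "four_half_twists = twist (\<lambda>z. 2 * pi * (z + 1))"
 by (auto simp: four_half_twists_def twist_def fun_eq_iff)

lemma compact_cylinder: "compact {x :: complex \<times> real. cmod (fst x) \<le> r \<and> \<bar>snd x\<bar> \<le> s}"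
proof -
 have "{x :: complex \<times> real. cmod (fst x) \<le> r \<and> \<bar>snd x\<bar> \<le> s} = cball 0 r \<times> {-s..s}"
  by (auto simp: abs_le_iff)
 then show ?thesis by (simp add: compact_Times)
qed

lemma open_cylinder: "open {x :: complex \<times> real. cmod (fst x) < r \<and> \<bar>snd x\<bar> < s}"
 by (intro open_Collect_conj open_Collect_less continuous_intros)

lemma S3_image_closed:
 fixes \<phi> :: "complex \<times> real => complex \<times> complex"
 assumes "continuous_on UNIV \<phi>" "compact B" shows "closed (\<phi> ` B)"
 by (rule compact_imp_closed[OF compact_continuous_image[OF continuous_on_subset[OF assms(1)] assms(2)]]) simp

lemma S3_image_open:
 fixes \<phi> :: "complex \<times> real => complex \<times> complex"
 assumes "continuous_on UNIV \<phi>" "inj \<phi>" "range \<phi> \<subseteq> S3" "open U"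
 obtains V where "open V" "\<phi> ` U = V Int S3"
 using continuous_injective_S3_open[OF assms] unfolding openin_open by blast

text \<open>A rotation whose angle depends on radius and height preserves the cylinder and is
  inverted by negating the angle. As the angle vanishes on the boundary, the identity continues it
  to the whole sphere.\<close>

lemma radial_twist_homeomorphism:
 fixes \<phi> :: "complex \<times> real => complex \<times> complex" and G :: "real => real => real"
 assumes \<phi>: "continuous_on UNIV \<phi>" "inj \<phi>" "range \<phi> \<subseteq> S3"
  and G: "continuous_on UNIV (\<lambda>(r, z). G r z)" "!!r z. r = 1 \<or> \<bar>z\<bar> = 1 ==> G r z = 0"
 shows "\<exists>h h'. homeomorphism S3 S3 h h' \<and>
  (\<forall>x\<in>model_ball. h (\<phi> x) = \<phi> (twist (G (cmod (fst x))) x)) \<and> (\<forall>y\<in>S3 - \<phi> ` model_ball. h y = y)"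
proof -
 obtain \<psi> V where V: "open V" "range \<phi> = V Int S3" "continuous_on (V Int S3) \<psi>" "!!x. \<psi> (\<phi> x) = x"
  using S3_chart[OF \<phi>] by metis
 define R where "R G x = twist (G (cmod (fst x))) x" for G :: "real => real => real" and x
 define h where "h G y = (if y \<in> \<phi> ` model_ball then \<phi> (R G (\<psi> y)) else y)" for G y
 have Rball: "R G x \<in> model_ball \<longleftrightarrow> x \<in> model_ball" for G x by (simp add: R_def model_ball_iff)
 have Rinv: "R (\<lambda>r z. - G r z) (R G x) = x" "R G (R (\<lambda>r z. - G r z) x) = x" for G x
  by (simp_all add: R_def)
 have closedB: "closed (\<phi> ` model_ball)"
  by (rule S3_image_closed[OF \<phi>(1)]) (simp add: model_ball_def compact_Times)
 have h1: "h G (\<phi> x) = \<phi> (R G x)" if "x \<in> model_ball" for G x using that V(4) by (simp add: h_def)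
 have h2: "h G y = y" if "y \<notin> \<phi> ` model_ball" for G y using that by (simp add: h_def)
 have hinv: "h (\<lambda>r z. - G r z) (h G y) = y" "h G (h (\<lambda>r z. - G r z) y) = y" for G y
  by (cases "y \<in> \<phi> ` model_ball"; auto simp: h1 h2 Rball Rinv)+
 have hS: "h G y \<in> S3" if "y \<in> S3" for G y using that \<phi>(3) by (auto simp: h_def)
 have cont: "continuous_on S3 (h G)" if G: "continuous_on UNIV (\<lambda>(r, z). G r z)" "!!r z. r = 1 \<or> \<bar>z\<bar> = 1 ==> G r z = 0" for G
 proof -
  obtain O1 where O1: "open O1" "\<phi> ` {x. cmod (fst x) < 1 \<and> \<bar>snd x\<bar> < 1} = O1 Int S3"
   by (rule S3_image_open[OF \<phi> open_cylinder])
  have contR: "continuous_on UNIV (R G)"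
  proof -
   have "continuous_on UNIV (\<lambda>x :: complex \<times> real. G (cmod (fst x)) (snd x))"
   proof -
    have "continuous_on UNIV (\<lambda>x :: complex \<times> real. (cmod (fst x), snd x))" by (intro continuous_intros)
    from continuous_on_compose2[OF G(1) this] show ?thesis by simp
   qed
   then show ?thesis unfolding R_def[abs_def] twist_def by (intro continuous_intros)
  qed
  \<comment> \<open>Two closed pieces, the ball and the complement of its interior, meet in the
    boundary, where both formulas agree.\<close>
  have "continuous_on (\<phi> ` model_ball \<union> (S3 - O1)) (\<lambda>y. if y \<in> \<phi> ` model_ball then \<phi> (R G (\<psi> y)) else y)"
  proof (rule continuous_on_cases)
   show "closed (S3 - O1)" using O1(1) by (intro closed_Diff) (auto simp: S3_def)
   have "continuous_on (\<phi> ` model_ball) \<psi>"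
    by (rule continuous_on_subset[OF V(3)]) (use V(2) in blast)
   then show "continuous_on (\<phi> ` model_ball) (\<lambda>y. \<phi> (R G (\<psi> y)))"
    by (intro continuous_on_compose2[OF \<phi>(1)] continuous_on_compose2[OF contR]) auto
   show "\<forall>x. x \<in> \<phi> ` model_ball \<and> x \<notin> \<phi> ` model_ball \<or> x \<in> S3 - O1 \<and> x \<in> \<phi> ` model_ball --> \<phi> (R G (\<psi> x)) = x"
   proof (intro allI impI)
    fix y assume "y \<in> \<phi> ` model_ball \<and> y \<notin> \<phi> ` model_ball \<or> y \<in> S3 - O1 \<and> y \<in> \<phi> ` model_ball"
    then have y: "y \<in> S3 - O1" "y \<in> \<phi> ` model_ball" by blast+
    then obtain x where x: "x \<in> model_ball" "y = \<phi> x" by blast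
    have "\<phi> x \<notin> \<phi> ` {x. cmod (fst x) < 1 \<and> \<bar>snd x\<bar> < 1}" using y x O1(2) by auto
    then have "\<not> (cmod (fst x) < 1 \<and> \<bar>snd x\<bar> < 1)" by blast
    then have "cmod (fst x) = 1 \<or> \<bar>snd x\<bar> = 1" using x(1) by (auto simp: model_ball_iff)
    then have "G (cmod (fst x)) (snd x) = 0" by (rule G(2))
    then show "\<phi> (R G (\<psi> y)) = y" by (simp add: x(2) V(4) R_def twist_def)
   qed
  qed (use closedB in auto)
  then show ?thesis unfolding h_def[abs_def]
  proof (rule continuous_on_subset)
   show "S3 \<subseteq> \<phi> ` model_ball \<union> (S3 - O1)"
   proof
    fix y assume y: "y \<in> S3"
    have "{x :: complex \<times> real. cmod (fst x) < 1 \<and> \<bar>snd x\<bar> < 1} \<subseteq> model_ball" by (auto simp: model_ball_iff)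
    then have "O1 Int S3 \<subseteq> \<phi> ` model_ball" using O1(2) by blast
    then show "y \<in> \<phi> ` model_ball \<union> (S3 - O1)" using y by blast
   qed
  qed
 qed
 have "continuous_on UNIV (\<lambda>(r, z). - G r z)" using continuous_on_minus[OF G(1)] by (simp add: case_prod_unfold)
 then have c2: "continuous_on S3 (h (\<lambda>r z. - G r z))" by (rule cont) (simp add: G(2))
 have "homeomorphism S3 S3 (h G) (h (\<lambda>r z. - G r z))"
 proof (rule homeomorphismI)
  show "continuous_on S3 (h G)" by (rule cont[OF G])
  show "h G ` S3 \<subseteq> S3" "h (\<lambda>r z. - G r z) ` S3 \<subseteq> S3" using hS by auto
 qed (use c2 hinv in auto)
 then show ?thesis using h1 h2 unfolding R_def by blast
qed

section \<open>Carrying a representation across four half-twists\<close>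

context meridian_data begin

text \<open>After gauging the old cocycle to the model inside the ball, the new one is its pullback
  under untwisting inside and the old one outside. They fit together on the shell between, where
  untwisting is the gauge transformation of \<open>twist_gauge\<close>. The twist used here is the
  one by \<open>ramp\<close>.\<close>

lemma add_twists_rep:
 fixes \<phi> :: "complex \<times> real => complex \<times> complex"
 assumes \<phi>: "continuous_on UNIV \<phi>" "inj \<phi>" "range \<phi> \<subseteq> S3"
  and A: "!!i. i \<in> {1..m} ==> A i \<subseteq> S3"
  and strands: "{x \<in> model_ball. \<phi> x \<in> (\<Union>i\<in>{1..m}. A i)} = model_strands"
  and rep: "link_rep S3 m A \<tau>"
 shows "\<exists>\<tau>'. link_rep S3 m (\<lambda>i. (A i - \<phi> ` model_ball) \<union> \<phi> ` (twist ramp ` {x \<in> model_ball. \<phi> x \<in> A i})) \<tau>'"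
proof -
 obtain \<psi> V0 where V0: "open V0" "range \<phi> = V0 Int S3" "continuous_on (V0 Int S3) \<psi>" "!!x. \<psi> (\<phi> x) = x"
  using S3_chart[OF \<phi>] by metis
 let ?Ti = "twist (\<lambda>z. - ramp z)"
 define LA where "LA = (\<Union>i\<in>{1..m}. A i)"
 define D where "D = {x :: complex \<times> real. cmod (fst x) < 1 \<and> \<bar>snd x\<bar> < 1}"
 define W where "W = {x \<in> D. fst x \<noteq> 1/2 \<and> fst x \<noteq> -1/2}"
 define X where "X = S3 - LA"
 have Dball: "D \<subseteq> model_ball" by (auto simp: D_def model_ball_iff)
 have inL: "\<phi> x \<in> LA \<longleftrightarrow> fst x = 1/2 \<or> fst x = -1/2" if "x \<in> model_ball" for x
 proof -
  have "x \<in> model_ball \<and> \<phi> x \<in> (\<Union>i\<in>{1..m}. A i) \<longleftrightarrow> x \<in> model_strands"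
   using arg_cong[OF strands, of "\<lambda>S. x \<in> S"] by (simp only: mem_Collect_eq)
  then show ?thesis using that unfolding LA_def[symmetric] model_strands_iff by (auto simp: model_ball_iff)
 qed
 have DX: "D Int (UNIV - (\<Union>i\<in>{1..m}. \<phi> -` A i)) = W"
 proof (rule Set.set_eqI)
  fix x
  have "x \<in> (\<Union>i\<in>{1..m}. \<phi> -` A i) \<longleftrightarrow> \<phi> x \<in> LA" unfolding LA_def by blast
  then show "x \<in> D Int (UNIV - (\<Union>i\<in>{1..m}. \<phi> -` A i)) \<longleftrightarrow> x \<in> W"
   using inL[of x] Dball unfolding W_def by blast
 qed
 have rep1: "link_rep UNIV m (\<lambda>i. \<phi> -` A i) (\<lambda>y z. \<tau> (\<phi> y) (\<phi> z))" by (rule link_rep_pullback[OF \<phi> rep])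
 have "(1/2, 0) \<in> model_ball" "(-1/2, 0) \<in> model_ball" by (simp_all add: model_ball_iff)
 then have "\<phi> (1/2, 0) \<in> LA" "\<phi> (-1/2, 0) \<in> LA" using inL by simp_all
 then obtain i1 i2 where i12: "i1 \<in> {1..m}" "\<phi> (1/2, 0) \<in> A i1" "i2 \<in> {1..m}" "\<phi> (-1/2, 0) \<in> A i2"
  unfolding LA_def by blast
 have "\<exists>a b k. a \<in> conj_class i1 \<and> b \<in> conj_class i2 \<and>
  locally2 W (\<lambda>x y. slit_cocycle a b (fst x) (fst y) = k x + \<tau> (\<phi> x) (\<phi> y) - k y)"
  unfolding W_def D_def
 proof (rule slit_normal_form[where X = "UNIV - (\<Union>i\<in>{1..m}. \<phi> -` A i)"])
  show "local_cocycle {x \<in> {x. cmod (fst x) < 1 \<and> \<bar>snd x\<bar> < 1}. fst x \<noteq> 1/2 \<and> fst x \<noteq> -1/2} (\<lambda>x y. \<tau> (\<phi> x) (\<phi> y))"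
   using rep1 DX unfolding D_def W_def link_rep_def by (blast intro: local_cocycle_subset)
  show "meridional i1 (UNIV - (\<Union>i\<in>{1..m}. \<phi> -` A i)) (\<lambda>x y. \<tau> (\<phi> x) (\<phi> y)) (1/2, 0)"
   "meridional i2 (UNIV - (\<Union>i\<in>{1..m}. \<phi> -` A i)) (\<lambda>x y. \<tau> (\<phi> x) (\<phi> y)) (-1/2, 0)"
   using rep1 i12 unfolding link_rep_def by simp_all
  show "{x. cmod (fst x) < 1 \<and> \<bar>snd x\<bar> < 1} Int (UNIV - (\<Union>i\<in>{1..m}. \<phi> -` A i)) =
   {x \<in> {x. cmod (fst x) < 1 \<and> \<bar>snd x\<bar> < 1}. fst x \<noteq> 1/2 \<and> fst x \<noteq> -1/2}" using DX unfolding D_def W_def .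
 qed
 then obtain a b k where ab: "a \<in> conj_class i1" "b \<in> conj_class i2"
  and k: "locally2 W (\<lambda>x y. slit_cocycle a b (fst x) (fst y) = k x + \<tau> (\<phi> x) (\<phi> y) - k y)"
  by (elim exE conjE) (rule that)
 let ?S = "slit_cocycle a b"
 define kk where "kk y = k (\<psi> y)" for y
 define \<tau>2 where "\<tau>2 y z = kk y + \<tau> y z - kk z" for y z
 have rep2: "link_rep S3 m A \<tau>2" unfolding \<tau>2_def by (rule link_rep_gauge[OF rep])
 have l2: "locally2 W (\<lambda>x y. ?S (fst x) (fst y) = \<tau>2 (\<phi> x) (\<phi> y))"
  by (rule locally2_mono[OF k order_refl]) (simp add: \<tau>2_def kk_def V0(4))
 \<comment> \<open>Exchanging the strands turns (a b)^2 into (b a)^2. The relations of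
   \<open>four_commute'\<close> are rearranged so that (b a)^2 commutes with both, as
   \<open>twist_gauge\<close> expects.\<close>
 have f1: "a + b + a + b + a = a + (a + b + a + b)" and f2: "b + a + b + a + b = b + (b + a + b + a)"
  using four_commute'[OF ab] four_commute'[OF ab(2,1)] .
 have f3: "b + (a + (b + a)) = a + (b + (a + b))"
  using f1 by (simp only: add.assoc add_left_cancel)
 have ca: "a + (b + a + (b + a)) = b + a + (b + a) + a"
  by (simp only: add.assoc f3)
 have cb: "b + (b + a + (b + a)) = b + a + (b + a) + b"
  using f2 by (simp only: add.assoc)
 obtain \<kappa> where \<kappa>: "\<forall>x. fst x \<noteq> 1/2 --> fst x \<noteq> -1/2 --> 3/4 < cmod (fst x) \<or> 3/4 < \<bar>snd x\<bar> -->
  (\<exists>N. open N \<and> x \<in> N \<and> (\<forall>y\<in>N. \<forall>z\<in>N. ?S (fst y) (fst z) = \<kappa> y + ?S (fst (?Ti y)) (fst (?Ti z)) - \<kappa> z))"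
  using twist_gauge[OF ca cb] by (elim exE) (rule that)
 define A2 where "A2 i = (A i - \<phi> ` model_ball) \<union> \<phi> ` (twist ramp ` {x \<in> model_ball. \<phi> x \<in> A i})" for i
 define LA2 where "LA2 = (\<Union>i\<in>{1..m}. A2 i)"
 define X2 where "X2 = S3 - LA2"
 have Tball: "?Ti x \<in> model_ball \<longleftrightarrow> x \<in> model_ball" "twist ramp x \<in> model_ball \<longleftrightarrow> x \<in> model_ball" for x
  by (simp_all add: model_ball_iff)
 have factI: "\<phi> x \<in> A2 i \<longleftrightarrow> \<phi> (?Ti x) \<in> A i" if xb: "x \<in> model_ball" for x i
 proof
  assume "\<phi> x \<in> A2 i"
  then obtain u where u: "\<phi> x = \<phi> (twist ramp u)" "\<phi> u \<in> A i" using xb unfolding A2_def by blast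
  then have "x = twist ramp u" using \<phi>(2) by (simp add: inj_eq)
  then show "\<phi> (?Ti x) \<in> A i" using u(2) by simp
 next
  assume "\<phi> (?Ti x) \<in> A i"
  then have "?Ti x \<in> {x \<in> model_ball. \<phi> x \<in> A i}" using xb Tball by simp
  then have "\<phi> (twist ramp (?Ti x)) \<in> A2 i" unfolding A2_def by blast
  then show "\<phi> x \<in> A2 i" by simp
 qed
 \<comment> \<open>Nested cylinders of sizes 3/4 and 7/8 in the ball of size 1. Outside
   \<open>Vin\<close> old and new link coincide, inside \<open>Di\<close> the pullback is used, and
   the shell between them is where \<open>twist_gauge\<close> applies.\<close>
 define Vin where "Vin = {x :: complex \<times> real. cmod (fst x) \<le> 3/4 \<and> \<bar>snd x\<bar> \<le> 3/4}"
 define Vb where "Vb = {x :: complex \<times> real. cmod (fst x) \<le> 7/8 \<and> \<bar>snd x\<bar> \<le> 7/8}"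
 define Di where "Di = {x :: complex \<times> real. cmod (fst x) < 7/8 \<and> \<bar>snd x\<bar> < 7/8}"
 have not_half: "w \<noteq> 1/2 \<and> w \<noteq> -1/2" if "cmod w > 3/4" for w
 proof -
  have "cmod w \<noteq> cmod (1/2)" "cmod w \<noteq> cmod (-1/2)" using that by simp_all
  then show ?thesis by metis
 qed
 have factB: "y \<in> A2 i \<longleftrightarrow> y \<in> A i" if y: "y \<notin> \<phi> ` Vin" and i: "i \<in> {1..m}" for y i
 proof (cases "y \<in> \<phi> ` model_ball")
  case False
  then have "y \<notin> \<phi> ` (twist ramp ` {x \<in> model_ball. \<phi> x \<in> A i})" using Tball by blast
  then show ?thesis using False by (simp add: A2_def)
 next
  case True
  then obtain x where x: "x \<in> model_ball" "y = \<phi> x" by blast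
  have "x \<notin> Vin" using y x by blast
  then consider "\<bar>snd x\<bar> > 3/4" | "cmod (fst x) > 3/4" by (auto simp: Vin_def)
  then show ?thesis
  proof cases
   case 1
   then have "?Ti x = x" by (intro twist_ramp_ends) simp
   then show ?thesis using factI[OF x(1), of i] by (simp add: x(2))
  next
   case 2
   have "\<phi> x \<notin> LA" using inL[OF x(1)] not_half[OF 2] by blast
   moreover have "cmod (fst (?Ti x)) > 3/4" using 2 by simp
   then have "fst (?Ti x) \<noteq> 1/2 \<and> fst (?Ti x) \<noteq> -1/2" by (rule not_half)
   then have "\<phi> (?Ti x) \<notin> LA" using inL[of "?Ti x"] x(1) Tball by blast
   ultimately show ?thesis using factI[OF x(1), of i] i by (auto simp: x(2) LA_def)
  qed
 qed
 have XX2: "y \<in> X \<longleftrightarrow> y \<in> X2" if "y \<notin> \<phi> ` Vin" for y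
  using factB[OF that] by (auto simp: X_def X2_def LA_def LA2_def)
 obtain O1 where O1: "open O1" "\<phi> ` Di = O1 Int S3" unfolding Di_def by (rule S3_image_open[OF \<phi> open_cylinder])
 define O2 where "O2 = - (\<phi> ` Vin)"
 have O2: "open O2" unfolding O2_def Vin_def by (intro open_Compl S3_image_closed[OF \<phi>(1)] compact_cylinder)
 have VinDi: "Vin \<subseteq> Di" "Di \<subseteq> Vb" "Vb \<subseteq> D" by (auto simp: Vin_def Di_def Vb_def D_def)
 have cover: "y \<in> O1 \<or> y \<in> O2" if "y \<in> S3" for y
 proof (cases "y \<in> \<phi> ` Vin")
  case True
  then have "y \<in> O1 Int S3" using O1(2) VinDi(1) by blast
  then show ?thesis by blast
 qed (simp add: O2_def)
 define f where "f y = \<phi> (?Ti (\<psi> y))" for y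
 define g where "g y = \<phi> (twist ramp (\<psi> y))" for y
 \<comment> \<open>The switch takes place at the boundary of \<open>Vb\<close>. Whether both, one or
   none of two nearby points are in \<open>Vb\<close> does not matter, as the two formulas agree
   there (\<open>out\<close>).\<close>
 define \<tau>3 where "\<tau>3 y z = (if y \<in> \<phi> ` Vb \<and> z \<in> \<phi> ` Vb then \<kappa> (\<psi> y) + \<tau>2 (f y) (f z) - \<kappa> (\<psi> z) else \<tau>2 y z)" for y z
 have out: "locally2 (X2 Int O2) (\<lambda>y z. \<tau>3 y z = 0 + \<tau>2 y z - 0)"
 proof (rule locally2I)
  fix x assume x: "x \<in> X2 Int O2"
  show "\<exists>N. open N \<and> x \<in> N \<and> (\<forall>y\<in>N Int (X2 Int O2). \<forall>z\<in>N Int (X2 Int O2). \<tau>3 y z = 0 + \<tau>2 y z - 0)"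
  proof (cases "x \<in> \<phi> ` Vb")
   case False
   have "open (- (\<phi> ` Vb))" unfolding Vb_def by (intro open_Compl S3_image_closed[OF \<phi>(1)] compact_cylinder)
   then show ?thesis using False by (intro exI[of _ "- (\<phi> ` Vb)"]) (simp add: \<tau>3_def)
  next
   case True
   then obtain x0 where x0: "x0 \<in> Vb" "x = \<phi> x0" by blast
   have x0D: "x0 \<in> D" "x0 \<in> model_ball" using x0 VinDi Dball by blast+
   have xX: "\<phi> x0 \<notin> LA" using XX2[of x] x by (auto simp: O2_def X_def x0(2))
   then have x0W: "x0 \<in> W" using inL[OF x0D(2)] x0D(1) by (simp add: W_def)
   have Tx0W: "?Ti x0 \<in> W"
   proof -
    have "\<phi> (?Ti x0) \<notin> LA" using x factI[OF x0D(2)] by (auto simp: X2_def LA2_def LA_def x0(2))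
    then show ?thesis using inL[of "?Ti x0"] x0D Tball by (simp add: W_def D_def)
   qed
   have col: "3/4 < cmod (fst x0) \<or> 3/4 < \<bar>snd x0\<bar>" using x by (force simp: O2_def Vin_def x0(2))
   obtain N0 where N0: "open N0" "x0 \<in> N0" "\<forall>y\<in>N0. \<forall>z\<in>N0. ?S (fst y) (fst z) = \<kappa> y + ?S (fst (?Ti y)) (fst (?Ti z)) - \<kappa> z"
    using \<kappa>[rule_format, OF _ _ col] x0W by (auto simp: W_def)
   obtain N1 where N1: "open N1" "x0 \<in> N1" "\<forall>y\<in>N1 Int W. \<forall>z\<in>N1 Int W. ?S (fst y) (fst z) = \<tau>2 (\<phi> y) (\<phi> z)"
    using locally2D[OF l2 x0W] by (elim exE conjE) (rule that)
   obtain N2 where N2: "open N2" "?Ti x0 \<in> N2" "\<forall>y\<in>N2 Int W. \<forall>z\<in>N2 Int W. ?S (fst y) (fst z) = \<tau>2 (\<phi> y) (\<phi> z)"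
    using locally2D[OF l2 Tx0W] by (elim exE conjE) (rule that)
   have "continuous_on UNIV ?Ti" by (intro continuous_twist continuous_intros continuous_ramp)
   then have N2': "open (?Ti -` N2)" using N2(1) by (simp add: continuous_on_open_vimage)
   define Q where "Q = N0 Int N1 Int ?Ti -` N2 Int D"
   have "open Q" unfolding Q_def D_def by (intro open_Int N0 N1 N2' open_cylinder)
   then obtain V where V: "open V" "\<phi> ` Q = V Int S3" by (rule S3_image_open[OF \<phi>])
   have xV: "x \<in> V"
   proof -
    have "x0 \<in> Q" using N0 N1 N2 x0D by (simp add: Q_def)
    then show ?thesis using V(2) x0(2) by blast
   qed
   have "\<tau>3 y z = 0 + \<tau>2 y z - 0" if y: "y \<in> V Int (X2 Int O2)" and z: "z \<in> V Int (X2 Int O2)" for y z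
   proof (cases "y \<in> \<phi> ` Vb \<and> z \<in> \<phi> ` Vb")
    case True
    have pt: "\<exists>u. v = \<phi> u \<and> u \<in> Q \<and> u \<in> W \<and> ?Ti u \<in> W" if v: "v \<in> V Int (X2 Int O2)" for v
    proof -
     have "v \<in> V Int S3" using v by (simp add: X2_def)
     then obtain u where u: "u \<in> Q" "v = \<phi> u" using V(2) by blast
     have uD: "u \<in> D" "u \<in> model_ball" using u(1) Dball by (auto simp: Q_def)
     have "v \<in> X" using XX2[of v] v by (simp add: O2_def)
     then have 1: "u \<in> W" using inL[OF uD(2)] uD(1) u(2) by (simp add: W_def X_def)
     have "\<phi> (?Ti u) \<notin> LA" using v factI[OF uD(2)] by (auto simp: X2_def LA2_def LA_def u(2))
     then have "?Ti u \<in> W" using inL[of "?Ti u"] uD Tball by (simp add: W_def D_def)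
     then show ?thesis using u 1 by blast
    qed
    obtain u where u: "y = \<phi> u" "u \<in> Q" "u \<in> W" "?Ti u \<in> W" using pt[OF y] by blast
    obtain v where v: "z = \<phi> v" "v \<in> Q" "v \<in> W" "?Ti v \<in> W" using pt[OF z] by blast
    have "\<tau>3 y z = \<kappa> u + \<tau>2 (\<phi> (?Ti u)) (\<phi> (?Ti v)) - \<kappa> v"
     using True by (simp add: \<tau>3_def f_def u(1) v(1) V0(4))
    also have "\<tau>2 (\<phi> (?Ti u)) (\<phi> (?Ti v)) = ?S (fst (?Ti u)) (fst (?Ti v))"
     using N2(3) u v by (simp add: Q_def)
    also have "\<kappa> u + \<dots> - \<kappa> v = ?S (fst u) (fst v)"
     using N0(3) u(2) v(2) by (simp add: Q_def)
    also have "\<dots> = \<tau>2 y z" using N1(3) u v by (simp add: Q_def)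
    finally show ?thesis by simp
   next
    case False
    show ?thesis unfolding \<tau>3_def if_not_P[OF False] by simp
   qed
   then show ?thesis using V(1) xV by blast
  qed
 qed
 have O1X2: "\<exists>u. y = \<phi> u \<and> u \<in> Di \<and> u \<in> model_ball" if "y \<in> O1 Int S3" for y
  using that VinDi Dball unfolding O1(2)[symmetric] by blast
 have fX: "f ` (O1 Int X2) \<subseteq> X"
 proof
  fix v assume "v \<in> f ` (O1 Int X2)"
  then obtain y where y: "y \<in> O1 Int X2" "v = f y" by blast
  have "y \<in> O1 Int S3" using y(1) by (simp add: X2_def)
  then obtain u where u: "y = \<phi> u" "u \<in> model_ball" using O1X2 by blast
  have "\<phi> (?Ti u) \<notin> LA" using y(1) factI[OF u(2)] by (auto simp: X2_def LA2_def LA_def u(1))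
  then show "v \<in> X" using \<phi>(3) by (auto simp: X_def y(2) f_def u(1) V0(4))
 qed
 have gX: "g ` (O1 Int X) \<subseteq> X2"
 proof
  fix v assume "v \<in> g ` (O1 Int X)"
  then obtain y where y: "y \<in> O1 Int X" "v = g y" by blast
  have "y \<in> O1 Int S3" using y(1) by (simp add: X_def)
  then obtain u where u: "y = \<phi> u" "u \<in> model_ball" using O1X2 by blast
  have "\<phi> (twist ramp u) \<notin> LA2"
   using y(1) factI[of "twist ramp u"] u(2) Tball by (auto simp: X_def LA2_def LA_def u(1))
  then show "v \<in> X2" using \<phi>(3) by (auto simp: X2_def y(2) g_def u(1) V0(4))
 qed
 have cont\<psi>: "continuous_on (O1 Int S3) \<psi>"
  by (rule continuous_on_subset[OF V0(3)]) (use O1(2) V0(2) in blast)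
 have contf: "continuous_on (O1 Int S3) f" and contg: "continuous_on (O1 Int S3) g"
  unfolding f_def[abs_def] g_def[abs_def]
  by (intro continuous_on_compose2[OF \<phi>(1)] continuous_on_compose2[OF _ cont\<psi>, of UNIV]
    continuous_twist continuous_intros continuous_ramp; simp)+
 have inn: "locally2 (O1 Int X2) (\<lambda>y z. \<tau>3 y z = \<kappa> (\<psi> y) + \<tau>2 (f y) (f z) - \<kappa> (\<psi> z))"
 proof (intro locally2I exI[of _ UNIV] conjI ballI)
  fix y z assume "y \<in> UNIV Int (O1 Int X2)" "z \<in> UNIV Int (O1 Int X2)"
  then have "y \<in> \<phi> ` Vb" "z \<in> \<phi> ` Vb" using O1(2) VinDi(2) by (auto simp: X2_def)
  then show "\<tau>3 y z = \<kappa> (\<psi> y) + \<tau>2 (f y) (f z) - \<kappa> (\<psi> z)" by (simp add: \<tau>3_def)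
 qed auto
 have cX: "local_cocycle X \<tau>2" using rep2 by (simp add: link_rep_def X_def LA_def)
 have coc1: "local_cocycle (O1 Int X2) \<tau>3"
 proof (rule local_cocycle_gauge[OF local_cocycle_pullback[OF cX _ fX] inn])
  show "continuous_on (O1 Int X2) f" by (rule continuous_on_subset[OF contf]) (auto simp: X2_def)
 qed
 have coc2: "local_cocycle (X2 Int O2) \<tau>3"
  by (rule local_cocycle_gauge[OF local_cocycle_subset[OF cX] out]) (use XX2 in \<open>auto simp: O2_def\<close>)
 have "link_rep S3 m A2 \<tau>3"
  unfolding link_rep_def LA2_def[symmetric] X2_def[symmetric]
 proof (intro conjI ballI)
  show "local_cocycle X2 \<tau>3"
  proof (rule local_cocycleI)
   fix x assume x: "x \<in> X2"
   then consider "x \<in> O1 Int X2" | "x \<in> X2 Int O2" using cover[of x] by (auto simp: X2_def)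
   then show "\<exists>N. open N \<and> x \<in> N \<and> (\<forall>u\<in>N Int X2. \<forall>v\<in>N Int X2. \<forall>w\<in>N Int X2. \<tau>3 u v + \<tau>3 v w = \<tau>3 u w)"
   proof cases
    case 1
    obtain N where "open N" "x \<in> N" "\<forall>u\<in>N Int (O1 Int X2). \<forall>v\<in>N Int (O1 Int X2). \<forall>w\<in>N Int (O1 Int X2). \<tau>3 u v + \<tau>3 v w = \<tau>3 u w"
     using local_cocycleD[OF coc1 1] by (elim exE conjE) (rule that)
    then show ?thesis using O1(1) 1 by (intro exI[of _ "N Int O1"]) (simp add: open_Int Int_assoc)
   next
    case 2
    obtain N where "open N" "x \<in> N" "\<forall>u\<in>N Int (X2 Int O2). \<forall>v\<in>N Int (X2 Int O2). \<forall>w\<in>N Int (X2 Int O2). \<tau>3 u v + \<tau>3 v w = \<tau>3 u w"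
     using local_cocycleD[OF coc2 2] by (elim exE conjE) (rule that)
    then show ?thesis using O2 2 by (intro exI[of _ "N Int O2"]) (simp add: open_Int Int_assoc Int_commute[of O2])
   qed
  qed
  fix i p assume i: "i \<in> {1..m}" and p: "p \<in> A2 i"
  have pS: "p \<in> S3" using p A[OF i] \<phi>(3) unfolding A2_def by blast
  have mer: "meridional i X \<tau>2 q" if "q \<in> A i" for q
   using rep2 i that by (simp add: link_rep_def X_def LA_def)
  show "meridional i X2 \<tau>3 p"
  proof (cases "p \<in> O2")
   case True
   then have "p \<in> A i" using factB[OF _ i] p by (simp add: O2_def)
   show ?thesis
   proof (rule meridional_cong[OF mer[OF \<open>p \<in> A i\<close>] O2 True])
    show "O2 Int X = O2 Int X2" using XX2 by (auto simp: O2_def)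
    show "locally2 (O2 Int X2) (\<lambda>y z. \<tau>3 y z = 0 + \<tau>2 y z - 0)" using out by (simp add: Int_commute)
   qed
  next
   case False
   then have p1: "p \<in> O1 Int S3" using cover[OF pS] pS by simp
   then obtain u where u: "p = \<phi> u" "u \<in> Di" "u \<in> model_ball" using O1X2 by blast
   have fp: "f p = \<phi> (?Ti u)" by (simp add: f_def u(1) V0(4))
   have fpA: "f p \<in> A i" using p factI[OF u(3)] by (simp add: u(1) fp[unfolded u(1)])
   have "?Ti u \<in> Di" using u(2) by (simp add: Di_def)
   then have fp1: "f p \<in> O1 Int S3" unfolding fp O1(2)[symmetric] by blast
   show ?thesis
   proof (rule meridional_transfer[where f = f and g = g and W = O1 and W' = O1 and S = S3 and S' = S3 and X = X2 and X' = X and \<tau> = \<tau>2 and k = "\<lambda>y. \<kappa> (\<psi> y)"])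
    show "meridional i X \<tau>2 (f p)" by (rule mer[OF fpA])
    show "g (f p) = p" unfolding fp g_def V0(4) unfolding u(1) by simp
    show "f (g y) = y" if y: "y \<in> O1 Int X" for y
    proof -
     have "y \<in> O1 Int S3" using y by (simp add: X_def)
     then obtain v where "y = \<phi> v" using O1X2 by blast
     then show ?thesis by (simp add: f_def g_def V0(4))
    qed
    show "X2 \<subseteq> S3" "X \<subseteq> S3" by (auto simp: X2_def X_def)
   qed (use O1(1) p1 fp1 contf contg fX gX inn in auto)
  qed
 qed
 then show ?thesis unfolding A2_def by blast
qed

end

lemma adds_four_half_twistsE:
 assumes "adds_four_half_twists m L L'"
 obtains \<phi> where "continuous_on UNIV \<phi>" "inj \<phi>" "range \<phi> \<subseteq> S3"
  "{x \<in> model_ball. \<phi> x \<in> (\<Union>i\<in>{1..m}. range (L i))} = model_strands"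
  "!!i t x. i \<in> {1..m} ==> x \<in> model_ball ==> L i t = \<phi> x ==> L' i t = \<phi> (four_half_twists x)"
  "!!i t. i \<in> {1..m} ==> L i t \<notin> \<phi> ` model_ball ==> L' i t = L i t"
proof -
 obtain \<phi> where \<phi>: "continuous_on UNIV \<phi>" "inj \<phi>" "range \<phi> \<subseteq> S3"
  "{x \<in> model_ball. \<phi> x \<in> (\<Union>i\<in>{1..m}. range (L i))} = model_strands"
  "\<forall>i\<in>{1..m}. \<forall>t. (\<forall>x\<in>model_ball. L i t = \<phi> x --> L' i t = \<phi> (four_half_twists x)) \<and>
     (L i t \<notin> \<phi> ` model_ball --> L' i t = L i t)"
  using assms unfolding adds_four_half_twists_def by (elim exE conjE) (rule that)
 show ?thesis
 proof (rule that[OF \<phi>(1-4)])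
  fix i t x assume "i \<in> {1..m}" "x \<in> model_ball" "L i t = \<phi> x"
  then show "L' i t = \<phi> (four_half_twists x)" using bspec[OF \<phi>(5), of i] by blast
 next
  fix i t assume "i \<in> {1..m}" "L i t \<notin> \<phi> ` model_ball"
  then show "L' i t = L i t" using bspec[OF \<phi>(5), of i] by blast
 qed
qed

lemma four_half_twists_ball: "four_half_twists x \<in> model_ball \<longleftrightarrow> x \<in> model_ball"
 by (simp add: four_half_twists_eq model_ball_iff)

lemma inj_four_half_twists: "inj four_half_twists"
 unfolding four_half_twists_eq
 by (rule inj_on_inverseI[where g = "twist (\<lambda>z. - (2 * pi * (z + 1)))"]) (rule twist_cancel)

text \<open>Up to the reflection of the model ball, the inverse move adds four half-twists, too.\<close>

lemma adds_four_half_twists_sym: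
 assumes "adds_four_half_twists m L L'" shows "adds_four_half_twists m L' L"
proof (rule adds_four_half_twistsE[OF assms])
 fix \<phi> assume \<phi>: "continuous_on UNIV \<phi>" "inj \<phi>" "range \<phi> \<subseteq> S3"
  and strands: "{x \<in> model_ball. \<phi> x \<in> (\<Union>i\<in>{1..m}. range (L i))} = model_strands"
  and inn: "!!i t x. i \<in> {1..m} ==> x \<in> model_ball ==> L i t = \<phi> x ==> L' i t = \<phi> (four_half_twists x)"
  and out: "!!i t. i \<in> {1..m} ==> L i t \<notin> \<phi> ` model_ball ==> L' i t = L i t"
 define r where "r x = (cnj (fst x), snd x)" for x :: "complex \<times> real"
 have rr: "r (r x) = x" and rball: "r x \<in> model_ball \<longleftrightarrow> x \<in> model_ball" and rstr: "r x \<in> model_strands \<longleftrightarrow> x \<in> model_strands" for x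
  by (auto simp: r_def model_ball_iff model_strands_iff complex_eq_iff)
 \<comment> \<open>Conjugation of the disc reverses the sense of rotation, so the second twist
   undoes the first.\<close>
 have trt: "four_half_twists (r (four_half_twists x)) = r x" for x
  by (simp add: four_half_twists_eq twist_def r_def cis_cnj cis_mult mult.assoc[symmetric])
 define \<phi>' where "\<phi>' x = \<phi> (four_half_twists (r x))" for x
 have ball: "\<phi>' ` model_ball = \<phi> ` model_ball"
 proof (intro equalityI subsetI)
  fix y assume "y \<in> \<phi> ` model_ball"
  then obtain x where x: "x \<in> model_ball" "y = \<phi> x" by blast
  define u where "u = r (twist (\<lambda>z. - (2 * pi * (z + 1))) x)"
  have "four_half_twists (r u) = x" by (simp add: u_def rr four_half_twists_eq)
  moreover have "u \<in> model_ball" unfolding u_def rball using x(1) by (simp add: model_ball_iff)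
  ultimately show "y \<in> \<phi>' ` model_ball" unfolding \<phi>'_def x(2) by (metis image_eqI)
 qed (auto simp: \<phi>'_def four_half_twists_ball rball)
 have key: "L i t = \<phi> (r x) \<and> r x \<in> model_ball" if i: "i \<in> {1..m}" and x: "x \<in> model_ball" "L' i t = \<phi>' x" for i t x
 proof (cases "L i t \<in> \<phi> ` model_ball")
  case True
  then obtain u where u: "u \<in> model_ball" "L i t = \<phi> u" by blast
  have "\<phi> (four_half_twists u) = \<phi> (four_half_twists (r x))" using inn[OF i u] x(2) by (simp add: \<phi>'_def)
  then have "u = r x" using \<phi>(2) inj_four_half_twists by (simp add: inj_eq)
  then show ?thesis using u by simp
 next
  case False
  then have "\<phi>' x \<notin> \<phi> ` model_ball" using out[OF i False] x(2) by simp
  then show ?thesis using ball x(1) by blast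
 qed
 show ?thesis
  unfolding adds_four_half_twists_def
 proof (intro exI[of _ \<phi>'] conjI ballI allI impI)
  have "continuous_on UNIV four_half_twists"
   unfolding four_half_twists_eq by (intro continuous_twist continuous_intros)
  moreover have "continuous_on UNIV r" unfolding r_def by (intro continuous_intros)
  ultimately show "continuous_on UNIV \<phi>'" unfolding \<phi>'_def[abs_def]
   using continuous_on_compose2[OF \<phi>(1)] continuous_on_compose2[of UNIV four_half_twists UNIV r] by simp
  show "inj \<phi>'"
  proof (rule injI)
   fix x y assume "\<phi>' x = \<phi>' y"
   then have "r x = r y" using \<phi>(2) inj_four_half_twists by (simp add: \<phi>'_def inj_eq)
   then show "x = y" by (metis rr)
  qed
  show "range \<phi>' \<subseteq> S3" using \<phi>(3) unfolding \<phi>'_def by blast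
  show "{x \<in> model_ball. \<phi>' x \<in> (\<Union>i\<in>{1..m}. range (L' i))} = model_strands"
  proof (intro equalityI subsetI)
   fix x assume "x \<in> {x \<in> model_ball. \<phi>' x \<in> (\<Union>i\<in>{1..m}. range (L' i))}"
   then obtain i t where it: "i \<in> {1..m}" "x \<in> model_ball" "L' i t = \<phi>' x" by force
   have "L i t = \<phi> (r x)" "r x \<in> model_ball" using key[OF it] by simp_all
   then have "\<phi> (r x) \<in> (\<Union>i\<in>{1..m}. range (L i))" using it(1) by (metis UN_I rangeI)
   then have "r x \<in> model_strands" using strands \<open>r x \<in> model_ball\<close> by blast
   then show "x \<in> model_strands" by (simp add: rstr)
  next
   fix x assume "x \<in> model_strands"
   then have "r x \<in> {x \<in> model_ball. \<phi> x \<in> (\<Union>i\<in>{1..m}. range (L i))}" using strands rstr by blast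
   then obtain i t where it: "i \<in> {1..m}" "r x \<in> model_ball" "L i t = \<phi> (r x)" by force
   have "L' i t = \<phi>' x" using inn[OF it] by (simp add: \<phi>'_def)
   then show "x \<in> {x \<in> model_ball. \<phi>' x \<in> (\<Union>i\<in>{1..m}. range (L' i))}"
    using it rball by (metis (mono_tags, lifting) UN_I mem_Collect_eq rangeI)
  qed
  fix i t assume i: "i \<in> {1..m}"
  show "L i t = \<phi>' (four_half_twists x)" if "x \<in> model_ball" "L' i t = \<phi>' x" for x
   using key[OF i that] by (simp add: \<phi>'_def trt)
  assume nb: "L' i t \<notin> \<phi>' ` model_ball"
  show "L i t = L' i t"
  proof (cases "L i t \<in> \<phi> ` model_ball")
   case True
   then obtain u where u: "u \<in> model_ball" "L i t = \<phi> u" by blast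
   have "L' i t \<in> \<phi> ` model_ball" using inn[OF i u] u(1) four_half_twists_ball by simp
   then show ?thesis using nb ball by simp
  qed (simp add: out[OF i])
 qed
qed

section \<open>Invariance under 4-equivalence\<close>

context meridian_data begin

text \<open>The move turns uniformly by \<open>2 * pi * (z + 1)\<close>, while
  \<open>add_twists_rep\<close> turns by \<open>ramp\<close>. The two angles agree at both ends, so
  a homeomorphism supported in the ball takes one link to the other.\<close>

lemma adds_four_half_twists_rep:
 assumes adds: "adds_four_half_twists m L L'" and L: "is_link S3 m L"
  and rep: "\<exists>\<tau>. link_rep S3 m (\<lambda>i. range (L i)) \<tau>"
 shows "\<exists>\<tau>. link_rep S3 m (\<lambda>i. range (L' i)) \<tau>"
proof (rule adds_four_half_twistsE[OF adds])
 fix \<phi> assume \<phi>: "continuous_on UNIV \<phi>" "inj \<phi>" "range \<phi> \<subseteq> S3"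
  and strands: "{x \<in> model_ball. \<phi> x \<in> (\<Union>i\<in>{1..m}. range (L i))} = model_strands"
  and inn: "!!i t x. i \<in> {1..m} ==> x \<in> model_ball ==> L i t = \<phi> x ==> L' i t = \<phi> (four_half_twists x)"
  and out: "!!i t. i \<in> {1..m} ==> L i t \<notin> \<phi> ` model_ball ==> L' i t = L i t"
 define A where "A i = (range (L i) - \<phi> ` model_ball) \<union> \<phi> ` (twist ramp ` {x \<in> model_ball. \<phi> x \<in> range (L i)})" for i
 obtain \<tau> where \<tau>: "link_rep S3 m (\<lambda>i. range (L i)) \<tau>" using rep by (elim exE) (rule that)
 have "\<exists>\<tau>'. link_rep S3 m A \<tau>'"
  unfolding A_def[abs_def] by (rule add_twists_rep[OF \<phi> _ strands \<tau>]) (rule is_linkD(2)[OF L])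
 then obtain \<tau>2 where \<tau>2: "link_rep S3 m A \<tau>2" by (elim exE) (rule that)
 \<comment> \<open>The cut-off factor is 1 up to radius 1/2, where the strands are, and 0 from
   radius 1 on. The difference of the angles vanishes at the heights 1 and -1.\<close>
 define G where "G r z = max 0 (min 1 (2 - 2 * r)) * (2 * pi * (z + 1) - ramp z)" for r z :: real
 have "\<exists>h h'. homeomorphism S3 S3 h h' \<and>
  (\<forall>x\<in>model_ball. h (\<phi> x) = \<phi> (twist (G (cmod (fst x))) x)) \<and> (\<forall>y\<in>S3 - \<phi> ` model_ball. h y = y)"
 proof (rule radial_twist_homeomorphism[OF \<phi>])
  show "continuous_on UNIV (\<lambda>(r, z). G r z)"
   unfolding G_def ramp_def case_prod_unfold by (intro continuous_intros)
  show "G r z = 0" if "r = 1 \<or> \<bar>z\<bar> = 1" for r z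
  proof -
   have "r = 1 \<or> z = 1 \<or> z = -1" using that by (auto simp: abs_if split: if_splits)
   then show ?thesis by (elim disjE) (simp_all add: G_def ramp_def)
  qed
 qed
 then obtain h h' where h: "homeomorphism S3 S3 h h'" "\<forall>x\<in>model_ball. h (\<phi> x) = \<phi> (twist (G (cmod (fst x))) x)"
  "\<forall>y\<in>S3 - \<phi> ` model_ball. h y = y" by (elim exE conjE) (rule that)
 have AS: "A i \<subseteq> S3" if "i \<in> {1..m}" for i
  using is_linkD(2)[OF L that] \<phi>(3) unfolding A_def by blast
 have rep3: "link_rep S3 m (\<lambda>i. h ` A i) (\<lambda>y z. \<tau>2 (h' y) (h' z))"
  by (rule link_rep_homeomorphism[OF \<tau>2 AS h(1)])
 have strand: "h (\<phi> (twist ramp u)) = L' i t" if i: "i \<in> {1..m}" and u: "u \<in> model_ball" "L i t = \<phi> u" for i t u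
 proof -
  have "\<phi> u \<in> (\<Union>i\<in>{1..m}. range (L i))" using i u(2) by (metis UN_I rangeI)
  then have "u \<in> model_strands" using strands u(1) by blast
  then have "fst u = 1/2 \<or> fst u = -1/2" by (simp add: model_strands_iff)
  then have cm: "cmod (fst u) = 1/2" by (elim disjE; simp only:; simp)
  have ball: "twist ramp u \<in> model_ball" using u(1) by (simp add: model_ball_iff)
  have "cmod (fst (twist ramp u)) = 1/2" unfolding cm[symmetric] by simp
  then have "h (\<phi> (twist ramp u)) = \<phi> (twist (G (1/2)) (twist ramp u))"
   using bspec[OF h(2) ball] by (simp only:)
  then have "h (\<phi> (twist ramp u)) = \<phi> (twist (\<lambda>z. G (1/2) z + ramp z) u)"
   by (simp only: twist_twist)
  also have "(\<lambda>z. G (1/2) z + ramp z) = (\<lambda>z. 2 * pi * (z + 1))" by (simp add: G_def fun_eq_iff)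
  also have "\<phi> (twist (\<lambda>z. 2 * pi * (z + 1)) u) = L' i t"
   using inn[OF i u] by (simp add: four_half_twists_eq)
  finally show ?thesis .
 qed
 have fix_out: "h (L i t) = L' i t" if i: "i \<in> {1..m}" and "L i t \<notin> \<phi> ` model_ball" for i t
  using h(3) out[OF that] is_linkD(2)[OF L i] that(2) by (metis Diff_iff rangeI subsetD)
 have "h ` A i = range (L' i)" if i: "i \<in> {1..m}" for i
 proof (intro equalityI subsetI)
  fix y assume "y \<in> h ` A i"
  then obtain x where x: "x \<in> A i" "y = h x" by blast
  then consider t where "x = L i t" "L i t \<notin> \<phi> ` model_ball" | u t where "u \<in> model_ball" "\<phi> u = L i t" "x = \<phi> (twist ramp u)"
   unfolding A_def by blast
  then show "y \<in> range (L' i)"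
  proof cases
   case 1
   then show ?thesis using fix_out[OF i] x(2) by simp
  next
   case 2
   then show ?thesis using strand[OF i 2(1), of t] x(2) by simp
  qed
 next
  fix y assume "y \<in> range (L' i)"
  then obtain t where t: "y = L' i t" by blast
  show "y \<in> h ` A i"
  proof (cases "L i t \<in> \<phi> ` model_ball")
   case True
   then obtain u where u: "u \<in> model_ball" "L i t = \<phi> u" by blast
   have "u \<in> {x \<in> model_ball. \<phi> x \<in> range (L i)}" using u by (metis (mono_tags, lifting) mem_Collect_eq rangeI)
   then have "\<phi> (twist ramp u) \<in> A i" unfolding A_def by blast
   then show ?thesis using strand[OF i u] t by (metis image_eqI)
  next
   case False
   then have "L i t \<in> A i" unfolding A_def by blast
   then show ?thesis using fix_out[OF i False] t by (metis image_eqI)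
  qed
 qed
 then have "link_rep S3 m (\<lambda>i. range (L' i)) (\<lambda>y z. \<tau>2 (h' y) (h' z))" by (rule link_rep_cong[OF rep3])
 then show ?thesis by (rule exI[of _ "\<lambda>y z. \<tau>2 (h' y) (h' z)"])
qed

lemma four_equivalent_rep:
 assumes "four_equivalent m L L'" "\<exists>\<tau>. link_rep S3 m (\<lambda>i. range (L' i)) \<tau>"
 shows "\<exists>\<tau>. link_rep S3 m (\<lambda>i. range (L i)) \<tau>"
 using assms(1) unfolding four_equivalent_def
proof (induction rule: converse_rtranclp_induct)
 case base
 then show ?case by (rule assms(2))
next
 case (step L1 L2)
 then have l: "is_link S3 m L1" "is_link S3 m L2" and alt: "isotopic_links m L1 L2 \<or> four_move m L1 L2" by simp_all
 from alt show ?case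
 proof
  assume "isotopic_links m L1 L2"
  then show ?thesis using isotopic_rep[OF step.IH _ l] by simp
 next
  assume "four_move m L1 L2"
  then have "adds_four_half_twists m L2 L1"
   using adds_four_half_twists_sym unfolding four_move_def by blast
  then show ?thesis by (rule adds_four_half_twists_rep[OF _ l(2) step.IH])
 qed
qed

lemma regular_projection_rep:
 assumes K: "regular_projection m K" and iso: "isotopic_links m (\<lambda>i t. inv_stereographic (K i t)) L"
  and L: "is_link S3 m L" and equiv: "four_equivalent m L trivial_link"
 shows "\<exists>\<tau>. link_rep UNIV m (\<lambda>i. range (K i)) \<tau>"
proof -
 have Kl: "is_link UNIV m K" using K by (simp add: regular_projection_def)
 note st = inv_stereographic_chart
 have "is_link S3 m (\<lambda>i t. inv_stereographic (K i t))"
  unfolding is_link_def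
 proof (intro conjI ballI allI impI)
  fix i t assume i: "i \<in> {1..m}"
  show "continuous_on UNIV (\<lambda>t. inv_stereographic (K i t))"
   using continuous_on_compose2[OF st(1) is_linkD(1)[OF Kl i]] by simp
  show "range (\<lambda>t. inv_stereographic (K i t)) \<subseteq> S3" using st(3) by blast
  show "inv_stereographic (K i (t + 1)) = inv_stereographic (K i t)" using is_linkD(3)[OF Kl i] by simp
 next
  fix i j s t assume ij: "i \<in> {1..m}" "j \<in> {1..m}" and "inv_stereographic (K i s) = inv_stereographic (K j t)"
  then have "K i s = K j t" using st(2) by (simp add: inj_eq)
  then show "i = j" "s - t \<in> \<int>" using is_link_inj[OF Kl ij] by blast+
 qed
 then have "\<exists>\<tau>. link_rep S3 m (\<lambda>i. range (\<lambda>t. inv_stereographic (K i t))) \<tau>"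
  by (rule isotopic_rep[OF four_equivalent_rep[OF equiv trivial_link_rep] iso _ L])
 then obtain \<tau> where \<tau>: "link_rep S3 m (\<lambda>i. range (\<lambda>t. inv_stereographic (K i t))) \<tau>" by (elim exE) (rule that)
 have "inv_stereographic -` range (\<lambda>t. inv_stereographic (K i t)) = range (K i)" for i
  using st(2) by (auto simp: inj_eq)
 then have "link_rep UNIV m (\<lambda>i. range (K i)) (\<lambda>y z. \<tau> (inv_stereographic y) (inv_stereographic z))"
  using link_rep_pullback[OF st \<tau>] by simp
 then show ?thesis by (rule exI[of _ "\<lambda>y z. \<tau> (inv_stereographic y) (inv_stereographic z)"])
qed

end

section \<open>Colouring a diagram\<close>

lemma transversal_has_derivative:
 fixes f g :: "real => complex"
 assumes "(f has_vector_derivative f') (at (fst x))" "(g has_vector_derivative g') (at (snd x))"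
 shows "((\<lambda>x. f (fst x) + g (snd x)) has_derivative (\<lambda>v. fst v *\<^sub>R f' + snd v *\<^sub>R g')) (at x)"
proof -
 have "(f has_derivative (\<lambda>h. h *\<^sub>R f')) (at (fst x))" "(g has_derivative (\<lambda>h. h *\<^sub>R g')) (at (snd x))"
  using assms by (simp_all add: has_vector_derivative_def)
 then have "((\<lambda>x. f (fst x)) has_derivative (\<lambda>h. fst h *\<^sub>R f')) (at x)"
  "((\<lambda>x. g (snd x)) has_derivative (\<lambda>h. snd h *\<^sub>R g')) (at x)"
  by (auto intro: has_derivative_compose[OF has_derivative_fst[OF has_derivative_ident]]
    has_derivative_compose[OF has_derivative_snd[OF has_derivative_ident]])
 then show ?thesis by (intro has_derivative_add)
qed

text \<open>Cramer's rule: \<open>Im (cnj a * b)\<close> is the determinant of the plane vectors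
  \<open>a\<close> and \<open>b\<close>.\<close>

lemma transversal_inverse:
 fixes a b :: complex
 assumes "Im (cnj a * b) \<noteq> 0"
 defines "G \<equiv> \<lambda>w. (Im (cnj w * b) / Im (cnj a * b), Im (cnj a * w) / Im (cnj a * b))"
 shows "bounded_linear G" "G \<circ> (\<lambda>v. fst v *\<^sub>R a + snd v *\<^sub>R b) = id"
proof -
 have "linear G"
  by (rule linearI) (simp_all add: G_def algebra_simps add_divide_distrib diff_divide_distrib)
 then show "bounded_linear G" by (simp add: linear_conv_bounded_linear)
 show "G \<circ> (\<lambda>v. fst v *\<^sub>R a + snd v *\<^sub>R b) = id"
 proof
  fix v :: "real \<times> real"
  have eqs: "Im (cnj (fst v *\<^sub>R a + snd v *\<^sub>R b) * b) = fst v * Im (cnj a * b)"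
   "Im (cnj a * (fst v *\<^sub>R a + snd v *\<^sub>R b)) = snd v * Im (cnj a * b)"
   by (simp_all add: algebra_simps)
  show "(G \<circ> (\<lambda>v. fst v *\<^sub>R a + snd v *\<^sub>R b)) v = id v"
   unfolding comp_def G_def eqs nonzero_mult_div_cancel_right[OF assms(1)] by simp
 qed
qed

text \<open>The derivative at \<open>(t0, s0)\<close> is invertible by transversality, and the
  derivatives of the two curves are continuous, so the sum map is injective nearby.\<close>

lemma transversal_chart:
 fixes f g :: "real => complex"
 assumes f: "!!t. (f has_vector_derivative f' t) (at t)" "continuous_on UNIV f'"
  and g: "!!t. (g has_vector_derivative g' t) (at t)" "continuous_on UNIV g'"
  and tr: "Im (cnj (f' t0) * g' s0) \<noteq> 0"
 shows "\<exists>d>0. inj_on (\<lambda>x. f (fst x) + g (snd x)) ({t0 - d<..<t0 + d} \<times> {s0 - d<..<s0 + d})"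
proof -
 define F :: "real \<times> real => complex" where "F x = f (fst x) + g (snd x)" for x
 define F' where "F' x v = fst v *\<^sub>R f' (fst x) + snd v *\<^sub>R g' (snd x)" for x v :: "real \<times> real"
 define G where "G w = (Im (cnj w * g' s0) / Im (cnj (f' t0) * g' s0), Im (cnj (f' t0) * w) / Im (cnj (f' t0) * g' s0))" for w
 have G: "bounded_linear G" "G \<circ> F' (t0, s0) = id"
  using transversal_inverse[OF tr] by (simp_all add: G_def[abs_def] F'_def[abs_def])
 have der: "(F has_derivative F' x) (at x)" for x
  unfolding F_def[abs_def] F'_def[abs_def] by (rule transversal_has_derivative[OF f(1) g(1)])
 \<comment> \<open>Continuity of the derivative in the operator norm. Each curve contributes at most
   \<open>e/3\<close>, which leaves a strict inequality.\<close>
 have on: "\<exists>d>0. \<forall>x. dist (t0, s0) x < d --> onorm (\<lambda>v. F' x v - F' (t0, s0) v) < e" if e: "e > 0" for e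
 proof -
  obtain d1 where d1: "d1 > 0" "!!t. dist t t0 < d1 ==> dist (f' t) (f' t0) < e/3"
   using f(2) e unfolding continuous_on_iff by (metis UNIV_I divide_pos_pos zero_less_numeral)
  obtain d2 where d2: "d2 > 0" "!!t. dist t s0 < d2 ==> dist (g' t) (g' s0) < e/3"
   using g(2) e unfolding continuous_on_iff by (metis UNIV_I divide_pos_pos zero_less_numeral)
  have "onorm (\<lambda>v. F' x v - F' (t0, s0) v) < e" if x: "dist (t0, s0) x < min d1 d2" for x
  proof -
   have "dist (fst x) t0 < d1" "dist (snd x) s0 < d2"
    using x dist_fst_le[of "(t0, s0)" x] dist_snd_le[of "(t0, s0)" x] by (simp_all add: dist_commute)
   then have b: "cmod (f' (fst x) - f' t0) < e/3" "cmod (g' (snd x) - g' s0) < e/3"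
    using d1(2) d2(2) by (simp_all add: dist_norm)
   have "onorm (\<lambda>v. F' x v - F' (t0, s0) v) \<le> 2 * e / 3"
   proof (rule onorm_bound)
    fix v :: "real \<times> real"
    have "F' x v - F' (t0, s0) v = fst v *\<^sub>R (f' (fst x) - f' t0) + snd v *\<^sub>R (g' (snd x) - g' s0)"
     by (simp add: F'_def algebra_simps)
    then have "cmod (F' x v - F' (t0, s0) v) \<le> \<bar>fst v\<bar> * cmod (f' (fst x) - f' t0) + \<bar>snd v\<bar> * cmod (g' (snd x) - g' s0)"
     by (metis norm_scaleR norm_triangle_ineq)
    also have "\<dots> \<le> norm v * (e/3) + norm v * (e/3)"
     using b norm_fst_le[of "fst v" "snd v"] norm_snd_le[of "snd v" "fst v"] by (intro add_mono mult_mono) auto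
    finally show "cmod (F' x v - F' (t0, s0) v) \<le> 2 * e / 3 * norm v" by simp
   qed (use e in simp)
   then show ?thesis using e by simp
  qed
  then show ?thesis using d1(1) d2(1) by (intro exI[of _ "min d1 d2"]) auto
 qed
 obtain r where r: "r > 0" "inj_on F (ball (t0, s0) r)"
  using has_derivative_locally_injective[OF UNIV_I open_UNIV G der on] by metis
 have "{t0 - r/2<..<t0 + r/2} \<times> {s0 - r/2<..<s0 + r/2} \<subseteq> ball (t0, s0) r"
 proof
  fix x :: "real \<times> real" assume x: "x \<in> {t0 - r/2<..<t0 + r/2} \<times> {s0 - r/2<..<s0 + r/2}"
  have "dist (t0, s0) x \<le> dist t0 (fst x) + dist s0 (snd x)"
   using sqrt_sum_squares_le_sum[of "dist t0 (fst x)" "dist s0 (snd x)"] by (simp add: dist_prod_def)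
  also have "\<dots> < r" using x by (auto simp: dist_real_def)
  finally show "x \<in> ball (t0, s0) r" by simp
 qed
 then have "inj_on F ({t0 - r/2<..<t0 + r/2} \<times> {s0 - r/2<..<s0 + r/2})"
  using r(2) inj_on_subset by blast
 then show ?thesis using r(1) by (intro exI[of _ "r/2"]) (simp add: F_def[abs_def])
qed

text \<open>The vector \<open>n\<close> points to the left of the curve \<open>f\<close>. Along it,
  the second coordinate of the inverse chart has the derivative \<open>Im (cnj (f' t0) * n)\<close>
  divided by the determinant. So the sign of \<open>r\<close> tells on which side of the first axis
  a point lies, up to the sign of the determinant.\<close>

lemma chart_side:
 fixes f g :: "real => complex"
 assumes f: "!!t. (f has_vector_derivative f' t) (at t)" and g: "!!t. (g has_vector_derivative g' t) (at t)"
  and tr: "Im (cnj (f' t0) * g' s0) \<noteq> 0" and n: "Im (cnj (f' t0) * n) > 0"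
  and B: "open B" "(t0, s0) \<in> B" "inj_on (\<lambda>x. f (fst x) + g (snd x)) B"
 shows "\<exists>\<rho>>0. \<forall>r. r \<noteq> 0 --> \<bar>r\<bar> < \<rho> --> (\<exists>x\<in>B. f (fst x) + g (snd x) = f t0 + g s0 + r *\<^sub>R n \<and>
  0 < r * ((snd x - s0) * Im (cnj (f' t0) * g' s0)))"
proof -
 define F :: "real \<times> real => complex" where "F x = f (fst x) + g (snd x)" for x
 define G where "G w = (Im (cnj w * g' s0) / Im (cnj (f' t0) * g' s0), Im (cnj (f' t0) * w) / Im (cnj (f' t0) * g' s0))" for w
 define D where "D = Im (cnj (f' t0) * g' s0)"
 have G: "bounded_linear G" "G \<circ> (\<lambda>v. fst v *\<^sub>R f' t0 + snd v *\<^sub>R g' s0) = id"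
  using transversal_inverse[OF tr] by (simp_all add: G_def[abs_def])
 have der: "(F has_derivative (\<lambda>v. fst v *\<^sub>R f' (fst x) + snd v *\<^sub>R g' (snd x))) (at x)" for x
  unfolding F_def[abs_def] by (rule transversal_has_derivative[OF f g])
 have contF: "continuous_on B F"
  using has_derivative_continuous[OF der] by (simp add: continuous_at_imp_continuous_on)
 have injF: "inj_on F B" using B(3) by (simp add: F_def[abs_def])
 obtain h where h: "homeomorphism B (F ` B) F h"
  using invariance_of_domain_homeomorphism[OF B(1) contF _ injF] by auto
 have op: "open (F ` B)" using invariance_of_domain_gen[OF B(1) contF injF] by simp
 have hF: "h (F x) = x" if "x \<in> B" for x using h that by (simp add: homeomorphism_apply1)
 have mem: "F (t0, s0) \<in> F ` B" using B(2) by blast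
 have "(h has_derivative G) (at (F (t0, s0)))"
 proof (rule has_derivative_inverse_basic[OF _ G(1) _ _ op mem])
  show "(F has_derivative (\<lambda>v. fst v *\<^sub>R f' t0 + snd v *\<^sub>R g' s0)) (at (h (F (t0, s0))))"
   using der[of "(t0, s0)"] hF[OF B(2)] by simp
  show "G \<circ> (\<lambda>v. fst v *\<^sub>R f' t0 + snd v *\<^sub>R g' s0) = id" by (rule G(2))
  show "continuous (at (F (t0, s0))) h"
   using homeomorphism_cont2[OF h] mem unfolding continuous_on_eq_continuous_at[OF op] by blast
  show "F (h w) = w" if "w \<in> F ` B" for w using homeomorphism_apply2[OF h that] .
 qed
 then have "(h has_derivative G) (at (F (t0, s0) + 0 *\<^sub>R n))" by simp
 moreover have "((\<lambda>r. F (t0, s0) + r *\<^sub>R n) has_derivative (\<lambda>r. r *\<^sub>R n)) (at 0)"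
  by (auto intro!: derivative_eq_intros)
 ultimately have "((\<lambda>r. h (F (t0, s0) + r *\<^sub>R n)) has_derivative (\<lambda>r. G (r *\<^sub>R n))) (at 0)"
  by (rule has_derivative_compose[rotated])
 then have "((\<lambda>r. snd (h (F (t0, s0) + r *\<^sub>R n))) has_derivative (\<lambda>r. snd (G (r *\<^sub>R n)))) (at 0)"
  by (rule has_derivative_snd)
 moreover have "snd (G (r *\<^sub>R n)) = Im (cnj (f' t0) * n) / D * r" for r
  by (simp add: G_def D_def algebra_simps diff_divide_distrib add_divide_distrib)
 ultimately have "((\<lambda>r. snd (h (F (t0, s0) + r *\<^sub>R n))) has_real_derivative Im (cnj (f' t0) * n) / D) (at 0)"
  by (simp only: has_field_derivative_def)
 then have lim: "((\<lambda>r. (snd (h (F (t0, s0) + r *\<^sub>R n)) - s0) / r * D) \<longlongrightarrow> Im (cnj (f' t0) * n)) (at 0)"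
 proof -
  assume "((\<lambda>r. snd (h (F (t0, s0) + r *\<^sub>R n))) has_real_derivative Im (cnj (f' t0) * n) / D) (at 0)"
  then have "((\<lambda>r. (snd (h (F (t0, s0) + r *\<^sub>R n)) - s0) / r) \<longlongrightarrow> Im (cnj (f' t0) * n) / D) (at 0)"
   using hF[OF B(2)] by (simp add: DERIV_def)
  note lim = tendsto_mult_right[OF this, of D]
  have "D \<noteq> 0" using tr unfolding D_def .
  with lim show ?thesis by (simp only: times_divide_eq_left nonzero_mult_div_cancel_right not_False_eq_True)
 qed
 have ev1: "\<forall>\<^sub>F r in at 0. 0 < (snd (h (F (t0, s0) + r *\<^sub>R n)) - s0) / r * D"
  by (rule order_tendstoD(1)[OF lim n])
 have "((\<lambda>r. F (t0, s0) + r *\<^sub>R n) \<longlongrightarrow> F (t0, s0) + 0 *\<^sub>R n) (at 0)" by (intro tendsto_intros)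
 then have ev2: "\<forall>\<^sub>F r in at 0. F (t0, s0) + r *\<^sub>R n \<in> F ` B"
  using topological_tendstoD[OF _ op] mem by auto
 obtain \<rho> where \<rho>: "\<rho> > 0" "!!r. r \<noteq> 0 ==> \<bar>r\<bar> < \<rho> ==>
  0 < (snd (h (F (t0, s0) + r *\<^sub>R n)) - s0) / r * D \<and> F (t0, s0) + r *\<^sub>R n \<in> F ` B"
  using eventually_conj[OF ev1 ev2] unfolding eventually_at by (auto simp: dist_real_def)
 show ?thesis
 proof (rule exI[of _ \<rho>], intro conjI allI impI)
  fix r assume r: "r \<noteq> 0" "\<bar>r\<bar> < \<rho>"
  then obtain x where x: "x \<in> B" "F (t0, s0) + r *\<^sub>R n = F x" using \<rho>(2) by blast
  have "0 < (snd x - s0) / r * D" using \<rho>(2)[OF r] x hF by simp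
  moreover have "0 < r * r" using r(1) not_real_square_gt_zero[of r] by blast
  ultimately have "0 < (snd x - s0) / r * D * (r * r)" by (rule mult_pos_pos)
  moreover have "(snd x - s0) / r * D * (r * r) = r * ((snd x - s0) * D)" using r(1) by (simp add: field_simps)
  ultimately have "0 < r * ((snd x - s0) * D)" by (simp only:)
  then show "\<exists>x\<in>B. f (fst x) + g (snd x) = f t0 + g s0 + r *\<^sub>R n \<and>
   0 < r * ((snd x - s0) * Im (cnj (f' t0) * g' s0))"
   using x by (intro bexI[of _ x]) (simp_all add: F_def D_def)
 qed (rule \<rho>(1))
qed

section \<open>Geometry of a regular projection\<close>

locale projection =
 fixes m :: nat and K :: "nat => real => complex \<times> real"
 assumes reg: "regular_projection m K"
begin

definition p where "p i t = fst (K i t)"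
definition z where "z i t = snd (K i t)"
definition d where "d i t = fst (vector_derivative (K i) (at t))"

lemma link: "is_link UNIV m K"
 using reg by (simp add: regular_projection_def)

lemma K_eq: "K i t = (p i t, z i t)"
 by (simp add: p_def z_def)

lemma K_cont: "i \<in> {1..m} ==> continuous_on A (K i)"
 using is_linkD(1)[OF link] continuous_on_subset by blast

lemma p_cont: "i \<in> {1..m} ==> continuous_on A (p i)"
 unfolding p_def[abs_def] by (intro continuous_on_fst K_cont)

lemma z_cont: "i \<in> {1..m} ==> continuous_on A (z i)"
 unfolding z_def[abs_def] by (intro continuous_on_snd K_cont)

lemma K_periodic: assumes i: "i \<in> {1..m}" shows "K i (t + of_int n) = K i t"
proof -
 have per: "K i (t + real k) = K i t" for k :: nat and t
 proof (induction k)
  case (Suc k)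
  then show ?case using is_linkD(3)[OF link i, of "t + real k"] by (simp add: algebra_simps)
 qed simp
 show ?thesis
 proof (cases "n \<ge> 0")
  case True
  then show ?thesis using per[of t "nat n"] by simp
 next
  case False
  then show ?thesis using per[of "t + of_int n" "nat (- n)"] by simp
 qed
qed

lemma pz_periodic: "i \<in> {1..m} ==> p i (t + of_int n) = p i t" "i \<in> {1..m} ==> z i (t + of_int n) = z i t"
 by (simp_all add: p_def z_def K_periodic)

lemma p_deriv: assumes i: "i \<in> {1..m}"
 shows "(p i has_vector_derivative d i t) (at t)" "continuous_on UNIV (d i)" "d i t \<noteq> 0"
proof -
 have C1: "K i C1_differentiable_on UNIV" and nz: "\<forall>t. fst (vector_derivative (K i) (at t)) \<noteq> 0"
  using reg i by (simp_all add: regular_projection_def)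
 have "(K i has_vector_derivative vector_derivative (K i) (at t)) (at t)"
  using C1 unfolding C1_differentiable_on_eq by (simp add: vector_derivative_works)
 then show "(p i has_vector_derivative d i t) (at t)"
  unfolding p_def[abs_def] d_def using bounded_linear.has_vector_derivative[OF bounded_linear_fst] by blast
 have "continuous_on UNIV (\<lambda>x. vector_derivative (K i) (at x))" using C1 unfolding C1_differentiable_on_eq by blast
 then show "continuous_on UNIV (d i)" unfolding d_def[abs_def] by (rule continuous_on_fst)
 show "d i t \<noteq> 0" using nz by (simp add: d_def)
qed

lemma d_periodic: assumes i: "i \<in> {1..m}" shows "d i (t + of_int n) = d i t"
proof -
 have "((\<lambda>s. p i (s + of_int n)) has_vector_derivative d i (t + of_int n)) (at t)"
 proof -
  have "((\<lambda>s. s + of_int n) has_vector_derivative 1) (at t)" for t :: real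
   by (rule derivative_eq_intros refl | simp)+
  from vector_diff_chain_at[OF this p_deriv(1)[OF i]] show ?thesis by (simp add: comp_def)
 qed
 then have "(p i has_vector_derivative d i (t + of_int n)) (at t)" using pz_periodic(1)[OF i] by simp
 then show ?thesis using p_deriv(1)[OF i] vector_derivative_unique_at by blast
qed

lemma transverse:
 assumes "i \<in> {1..m}" "j \<in> {1..m}" "p i s = p j t" "K i s \<noteq> K j t"
 shows "Im (cnj (d i s) * d j t) \<noteq> 0"
 using reg assms unfolding regular_projection_def p_def d_def by blast

lemma no_triple:
 assumes "i \<in> {1..m}" "j \<in> {1..m}" "k \<in> {1..m}" "p i r = p j s" "p j s = p k t"
 shows "K i r = K j s \<or> K j s = K k t \<or> K i r = K k t"
 using reg assms unfolding regular_projection_def p_def by blast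

lemma K_inj: assumes "i \<in> {1..m}" "j \<in> {1..m}" "K i s = K j t" shows "i = j \<and> (\<exists>n::int. s = t + of_int n)"
proof -
 have "i = j" "s - t \<in> \<int>" using is_link_inj[OF link assms] by blast+
 then obtain n :: int where "s - t = of_int n" by (auto elim: Ints_cases)
 then have "s = t + of_int n" by simp
 then show ?thesis using \<open>i = j\<close> by blast
qed

lemma height_bound: obtains M where "!!i t. i \<in> {1..m} ==> \<bar>z i t\<bar> < M"
proof -
 have "bounded (\<Union>i\<in>{1..m}. z i ` {0..1})"
  by (intro bounded_UN ballI compact_imp_bounded compact_continuous_image z_cont) auto
 then obtain M where M: "!!x. x \<in> (\<Union>i\<in>{1..m}. z i ` {0..1}) ==> \<bar>x\<bar> \<le> M"
  unfolding bounded_iff real_norm_def by blast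
 show ?thesis
 proof (rule that[of "M + 1"])
  fix i t assume i: "i \<in> {1..m}"
  have "z i (frac t) = z i t" using pz_periodic(2)[OF i, of "frac t" "\<lfloor>t\<rfloor>"] by (simp add: frac_def)
  moreover have "frac t \<in> {0..1}" using frac_lt_1[of t] by (simp add: less_imp_le)
  ultimately have "z i t \<in> (\<Union>i\<in>{1..m}. z i ` {0..1})" using i by (metis UN_I image_eqI)
  then show "\<bar>z i t\<bar> < M + 1" using M[of "z i t"] by linarith
 qed
qed

text \<open>Closeness of parameters on the circle, that is, modulo the period 1.\<close>

definition near :: "real => real => real => bool" where "near t e u \<longleftrightarrow> (\<exists>n::int. \<bar>u - of_int n - t\<bar> < e)"

lemma open_near: "open {u. near t e u}"
proof -
 have "{u. near t e u} = (\<Union>n::int. {u. \<bar>u - of_int n - t\<bar> < e})" by (auto simp: near_def)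
 moreover have "open {u. \<bar>u - of_int n - t\<bar> < e}" for n :: int
 proof -
  have "{u. \<bar>u - of_int n - t\<bar> < e} = ball (of_int n + t) e" by (auto simp: dist_real_def)
  then show ?thesis by simp
 qed
 ultimately show ?thesis by auto
qed

text \<open>The points whose parameters violate \<open>P\<close> form a compact set, as one period
  suffices. It misses the closed set \<open>T\<close>, hence has positive distance from it.\<close>

lemma separate_strands:
 assumes T: "closed T" and op: "!!j. open {u. P j u}" and per: "!!j u n. P j (u + of_int n) \<longleftrightarrow> P j u"
  and disj: "!!j u. j \<in> {1..m} ==> K j u \<in> T ==> P j u"
 obtains e where "e > 0" "!!j u y. j \<in> {1..m} ==> y \<in> T ==> dist (K j u) y < e ==> P j u"
proof -
 define C where "C = (\<Union>j\<in>{1..m}. K j ` ({0..1} - {u. P j u}))"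
 have "compact C" unfolding C_def
  by (intro compact_UN compact_continuous_image K_cont compact_diff op) auto
 moreover have "C Int T = {}" using disj by (auto simp: C_def)
 ultimately have "\<exists>e>0. \<forall>x\<in>C. \<forall>y\<in>T. e \<le> dist x y"
  using separate_compact_closed[OF _ T, of C] by (simp only:)
 then obtain e where e: "e > 0" "\<forall>x\<in>C. \<forall>y\<in>T. e \<le> dist x y" by (elim exE conjE) (rule that)
 show ?thesis
 proof (rule that[OF e(1)], rule ccontr)
  fix j u y assume j: "j \<in> {1..m}" and y: "y \<in> T" "dist (K j u) y < e" and n: "\<not> P j u"
  have fr: "K j (frac u) = K j u" "P j (frac u) \<longleftrightarrow> P j u"
   using K_periodic[OF j, of "frac u" "\<lfloor>u\<rfloor>"] per[of j "frac u" "\<lfloor>u\<rfloor>"] by (simp_all add: frac_def)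
  have "\<not> P j (frac u)" using fr(2) n by metis
  moreover have "frac u \<in> {0..1}" using frac_lt_1[of u] by (simp add: less_imp_le)
  ultimately have "frac u \<in> {0..1} - {u. P j u}" by (metis DiffI mem_Collect_eq)
  then have "K j (frac u) \<in> C" unfolding C_def using j by blast
  then have "K j u \<in> C" unfolding fr(1) .
  from bspec[OF bspec[OF e(2) this] y(1)] y(2) show False by linarith
 qed
qed

lemma near_periodic: "near t e (u + of_int n) \<longleftrightarrow> near t e u"
proof
 assume "near t e (u + of_int n)"
 then obtain k :: int where "\<bar>u + of_int n - of_int k - t\<bar> < e" by (auto simp: near_def)
 then show "near t e u" unfolding near_def by (intro exI[of _ "k - n"]) (simp add: algebra_simps)
next
 assume "near t e u"
 then obtain k :: int where "\<bar>u - of_int k - t\<bar> < e" by (auto simp: near_def)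
 then show "near t e (u + of_int n)" unfolding near_def by (intro exI[of _ "k + n"]) (simp add: algebra_simps)
qed

end

section \<open>Charts along a strand\<close>

context projection
begin

definition box where "box t e = {t - e<..<t + e} \<times> {- e<..<e :: real}" for t e :: real

lemma box_mono: "e \<le> e' ==> box t e \<subseteq> box t e'"
 by (auto simp: box_def)

text \<open>The first axis is the projected strand \<open>i\<close>, the second one a curve
  \<open>g\<close> starting at its point \<open>p i t\<close>. By the last clause the determinant
  keeps its sign on the box, so the sign of the second coordinate distinguishes the sides of the
  strand.\<close>

definition plane_chart where
 "plane_chart i g g' t e \<longleftrightarrow> e > 0 \<and> g 0 = 0 \<and> (\<forall>r. (g has_vector_derivative g' r) (at r)) \<and>
  inj_on (\<lambda>x. p i (fst x) + g (snd x)) (box t e) \<and>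
  (\<forall>x\<in>box t e. 0 < Im (cnj (d i (fst x)) * g' (snd x)) * Im (cnj (d i t) * g' 0))"

lemma plane_chart_mono: "plane_chart i g g' t e ==> 0 < e' ==> e' \<le> e ==> plane_chart i g g' t e'"
 unfolding plane_chart_def
 by (intro conjI; elim conjE; (assumption | rule ballI inj_on_subset | erule bspec | erule subsetD[OF box_mono, rotated] | rule box_mono)+)

lemma plane_chart_exists:
 assumes i: "i \<in> {1..m}" and g: "!!r. (g has_vector_derivative g' r) (at r)" "continuous_on UNIV g'" "g 0 = 0"
  and tr: "Im (cnj (d i t) * g' 0) \<noteq> 0"
 obtains e where "plane_chart i g g' t e"
proof -
 obtain e where e: "e > 0" "inj_on (\<lambda>x. p i (fst x) + g (snd x)) ({t - e<..<t + e} \<times> {0 - e<..<0 + e})"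
  using transversal_chart[OF p_deriv(1,2)[OF i] g(1,2) tr] by (elim exE conjE) (rule that)
 define q where "q x = Im (cnj (d i (fst x)) * g' (snd x)) * Im (cnj (d i t) * g' 0)" for x :: "real \<times> real"
 have cont: "continuous_on UNIV q" unfolding q_def
  by (intro continuous_intros continuous_on_compose2[OF p_deriv(2)[OF i]] continuous_on_compose2[OF g(2)]) auto
 have "q (t, 0) > 0" unfolding q_def fst_conv snd_conv using tr not_real_square_gt_zero by blast
 then have mem: "(t, 0) \<in> {x. q x > 0}" by simp
 have op: "open {x. q x > 0}" by (rule open_Collect_less[OF continuous_on_const cont])
 obtain A B where AB': "open A" "open B" "(t, 0) \<in> A \<times> B" "A \<times> B \<subseteq> {x. q x > 0}"
  by (rule open_prod_elim[OF op mem])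
 then have AB: "open A" "open B" "t \<in> A" "0 \<in> B" "A \<times> B \<subseteq> {x. q x > 0}" by auto
 obtain e1 e2 where e12: "e1 > 0" "ball t e1 \<subseteq> A" "e2 > 0" "ball 0 e2 \<subseteq> B"
  using AB unfolding open_contains_ball by metis
 define e' where "e' = min e (min e1 e2)"
 have e': "e' > 0" "e' \<le> e" "e' \<le> e1" "e' \<le> e2" using e(1) e12 by (simp_all add: e'_def)
 have "box t e' \<subseteq> A \<times> B"
 proof
  fix x assume x: "x \<in> box t e'"
  then have "fst x \<in> ball t e1" "snd x \<in> ball 0 e2" using e' by (auto simp: box_def dist_real_def)
  then show "x \<in> A \<times> B" using e12 by (auto simp: mem_Times_iff)
 qed
 then have "\<forall>x\<in>box t e'. q x > 0" using AB(5) by blast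
 moreover have "inj_on (\<lambda>x. p i (fst x) + g (snd x)) (box t e')"
  by (rule inj_on_subset[OF e(2)]) (use e'(2) in \<open>auto simp: box_def\<close>)
 ultimately have "plane_chart i g g' t e'" unfolding plane_chart_def q_def using e'(1) g by blast
 then show ?thesis by (rule that)
qed

lemma chart_cont:
 assumes "i \<in> {1..m}" "plane_chart i g g' t e"
 shows "continuous_on A (\<lambda>x. p i (fst x) + g (snd x))"
proof -
 have "continuous_on UNIV g"
  using assms(2) unfolding plane_chart_def
  by (meson continuous_at_imp_continuous_on has_vector_derivative_continuous)
 from continuous_on_compose2[OF this continuous_on_snd[OF continuous_on_id] subset_UNIV]
  continuous_on_compose2[OF p_cont[OF assms(1), of UNIV] continuous_on_fst[OF continuous_on_id] subset_UNIV]
 show ?thesis by (intro continuous_on_add)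
qed

text \<open>The flag \<open>cr\<close> treats crossing and non-crossing points together: at a crossing, the second axis
 of the chart is the strand \<open>k\<close>.\<close>

lemma chart_strands:
 assumes i: "i \<in> {1..m}" and ch: "plane_chart i g g' t0 e" and l: "l < z i t0"
  and above: "!!j u. j \<in> {1..m} ==> p j u = p i t0 ==> l \<le> z j u ==>
   (j = i \<and> (\<exists>n::int. u = t0 + of_int n)) \<or> (cr \<and> j = k \<and> (\<exists>n::int. u = s0 + of_int n))"
  and cr: "cr ==> k \<in> {1..m} \<and> g = (\<lambda>r. p k (s0 + r) - p i t0)"
 obtains e' where "e' > 0" "e' \<le> e"
  "!!x j u. x \<in> box t0 e' ==> j \<in> {1..m} ==> p j u = p i (fst x) + g (snd x) ==> l < z j u ==>
   (snd x = 0 \<and> z j u = z i (fst x)) \<or> (cr \<and> fst x = t0 \<and> z j u = z k (s0 + snd x))"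
proof -
 define P where "P j u \<longleftrightarrow> (j = i \<and> near t0 e u) \<or> (cr \<and> j = k \<and> near s0 e u)" for j u
 have epos: "e > 0" and g0: "g 0 = 0" and inj: "inj_on (\<lambda>x. p i (fst x) + g (snd x)) (box t0 e)"
  using ch by (simp_all add: plane_chart_def)
 have nearI: "near t e (t + of_int n)" for t and n :: int
  using epos unfolding near_def by (intro exI[of _ n]) simp
 have op: "open {u. P j u}" for j
 proof -
  have "{u. P j u} = (if j = i then {u. near t0 e u} else {}) \<union> (if cr \<and> j = k then {u. near s0 e u} else {})"
   by (auto simp: P_def)
  then show ?thesis by (simp add: open_near open_Un)
 qed
 \<comment> \<open>The vertical ray from the level \<open>l\<close> upwards. A strand that passes
   close to it must be one of those listed, near one of the listed parameters, and injectivity of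
   the chart then fixes its coordinates.\<close>
 have "closed ({p i t0} \<times> {l..})" by (intro closed_Times) auto
 then obtain \<epsilon> where \<epsilon>: "\<epsilon> > 0" "!!j u y. j \<in> {1..m} ==> y \<in> {p i t0} \<times> {l..} ==> dist (K j u) y < \<epsilon> ==> P j u"
 proof (rule separate_strands[of "{p i t0} \<times> {l..}" P])
  show "open {u. P j u}" for j by (rule op)
  show "P j (u + of_int n) \<longleftrightarrow> P j u" for j u and n :: int by (simp add: P_def near_periodic)
  show "P j u" if "j \<in> {1..m}" "K j u \<in> {p i t0} \<times> {l..}" for j u
  proof -
   have "p j u = p i t0" "l \<le> z j u" using that(2) by (auto simp: K_eq)
   from above[OF that(1) this] show ?thesis by (auto simp: P_def nearI)
  qed
 qed blast
 define F where "F x = p i (fst x) + g (snd x)" for x :: "real \<times> real"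
 have "continuous_on UNIV F" unfolding F_def using chart_cont[OF i ch] .
 moreover have "F (t0, 0) = p i t0" by (simp add: F_def g0)
 ultimately obtain \<delta> where \<delta>: "\<delta> > 0" "!!x. dist x (t0, 0) < \<delta> ==> dist (F x) (p i t0) < \<epsilon>"
  using \<epsilon>(1) unfolding continuous_on_iff by (metis UNIV_I)
 show ?thesis
 proof (rule that[of "min e (\<delta>/2)"])
  fix x j u
  assume x: "x \<in> box t0 (min e (\<delta>/2))" and j: "j \<in> {1..m}" and u: "p j u = p i (fst x) + g (snd x)" "l < z j u"
  have "dist x (t0, 0) \<le> dist (fst x) t0 + dist (snd x) 0"
   using sqrt_sum_squares_le_sum[of "dist (fst x) t0" "dist (snd x) 0"] by (simp add: dist_prod_def)
  also have "\<dots> < \<delta>" using x by (auto simp: box_def dist_real_def)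
  finally have "dist (p j u) (p i t0) < \<epsilon>" using \<delta>(2) u(1) by (simp add: F_def)
  then have "dist (K j u) (p i t0, z j u) < \<epsilon>" by (simp add: K_eq dist_Pair_Pair)
  then have "P j u" using \<epsilon>(2)[OF j, of "(p i t0, z j u)" u] u(2) by simp
  then consider n :: int where "j = i" "\<bar>u - of_int n - t0\<bar> < e"
   | n :: int where "cr" "j = k" "\<bar>u - of_int n - s0\<bar> < e"
   unfolding P_def near_def by blast
  then show "(snd x = 0 \<and> z j u = z i (fst x)) \<or> (cr \<and> fst x = t0 \<and> z j u = z k (s0 + snd x))"
  proof cases
   case (1 n)
   have pz: "p i (u - of_int n) = p j u" "z i (u - of_int n) = z j u"
    using pz_periodic[OF i, of "u - of_int n" n] 1(1) by simp_all
   have "(u - of_int n, 0) = x"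
    by (rule inj_onD[OF inj]) (use 1(2) x u(1) pz g0 epos in \<open>auto simp: box_def\<close>)
   then show ?thesis using pz by auto
  next
   case (2 n)
   have pz: "p k (u - of_int n) = p j u" "z k (u - of_int n) = z j u"
    using pz_periodic[of k "u - of_int n" n] cr[OF 2(1)] 2(2) by simp_all
   have "(t0, u - of_int n - s0) = x"
    by (rule inj_onD[OF inj]) (use 2(3) x u(1) pz epos cr[OF 2(1)] in \<open>auto simp: box_def\<close>)
   then show ?thesis using pz 2(1) by auto
  qed
 qed (use epos \<delta>(1) in auto)
qed

text \<open>The complement of the curtains that hang down from the link, seen from high above. Its
  points have nothing of the link over them.\<close>

definition above where "above = {x. \<forall>j\<in>{1..m}. \<forall>u. p j u = fst x --> z j u < snd x}"

text \<open>Nothing else of the link lies over the point at height \<open>l\<close> or more. Between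
  \<open>l\<close> and the strand, a vertical segment then runs in its curtain and in no
  other.\<close>

definition clear where
 "clear i t l \<longleftrightarrow> l < z i t \<and> (\<forall>j\<in>{1..m}. \<forall>u. p j u = p i t --> l \<le> z j u --> K j u = K i t)"

lemma clear_chart:
 assumes i: "i \<in> {1..m}" and cl: "clear i t0 l"
 obtains g g' e where "plane_chart i g g' t0 e" "Im (cnj (d i t0) * g' 0) > 0"
  "!!x j u. x \<in> box t0 e ==> j \<in> {1..m} ==> p j u = p i (fst x) + g (snd x) ==> l < z j u ==>
   snd x = 0 \<and> z j u = z i (fst x)"
  "!!s. \<bar>s - t0\<bar> < e ==> l < z i s"
proof -
 \<comment> \<open>The normal of the strand, pointing to its left.\<close>
 define g where "g r = r *\<^sub>R (\<i> * d i t0)" for r :: real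
 define g' where "g' r = \<i> * d i t0" for r :: real
 have g: "(g has_vector_derivative g' r) (at r)" "continuous_on UNIV g'" "g 0 = 0" for r
  unfolding g_def[abs_def] g'_def[abs_def] by (auto intro!: derivative_eq_intros)
 have "Im (cnj (d i t0) * g' 0) = (cmod (d i t0))\<^sup>2"
  by (simp add: g'_def cmod_power2 power2_eq_square[of "Re _"] power2_eq_square[of "Im _"])
 then have pos: "Im (cnj (d i t0) * g' 0) > 0" using p_deriv(3)[OF i] by simp
 have tr: "Im (cnj (d i t0) * g' 0) \<noteq> 0" using pos by (rule less_imp_neq[symmetric])
 obtain e where ch: "plane_chart i g g' t0 e"
  using plane_chart_exists[OF i g(1,2,3) tr] by blast
 have l: "l < z i t0" using cl by (simp add: clear_def)
 obtain e' where e': "e' > 0" "e' \<le> e"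
  "!!x j u. x \<in> box t0 e' ==> j \<in> {1..m} ==> p j u = p i (fst x) + g (snd x) ==> l < z j u ==>
   (snd x = 0 \<and> z j u = z i (fst x)) \<or> (False \<and> fst x = t0 \<and> z j u = z i (t0 + snd x))"
 proof (rule chart_strands[OF i ch l, of False i t0])
  fix j u assume "j \<in> {1..m}" "p j u = p i t0" "l \<le> z j u"
  then have "K j u = K i t0" using cl unfolding clear_def by blast
  then show "(j = i \<and> (\<exists>n::int. u = t0 + of_int n)) \<or> (False \<and> j = i \<and> (\<exists>n::int. u = t0 + of_int n))"
   using K_inj \<open>j \<in> {1..m}\<close> i by blast
 qed blast+
 have "continuous_on UNIV (z i)" by (rule z_cont[OF i])
 then obtain \<delta> where \<delta>: "\<delta> > 0" "!!s. dist s t0 < \<delta> ==> dist (z i s) (z i t0) < z i t0 - l"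
  using l unfolding continuous_on_iff by (metis UNIV_I diff_gt_0_iff_gt)
 show ?thesis
 proof (rule that[of g g' "min e' \<delta>"])
  show "plane_chart i g g' t0 (min e' \<delta>)" by (rule plane_chart_mono[OF ch]) (use e' \<delta>(1) in auto)
  show "Im (cnj (d i t0) * g' 0) > 0" by (rule pos)
  show "snd x = 0 \<and> z j u = z i (fst x)" if "x \<in> box t0 (min e' \<delta>)" "j \<in> {1..m}"
   "p j u = p i (fst x) + g (snd x)" "l < z j u" for x j u
   using e'(3)[of x j u] that box_mono[of "min e' \<delta>" e' t0] by auto
  show "l < z i s" if "\<bar>s - t0\<bar> < min e' \<delta>" for s
   using \<delta>(2)[of s] that by (auto simp: dist_real_def)
 qed
qed

definition crossed where "crossed i t \<longleftrightarrow> (\<exists>k\<in>{1..m}. \<exists>s. passes_over K k s i t)"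

lemma passes_over_iff: "passes_over K k s i t \<longleftrightarrow> p k s = p i t \<and> z i t < z k s"
 by (simp add: passes_over_def p_def z_def)

lemma clear_not_crossed: assumes "clear i t l" shows "\<not> crossed i t"
proof
 assume "crossed i t"
 then obtain k s where k: "k \<in> {1..m}" "p k s = p i t" "z i t < z k s" by (auto simp: crossed_def passes_over_iff)
 then have "K k s = K i t" using assms unfolding clear_def by (metis less_imp_le less_trans)
 then show False using k by (simp add: K_eq)
qed

text \<open>Without triple points there is at most one other strand on the vertical line, and it
  lies below. A level midway between the two serves.\<close>

lemma not_crossed_clear: assumes i: "i \<in> {1..m}" and nc: "\<not> crossed i t" shows "\<exists>l. clear i t l"
proof (cases "\<exists>k\<in>{1..m}. \<exists>s. p k s = p i t \<and> K k s \<noteq> K i t")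
 case True
 then obtain k s where k: "k \<in> {1..m}" "p k s = p i t" "K k s \<noteq> K i t" by blast
 have less: "z j u < z i t" if "j \<in> {1..m}" "p j u = p i t" "K j u \<noteq> K i t" for j u
  using nc that unfolding crossed_def passes_over_iff by (metis K_eq linorder_neqE_linordered_idom)
 have "K j u = K i t" if j: "j \<in> {1..m}" "p j u = p i t" "(z k s + z i t) / 2 \<le> z j u" for j u
 proof (rule ccontr)
  assume "K j u \<noteq> K i t"
  then have "K j u = K k s" using no_triple[OF j(1) i k(1) j(2) k(2)[symmetric]] k(3) by metis
  then show False using j(3) less[OF k] by (simp add: K_eq)
 qed
 then have "clear i t ((z k s + z i t) / 2)" unfolding clear_def using less[OF k] by auto
 then show ?thesis by blast
next
 case False
 then have "clear i t (z i t - 1)" unfolding clear_def by auto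
 then show ?thesis by blast
qed

lemma crossing_unique:
 assumes "i \<in> {1..m}" "k \<in> {1..m}" "k' \<in> {1..m}" "passes_over K k s i t" "passes_over K k' s' i t"
 shows "K k s = K k' s'"
proof -
 have "p k s = p i t" "p i t = p k' s'" "K k s \<noteq> K i t" "K i t \<noteq> K k' s'"
  using assms(4,5) by (simp_all add: passes_over_iff K_eq)
 from no_triple[OF assms(2,1,3) this(1,2)] this(3,4) show ?thesis by blast
qed

end

lemma ex_pos_le:
 fixes S :: "real set"
 assumes "finite S" "\<forall>x\<in>S. 0 < x"
 obtains \<delta> where "\<delta> > 0" "\<forall>x\<in>S. \<delta> \<le> x"
proof (rule that[of "Min (insert 1 S)"])
 show "Min (insert 1 S) > 0" using assms by (subst Min_gr_iff) auto
 show "\<forall>x\<in>S. Min (insert 1 S) \<le> x" using assms(1) by auto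
qed

text \<open>The hypothesis \<open>zero\<close> fixes the gauge: above the curtains nothing happens,
  as if all paths started at an observer high above the diagram. The whole cocycle is then visible
  in its jumps across curtains, the classical Wirtinger generators.\<close>

locale colouring = projection m K + meridian_data H \<theta>
 for m :: nat and K :: "nat => real => complex \<times> real"
  and H :: "nat => 'g::group_add set" and \<theta> :: "nat => 'g => bit" +
 fixes \<sigma> :: "complex \<times> real => complex \<times> real => 'g"
 assumes rep: "link_rep UNIV m (\<lambda>i. range (K i)) \<sigma>"
  and zero: "locally2 above (\<lambda>y z. \<sigma> y z = 0)"
begin

definition X where "X = UNIV - (\<Union>i\<in>{1..m}. range (K i))"

lemma cocycle: "local_cocycle X \<sigma>"
 using rep by (simp add: link_rep_def X_def)

lemma above_X: "above \<subseteq> X"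
 by (force simp: above_def X_def K_eq)

text \<open>The jump across the curtain below the strand, from its right to its left side.\<close>

definition jump where
 "jump i t h a \<longleftrightarrow> (\<exists>\<rho>>0. \<forall>r r'. 0 < r --> r < \<rho> --> 0 < r' --> r' < \<rho> -->
  \<sigma> (p i t - r *\<^sub>R (\<i> * d i t), h) (p i t + r' *\<^sub>R (\<i> * d i t), h) = a)"

lemma jump_unique: assumes "jump i t h a" "jump i t h a'" shows "a = a'"
proof -
 obtain \<rho> where \<rho>: "\<rho> > 0" "!!r r'. 0 < r ==> r < \<rho> ==> 0 < r' ==> r' < \<rho> ==>
  \<sigma> (p i t - r *\<^sub>R (\<i> * d i t), h) (p i t + r' *\<^sub>R (\<i> * d i t), h) = a"
  using assms(1) unfolding jump_def by blast
 obtain \<rho>' where \<rho>': "\<rho>' > 0" "!!r r'. 0 < r ==> r < \<rho>' ==> 0 < r' ==> r' < \<rho>' ==>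
  \<sigma> (p i t - r *\<^sub>R (\<i> * d i t), h) (p i t + r' *\<^sub>R (\<i> * d i t), h) = a'"
  using assms(2) unfolding jump_def by blast
 define r where "r = min \<rho> \<rho>' / 2"
 have "0 < r" "r < \<rho>" "r < \<rho>'" using \<rho>(1) \<rho>'(1) by (auto simp: r_def min_def)
 then show ?thesis using \<rho>(2)[of r r] \<rho>'(2)[of r r] by simp
qed

definition slab :: "nat => (real => complex) => real set => real set => real => real => (complex \<times> real) set" where
 "slab i g I J h1 h2 = (\<lambda>(x, h). (p i (fst x) + g (snd x), h)) ` ((I \<times> J) \<times> {h1<..<h2 :: real})"

lemma slab_mem: "fst x \<in> I ==> snd x \<in> J ==> h1 < h ==> h < h2 ==> (p i (fst x) + g (snd x), h) \<in> slab i g I J h1 h2"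
 by (force simp: slab_def image_iff mem_Times_iff)

lemma slab_mono: "I' \<subseteq> I ==> J' \<subseteq> J ==> slab i g I' J' h1 h2 \<subseteq> slab i g I J h1 h2"
 unfolding slab_def by blast

lemma connected_slab:
 assumes "continuous_on UNIV (\<lambda>x. p i (fst x) + g (snd x))" "connected I" "connected J"
 shows "connected (slab i g I J h1 h2)"
 unfolding slab_def
proof (rule connected_continuous_image)
 show "continuous_on ((I \<times> J) \<times> {h1<..<h2}) (\<lambda>(x, h). (p i (fst x) + g (snd x), h))"
  unfolding case_prod_unfold
  by (intro continuous_on_Pair continuous_on_snd continuous_on_id
    continuous_on_compose2[OF assms(1) continuous_on_fst[OF continuous_on_id] subset_UNIV])
 show "connected ((I \<times> J) \<times> {h1<..<h2})"
  using assms(2,3) by (intro connected_Times) auto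
qed

text \<open>The wall with second coordinate 0 divides the slab into two connected halves on which
  the transport vanishes, so all transports from one half to the other coincide. The sign of
  \<open>D\<close> says whether positive second coordinates are to the left of the strand.\<close>

lemma jump_slab:
 assumes i: "i \<in> {1..m}" and g: "!!r. (g has_vector_derivative g' r) (at r)" "g 0 = 0"
  and I: "open I" "connected I" and e: "e > 0" and inj: "inj_on (\<lambda>x. p i (fst x) + g (snd x)) (I \<times> {-e<..<e})"
  and D: "!!s. s \<in> I ==> 0 < Im (cnj (d i s) * g' 0) * D"
  and exact: "!!u v w. u \<in> N ==> v \<in> N ==> w \<in> N ==> \<sigma> u v + \<sigma> v w = \<sigma> u w"
  and N: "slab i g I {-e<..<e} h1 h2 \<subseteq> N"
  and ab: "slab i g I {-e<..<0} h1 h2 \<subseteq> above" "slab i g I {0<..<e} h1 h2 \<subseteq> above"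
  and y: "y \<in> slab i g I (if D > 0 then {-e<..<0} else {0<..<e}) h1 h2"
  and w: "w \<in> slab i g I (if D > 0 then {0<..<e} else {-e<..<0}) h1 h2"
  and s: "s \<in> I" and h: "h1 < h" "h < h2"
 shows "jump i s h (\<sigma> y w)"
proof -
 have "continuous_on UNIV g" using g(1)
  by (meson continuous_at_imp_continuous_on has_vector_derivative_continuous)
 from continuous_on_compose2[OF this continuous_on_snd[OF continuous_on_id] subset_UNIV]
  continuous_on_compose2[OF p_cont[OF i, of UNIV] continuous_on_fst[OF continuous_on_id] subset_UNIV]
 have cont: "continuous_on UNIV (\<lambda>x. p i (fst x) + g (snd x))" by (intro continuous_on_add)
 have zero_half: "\<sigma> u v = 0" if J: "J = {-e<..<0} \<or> J = {0<..<e}" and uv: "u \<in> slab i g I J h1 h2" "v \<in> slab i g I J h1 h2" for J u v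
 proof (rule cocycle_zero_on_connected[OF connected_slab[OF cont I(2)] _ _ uv])
  show "connected J" using J by auto
  have "slab i g I J h1 h2 \<subseteq> N"
   using N slab_mono[of I I J "{-e<..<e}" i g h1 h2] J e by force
  then show "\<sigma> a b + \<sigma> b c = \<sigma> a c" if "a \<in> slab i g I J h1 h2" "b \<in> slab i g I J h1 h2" "c \<in> slab i g I J h1 h2" for a b c
   using exact that by blast
  show "locally2 (slab i g I J h1 h2) (\<lambda>y z. \<sigma> y z = 0)"
   by (rule locally2_mono[OF zero]) (use J ab in auto)
 qed
 define n where "n = \<i> * d i s"
 have n: "Im (cnj (d i s) * n) > 0"
 proof -
  have "Im (cnj (d i s) * n) = (cmod (d i s))\<^sup>2"
   by (simp add: n_def cmod_power2 power2_eq_square[of "Re _"] power2_eq_square[of "Im _"])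
  then show ?thesis using p_deriv(3)[OF i] by simp
 qed
 have tr: "Im (cnj (d i s) * g' 0) \<noteq> 0" using D[OF s] by auto
 have "open (I \<times> {-e<..<e})" "(s, 0) \<in> I \<times> {-e<..<e}" using I(1) s e by (auto intro: open_Times)
 from chart_side[OF p_deriv(1)[OF i] g(1) tr n this inj] obtain \<rho> where \<rho>: "\<rho> > 0"
  "!!r. r \<noteq> 0 ==> \<bar>r\<bar> < \<rho> ==> \<exists>x\<in>I \<times> {-e<..<e}. p i (fst x) + g (snd x) = p i s + g 0 + r *\<^sub>R n \<and>
   0 < r * ((snd x - 0) * Im (cnj (d i s) * g' 0))" by blast
 \<comment> \<open>A point moved off the strand along its left normal lands in the half predicted by
   \<open>chart_side\<close>.\<close>
 have side: "(p i s + r *\<^sub>R n, h) \<in> slab i g I (if r * D > 0 then {0<..<e} else {-e<..<0}) h1 h2"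
  if r: "r \<noteq> 0" "\<bar>r\<bar> < \<rho>" for r
 proof -
  obtain x where x: "x \<in> I \<times> {-e<..<e}" "p i (fst x) + g (snd x) = p i s + r *\<^sub>R n"
   "0 < r * (snd x * Im (cnj (d i s) * g' 0))" using \<rho>(2)[OF r] g(2) by auto
  have "0 < (r * (snd x * Im (cnj (d i s) * g' 0))) * (Im (cnj (d i s) * g' 0) * D)"
   by (rule mult_pos_pos[OF x(3) D[OF s]])
  then have "0 < (Im (cnj (d i s) * g' 0))\<^sup>2 * (r * D * snd x)"
   by (simp only: power2_eq_square mult_ac)
  then have "0 < r * D * snd x" using tr by (simp only: zero_less_mult_iff zero_less_power2 power2_less_0) blast
  then have sgn: "(0 < r * D \<and> 0 < snd x) \<or> (\<not> 0 < r * D \<and> snd x < 0)"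
   by (subst (asm) zero_less_mult_iff) (metis less_asym)
  have "- e < snd x" "snd x < e" using x(1) by auto
  then have "snd x \<in> (if r * D > 0 then {0<..<e} else {-e<..<0})" using sgn by (elim disjE) simp_all
  then show ?thesis using slab_mem[of x I _ h1 h h2 i g] x h by (auto simp: mem_Times_iff)
 qed
 have "\<sigma> (p i s - r *\<^sub>R n, h) (p i s + r' *\<^sub>R n, h) = \<sigma> y w" if r: "0 < r" "r < \<rho>" "0 < r'" "r' < \<rho>" for r r'
 proof -
  define a b where "a = (p i s - r *\<^sub>R n, h)" and "b = (p i s + r' *\<^sub>R n, h)"
  have Dnz: "D \<noteq> 0" using D[OF s] by auto
  have "(- r) * D > 0 \<longleftrightarrow> \<not> D > 0" using r Dnz by (auto simp: mult_less_0_iff)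
  then have ua: "a \<in> slab i g I (if D > 0 then {-e<..<0} else {0<..<e}) h1 h2"
   using side[of "- r"] r by (auto simp: a_def split: if_splits)
  have "r' * D > 0 \<longleftrightarrow> D > 0" using r Dnz by (auto simp: zero_less_mult_iff)
  then have ub: "b \<in> slab i g I (if D > 0 then {0<..<e} else {-e<..<0}) h1 h2"
   using side[of r'] r by (auto simp: b_def split: if_splits)
  have sub: "slab i g I J h1 h2 \<subseteq> N" if "J \<subseteq> {-e<..<e}" for J
   by (rule subset_trans[OF slab_mono[OF subset_refl that] N])
  have J: "(if D > 0 then {-e<..<0} else {0<..<e}) \<subseteq> {-e<..<e}" "(if D > 0 then {0<..<e} else {-e<..<0}) \<subseteq> {-e<..<e}"
   using e by auto
  have "\<sigma> a y = 0" "\<sigma> w b = 0"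
   by (rule zero_half[OF _ ua y], simp, rule zero_half[OF _ w ub], simp)
  moreover have mem: "a \<in> N" "b \<in> N" "y \<in> N" "w \<in> N"
   using subsetD[OF sub[OF J(1)] ua] subsetD[OF sub[OF J(2)] ub] subsetD[OF sub[OF J(1)] y] subsetD[OF sub[OF J(2)] w] by simp_all
  ultimately show ?thesis
   using exact[OF mem(1,3,4)] exact[OF mem(1,4,2)] by (simp add: a_def b_def)
 qed
 then show ?thesis unfolding jump_def n_def[symmetric] using \<rho>(1) by blast
qed

lemma slab_continuous:
 assumes "i \<in> {1..m}" "continuous_on UNIV g"
 shows "continuous_on A (\<lambda>(x, h). (p i (fst x) + g (snd x), h :: real))"
proof -
 from continuous_on_compose2[OF assms(2) continuous_on_snd[OF continuous_on_id] subset_UNIV]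
  continuous_on_compose2[OF p_cont[OF assms(1), of UNIV] continuous_on_fst[OF continuous_on_id] subset_UNIV]
 have cont: "continuous_on UNIV (\<lambda>x. p i (fst x) + g (snd x))" by (intro continuous_on_add)
 show ?thesis unfolding case_prod_unfold
  by (intro continuous_on_Pair continuous_on_snd continuous_on_id
    continuous_on_compose2[OF cont continuous_on_fst[OF continuous_on_id] subset_UNIV])
qed

lemma small_slab:
 assumes i: "i \<in> {1..m}" and g: "continuous_on UNIV g" and N: "open N" "(p i s + g r, h) \<in> N"
 obtains \<delta> where "\<delta> > 0" "slab i g {s - \<delta><..<s + \<delta>} {r - \<delta><..<r + \<delta>} (h - \<delta>) (h + \<delta>) \<subseteq> N"
proof -
 define f where "f = (\<lambda>(x, h). (p i (fst x) + g (snd x), h :: real))"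
 have "open (f -` N)" using slab_continuous[OF i g, of UNIV] N(1) unfolding f_def by (simp add: open_vimage)
 moreover have "((s, r), h) \<in> f -` N" using N(2) by (simp add: f_def)
 ultimately obtain \<rho> where \<rho>: "\<rho> > 0" "ball ((s, r), h) \<rho> \<subseteq> f -` N" by (meson openE)
 have "slab i g {s - \<rho>/3<..<s + \<rho>/3} {r - \<rho>/3<..<r + \<rho>/3} (h - \<rho>/3) (h + \<rho>/3) \<subseteq> N"
 proof
  fix y assume "y \<in> slab i g {s - \<rho>/3<..<s + \<rho>/3} {r - \<rho>/3<..<r + \<rho>/3} (h - \<rho>/3) (h + \<rho>/3)"
  then obtain s' r' h' where y': "y = f ((s', r'), h')" "s' \<in> {s - \<rho>/3<..<s + \<rho>/3}" "r' \<in> {r - \<rho>/3<..<r + \<rho>/3}" "h' \<in> {h - \<rho>/3<..<h + \<rho>/3}"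
   unfolding slab_def f_def[symmetric] by blast
  then have y: "y = f ((s', r'), h')" "dist s s' < \<rho>/3" "dist r r' < \<rho>/3" "dist h h' < \<rho>/3"
   by (auto simp: dist_real_def abs_if)
  have "dist ((s, r), h) ((s', r'), h') \<le> dist (s, r) (s', r') + dist h h'"
   using sqrt_sum_squares_le_sum[of "dist (s, r) (s', r')" "dist h h'"] by (simp add: dist_Pair_Pair)
  also have "dist (s, r) (s', r') \<le> dist s s' + dist r r'"
   using sqrt_sum_squares_le_sum[of "dist s s'" "dist r r'"] by (simp add: dist_Pair_Pair)
  finally have "((s', r'), h') \<in> ball ((s, r), h) \<rho>" using y by simp
  then show "y \<in> N" using \<rho>(2) y(1) by blast
 qed
 then show ?thesis using \<rho>(1) by (intro that[of "\<rho>/3"]) auto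
qed

lemma open_slab:
 assumes "i \<in> {1..m}" "continuous_on UNIV g" "inj_on (\<lambda>x. p i (fst x) + g (snd x)) (I \<times> J)" "open I" "open J"
 shows "open (slab i g I J h1 h2)"
 unfolding slab_def
proof (rule invariance_of_domain_gen)
 show "open ((I \<times> J) \<times> {h1<..<h2})" using assms(4,5) by (intro open_Times) auto
 show "continuous_on ((I \<times> J) \<times> {h1<..<h2}) (\<lambda>(x, h). (p i (fst x) + g (snd x), h))"
  by (rule slab_continuous[OF assms(1,2)])
 show "inj_on (\<lambda>(x, h). (p i (fst x) + g (snd x), h)) ((I \<times> J) \<times> {h1<..<h2})"
 proof (rule inj_onI)
  fix x y assume xy: "x \<in> (I \<times> J) \<times> {h1<..<h2}" "y \<in> (I \<times> J) \<times> {h1<..<h2}"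
   and eq: "(case x of (x, h) => (p i (fst x) + g (snd x), h)) = (case y of (x, h) => (p i (fst x) + g (snd x), h))"
  have "fst x = fst y" by (rule inj_onD[OF assms(3)]) (use xy eq in \<open>auto simp: case_prod_unfold\<close>)
  then show "x = y" using eq by (simp add: case_prod_unfold prod_eq_iff)
 qed
qed simp

text \<open>A chart at a clear point, so small that the strand itself is all of the link above the
  level \<open>l\<close>. Over the box the curtain is then a single sheet.\<close>

definition sheet_chart where
 "sheet_chart i g g' t0 e l \<longleftrightarrow> i \<in> {1..m} \<and> plane_chart i g g' t0 e \<and> 0 < Im (cnj (d i t0) * g' 0) \<and>
  (\<forall>x\<in>box t0 e. \<forall>j\<in>{1..m}. \<forall>u. p j u = p i (fst x) + g (snd x) --> l < z j u --> snd x = 0 \<and> z j u = z i (fst x)) \<and>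
  (\<forall>s. \<bar>s - t0\<bar> < e --> l < z i s)"

lemma sheet_chartD:
 assumes "sheet_chart i g g' t0 e l"
 shows "i \<in> {1..m}" "plane_chart i g g' t0 e" "e > 0" "g 0 = 0" "!!r. (g has_vector_derivative g' r) (at r)"
  "inj_on (\<lambda>x. p i (fst x) + g (snd x)) (box t0 e)" "continuous_on UNIV g"
  "!!s. \<bar>s - t0\<bar> < e ==> 0 < Im (cnj (d i s) * g' 0) * Im (cnj (d i t0) * g' 0)" "0 < Im (cnj (d i t0) * g' 0)"
  "!!x j u. x \<in> box t0 e ==> j \<in> {1..m} ==> p j u = p i (fst x) + g (snd x) ==> l < z j u ==> snd x = 0 \<and> z j u = z i (fst x)"
  "!!s. \<bar>s - t0\<bar> < e ==> l < z i s"
proof -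
 show i: "i \<in> {1..m}" and ch: "plane_chart i g g' t0 e" and "0 < Im (cnj (d i t0) * g' 0)"
  "!!s. \<bar>s - t0\<bar> < e ==> l < z i s"
  using assms by (simp_all add: sheet_chart_def)
 show e: "e > 0" and "g 0 = 0" and g: "!!r. (g has_vector_derivative g' r) (at r)"
  and "inj_on (\<lambda>x. p i (fst x) + g (snd x)) (box t0 e)"
  using ch by (simp_all add: plane_chart_def)
 show "continuous_on UNIV g"
  by (rule continuous_at_imp_continuous_on) (use has_vector_derivative_continuous[OF g] in blast)
 show "0 < Im (cnj (d i s) * g' 0) * Im (cnj (d i t0) * g' 0)" if "\<bar>s - t0\<bar> < e" for s
 proof -
  have "(s, 0) \<in> box t0 e" using that e by (auto simp: box_def)
  then show ?thesis using ch unfolding plane_chart_def by (metis fst_conv snd_conv)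
 qed
 show "snd x = 0 \<and> z j u = z i (fst x)"
  if "x \<in> box t0 e" "j \<in> {1..m}" "p j u = p i (fst x) + g (snd x)" "l < z j u" for x j u
  using assms that unfolding sheet_chart_def by blast
qed

lemma clear_sheet_chart:
 assumes "i \<in> {1..m}" "clear i t0 l"
 obtains g g' e where "sheet_chart i g g' t0 e l"
proof (rule clear_chart[OF assms])
 fix g g' e
 assume "plane_chart i g g' t0 e" "Im (cnj (d i t0) * g' 0) > 0"
  "!!x j u. x \<in> box t0 e ==> j \<in> {1..m} ==> p j u = p i (fst x) + g (snd x) ==> l < z j u ==>
   snd x = 0 \<and> z j u = z i (fst x)"
  "!!s. \<bar>s - t0\<bar> < e ==> l < z i s"
 then have "sheet_chart i g g' t0 e l" unfolding sheet_chart_def using assms(1) by blast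
 then show ?thesis by (rule that)
qed

lemma sheet_chart_above:
 assumes ch: "sheet_chart i g g' t0 e l" and x: "x \<in> box t0 e" and h: "l < h"
 shows "(p i (fst x) + g (snd x), h) \<in> above \<longleftrightarrow> snd x \<noteq> 0 \<or> z i (fst x) < h"
  "(p i (fst x) + g (snd x), h) \<in> X \<longleftrightarrow> snd x \<noteq> 0 \<or> z i (fst x) \<noteq> h"
proof -
 note D = sheet_chartD[OF ch]
 show "(p i (fst x) + g (snd x), h) \<in> above \<longleftrightarrow> snd x \<noteq> 0 \<or> z i (fst x) < h"
 proof
  assume "(p i (fst x) + g (snd x), h) \<in> above"
  then have "snd x = 0 ==> z i (fst x) < h" unfolding above_def using D(1,4) by simp
  then show "snd x \<noteq> 0 \<or> z i (fst x) < h" by blast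
 next
  assume a: "snd x \<noteq> 0 \<or> z i (fst x) < h"
  have "z j u < h" if "j \<in> {1..m}" "p j u = p i (fst x) + g (snd x)" for j u
  proof (cases "l < z j u")
   case True
   then show ?thesis using D(10)[OF x that True] a by simp
  qed (use h in linarith)
  then show "(p i (fst x) + g (snd x), h) \<in> above" unfolding above_def by simp
 qed
 show "(p i (fst x) + g (snd x), h) \<in> X \<longleftrightarrow> snd x \<noteq> 0 \<or> z i (fst x) \<noteq> h"
 proof
  assume a: "(p i (fst x) + g (snd x), h) \<in> X"
  show "snd x \<noteq> 0 \<or> z i (fst x) \<noteq> h"
  proof (rule ccontr)
   assume "\<not> (snd x \<noteq> 0 \<or> z i (fst x) \<noteq> h)"
   then have "(p i (fst x) + g (snd x), h) = K i (fst x)" using D(4) by (simp add: K_eq)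
   then show False using a D(1) unfolding X_def by blast
  qed
 next
  assume a: "snd x \<noteq> 0 \<or> z i (fst x) \<noteq> h"
  have "(p i (fst x) + g (snd x), h) \<noteq> K j u" if "j \<in> {1..m}" for j u
   using D(10)[OF x that, of u] a h by (auto simp: K_eq)
  then show "(p i (fst x) + g (snd x), h) \<in> X" unfolding X_def by blast
 qed
qed

text \<open>A slab around a point of the curtain, narrow enough to stay below the strand. The two
  halves are in \<open>above\<close>, and the cocycle identity holds throughout. The set
  \<open>N0\<close> allows the two witnesses to be found in any prescribed neighbourhood.\<close>

lemma jump_point:
 assumes ch: "sheet_chart i g g' t0 e l" and s1: "\<bar>s1 - t0\<bar> < e" and h1: "l < h1" "h1 < z i s1"
  and N0: "open N0" "(p i s1, h1) \<in> N0"
 shows "\<exists>N a r. open N \<and> (p i s1, h1) \<in> N \<and> 0 < r \<and> r < e \<and>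
  (\<forall>y\<in>N Int above. \<forall>w\<in>N Int above. \<sigma> y w = 0 \<or> \<sigma> y w = a \<or> \<sigma> y w = - a) \<and>
  (p i s1 + g (- r), h1) \<in> N0 \<and> (p i s1 + g r, h1) \<in> N0 \<and> \<sigma> (p i s1 + g (- r), h1) (p i s1 + g r, h1) = a \<and>
  (\<forall>s h. \<bar>s - s1\<bar> < r --> \<bar>h - h1\<bar> < r --> jump i s h a)"
proof -
 note D = sheet_chartD[OF ch]
 have box1: "(s1, 0) \<in> box t0 e" using s1 D(3) by (auto simp: box_def)
 have "(p i s1 + g 0, h1) \<in> X" using sheet_chart_above(2)[OF ch box1 h1(1)] h1(2) by simp
 then have inX: "(p i s1, h1) \<in> X" using D(4) by simp
 obtain N1 where N1: "open N1" "(p i s1, h1) \<in> N1"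
  "\<forall>u\<in>N1 Int X. \<forall>v\<in>N1 Int X. \<forall>w\<in>N1 Int X. \<sigma> u v + \<sigma> v w = \<sigma> u w"
  using local_cocycleD[OF cocycle inX] by (elim exE conjE) (rule that)
 have "open (N0 Int N1)" "(p i s1 + g 0, h1) \<in> N0 Int N1" using N0 N1(1,2) D(4) by auto
 then obtain \<delta>1 where \<delta>1: "\<delta>1 > 0" "slab i g {s1 - \<delta>1<..<s1 + \<delta>1} {0 - \<delta>1<..<0 + \<delta>1} (h1 - \<delta>1) (h1 + \<delta>1) \<subseteq> N0 Int N1"
  by (rule small_slab[OF D(1,7)])
 have "continuous_on UNIV (z i)" by (rule z_cont[OF D(1)])
 moreover have "(z i s1 - h1) / 2 > 0" using h1 by simp
 ultimately obtain \<delta>2 where \<delta>2: "\<delta>2 > 0" "!!s. dist s s1 < \<delta>2 ==> dist (z i s) (z i s1) < (z i s1 - h1) / 2"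
  unfolding continuous_on_iff by (metis UNIV_I)
 have "\<forall>x\<in>{\<delta>1, \<delta>2, e - \<bar>s1 - t0\<bar>, (z i s1 - h1) / 2, h1 - l, e}. 0 < x"
  using \<delta>1(1) \<delta>2(1) s1 h1 D(3) by simp
 then obtain \<delta> where \<delta>0: "\<delta> > 0" "\<forall>x\<in>{\<delta>1, \<delta>2, e - \<bar>s1 - t0\<bar>, (z i s1 - h1) / 2, h1 - l, e}. \<delta> \<le> x"
  by (rule ex_pos_le[rotated]) simp_all
 then have \<delta>: "\<delta> > 0" "\<delta> \<le> \<delta>1" "\<delta> \<le> \<delta>2" "\<delta> \<le> e - \<bar>s1 - t0\<bar>" "\<delta> \<le> (z i s1 - h1) / 2" "\<delta> \<le> h1 - l" "\<delta> \<le> e"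
  by simp_all
 define I where "I = {s1 - \<delta><..<s1 + \<delta>}"
 have Isub: "\<bar>s - t0\<bar> < e" if "s \<in> I" for s using that \<delta>(4) by (auto simp: I_def)
 have bx: "I \<times> {-\<delta><..<\<delta>} \<subseteq> box t0 e"
 proof
  fix x assume "x \<in> I \<times> {-\<delta><..<\<delta>}"
  then show "x \<in> box t0 e" using Isub[of "fst x"] \<delta>(7) by (auto simp: box_def)
 qed
 \<comment> \<open>The slab is lower than half the distance from \<open>h1\<close> to the strand,
   and the strand moves by less than the other half.\<close>
 have hz: "h < z i s" if "s \<in> I" "h < h1 + \<delta>" for s h
 proof -
  have "dist s s1 < \<delta>2" using that(1) \<delta>(3) by (auto simp: I_def dist_real_def)
  then have "\<bar>z i s - z i s1\<bar> < (z i s1 - h1) / 2" using \<delta>2(2) by (simp only: dist_real_def)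
  then have "- (z i s - z i s1) < (z i s1 - h1) / 2" by (simp only: abs_less_iff)
  then have "- (z i s - z i s1) * 2 < z i s1 - h1" by (simp only: pos_less_divide_eq[OF zero_less_numeral])
  moreover have "\<delta> * 2 \<le> z i s1 - h1" using \<delta>(5) by (simp only: pos_le_divide_eq[OF zero_less_numeral])
  ultimately show ?thesis using that(2) by (smt (verit))
 qed
 have bxI: "x \<in> box t0 e" if "fst x \<in> I" "snd x \<in> {-\<delta><..<\<delta>}" for x
  using bx that by (auto simp: mem_Times_iff)
 define N where "N = slab i g I {-\<delta><..<\<delta>} (h1 - \<delta>) (h1 + \<delta>)"
 have NX: "N \<subseteq> N0 Int N1 Int X"
 proof
  fix y assume y: "y \<in> N"
  have "N \<subseteq> slab i g {s1 - \<delta>1<..<s1 + \<delta>1} {0 - \<delta>1<..<0 + \<delta>1} (h1 - \<delta>1) (h1 + \<delta>1)"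
   unfolding N_def slab_def I_def using \<delta>(2) by (intro image_mono) auto
  then have "y \<in> N0 Int N1" using \<delta>1(2) y by blast
  moreover obtain x h where x: "y = (p i (fst x) + g (snd x), h)" "fst x \<in> I" "snd x \<in> {-\<delta><..<\<delta>}" "h1 - \<delta> < h" "h < h1 + \<delta>"
   using y unfolding N_def slab_def by auto
  moreover have "y \<in> X" using sheet_chart_above(2)[OF ch bxI[OF x(2,3)], of h] hz[OF x(2,5)] x(1,4) \<delta>(6) by auto
  ultimately show "y \<in> N0 Int N1 Int X" by blast
 qed
 have half: "slab i g I J (h1 - \<delta>) (h1 + \<delta>) \<subseteq> above" if J: "J \<subseteq> {-\<delta><..<\<delta>}" "0 \<notin> J" for J
 proof
  fix y assume "y \<in> slab i g I J (h1 - \<delta>) (h1 + \<delta>)"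
  then obtain x h where x: "y = (p i (fst x) + g (snd x), h)" "fst x \<in> I" "snd x \<in> J" "h1 - \<delta> < h" "h < h1 + \<delta>"
   unfolding slab_def by auto
  have "snd x \<in> {-\<delta><..<\<delta>}" "snd x \<noteq> 0" using x(3) J by auto
  then show "y \<in> above" using sheet_chart_above(1)[OF ch bxI[OF x(2)], of h] x(1,4) \<delta>(6) by auto
 qed
 define y0 w0 where "y0 = (p i s1 + g (- (\<delta>/2)), h1)" and "w0 = (p i s1 + g (\<delta>/2), h1)"
 have y0: "y0 \<in> slab i g I {-\<delta><..<0} (h1 - \<delta>) (h1 + \<delta>)" and w0: "w0 \<in> slab i g I {0<..<\<delta>} (h1 - \<delta>) (h1 + \<delta>)"
  using slab_mem[of "(s1, - (\<delta>/2))" I "{-\<delta><..<0}" "h1 - \<delta>" h1 "h1 + \<delta>" i g]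
   slab_mem[of "(s1, \<delta>/2)" I "{0<..<\<delta>}" "h1 - \<delta>" h1 "h1 + \<delta>" i g] \<delta>(1)
  by (simp_all add: y0_def w0_def I_def)
 have half': "slab i g I {-\<delta><..<0} (h1 - \<delta>) (h1 + \<delta>) \<subseteq> above" "slab i g I {0<..<\<delta>} (h1 - \<delta>) (h1 + \<delta>) \<subseteq> above"
  by (rule half; use \<delta>(1) in auto)+
 have subN: "slab i g I {-\<delta><..<0} (h1 - \<delta>) (h1 + \<delta>) \<subseteq> N" "slab i g I {0<..<\<delta>} (h1 - \<delta>) (h1 + \<delta>) \<subseteq> N"
  unfolding N_def by (rule slab_mono; use \<delta>(1) in auto)+
 have exact: "\<sigma> u v + \<sigma> v w = \<sigma> u w" if "u \<in> N" "v \<in> N" "w \<in> N" for u v w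
 proof -
  have "u \<in> N1 Int X" "v \<in> N1 Int X" "w \<in> N1 Int X" using NX that by blast+
  then show ?thesis using bspec[OF bspec[OF bspec[OF N1(3)]]] by blast
 qed
 have I: "open I" "connected I" by (simp_all add: I_def)
 have inj: "inj_on (\<lambda>x. p i (fst x) + g (snd x)) (I \<times> {-\<delta><..<\<delta>})" by (rule inj_on_subset[OF D(6) bx])
 have jmp: "jump i s h (\<sigma> y0 w0)" if s: "s \<in> I" and h: "h1 - \<delta> < h" "h < h1 + \<delta>" for s h
 proof (rule jump_slab[OF D(1,5,4) I \<delta>(1) inj D(8)[OF Isub] exact _ half' _ _ s h])
  show "slab i g I {-\<delta><..<\<delta>} (h1 - \<delta>) (h1 + \<delta>) \<subseteq> N" by (simp add: N_def)
 qed (use y0 w0 D(9) in simp_all)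
 have zero_half: "\<sigma> u v = 0" if J: "J = {-\<delta><..<0} \<or> J = {0<..<\<delta>}"
  and uv: "u \<in> slab i g I J (h1 - \<delta>) (h1 + \<delta>)" "v \<in> slab i g I J (h1 - \<delta>) (h1 + \<delta>)" for J u v
 proof (rule cocycle_zero_on_connected[OF _ _ _ uv])
  show "connected (slab i g I J (h1 - \<delta>) (h1 + \<delta>))"
   by (rule connected_slab[OF chart_cont[OF D(1,2)] I(2)]) (use J in auto)
  have "slab i g I J (h1 - \<delta>) (h1 + \<delta>) \<subseteq> N" using J subN by blast
  then show "\<sigma> a b + \<sigma> b c = \<sigma> a c" if "a \<in> slab i g I J (h1 - \<delta>) (h1 + \<delta>)"
   "b \<in> slab i g I J (h1 - \<delta>) (h1 + \<delta>)" "c \<in> slab i g I J (h1 - \<delta>) (h1 + \<delta>)" for a b c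
   using exact that by blast
  show "locally2 (slab i g I J (h1 - \<delta>) (h1 + \<delta>)) (\<lambda>y z. \<sigma> y z = 0)"
   by (rule locally2_mono[OF zero]) (use J half' in auto)
 qed
 have "0 \<in> {-\<delta><..<\<delta>}" using \<delta>(1) by simp
 have "open N" unfolding N_def by (rule open_slab[OF D(1,7) inj I(1)]) auto
 moreover have "(p i s1, h1) \<in> N"
  using slab_mem[of "(s1, 0)" I "{-\<delta><..<\<delta>}" "h1 - \<delta>" h1 "h1 + \<delta>" i g] \<delta>(1) D(4) by (simp add: N_def I_def)
 moreover have "\<sigma> y w = 0 \<or> \<sigma> y w = \<sigma> y0 w0 \<or> \<sigma> y w = - \<sigma> y0 w0" if "y \<in> N Int above" "w \<in> N Int above" for y w
 proof -
  have sides: "u \<in> slab i g I {-\<delta><..<0} (h1 - \<delta>) (h1 + \<delta>) \<or> u \<in> slab i g I {0<..<\<delta>} (h1 - \<delta>) (h1 + \<delta>)" if u: "u \<in> N Int above" for u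
  proof -
   obtain x h where x: "u = (p i (fst x) + g (snd x), h)" "fst x \<in> I" "snd x \<in> {-\<delta><..<\<delta>}" "h1 - \<delta> < h" "h < h1 + \<delta>"
    using u unfolding N_def slab_def by auto
   have "snd x \<noteq> 0"
    using sheet_chart_above(1)[OF ch bxI[OF x(2,3)], of h] u hz[OF x(2,5)] x(1,4) \<delta>(6) by auto
   then have "snd x \<in> {-\<delta><..<0} \<or> snd x \<in> {0<..<\<delta>}" using x(3) by auto
   then show ?thesis unfolding x(1) using slab_mem[OF x(2) _ x(4,5)] by blast
  qed
  have mem: "y \<in> N" "w \<in> N" "y0 \<in> N" "w0 \<in> N" using that y0 w0 subN by blast+
  have opp: "\<sigma> u v = \<sigma> y0 w0" if uv: "u \<in> slab i g I {-\<delta><..<0} (h1 - \<delta>) (h1 + \<delta>)" "v \<in> slab i g I {0<..<\<delta>} (h1 - \<delta>) (h1 + \<delta>)" for u v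
  proof -
   have "u \<in> N" "v \<in> N" using uv subN by blast+
   then show ?thesis
    using exact[of u y0 w0] exact[of u w0 v] mem zero_half[OF _ uv(1) y0] zero_half[OF _ w0 uv(2)] by simp
  qed
  have neg: "\<sigma> v u = - \<sigma> u v" if "u \<in> N" "v \<in> N" for u v
   using cocycle_rules(2)[of N \<sigma> u v] exact that by blast
  show ?thesis
   using sides[OF that(1)] sides[OF that(2)] opp zero_half neg[OF mem(1,2)] neg[OF mem(2,1)] by metis
 qed
 moreover have "y0 \<in> N0" "w0 \<in> N0" using y0 w0 subN NX by blast+
 moreover have "0 < \<delta>/2" "\<delta>/2 < e" using \<delta>(1,7) by auto
 moreover have "jump i s h (\<sigma> y0 w0)" if "\<bar>s - s1\<bar> < \<delta>/2" "\<bar>h - h1\<bar> < \<delta>/2" for s h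
  by (rule jmp) (use that in \<open>auto simp: I_def abs_if split: if_splits\<close>)
 ultimately show ?thesis
  unfolding y0_def w0_def by (intro exI[of _ N] exI[of _ "\<sigma> y0 w0"] exI[of _ "\<delta>/2"]) (simp add: y0_def w0_def)
qed

end

section \<open>The colour of a point of the link\<close>

context colouring
begin

lemma slab_elim:
 assumes "y \<in> slab i g I J h1 h2"
 shows "\<exists>x h. y = (p i (fst x) + g (snd x), h) \<and> fst x \<in> I \<and> snd x \<in> J \<and> h1 < h \<and> h < h2"
proof -
 obtain c where "y = (\<lambda>(x, h). (p i (fst x) + g (snd x), h)) c" "c \<in> (I \<times> J) \<times> {h1<..<h2}"
  using assms unfolding slab_def by (rule imageE)
 then show ?thesis by (intro exI[of _ "fst c"] exI[of _ "snd c"]) (simp add: case_prod_unfold mem_Times_iff)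
qed

lemma sheet_chart_mono:
 assumes ch: "sheet_chart i g g' t0 e l" and e': "0 < e'" "e' \<le> e"
 shows "sheet_chart i g g' t0 e' l"
proof -
 note D = sheet_chartD[OF ch]
 have "\<forall>x\<in>box t0 e'. \<forall>j\<in>{1..m}. \<forall>u. p j u = p i (fst x) + g (snd x) --> l < z j u -->
   snd x = 0 \<and> z j u = z i (fst x)"
  using D(10)[OF subsetD[OF box_mono[OF e'(2)]]] by (intro ballI allI impI)
 moreover have "\<forall>s. \<bar>s - t0\<bar> < e' --> l < z i s"
  using D(11)[OF order.strict_trans2[OF _ e'(2)]] by (intro allI impI)
 ultimately show ?thesis
  unfolding sheet_chart_def using D(1,9) plane_chart_mono[OF D(2) e'] by (intro conjI)
qed

text \<open>The piece of curtain between the level \<open>l\<close> and the strand, parametrized by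
  position and height, is connected, and the jump is locally constant on it. The level midway to the
  strand is again clear at nearby points.\<close>

lemma jump_constant_near:
 assumes i: "i \<in> {1..m}" and cl: "clear i t0 l"
 obtains e a where "e > 0" "!!s. \<bar>s - t0\<bar> < e ==> clear i s ((l + z i s) / 2)"
  "!!s h. \<bar>s - t0\<bar> < e ==> l < h ==> h < z i s ==> jump i s h a"
proof -
 obtain g g' e where ch: "sheet_chart i g g' t0 e l" by (rule clear_sheet_chart[OF i cl])
 note D = sheet_chartD[OF ch]
 \<comment> \<open>Rescaling the heights exhibits the piece of curtain as the image of a
   rectangle.\<close>
 define C where "C = (\<lambda>(s, c). (s, l + c * (z i s - l))) ` ({t0 - e<..<t0 + e} \<times> {0<..<1})"
 have C: "(s, h) \<in> C \<longleftrightarrow> \<bar>s - t0\<bar> < e \<and> l < h \<and> h < z i s" for s h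
 proof
  assume "(s, h) \<in> C"
  then obtain c where c: "\<bar>s - t0\<bar> < e" "0 < c" "c < 1" "h = l + c * (z i s - l)" by (auto simp: C_def)
  have pos: "0 < z i s - l" using D(11)[OF c(1)] by simp
  have "0 < c * (z i s - l)" using c(2) pos by (rule mult_pos_pos)
  moreover have "c * (z i s - l) < 1 * (z i s - l)" using c(3) pos by (rule mult_strict_right_mono)
  ultimately show "\<bar>s - t0\<bar> < e \<and> l < h \<and> h < z i s" using c(1,4) by simp
 next
  assume a: "\<bar>s - t0\<bar> < e \<and> l < h \<and> h < z i s"
  have "(s, h) = (\<lambda>(s, c). (s, l + c * (z i s - l))) (s, (h - l) / (z i s - l))"
   using a by simp
  moreover have "(s, (h - l) / (z i s - l)) \<in> {t0 - e<..<t0 + e} \<times> {0<..<1}" using a by auto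
  ultimately show "(s, h) \<in> C" unfolding C_def by (rule image_eqI)
 qed
 have conn: "connected C" unfolding C_def
 proof (rule connected_continuous_image)
  show "continuous_on ({t0 - e<..<t0 + e} \<times> {0<..<1}) (\<lambda>(s, c). (s, l + c * (z i s - l)))"
   unfolding case_prod_unfold
   by (intro continuous_intros continuous_on_compose2[OF z_cont[OF i, of UNIV] continuous_on_fst[OF continuous_on_id] subset_UNIV])
  show "connected ({t0 - e<..<t0 + e} \<times> {0<..<1::real})" by (intro connected_Times) auto
 qed
 have loc: "\<exists>r a. 0 < r \<and> (\<forall>s h. \<bar>s - s1\<bar> < r --> \<bar>h - h1\<bar> < r --> jump i s h a)" if "(s1, h1) \<in> C" for s1 h1
  using jump_point[OF ch, of s1 h1 UNIV] that unfolding C by blast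
 define f where "f x = (SOME a. jump i (fst x) (snd x) a)" for x
 have f: "jump i s h (f (s, h))" if sh: "(s, h) \<in> C" for s h
 proof -
  obtain r a where r: "0 < r" "\<forall>s' h'. \<bar>s' - s\<bar> < r --> \<bar>h' - h\<bar> < r --> jump i s' h' a"
   using loc[OF sh] by (elim exE conjE) (rule that)
  have "jump i s h a" using r(1) r(2)[rule_format, of s h] by simp
  then show ?thesis unfolding f_def by (simp add: someI[of "jump i s h"])
 qed
 have "locally2 C (\<lambda>y z. f y = f z)"
 proof (rule locally2I)
  fix x assume x: "x \<in> C"
  obtain s1 h1 where x1: "x = (s1, h1)" by (cases x)
  obtain r a where r: "0 < r" "\<forall>s' h'. \<bar>s' - s1\<bar> < r --> \<bar>h' - h1\<bar> < r --> jump i s' h' a"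
   using loc[OF x[unfolded x1]] by (elim exE conjE) (rule that)
  have eq: "f y = a" if y: "y \<in> ball s1 r \<times> ball h1 r Int C" for y
  proof -
   obtain s h where sh: "y = (s, h)" by (cases y)
   have "\<bar>s - s1\<bar> < r" "\<bar>h - h1\<bar> < r" using y sh by (auto simp: dist_real_def)
   then have "jump i s h a" using r(2) by blast
   moreover have "jump i s h (f (s, h))" by (rule f) (use y sh in simp)
   ultimately show ?thesis using jump_unique sh by metis
  qed
  show "\<exists>N. open N \<and> x \<in> N \<and> (\<forall>y\<in>N Int C. \<forall>z\<in>N Int C. f y = f z)"
  proof (intro exI conjI ballI)
   show "open (ball s1 r \<times> ball h1 r)" by (intro open_Times) auto
   show "x \<in> ball s1 r \<times> ball h1 r" using r(1) x1 by simp
  qed (use eq in metis)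
 qed
 then have const: "f x = f y" if "x \<in> C" "y \<in> C" for x y by (rule locally2_const[OF conn _ that])
 have "(t0, (l + z i t0) / 2) \<in> C" unfolding C using D(3) D(11)[of t0] by simp
 then have jmp: "jump i s h (f (t0, (l + z i t0) / 2))" if "(s, h) \<in> C" for s h
  using f[OF that] const[OF that] by metis
 show ?thesis
 proof (rule that[OF D(3)])
  show "jump i s h (f (t0, (l + z i t0) / 2))" if "\<bar>s - t0\<bar> < e" "l < h" "h < z i s" for s h
   by (rule jmp) (use C that in blast)
  show "clear i s ((l + z i s) / 2)" if s: "\<bar>s - t0\<bar> < e" for s
   unfolding clear_def
  proof (intro conjI ballI allI impI)
   have ls: "l < z i s" by (rule D(11)[OF s])
   then show "(l + z i s) / 2 < z i s" by simp
   fix j u assume j: "j \<in> {1..m}" "p j u = p i s" "(l + z i s) / 2 \<le> z j u"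
   have "(s, 0) \<in> box t0 e" using s D(3) by (auto simp: box_def)
   moreover have "p j u = p i (fst (s, 0::real)) + g (snd (s, 0::real))" using j(2) D(4) by simp
   ultimately have "z j u = z i (fst (s, 0::real))" using D(10) j(1,3) ls by fastforce
   then show "K j u = K i s" using j(2) by (simp add: K_eq)
  qed
 qed
qed

text \<open>The Wirtinger generator of the strand: the jump right below it. The level
  \<open>l\<close> is hidden in the choice, and \<open>col_jump\<close> shows that every clear level
  gives the same value.\<close>

definition col where
 "col i t = (SOME a. \<exists>l. clear i t l \<and> (\<forall>h. l < h --> h < z i t --> jump i t h a))"

lemma col_jump:
 assumes i: "i \<in> {1..m}" and cl: "clear i t l" and h: "l < h" "h < z i t"
 shows "jump i t h (col i t)"
proof -
 obtain e a where e: "e > 0" and a: "!!s h. \<bar>s - t\<bar> < e ==> l < h ==> h < z i s ==> jump i s h a"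
  using jump_constant_near[OF i cl] by metis
 have a': "jump i t h a" if "l < h" "h < z i t" for h using a[of t h] e that by simp
 have "\<exists>l. clear i t l \<and> (\<forall>h. l < h --> h < z i t --> jump i t h (col i t))"
  unfolding col_def by (rule someI[of _ a]) (use a' cl in blast)
 then obtain l' where l': "clear i t l'" "!!h. l' < h ==> h < z i t ==> jump i t h (col i t)" by blast
 define h' where "h' = (max l l' + z i t) / 2"
 have "max l l' < z i t" using cl l'(1) by (simp add: clear_def)
 then have "l < h'" "l' < h'" "h' < z i t" by (auto simp: h'_def max_def)
 then have "col i t = a" using jump_unique l'(2) a' by blast
 then show ?thesis using a' h by simp
qed

lemma col_locally_constant:
 assumes i: "i \<in> {1..m}" and nc: "\<not> crossed i t"
 obtains e where "e > 0" "!!s. \<bar>s - t\<bar> < e ==> \<not> crossed i s \<and> col i s = col i t"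
proof -
 obtain l where cl: "clear i t l" using not_crossed_clear[OF i nc] by blast
 obtain e a where e: "e > 0" and cs: "!!s. \<bar>s - t\<bar> < e ==> clear i s ((l + z i s) / 2)"
  and a: "!!s h. \<bar>s - t\<bar> < e ==> l < h ==> h < z i s ==> jump i s h a"
  using jump_constant_near[OF i cl] by metis
 have col: "col i s = a" if s: "\<bar>s - t\<bar> < e" for s
 proof -
  define h where "h = (l + 3 * z i s) / 4"
  have "(l + z i s) / 2 < z i s" using cs[OF s] by (simp add: clear_def)
  then have "(l + z i s) / 2 < h" "h < z i s" "l < h" by (auto simp: h_def)
  then show ?thesis using col_jump[OF i cs[OF s]] a[OF s] jump_unique by blast
 qed
 show ?thesis
  by (rule that[OF e]) (use clear_not_crossed[OF cs] col col[of t] e in simp)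
qed

lemma col_periodic: "i \<in> {1..m} ==> col i (t + of_int n) = col i t"
 unfolding col_def clear_def jump_def by (simp add: pz_periodic d_periodic K_periodic)

lemma crossed_periodic: "i \<in> {1..m} ==> crossed i (t + of_int n) \<longleftrightarrow> crossed i t"
 unfolding crossed_def passes_over_iff by (simp add: pz_periodic)

text \<open>An arch over the strand lies in \<open>above\<close> and is connected, so the gauge to
  \<open>H i\<close> stays in one coset along it. The jump below the strand closes the arch to a
  meridian loop. For the parity: if the colour had parity 0, all nearby transports would, and the
  parity would have a primitive around the point.\<close>

lemma clear_meridian:
 assumes i: "i \<in> {1..m}" and cl: "clear i t0 l"
 shows "col i t0 \<in> conj_class i" "\<theta> i (col i t0) = 1"
proof -
 obtain g g' e0 where ch0: "sheet_chart i g g' t0 e0 l" by (rule clear_sheet_chart[OF i cl])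
 obtain e1 a1 where e1: "e1 > 0" and a1: "!!s h. \<bar>s - t0\<bar> < e1 ==> l < h ==> h < z i s ==> jump i s h a1"
  using jump_constant_near[OF i cl] by metis
 define e where "e = min e0 e1"
 have ch: "sheet_chart i g g' t0 e l"
  by (rule sheet_chart_mono[OF ch0]) (use e1 sheet_chartD(3)[OF ch0] in \<open>simp_all add: e_def\<close>)
 note D = sheet_chartD[OF ch]
 have K0: "(p i t0 + g 0, z i t0) = K i t0" using D(4) by (simp add: K_eq)
 have lz: "l < z i t0" using cl by (simp add: clear_def)
 have mer: "meridional i X \<sigma> (K i t0)" using rep i unfolding link_rep_def X_def by blast
 have col: "a = col i t0" if "jump i t0 h a" "l < h" "h < z i t0" for a h
  using jump_unique[OF that(1)] col_jump[OF i cl that(2,3)] by blast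
 obtain W k where W: "open W" "K i t0 \<in> W" "locally2 (W Int X) (\<lambda>y z. k y + \<sigma> y z - k z \<in> H i)"
  using mer unfolding meridional_def by (elim exE conjE) (rule that)
 obtain \<delta>1 where \<delta>1: "\<delta>1 > 0" "slab i g {t0 - \<delta>1<..<t0 + \<delta>1} {0 - \<delta>1<..<0 + \<delta>1} (z i t0 - \<delta>1) (z i t0 + \<delta>1) \<subseteq> W"
  using small_slab[OF D(1,7) W(1), of t0 0 "z i t0"] W(2) K0 by metis
 have "\<forall>x\<in>{\<delta>1, e, z i t0 - l}. 0 < x" using \<delta>1(1) D(3) lz by simp
 then obtain E where E0: "E > 0" "\<forall>x\<in>{\<delta>1, e, z i t0 - l}. E \<le> x" by (rule ex_pos_le[rotated]) simp_all
 then have E: "E > 0" "E \<le> \<delta>1" "E \<le> e" "E \<le> z i t0 - l" by simp_all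
 have "continuous_on UNIV (z i)" by (rule z_cont[OF i])
 then obtain \<delta>2 where \<delta>2: "\<delta>2 > 0" "!!s. dist s t0 < \<delta>2 ==> dist (z i s) (z i t0) < E / 2"
  using E(1) unfolding continuous_on_iff by (metis UNIV_I half_gt_zero)
 define \<rho> where "\<rho> = min \<delta>2 E"
 have \<rho>: "\<rho> > 0" "\<rho> \<le> E" "\<rho> \<le> \<delta>2" using \<delta>2(1) E(1) by (simp_all add: \<rho>_def)
 define I where "I = {t0 - \<rho><..<t0 + \<rho>}"
 define S where "S J h1 h2 = slab i g I J h1 h2" for J h1 h2
 have zI: "\<bar>z i s - z i t0\<bar> < E / 2" if "s \<in> I" for s
 proof -
  have "dist s t0 < \<delta>2" using that \<rho>(3) by (auto simp: I_def dist_real_def)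
  then show ?thesis using \<delta>2(2) by (simp only: dist_real_def)
 qed
 have bx: "I \<times> {-E<..<E} \<subseteq> box t0 e" using \<rho>(2) E(3) by (auto simp: I_def box_def)
 have bxI: "x \<in> box t0 e" if "fst x \<in> I" "snd x \<in> {-E<..<E}" for x
  using bx that by (auto simp: mem_Times_iff)
 \<comment> \<open>The arch: blocks on both sides of the strand and a block on top that meets
   both.\<close>
 define L R T where "L = S {-E<..<0} (z i t0 - E) (z i t0 + E)" and "R = S {0<..<E} (z i t0 - E) (z i t0 + E)"
  and "T = S {-E<..<E} (z i t0 + E / 2) (z i t0 + E)"
 define Z where "Z = L \<union> R \<union> T"
 have conn: "connected (S J h1 h2)" if "connected J" for J h1 h2
  unfolding S_def by (rule connected_slab[OF chart_cont[OF D(1,2)] _ that]) (simp add: I_def)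
 have t0I: "t0 \<in> I" using \<rho>(1) by (simp add: I_def)
 have mem: "(p i t0 + g r, h) \<in> S J h1 h2" if "r \<in> J" "h1 < h" "h < h2" for r h J h1 h2
  using slab_mem[of "(t0, r)" I J h1 h h2 i g] that t0I by (simp add: S_def)
 have cL: "connected L" and cR: "connected R" and cT: "connected T"
  unfolding L_def R_def T_def by (rule conn; simp)+
 have LT: "(p i t0 + g (- (E/2)), z i t0 + 3 * E / 4) \<in> L Int T" and RT: "(p i t0 + g (E/2), z i t0 + 3 * E / 4) \<in> R Int T"
  unfolding L_def R_def T_def using E(1) by (intro IntI mem; simp)+
 have "connected ((L \<union> T) \<union> (R \<union> T))"
  by (intro connected_Un cL cT cR) (use LT RT in blast)+
 moreover have "(L \<union> T) \<union> (R \<union> T) = Z" unfolding Z_def by blast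
 ultimately have Zconn: "connected Z" by (simp only:)
 define B where "B = S {-E<..<E} (z i t0 - E) (z i t0 + E)"
 have BE: "\<exists>x h. y = (p i (fst x) + g (snd x), h) \<and> fst x \<in> I \<and> snd x \<in> J \<and> h1 < h \<and> h < h2"
  if y: "y \<in> S J h1 h2" for y J h1 h2
 proof -
  from y show ?thesis unfolding S_def by (rule slab_elim)
 qed
 have "B \<subseteq> slab i g {t0 - \<delta>1<..<t0 + \<delta>1} {0 - \<delta>1<..<0 + \<delta>1} (z i t0 - \<delta>1) (z i t0 + \<delta>1)"
  unfolding B_def S_def slab_def by (rule image_mono) (use E(2) \<rho>(2) in \<open>auto simp: I_def\<close>)
 then have BW: "B \<subseteq> W" using \<delta>1(2) by blast
 have ZB: "Z \<subseteq> B" unfolding Z_def L_def R_def T_def B_def S_def slab_def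
  by (intro Un_least image_mono) (use E(1) in auto)
 have Zab: "Z \<subseteq> above"
 proof
  fix y assume y: "y \<in> Z"
  then consider J where "y \<in> S J (z i t0 - E) (z i t0 + E)" "J \<subseteq> {-E<..<E}" "0 \<notin> J" | "y \<in> T"
   unfolding Z_def L_def R_def using E(1) by fastforce
  then show "y \<in> above"
  proof cases
   case (1 J)
   then obtain x h where x: "y = (p i (fst x) + g (snd x), h)" "fst x \<in> I" "snd x \<in> J" "z i t0 - E < h"
    using BE by blast
   have "snd x \<in> {-E<..<E}" "snd x \<noteq> 0" using x(3) 1(2,3) by auto
   then show ?thesis using sheet_chart_above(1)[OF ch bxI[OF x(2)], of h] x(1,4) E(4) by auto
  next
   case 2
   then obtain x h where x: "y = (p i (fst x) + g (snd x), h)" "fst x \<in> I" "snd x \<in> {-E<..<E}" "z i t0 + E / 2 < h"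
    unfolding T_def using BE by blast
   have "z i (fst x) < h" using zI[OF x(2)] x(4) by linarith
   then show ?thesis using sheet_chart_above(1)[OF ch bxI[OF x(2,3)], of h] x(1,4) E(1) lz by auto
  qed
 qed
 define h0 where "h0 = z i t0 - E / 2"
 have h0: "l < h0" "h0 < z i t0" "z i t0 - E < h0" "h0 < z i t0 + E" using E(1,4) lz by (simp_all add: h0_def)
 have box0: "(t0, 0) \<in> box t0 e" using D(3) by (auto simp: box_def)
 have "(p i t0 + g 0, h0) \<in> B" unfolding B_def using mem[of 0 "{-E<..<E}"] h0 E(1) by simp
 then have h0W: "(p i t0, h0) \<in> W Int X"
  using BW sheet_chart_above(2)[OF ch box0 h0(1)] h0(2) D(4) by auto
 show conj: "col i t0 \<in> conj_class i"
 proof -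
  obtain N0 where N0: "open N0" "(p i t0, h0) \<in> N0" "\<forall>y\<in>N0 Int (W Int X). \<forall>w\<in>N0 Int (W Int X). k y + \<sigma> y w - k w \<in> H i"
   using locally2D[OF W(3) h0W] by (elim exE conjE) (rule that)
  have "open (N0 Int B)" "(p i t0, h0) \<in> N0 Int B"
   using N0(1,2) open_slab[OF D(1,7) inj_on_subset[OF D(6) bx], of "z i t0 - E" "z i t0 + E"]
    \<open>(p i t0 + g 0, h0) \<in> B\<close> D(4) by (auto simp: B_def S_def I_def)
  from jump_point[OF ch _ h0(1,2) this] D(3) obtain a r where r: "0 < r" "r < e"
   "(p i t0 + g (- r), h0) \<in> N0 Int B" "(p i t0 + g r, h0) \<in> N0 Int B"
   "\<sigma> (p i t0 + g (- r), h0) (p i t0 + g r, h0) = a"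
   "\<forall>s h. \<bar>s - t0\<bar> < r --> \<bar>h - h0\<bar> < r --> jump i s h a" by auto
  have "jump i t0 h0 a" using r(1) r(6)[rule_format, of t0 h0] by simp
  then have a: "a = col i t0" using col h0(1,2) by blast
  have inZ: "(p i t0 + g r', h0) \<in> Z" if r': "(p i t0 + g r', h0) \<in> B" "r' \<noteq> 0" "\<bar>r'\<bar> < e" for r'
  proof -
   obtain x h where x: "(p i t0 + g r', h0) = (p i (fst x) + g (snd x), h)" "fst x \<in> I" "snd x \<in> {-E<..<E}"
    using BE[of _ "{-E<..<E}"] r'(1) unfolding B_def by blast
   have "x = (t0, r')" by (rule inj_onD[OF D(6)]) (use x bxI[OF x(2,3)] r'(3) D(3) in \<open>auto simp: box_def\<close>)
   then have "r' \<in> {-E<..<0} \<or> r' \<in> {0<..<E}" using x(3) r'(2) by auto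
   then show ?thesis unfolding Z_def L_def R_def using mem[of r' _ "z i t0 - E" h0 "z i t0 + E"] h0 by blast
  qed
  have yw: "(p i t0 + g (- r), h0) \<in> Z" "(p i t0 + g r, h0) \<in> Z"
   using inZ[of "- r"] inZ[of r] r(1-4) by auto
  show ?thesis
  proof (rule conj_class_from_gauge[OF Zconn _ yw])
   have "locally2 Z (\<lambda>y w. \<sigma> y w = 0 \<and> k y + \<sigma> y w - k w \<in> H i)"
   proof (rule locally2_conj)
    show "locally2 Z (\<lambda>y w. \<sigma> y w = 0)" by (rule locally2_mono[OF zero Zab])
    have "Z \<subseteq> W Int X" using ZB BW Zab above_X by blast
    then show "locally2 Z (\<lambda>y w. k y + \<sigma> y w - k w \<in> H i)" by (rule locally2_mono[OF W(3)])
   qed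
   then show "locally2 Z (\<lambda>y w. k y - k w \<in> H i)"
    by (rule locally2_mono) auto
   have "(p i t0 + g (- r), h0) \<in> N0 Int (W Int X)" "(p i t0 + g r, h0) \<in> N0 Int (W Int X)"
    using r(3,4) BW yw Zab above_X by blast+
   from bspec[OF bspec[OF N0(3) this(1)] this(2)]
   show "k (p i t0 + g (- r), h0) + col i t0 - k (p i t0 + g r, h0) \<in> H i" using r(5) a by simp
  qed
 qed
 show "\<theta> i (col i t0) = 1"
 proof (rule ccontr)
  assume "\<theta> i (col i t0) \<noteq> 1"
  then have \<theta>0: "\<theta> i (col i t0) = 0" by (cases "\<theta> i (col i t0)") auto
  have opB: "open B" unfolding B_def S_def
   by (rule open_slab[OF D(1,7) inj_on_subset[OF D(6) bx]]) (simp_all add: I_def)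
  \<comment> \<open>The parity is compared with the trivial cocycle. They agree off the curtain,
    since the jumps have parity 0, and \<open>gauge_extend\<close> turns this into a primitive on
    all of \<open>B Int X\<close>.\<close>
  have "\<exists>k. locally2 (B Int X) (\<lambda>y w. \<theta> i (\<sigma> y w) = k y + 0 - k w)"
  proof (rule gauge_extend[where h = "\<lambda>_. 0" and V = "B Int above"])
   show "local_cocycle (B Int X) (\<lambda>_ _. 0 :: bit)" by (rule local_cocycleI) (auto intro: open_UNIV)
   show "local_cocycle (B Int X) (\<lambda>y w. \<theta> i (\<sigma> y w))"
   proof (rule local_cocycleI)
    fix x assume "x \<in> B Int X"
    then have "x \<in> X" by blast
    then obtain N where N: "open N" "x \<in> N" "\<forall>u\<in>N Int X. \<forall>v\<in>N Int X. \<forall>w\<in>N Int X. \<sigma> u v + \<sigma> v w = \<sigma> u w"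
     using local_cocycleD[OF cocycle \<open>x \<in> X\<close>] by (elim exE conjE) (rule that)
    have "\<theta> i (\<sigma> u v) + \<theta> i (\<sigma> v w) = \<theta> i (\<sigma> u w)" if "u \<in> N Int X" "v \<in> N Int X" "w \<in> N Int X" for u v w
     using bspec[OF bspec[OF bspec[OF N(3) that(1)] that(2)] that(3)] \<theta>_add by metis
    then show "\<exists>N. open N \<and> x \<in> N \<and> (\<forall>u\<in>N Int (B Int X). \<forall>v\<in>N Int (B Int X). \<forall>w\<in>N Int (B Int X).
      \<theta> i (\<sigma> u v) + \<theta> i (\<sigma> v w) = \<theta> i (\<sigma> u w))"
     using N(1,2) by (intro exI[of _ N] conjI ballI) auto
   qed
   show "B Int above \<subseteq> B Int X" using above_X by blast
   fix x assume x: "x \<in> B Int X"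
   then obtain y h where y: "x = (p i (fst y) + g (snd y), h)" "fst y \<in> I" "snd y \<in> {-E<..<E}" "z i t0 - E < h"
    unfolding B_def using BE by blast
   have lh: "l < h" using y(4) E(4) by linarith
   show "\<exists>N. open N \<and> x \<in> N \<and> (\<forall>y\<in>N Int (B Int above). \<forall>w\<in>N Int (B Int above). \<theta> i (\<sigma> y w) = 0 + 0 - 0)"
   proof (cases "x \<in> above")
    case True
    obtain N where N: "open N" "x \<in> N" "\<forall>y\<in>N Int above. \<forall>w\<in>N Int above. \<sigma> y w = 0"
     using locally2D[OF zero True] by (elim exE conjE) (rule that)
    have "\<theta> i (\<sigma> y w) = 0 + 0 - 0" if "y \<in> N Int (B Int above)" "w \<in> N Int (B Int above)" for y w
    proof -
     have "y \<in> N Int above" "w \<in> N Int above" using that by blast+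
     from bspec[OF bspec[OF N(3) this(1)] this(2)] show ?thesis by simp
    qed
    then show ?thesis using N(1,2) by blast
   next
    case False
    then have y0: "snd y = 0" "h < z i (fst y)"
     using x y sheet_chart_above[OF ch bxI[OF y(2,3)] lh] by auto
    have near: "\<bar>fst y - t0\<bar> < e" using bxI[OF y(2,3)] by (auto simp: box_def abs_if)
    have xP: "x = (p i (fst y), h)" using y(1) y0(1) D(4) by simp
    obtain N a r where N: "open N" "(p i (fst y), h) \<in> N" "0 < r"
     "\<forall>y\<in>N Int above. \<forall>w\<in>N Int above. \<sigma> y w = 0 \<or> \<sigma> y w = a \<or> \<sigma> y w = - a"
     "\<forall>s' h'. \<bar>s' - fst y\<bar> < r --> \<bar>h' - h\<bar> < r --> jump i s' h' a"
     using jump_point[OF ch near lh y0(2) open_UNIV UNIV_I] by (elim exE conjE) (rule that)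
    have "jump i (fst y) h a" using N(3) N(5)[rule_format, of "fst y" h] by simp
    moreover have "jump i (fst y) h a1" using a1[OF _ lh y0(2)] near by (simp add: e_def)
    moreover have "a1 = col i t0" by (rule col[of h0]) (use a1[of t0 h0] e1 h0 in auto)
    ultimately have "\<theta> i a = 0" using jump_unique \<theta>0 by metis
    then have "\<theta> i (\<sigma> y w) = 0 + 0 - 0" if "y \<in> N Int (B Int above)" "w \<in> N Int (B Int above)" for y w
    proof -
     have "y \<in> N Int above" "w \<in> N Int above" using that by blast+
     from bspec[OF bspec[OF N(4) this(1)] this(2)] \<open>\<theta> i a = 0\<close> show ?thesis by auto
    qed
    then show ?thesis using N(1,2) xP by blast
   qed
  next
   fix N x assume N: "open N" and x: "x \<in> N Int (B Int X)"
   then obtain y h where y: "x = (p i (fst y) + g (snd y), h)" "fst y \<in> I" "snd y \<in> {-E<..<E}" "z i t0 - E < h" "h < z i t0 + E"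
    unfolding B_def using BE by blast
   have lh: "l < h" using y(4) E(4) by linarith
   show "N Int (B Int above) \<noteq> {}"
   proof (cases "snd y = 0")
    case False
    then have "x \<in> above" using sheet_chart_above(1)[OF ch bxI[OF y(2,3)] lh] y(1) by simp
    then show ?thesis using x by blast
   next
    case True
    have "(p i (fst y) + g 0, h) \<in> N Int B" using x y(1) True by simp
    then obtain \<delta> where \<delta>: "\<delta> > 0" "slab i g {fst y - \<delta><..<fst y + \<delta>} {0 - \<delta><..<0 + \<delta>} (h - \<delta>) (h + \<delta>) \<subseteq> N Int B"
     using small_slab[OF D(1,7) open_Int[OF N opB]] by metis
    define r where "r = min (\<delta> / 2) (E / 2)"
    have r: "0 < r" "r < \<delta>" "r < E" using \<delta>(1) E(1) by (auto simp: r_def)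
    have in1: "(p i (fst y) + g r, h) \<in> N Int B"
     using slab_mem[of "(fst y, r)" "{fst y - \<delta><..<fst y + \<delta>}" "{0 - \<delta><..<0 + \<delta>}" "h - \<delta>" h "h + \<delta>" i g] r \<delta> by auto
    have rE: "r \<in> {-E<..<E}" using r by auto
    have "(p i (fst y) + g r, h) \<in> above"
     using sheet_chart_above(1)[OF ch bxI[of "(fst y, r)"] lh] y(2) rE r(1) by simp
    then show ?thesis using in1 by blast
   qed
  qed
  then obtain k where k: "locally2 (B Int X) (\<lambda>y w. \<theta> i (\<sigma> y w) = k y + 0 - k w)" by (elim exE) (rule that)
  have "locally2 (B Int X) (\<lambda>y w. \<theta> i (\<sigma> y w) = k y + k w)"
   by (rule locally2_mono[OF k subset_refl]) simp
  moreover have "K i t0 \<in> B" using mem[of 0 "{-E<..<E}" "z i t0 - E" "z i t0" "z i t0 + E"] E(1) K0 by (simp add: B_def)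
  ultimately show False using mer opB unfolding meridional_def by blast
 qed
qed

end

section \<open>The Wirtinger relation at a crossing\<close>

context colouring
begin

lemma over_not_crossed:
 assumes i: "i \<in> {1..m}" and k: "k \<in> {1..m}" and over: "passes_over K k s0 i t0"
 shows "\<not> crossed k s0"
proof
 assume "crossed k s0"
 then obtain k' s where k': "k' \<in> {1..m}" "p k' s = p k s0" "z k s0 < z k' s"
  by (auto simp: crossed_def passes_over_iff)
 have "passes_over K k' s i t0" using over k' by (simp add: passes_over_iff)
 from crossing_unique[OF i k'(1) k this over] k'(3) show False by (simp add: K_eq)
qed

lemma det_swap: "Im (cnj a * b) = - Im (cnj b * a)"
 by (simp add: algebra_simps)

text \<open>Below both strands the two curtains cross and divide a small slab into four quadrants.
  The transport around the four quadrants is trivial, and its sides are the colours of the lower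
  strand before and after the crossing and twice the colour of the upper one. The sign of the
  crossing decides the direction of the conjugation.\<close>

lemma crossing_relation:
 assumes i: "i \<in> {1..m}" and k: "k \<in> {1..m}" and over: "passes_over K k s0 i t0"
 obtains e a a' where "e > 0"
  "!!s. t0 - e < s ==> s < t0 ==> \<not> crossed i s \<and> col i s = a"
  "!!s. t0 < s ==> s < t0 + e ==> \<not> crossed i s \<and> col i s = a'"
  "a' = (if Im (cnj (d k s0) * d i t0) > 0 then - col k s0 + a + col k s0 else col k s0 + a - col k s0)"
proof -
 define g where "g r = p k (s0 + r) - p i t0" for r
 define g' where "g' r = d k (s0 + r)" for r
 define gi where "gi r = p i (t0 + r) - p i t0" for r
 have pk: "p k s0 = p i t0" and zk: "z i t0 < z k s0" using over by (simp_all add: passes_over_iff)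
 have shift: "((\<lambda>r. p j (t + r) - c) has_vector_derivative d j (t + r)) (at r)" if "j \<in> {1..m}" for j t c r
 proof -
  have "((\<lambda>r. t + r) has_vector_derivative 1) (at r)" by (rule derivative_eq_intros refl | simp)+
  from has_vector_derivative_diff_const[THEN iffD2, OF vector_diff_chain_at[OF this p_deriv(1)[OF that]]]
  show ?thesis by (simp add: comp_def)
 qed
 have g: "!!r. (g has_vector_derivative g' r) (at r)" unfolding g_def[abs_def] g'_def by (rule shift[OF k])
 have gi: "!!r. (gi has_vector_derivative d i (t0 + r)) (at r)" unfolding gi_def[abs_def] by (rule shift[OF i])
 have g'c: "continuous_on UNIV g'" unfolding g'_def[abs_def]
  by (intro continuous_on_compose2[OF p_deriv(2)[OF k]] continuous_intros) auto
 have g0: "g 0 = 0" "gi 0 = 0" by (simp_all add: g_def gi_def pk)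
 have tr: "Im (cnj (d i t0) * g' 0) \<noteq> 0"
  unfolding g'_def using transverse[OF i k pk[symmetric]] zk by (simp add: K_eq)
 obtain e0 where ch: "plane_chart i g g' t0 e0" by (rule plane_chart_exists[OF i g g'c g0(1) tr])
 \<comment> \<open>Only the two crossing strands meet the vertical line, so 1 below the lower one is
   a possible level. The slab lies midway, and the margins of 1/4 keep it between this level and the
   strands.\<close>
 define l where "l = z i t0 - 1"
 obtain e1 where e1: "e1 > 0" "e1 \<le> e0"
  "!!x j u. x \<in> box t0 e1 ==> j \<in> {1..m} ==> p j u = p i (fst x) + g (snd x) ==> l < z j u ==>
   (snd x = 0 \<and> z j u = z i (fst x)) \<or> (True \<and> fst x = t0 \<and> z j u = z k (s0 + snd x))"
 proof (rule chart_strands[OF i ch, of l True k s0])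
  fix j u assume j: "j \<in> {1..m}" "p j u = p i t0"
  have "K i t0 \<noteq> K k s0" using zk by (simp add: K_eq)
  then have "K j u = K i t0 \<or> K j u = K k s0" using no_triple[OF j(1) i k j(2) pk[symmetric]] by metis
  then show "(j = i \<and> (\<exists>n::int. u = t0 + of_int n)) \<or> (True \<and> j = k \<and> (\<exists>n::int. u = s0 + of_int n))"
   using K_inj j(1) i k by blast
 qed (use k in \<open>auto simp: g_def[abs_def] l_def\<close>)
 have zc: "\<exists>\<delta>>0. \<forall>s. \<bar>s - t\<bar> < \<delta> --> z i t0 - 1/4 < z j s" if j: "j \<in> {1..m}" "z i t0 \<le> z j t" for j t
 proof -
  have "continuous_on UNIV (z j)" by (rule z_cont[OF j(1)])
  then obtain \<delta> where "\<delta> > 0" "!!s. dist s t < \<delta> ==> dist (z j s) (z j t) < 1/4"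
   unfolding continuous_on_iff by (metis UNIV_I zero_less_divide_1_iff zero_less_numeral)
  moreover have "z i t0 - 1/4 < z j s" if "dist (z j s) (z j t) < 1/4" for s
   using that j(2) unfolding dist_real_def by (smt (verit))
  ultimately show ?thesis unfolding dist_real_def by blast
 qed
 obtain \<delta>1 where \<delta>1: "\<delta>1 > 0" "!!s. \<bar>s - t0\<bar> < \<delta>1 ==> z i t0 - 1/4 < z i s" using zc[OF i order_refl] by blast
 obtain \<delta>2 where \<delta>2: "\<delta>2 > 0" "!!s. \<bar>s - s0\<bar> < \<delta>2 ==> z i t0 - 1/4 < z k s"
  using zc[OF k less_imp_le[OF zk]] by blast
 define h0 where "h0 = z i t0 - 1/2"
 have inX: "(p i t0, h0) \<in> X"
 proof -
  have "(p i t0, h0) \<noteq> K j u" if j: "j \<in> {1..m}" for j u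
  proof
   assume a: "(p i t0, h0) = K j u"
   have "K i t0 \<noteq> K k s0" using zk by (simp add: K_eq)
   moreover have "p j u = p i t0" using a by (simp add: K_eq)
   ultimately have "K j u = K i t0 \<or> K j u = K k s0" using no_triple[OF j i k _ pk[symmetric]] by metis
   then show False using a zk by (auto simp: K_eq h0_def)
  qed
  then show ?thesis unfolding X_def by blast
 qed
 obtain N1 where N1: "open N1" "(p i t0, h0) \<in> N1"
  "\<forall>u\<in>N1 Int X. \<forall>v\<in>N1 Int X. \<forall>w\<in>N1 Int X. \<sigma> u v + \<sigma> v w = \<sigma> u w"
  using local_cocycleD[OF cocycle inX] by (elim exE conjE) (rule that)
 have gc: "continuous_on UNIV g"
  by (rule continuous_at_imp_continuous_on) (use has_vector_derivative_continuous[OF g] in blast)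
 obtain \<delta>3 where \<delta>3: "\<delta>3 > 0" "slab i g {t0 - \<delta>3<..<t0 + \<delta>3} {0 - \<delta>3<..<0 + \<delta>3} (h0 - \<delta>3) (h0 + \<delta>3) \<subseteq> N1"
  using small_slab[OF i gc N1(1), of t0 0 h0] N1(2) g0(1) by (metis add_0_right)
 obtain e4 where e4: "e4 > 0" "!!s. \<bar>s - s0\<bar> < e4 ==> \<not> crossed k s \<and> col k s = col k s0"
  using col_locally_constant[OF k over_not_crossed[OF i k over]] by metis
 have "\<forall>x\<in>{e1, \<delta>1, \<delta>2, \<delta>3, e4, 1/4}. 0 < x" using e1(1) \<delta>1(1) \<delta>2(1) \<delta>3(1) e4(1) by simp
 then obtain E where E0: "E > 0" "\<forall>x\<in>{e1, \<delta>1, \<delta>2, \<delta>3, e4, 1/4}. E \<le> x" by (rule ex_pos_le[rotated]) simp_all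
 then have E: "E > 0" "E \<le> e1" "E \<le> \<delta>1" "E \<le> \<delta>2" "E \<le> \<delta>3" "E \<le> e4" "E \<le> 1/4" by simp_all
 define I where "I = {t0 - E<..<t0 + E}"
 define J where "J = {-E<..<E}"
 define F where "F s r = p i s + g r" for s r
 define M where "M = {(F s r, h) | s r h. s \<in> I \<and> r \<in> J \<and> h0 - E < h \<and> h < h0 + E}"
 have bx: "(s, r) \<in> box t0 E \<longleftrightarrow> s \<in> I \<and> r \<in> J" for s r by (auto simp: box_def I_def J_def)
 have chE: "plane_chart i g g' t0 E" by (rule plane_chart_mono[OF ch]) (use E e1 in auto)
 have injF: "s = s' \<and> r = r'" if "F s r = F s' r'" "s \<in> I" "r \<in> J" "s' \<in> I" "r' \<in> J" for s r s' r'
 proof -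
  have inj: "inj_on (\<lambda>x. p i (fst x) + g (snd x)) (box t0 E)" using chE by (simp add: plane_chart_def)
  have "(s, r) = (s', r')" by (rule inj_onD[OF inj]) (use that bx in \<open>simp_all add: F_def\<close>)
  then show ?thesis by simp
 qed
 have det: "0 < Im (cnj (d i s) * d k (s0 + r)) * Im (cnj (d i t0) * d k s0)" if "s \<in> I" "r \<in> J" for s r
  using chE that bx[of s r] unfolding plane_chart_def g'_def by force
 have zlow: "h0 + E < z i s" "h0 + E < z k (s0 + r)" if "s \<in> I" "r \<in> J" for s r
 proof -
  have "\<bar>s - t0\<bar> < \<delta>1" "\<bar>s0 + r - s0\<bar> < \<delta>2" using that E(3,4) by (auto simp: I_def J_def)
  from \<delta>1(2)[OF this(1)] \<delta>2(2)[OF this(2)] show "h0 + E < z i s" "h0 + E < z k (s0 + r)"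
   using E(7) unfolding h0_def by linarith+
 qed
 have strands: "(r = 0 \<and> z j u = z i s) \<or> (s = t0 \<and> z j u = z k (s0 + r))"
  if "s \<in> I" "r \<in> J" "j \<in> {1..m}" "p j u = F s r" "l < z j u" for s r j u
 proof -
  have "(s, r) \<in> box t0 e1" using that(1,2) bx box_mono[OF E(2)] by blast
  from e1(3)[OF this that(3)] that(4,5) show ?thesis by (simp add: F_def)
 qed
 have lh: "l < h0 - E" using E(7) by (simp add: l_def h0_def)
 have MX: "M \<subseteq> N1 Int X"
 proof
  fix y assume "y \<in> M"
  then obtain s r h where y: "y = (F s r, h)" "s \<in> I" "r \<in> J" "h0 - E < h" "h < h0 + E" unfolding M_def by blast
  have "y \<in> slab i g {t0 - \<delta>3<..<t0 + \<delta>3} {0 - \<delta>3<..<0 + \<delta>3} (h0 - \<delta>3) (h0 + \<delta>3)"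
   using slab_mem[of "(s, r)" "{t0 - \<delta>3<..<t0 + \<delta>3}" "{0 - \<delta>3<..<0 + \<delta>3}" "h0 - \<delta>3" h "h0 + \<delta>3" i g] y E(5)
   by (auto simp: F_def I_def J_def)
  moreover have "y \<noteq> K j u" if "j \<in> {1..m}" for j u
  proof
   assume a: "y = K j u"
   then have "p j u = F s r" "z j u = h" using y(1) by (simp_all add: K_eq)
   then show False using strands[OF y(2,3) that, of u] zlow[OF y(2,3)] y(4,5) lh by auto
  qed
  ultimately show "y \<in> N1 Int X" using \<delta>3(2) unfolding X_def by blast
 qed
 have exact: "\<sigma> u v + \<sigma> v w = \<sigma> u w" if "u \<in> M" "v \<in> M" "w \<in> M" for u v w
 proof -
  have "u \<in> N1 Int X" "v \<in> N1 Int X" "w \<in> N1 Int X" using MX that by blast+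
  then show ?thesis using bspec[OF bspec[OF bspec[OF N1(3)]]] by blast
 qed
 have quad: "(F s r, h) \<in> above" if "s \<in> I" "r \<in> J" "s \<noteq> t0" "r \<noteq> 0" "h0 - E < h" for s r h
 proof -
  have "z j u < h" if j: "j \<in> {1..m}" "p j u = F s r" for j u
  proof (cases "l < z j u")
   case True
   then show ?thesis using strands[OF \<open>s \<in> I\<close> \<open>r \<in> J\<close> j True] \<open>s \<noteq> t0\<close> \<open>r \<noteq> 0\<close> by blast
  qed (use lh \<open>h0 - E < h\<close> in linarith)
  then show ?thesis unfolding above_def by simp
 qed
 \<comment> \<open>One point in each quadrant. The signs \<open>a\<close> and \<open>b\<close>
   belong to the direction of the lower strand \<open>i\<close> and of the upper strand
   \<open>k\<close>.\<close>
 define q where "q a b = (F (t0 + a * (E/2)) (b * (E/2)), h0)" for a b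
 have qM: "q a b \<in> M" if "a \<in> {1, -1}" "b \<in> {1, -1}" for a b
  using that E(1) unfolding M_def q_def by (force simp: I_def J_def)
 define D where "D = Im (cnj (d i t0) * d k s0)"
 have Dnz: "D \<noteq> 0" using tr by (simp add: D_def g'_def)
 have clear_i: "clear i s h0" if s: "s \<in> I" "s \<noteq> t0" for s
  unfolding clear_def
 proof (intro conjI ballI allI impI)
  have J0: "0 \<in> J" using E(1) by (simp add: J_def)
  show "h0 < z i s" using zlow(1)[OF s(1) J0] E(1) by linarith
  fix j u assume j: "j \<in> {1..m}" "p j u = p i s" "h0 \<le> z j u"
  have "l < z j u" using j(3) lh E(1) by linarith
  then have "z j u = z i s" using strands[OF s(1) J0 j(1), of u] j(2) s(2) g0(1) by (simp add: F_def)
  then show "K j u = K i s" using j(2) by (simp add: K_eq)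
 qed
 have clear_k: "clear k (s0 + r) h0" if r: "r \<in> J" "r \<noteq> 0" for r
  unfolding clear_def
 proof (intro conjI ballI allI impI)
  have I0: "t0 \<in> I" using E(1) by (simp add: I_def)
  show "h0 < z k (s0 + r)" using zlow(2)[OF I0 r(1)] E(1) by linarith
  fix j u assume j: "j \<in> {1..m}" "p j u = p k (s0 + r)" "h0 \<le> z j u"
  have "l < z j u" using j(3) lh E(1) by linarith
  then have "z j u = z k (s0 + r)" using strands[OF I0 r(1) j(1), of u] j(2) r(2) by (simp add: F_def g_def)
  then show "K j u = K k (s0 + r)" using j(2) by (simp add: K_eq)
 qed
 have low_i: "h0 - E < h0" "h0 < h0 + E" using E(1) by simp_all
 note slabE = slab_elim
 have jump_i: "jump i s h (\<sigma> (q a (if D > 0 then -1 else 1)) (q a (if D > 0 then 1 else -1)))"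
  if s: "s \<in> A" and A: "a = 1 \<and> A = {t0<..<t0 + E} \<or> a = -1 \<and> A = {t0 - E<..<t0}" and h: "h0 - E < h" "h < h0 + E"
  for s h a A
 proof (rule jump_slab[OF i g g0(1) _ _ E(1) _ _ exact _ _ _ _ _ s h, where D = D])
  have AI: "A \<subseteq> I" "t0 \<notin> A" using A E(1) by (auto simp: I_def)
  show "open A" "connected A" using A by auto
  show "inj_on (\<lambda>x. p i (fst x) + g (snd x)) (A \<times> {-E<..<E})"
   by (rule inj_on_subset[of _ "box t0 E"]) (use chE AI in \<open>auto simp: plane_chart_def bx J_def\<close>)
  show "0 < Im (cnj (d i s) * g' 0) * D" if "s \<in> A" for s
   using det[of s 0] AI that E(1) by (auto simp: J_def D_def g'_def)
  show "slab i g A {-E<..<E} (h0 - E) (h0 + E) \<subseteq> M"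
  proof
   fix y assume "y \<in> slab i g A {-E<..<E} (h0 - E) (h0 + E)"
   from slabE[OF this] show "y \<in> M" using AI unfolding M_def F_def J_def by blast
  qed
  have ab: "slab i g A B (h0 - E) (h0 + E) \<subseteq> above" if B: "B \<subseteq> J" "0 \<notin> B" for B
  proof
   fix y assume "y \<in> slab i g A B (h0 - E) (h0 + E)"
   from slabE[OF this] obtain x h where x: "y = (p i (fst x) + g (snd x), h)" "fst x \<in> A" "snd x \<in> B" "h0 - E < h" by blast
   have "fst x \<in> I" "snd x \<in> J" "fst x \<noteq> t0" "snd x \<noteq> 0" using x(2,3) AI B by auto
   from quad[OF this x(4)] show "y \<in> above" by (simp add: x(1) F_def)
  qed
  show "slab i g A {-E<..<0} (h0 - E) (h0 + E) \<subseteq> above" "slab i g A {0<..<E} (h0 - E) (h0 + E) \<subseteq> above"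
   by (rule ab; use E(1) in \<open>auto simp: J_def\<close>)+
  have "t0 + a * (E/2) \<in> A" using A E(1) by auto
  then have "q a b \<in> slab i g A B (h0 - E) (h0 + E)" if "b * (E/2) \<in> B" for b B
   using slab_mem[of "(t0 + a * (E/2), b * (E/2))" A B "h0 - E" h0 "h0 + E" i g] that low_i
   by (simp add: q_def F_def)
  then show "q a (if D > 0 then -1 else 1) \<in> slab i g A (if D > 0 then {-E<..<0} else {0<..<E}) (h0 - E) (h0 + E)"
   "q a (if D > 0 then 1 else -1) \<in> slab i g A (if D > 0 then {0<..<E} else {-E<..<0}) (h0 - E) (h0 + E)"
   using E(1) by auto
 qed
 have Fk: "F (t0 + r) (u - s0) = p k u + gi r" for r u by (simp add: F_def g_def gi_def)
 \<comment> \<open>The same argument with the axes exchanged, hence with the opposite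
   determinant.\<close>
 have jump_k: "jump k u h (\<sigma> (q (if - D > 0 then -1 else 1) b) (q (if - D > 0 then 1 else -1) b))"
  if u: "u \<in> A" and A: "b = 1 \<and> A = {s0<..<s0 + E} \<or> b = -1 \<and> A = {s0 - E<..<s0}" and h: "h0 - E < h" "h < h0 + E"
  for u h b A
 proof (rule jump_slab[OF k gi g0(2) _ _ E(1) _ _ exact _ _ _ _ _ u h, where D = "- D"])
  have AJ: "v - s0 \<in> J" "v \<noteq> s0" if "v \<in> A" for v using A E(1) that by (auto simp: J_def)
  show "open A" "connected A" using A by auto
  show "inj_on (\<lambda>x. p k (fst x) + gi (snd x)) (A \<times> {-E<..<E})"
  proof (rule inj_onI)
   fix x y assume x: "x \<in> A \<times> {-E<..<E}" and y: "y \<in> A \<times> {-E<..<E}"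
    and eq: "p k (fst x) + gi (snd x) = p k (fst y) + gi (snd y)"
   have "t0 + snd x = t0 + snd y \<and> fst x - s0 = fst y - s0"
    by (rule injF) (use eq x y AJ in \<open>auto simp: Fk I_def\<close>)
   then show "x = y" by (simp add: prod_eq_iff)
  qed
  show "0 < Im (cnj (d k s) * d i (t0 + 0)) * - D" if "s \<in> A" for s
  proof -
   have "t0 \<in> I" using E(1) by (simp add: I_def)
   from det[OF this AJ(1)[OF that]] have "0 < Im (cnj (d i t0) * d k s) * D" by (simp add: D_def)
   then show ?thesis unfolding det_swap[of "d i t0" "d k s"] by (simp only: add_0_right mult_minus_left mult_minus_right)
  qed
  show "slab k gi A {-E<..<E} (h0 - E) (h0 + E) \<subseteq> M"
  proof
   fix y assume "y \<in> slab k gi A {-E<..<E} (h0 - E) (h0 + E)"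
   from slabE[OF this] obtain x h where x: "y = (p k (fst x) + gi (snd x), h)" "fst x \<in> A" "snd x \<in> {-E<..<E}"
    "h0 - E < h" "h < h0 + E" by blast
   have "t0 + snd x \<in> I" using x(3) by (simp add: I_def)
   then show "y \<in> M" unfolding M_def x(1) Fk[symmetric] using AJ(1)[OF x(2)] x(4,5) by blast
  qed
  have ab: "slab k gi A B (h0 - E) (h0 + E) \<subseteq> above" if B: "B \<subseteq> {-E<..<E}" "0 \<notin> B" for B
  proof
   fix y assume "y \<in> slab k gi A B (h0 - E) (h0 + E)"
   from slabE[OF this] obtain x h where x: "y = (p k (fst x) + gi (snd x), h)" "fst x \<in> A" "snd x \<in> B" "h0 - E < h" by blast
   have "t0 + snd x \<in> I" "t0 + snd x \<noteq> t0" using x(3) B by (auto simp: I_def)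
   from quad[OF this(1) AJ(1)[OF x(2)] this(2) _ x(4)] AJ(2)[OF x(2)] show "y \<in> above" by (simp add: x(1) Fk)
  qed
  show "slab k gi A {-E<..<0} (h0 - E) (h0 + E) \<subseteq> above" "slab k gi A {0<..<E} (h0 - E) (h0 + E) \<subseteq> above"
   by (rule ab; use E(1) in auto)+
  have "s0 + b * (E/2) \<in> A" using A E(1) by auto
  then have "q a b \<in> slab k gi A B (h0 - E) (h0 + E)" if "a * (E/2) \<in> B" for a B
   using slab_mem[of "(s0 + b * (E/2), a * (E/2))" A B "h0 - E" h0 "h0 + E" k gi] that low_i
    Fk[of "a * (E/2)" "s0 + b * (E/2)"] by (simp add: q_def)
  then show "q (if - D > 0 then -1 else 1) b \<in> slab k gi A (if - D > 0 then {-E<..<0} else {0<..<E}) (h0 - E) (h0 + E)"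
   "q (if - D > 0 then 1 else -1) b \<in> slab k gi A (if - D > 0 then {0<..<E} else {-E<..<0}) (h0 - E) (h0 + E)"
   using E(1) by auto
 qed
 define x where "x a = \<sigma> (q a (if D > 0 then -1 else 1)) (q a (if D > 0 then 1 else -1))" for a
 have col_i: "\<not> crossed i s \<and> col i s = x a"
  if s: "s \<in> A" and A: "a = 1 \<and> A = {t0<..<t0 + E} \<or> a = -1 \<and> A = {t0 - E<..<t0}" for s a A
 proof -
  have sI: "s \<in> I" "s \<noteq> t0" using s A E(1) by (auto simp: I_def)
  have J0: "0 \<in> J" using E(1) by (simp add: J_def)
  define h where "h = h0 + E / 2"
  have h: "h0 < h" "h0 - E < h" "h < h0 + E" "h < z i s"
   using E(1) zlow(1)[OF sI(1) J0] by (simp_all add: h_def)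
  show ?thesis unfolding x_def
   using jump_unique[OF col_jump[OF i clear_i[OF sI] h(1,4)] jump_i[OF s A h(2,3)]] clear_not_crossed[OF clear_i[OF sI]]
   by blast
 qed
 have col_k: "col k s0 = \<sigma> (q (if - D > 0 then -1 else 1) b) (q (if - D > 0 then 1 else -1) b)"
  if b: "b \<in> {1, -1}" for b
 proof -
  define A where "A = (if b = 1 then {s0<..<s0 + E} else {s0 - E<..<s0})"
  have A: "b = 1 \<and> A = {s0<..<s0 + E} \<or> b = -1 \<and> A = {s0 - E<..<s0}" using b by (auto simp: A_def)
  define r where "r = b * (E / 2)"
  have r: "r \<in> J" "r \<noteq> 0" "s0 + r \<in> A" "\<bar>s0 + r - s0\<bar> < e4" using b E(1,6) by (auto simp: r_def J_def A_def)
  have I0: "t0 \<in> I" using E(1) by (simp add: I_def)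
  define h where "h = h0 + E / 2"
  have h: "h0 < h" "h0 - E < h" "h < h0 + E" "h < z k (s0 + r)"
   using E(1) zlow(2)[OF I0 r(1)] by (simp_all add: h_def)
  show ?thesis
   using jump_unique[OF col_jump[OF k clear_k[OF r(1,2)] h(1,4)] jump_k[OF r(3) A h(2,3)]] e4(2)[OF r(4)] by simp
 qed
 have neg: "\<sigma> v u = - \<sigma> u v" if "u \<in> M" "v \<in> M" for u v
  using cocycle_rules(2)[of M \<sigma> u v] exact that by blast
 have tri: "\<sigma> u v = \<sigma> u a + \<sigma> a b + \<sigma> b v" if "u \<in> M" "v \<in> M" "a \<in> M" "b \<in> M" for u v a b
  using exact[OF that(1,3,4)] exact[OF that(1,4,2)] by simp
 have Dki: "Im (cnj (d k s0) * d i t0) > 0 \<longleftrightarrow> D < 0" unfolding D_def det_swap[of "d i t0"] by linarith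
 \<comment> \<open>The cocycle identity along three sides of the quadrilateral gives the fourth one.
   One of the two sides with the colour of \<open>k\<close> is passed backwards.\<close>
 have rel: "x 1 = (if Im (cnj (d k s0) * d i t0) > 0 then - col k s0 + x (-1) + col k s0 else col k s0 + x (-1) - col k s0)"
 proof (cases "D > 0")
  case True
  have "x 1 = \<sigma> (q 1 (-1)) (q 1 1)" "x (-1) = \<sigma> (q (-1) (-1)) (q (-1) 1)"
   "col k s0 = \<sigma> (q 1 (-1)) (q (-1) (-1))" "col k s0 = \<sigma> (q 1 1) (q (-1) 1)"
   using True col_k[of "-1"] col_k[of 1] by (simp_all add: x_def)
  then show ?thesis
   using tri[of "q 1 (-1)" "q 1 1" "q (-1) (-1)" "q (-1) 1"] neg[of "q 1 1" "q (-1) 1"] qM True Dki by simp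
 next
  case False
  then have D0: "D < 0" using Dnz by simp
  have "x 1 = \<sigma> (q 1 1) (q 1 (-1))" "x (-1) = \<sigma> (q (-1) 1) (q (-1) (-1))"
   "col k s0 = \<sigma> (q (-1) 1) (q 1 1)" "col k s0 = \<sigma> (q (-1) (-1)) (q 1 (-1))"
   using D0 col_k[of "-1"] col_k[of 1] by (simp_all add: x_def)
  then show ?thesis
   using tri[of "q 1 1" "q 1 (-1)" "q (-1) 1" "q (-1) (-1)"] neg[of "q (-1) 1" "q 1 1"] qM D0 Dki by simp
 qed
 show ?thesis
 proof (rule that[OF E(1) _ _ rel])
  show "\<not> crossed i s \<and> col i s = x (-1)" if "t0 - E < s" "s < t0" for s
   by (rule col_i[of s "{t0 - E<..<t0}"]) (use that in auto)
  show "\<not> crossed i s \<and> col i s = x 1" if "t0 < s" "s < t0 + E" for s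
   by (rule col_i[of s "{t0<..<t0 + E}"]) (use that in auto)
 qed
qed

end

section \<open>Colours of the arcs of a diagram\<close>

context colouring
begin

lemma col_interval:
 assumes i: "i \<in> {1..m}" and ab: "a \<le> b" and nc: "!!s. a \<le> s ==> s \<le> b ==> \<not> crossed i s"
 shows "col i a = col i b"
proof (rule locally2_const[of "{a..b}" "col i"])
 show "locally2 {a..b} (\<lambda>y z. col i y = col i z)"
 proof (rule locally2I)
  fix x assume x: "x \<in> {a..b}"
  obtain e where e: "e > 0" "!!s. \<bar>s - x\<bar> < e ==> \<not> crossed i s \<and> col i s = col i x"
   using col_locally_constant[OF i nc] x by (metis atLeastAtMost_iff)
  have "col i y = col i x" if "y \<in> ball x e" for y
   using e(2)[of y] that by (simp add: dist_real_def abs_minus_commute)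
  then show "\<exists>N. open N \<and> x \<in> N \<and> (\<forall>y\<in>N Int {a..b}. \<forall>z\<in>N Int {a..b}. col i y = col i z)"
  proof (intro exI conjI ballI)
   show "open (ball x e)" "x \<in> ball x e" using e(1) by simp_all
  qed (metis IntD1 \<open>!!y. y \<in> ball x e ==> col i y = col i x\<close>)
 qed
qed (use ab in auto)

lemma crossed_isolated:
 assumes i: "i \<in> {1..m}"
 obtains e where "e > 0" "!!s. \<bar>s - t\<bar> < e ==> s \<noteq> t ==> \<not> crossed i s"
proof (cases "crossed i t")
 case True
 then obtain k s0 where k: "k \<in> {1..m}" "passes_over K k s0 i t" by (auto simp: crossed_def)
 obtain e a a' where e: "e > 0" "!!s. t - e < s ==> s < t ==> \<not> crossed i s \<and> col i s = a"
  "!!s. t < s ==> s < t + e ==> \<not> crossed i s \<and> col i s = a'"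
  by (rule crossing_relation[OF i k]) (rule that)
 show ?thesis
 proof (rule that[OF e(1)])
  fix s assume "\<bar>s - t\<bar> < e" "s \<noteq> t"
  then show "\<not> crossed i s" using e(2)[of s] e(3)[of s] by (cases "s < t") auto
 qed
next
 case False
 show ?thesis by (rule col_locally_constant[OF i False]) (rule that, auto)
qed

text \<open>Every parameter has a punctured neighbourhood without under-crossings, so they cannot
  accumulate in a compact interval.\<close>

lemma finite_crossed: assumes i: "i \<in> {1..m}" shows "finite {t \<in> {a..b}. crossed i t}"
proof (rule ccontr)
 assume "infinite {t \<in> {a..b}. crossed i t}"
 then obtain x where x: "x \<in> {a..b}" "x islimpt {t \<in> {a..b}. crossed i t}"
  using compact_eq_Bolzano_Weierstrass[of "{a..b}"] by (metis (no_types, lifting) compact_Icc mem_Collect_eq subsetI)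
 obtain e where e: "e > 0" "!!s. \<bar>s - x\<bar> < e ==> s \<noteq> x ==> \<not> crossed i s" by (rule crossed_isolated[OF i, of x]) (rule that)
 then show False using x(2) unfolding islimpt_approachable by (auto simp: dist_real_def)
qed

lemma under_params_eq: "under_params m K b i = {t \<in> {b i..<b i + 1}. crossed i t}"
 by (simp add: under_params_def crossed_def)

context
 fixes b :: "nat => real"
 assumes base: "!!i. i \<in> {1..m} ==> b i \<notin> under_params m K b i"
begin

definition us where "us i = sorted_list_of_set (under_params m K b i)"

lemma us:
 assumes i: "i \<in> {1..m}"
 shows "finite (under_params m K b i)" "set (us i) = under_params m K b i" "sorted_wrt (<) (us i)"
  "length (us i) = card (under_params m K b i)"
proof -
 have "under_params m K b i \<subseteq> {t \<in> {b i..b i + 1}. crossed i t}" by (auto simp: under_params_eq)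
 then show "finite (under_params m K b i)" using finite_crossed[OF i] finite_subset by blast
 then show "set (us i) = under_params m K b i" "sorted_wrt (<) (us i)" "length (us i) = card (under_params m K b i)"
  by (simp_all add: us_def strict_sorted_list_of_set)
qed

lemma base_not_crossed: "i \<in> {1..m} ==> \<not> crossed i (b i)"
 using base[of i] by (simp add: under_params_eq)

text \<open>Here the arcs between \<open>b i\<close> and \<open>b i + 1\<close> are numbered from 0; the last one continues the arc 0.\<close>

definition arc_start where "arc_start i j = (if j = 0 then b i else us i ! (j - 1))"
definition arc_end where "arc_end i j = (if j < length (us i) then us i ! j else b i + 1)"
definition arc_col where
 "arc_col i j = col i ((arc_start i j + arc_end i j) / 2)"

lemma us_bounds:
 assumes i: "i \<in> {1..m}" and j: "j < length (us i)"
 shows "b i < us i ! j" "us i ! j < b i + 1" "crossed i (us i ! j)"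
proof -
 have "us i ! j \<in> under_params m K b i" using us(2)[OF i] j nth_mem by blast
 moreover have "us i ! j \<noteq> b i" using base[OF i] calculation by metis
 ultimately show "b i < us i ! j" "us i ! j < b i + 1" "crossed i (us i ! j)"
  by (auto simp: under_params_eq)
qed

lemma us_less:
 assumes i: "i \<in> {1..m}" and jk: "j < k" "k < length (us i)"
 shows "us i ! j < us i ! k"
 using us(3)[OF i] jk by (simp add: sorted_wrt_iff_nth_less)

lemma arc_not_crossed:
 assumes i: "i \<in> {1..m}" and j: "j \<le> length (us i)" and s: "arc_start i j < s" "s < arc_end i j"
 shows "\<not> crossed i s"
proof
 assume c: "crossed i s"
 have "b i \<le> arc_start i j"
 proof (cases "j = 0")
  case False
  then have "j - 1 < length (us i)" using j by linarith
  from us_bounds(1)[OF i this] False show ?thesis by (simp add: arc_start_def)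
 qed (simp add: arc_start_def)
 moreover have "arc_end i j \<le> b i + 1"
  using us_bounds(2)[OF i, of j] by (auto simp: arc_end_def)
 ultimately have "s \<in> set (us i)" using s c us(2)[OF i] by (simp add: under_params_eq)
 then obtain k where k: "k < length (us i)" "s = us i ! k" by (metis in_set_conv_nth)
 show False
 proof (cases "k < j")
  case True
  then have "us i ! k \<le> us i ! (j - 1)"
  proof (cases "k = j - 1")
   case False
   then have "k < j - 1" "j - 1 < length (us i)" using True j by linarith+
   from us_less[OF i this] show ?thesis by simp
  qed simp
  then show False using s(1) k True by (simp add: arc_start_def split: if_splits)
 next
  case False
  then have "us i ! j \<le> us i ! k" using us_less[OF i, of j k] k by (cases "k = j") auto
  then show False using s(2) k False by (simp add: arc_end_def split: if_splits)
 qed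
qed

lemma arc_nonempty: assumes "i \<in> {1..m}" "j \<le> length (us i)" shows "arc_start i j < arc_end i j"
 using us_bounds[OF assms(1), of j] us_bounds[OF assms(1), of "j - 1"] us_less[OF assms(1), of "j - 1" j] assms(2)
 by (auto simp: arc_start_def arc_end_def)

lemma arc_col_eq:
 assumes i: "i \<in> {1..m}" and j: "j \<le> length (us i)" and s: "arc_start i j < s" "s < arc_end i j"
 shows "col i s = arc_col i j"
proof -
 define t where "t = (arc_start i j + arc_end i j) / 2"
 have t: "arc_start i j < t" "t < arc_end i j" using arc_nonempty[OF i j] by (simp_all add: t_def)
 show ?thesis
 proof (cases "s \<le> t")
  case True
  then show ?thesis
   using col_interval[OF i True arc_not_crossed[OF i j]] s t by (simp add: arc_col_def t_def[symmetric])
 next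
  case False
  then have "t \<le> s" by simp
  from col_interval[OF i this arc_not_crossed[OF i j]] s t show ?thesis
   by (simp add: arc_col_def t_def[symmetric])
 qed
qed

text \<open>The base point is an end of arc 0 and, one period later, of the last arc. It is no
  under-crossing, so its colour agrees with that of nearby inner points of both arcs.\<close>

lemma arc_col_base:
 assumes i: "i \<in> {1..m}"
 shows "arc_col i 0 = col i (b i)" "arc_col i (length (us i)) = col i (b i)"
proof -
 have close: "\<exists>s. a < s \<and> s < c \<and> col i s = col i t" if t: "\<not> crossed i t" "a < t \<and> t \<le> c \<or> a \<le> t \<and> t < c" for a c t
 proof -
  obtain e where e: "e > 0" "!!s. \<bar>s - t\<bar> < e ==> \<not> crossed i s \<and> col i s = col i t"
   by (rule col_locally_constant[OF i t(1)]) metis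
  show ?thesis
  proof (cases "a < t \<and> t \<le> c")
   case True
   then have "max (t - e/2) ((a + t)/2) < t" "a < max (t - e/2) ((a + t)/2)" "t - e < max (t - e/2) ((a + t)/2)"
    using e(1) by (auto simp: max_def)
   then show ?thesis using e(2)[of "max (t - e/2) ((a + t)/2)"] True by (intro exI[of _ "max (t - e/2) ((a + t)/2)"]) auto
  next
   case False
   then have "t < min (t + e/2) ((c + t)/2)" "min (t + e/2) ((c + t)/2) < c" "min (t + e/2) ((c + t)/2) < t + e"
    using e(1) t(2) by (auto simp: min_def)
   then show ?thesis using e(2)[of "min (t + e/2) ((c + t)/2)"] False t(2) by (intro exI[of _ "min (t + e/2) ((c + t)/2)"]) auto
  qed
 qed
 have nb: "\<not> crossed i (b i)" by (rule base_not_crossed[OF i])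
 have nb1: "\<not> crossed i (b i + 1)" "col i (b i + 1) = col i (b i)"
  using crossed_periodic[OF i, of "b i" 1] col_periodic[OF i, of "b i" 1] nb by simp_all
 have "arc_start i 0 \<le> b i \<and> b i < arc_end i 0" using arc_nonempty[OF i, of 0] by (simp add: arc_start_def)
 then obtain s where "arc_start i 0 < s" "s < arc_end i 0" "col i s = col i (b i)" using close[OF nb] by blast
 then show "arc_col i 0 = col i (b i)" using arc_col_eq[OF i, of 0 s] by simp
 have "arc_start i (length (us i)) < b i + 1 \<and> b i + 1 \<le> arc_end i (length (us i))"
  using arc_nonempty[OF i order_refl] by (simp add: arc_end_def)
 then obtain s where "arc_start i (length (us i)) < s" "s < arc_end i (length (us i))" "col i s = col i (b i)"
  using close[OF nb1(1)] nb1(2) by metis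
 then show "arc_col i (length (us i)) = col i (b i)" using arc_col_eq[OF i order_refl, of s] by simp
qed

text \<open>The arcs of a \<open>link_diagram\<close> are numbered from 1, those of
  \<open>arc_col\<close> from 0.\<close>

definition x where "x = (\<lambda>(i, j). arc_col i (j - 1))"

lemma x_meridian:
 assumes i: "i \<in> {1..m}"
 shows "x (i, 1) \<in> conj_class i" "\<theta> i (x (i, 1)) = 1"
proof -
 obtain l where "clear i (b i) l" using not_crossed_clear[OF i base_not_crossed[OF i]] by blast
 from clear_meridian[OF i this] show "x (i, 1) \<in> conj_class i" "\<theta> i (x (i, 1)) = 1"
  using arc_col_base(1)[OF i] by (simp_all add: x_def)
qed

lemma x_arc_index:
 assumes k: "k \<in> {1..m}" and s: "s \<in> {b k..<b k + 1}" and nc: "\<not> crossed k s"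
 shows "x (k, arc_index m K b k s) = col k s" "arc_index m K b k s \<in> {1..max 1 (length (us k))}"
proof -
 define j where "j = card {t \<in> under_params m K b k. t < s}"
 have jl: "j \<le> length (us k)" unfolding j_def us(4)[OF k] using us(1)[OF k] by (intro card_mono) auto
 have idx: "arc_index m K b k s = j mod length (us k) + 1" by (simp add: arc_index_def j_def us(4)[OF k])
 show "arc_index m K b k s \<in> {1..max 1 (length (us k))}"
 proof (cases "length (us k) = 0")
  case False
  then have "j mod length (us k) < length (us k)" by simp
  then show ?thesis unfolding idx by auto
 qed (use jl idx in auto)
 have split: "{t \<in> under_params m K b k. t < s} = (\<lambda>n. us k ! n) ` {n. n < length (us k) \<and> us k ! n < s}"
  unfolding us(2)[OF k, symmetric] by (auto simp: in_set_conv_nth)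
 have inj: "inj_on (\<lambda>n. us k ! n) {n. n < length (us k) \<and> us k ! n < s}"
  by (rule inj_onI) (metis (mono_tags, lifting) linorder_neqE_nat mem_Collect_eq order_less_irrefl us_less[OF k])
 have jc: "j = card {n. n < length (us k) \<and> us k ! n < s}" unfolding j_def split by (rule card_image[OF inj])
 have below: "us k ! n < s \<longleftrightarrow> n < j" if n: "n < length (us k)" for n
 proof
  assume a: "us k ! n < s"
  have "{..n} \<subseteq> {n. n < length (us k) \<and> us k ! n < s}"
  proof
   fix l assume "l \<in> {..n}"
   then have "l = n \<or> us k ! l < us k ! n" using us_less[OF k, of l n] n by (cases "l = n") auto
   then have "us k ! l < s" using a by auto
   then show "l \<in> {n. n < length (us k) \<and> us k ! n < s}" using \<open>l \<in> {..n}\<close> n by auto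
  qed
  then have "card {..n} \<le> j" unfolding jc by (intro card_mono) auto
  then show "n < j" by simp
 next
  assume a: "n < j"
  show "us k ! n < s"
  proof (rule ccontr)
   assume c: "\<not> us k ! n < s"
   have "{n. n < length (us k) \<and> us k ! n < s} \<subseteq> {..<n}"
   proof
    fix l assume l: "l \<in> {n. n < length (us k) \<and> us k ! n < s}"
    show "l \<in> {..<n}" using us_less[OF k, of n l] l c by (cases l n rule: linorder_cases) auto
   qed
   then have "j \<le> card {..<n}" unfolding jc by (intro card_mono) auto
   then show False using a by simp
  qed
 qed
 have ns: "us k ! n \<noteq> s" if "n < length (us k)" for n using us_bounds(3)[OF k that] nc by metis
 have "col k s = arc_col k j"
 proof (cases "s = b k")
  case True
  then have "j = 0" using us_bounds(1)[OF k] below jl by (metis gr0I less_le_not_le less_imp_le order_less_le_trans)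
  then show ?thesis using arc_col_base(1)[OF k] True by simp
 next
  case False
  show ?thesis
  proof (rule arc_col_eq[OF k jl])
   show "arc_start k j < s" using False s below[of "j - 1"] jl by (auto simp: arc_start_def)
   show "s < arc_end k j" using s below[of j] ns[of j] by (auto simp: arc_end_def)
  qed
 qed
 \<comment> \<open>Behind the last under-crossing the index wraps around to the first arc, which has
   the same colour.\<close>
 also have "\<dots> = arc_col k (j mod length (us k))"
  using jl arc_col_base[OF k] by (cases "j = length (us k)") (auto simp: mod_if)
 finally show "x (k, arc_index m K b k s) = col k s" by (simp add: x_def idx)
qed

lemma x_crossing:
 fixes D
 defines "D \<equiv> projection_diagram m K b"
 assumes i: "i \<in> {1..m}" and j: "1 \<le> j" "j \<le> under_crossings D i"
 shows "over_arc D i j \<in> arcs D" "crossing_sign D i j = 1 \<or> crossing_sign D i j = -1"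
  "x (i, j mod under_crossings D i + 1) =
   (if crossing_sign D i j = 1 then - x (over_arc D i j) + x (i, j) + x (over_arc D i j)
   else x (over_arc D i j) + x (i, j) - x (over_arc D i j))"
proof -
 have r: "under_crossings D i = length (us i)" by (simp add: D_def projection_diagram_def us(4)[OF i])
 have jr: "j - 1 < length (us i)" "j \<le> length (us i)" using j r by auto
 define t where "t = us i ! (j - 1)"
 have tu: "t = under_param m K b i j" by (simp add: t_def under_param_def us_def)
 have "crossed i t" unfolding t_def by (rule us_bounds(3)[OF i jr(1)])
 then obtain k s' where k: "k \<in> {1..m}" "passes_over K k s' i t" by (auto simp: crossed_def)
 \<comment> \<open>The parameter of the over-passing strand is shifted into the period that begins
   at its base point, as \<open>over_point\<close> requires.\<close>
 define n where "n = \<lfloor>s' - b k\<rfloor>"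
 define s where "s = s' - of_int n"
 have s: "s \<in> {b k..<b k + 1}" 
 proof -
  have "of_int n \<le> s' - b k" "s' - b k < of_int n + 1" unfolding n_def by linarith+
  then show ?thesis by (auto simp: s_def)
 qed
 have over: "passes_over K k s i t"
  using k pz_periodic[OF k(1), of s n] by (simp add: passes_over_iff s_def)
 have op: "over_point m K b i j = (k, s)"
  unfolding over_point_def
 proof (rule the_equality)
  show "fst (k, s) \<in> {1..m} \<and> snd (k, s) \<in> {b (fst (k, s))..<b (fst (k, s)) + 1} \<and>
   passes_over K (fst (k, s)) (snd (k, s)) i (under_param m K b i j)"
   using k(1) s over tu by simp
  fix q assume q: "fst q \<in> {1..m} \<and> snd q \<in> {b (fst q)..<b (fst q) + 1} \<and> passes_over K (fst q) (snd q) i (under_param m K b i j)"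
  have "K (fst q) (snd q) = K k s" using crossing_unique[OF i _ k(1) _ over] q tu by metis
  then have "fst q = k" "\<exists>n::int. snd q = s + of_int n" using K_inj q k(1) by blast+
  then obtain n :: int where n: "snd q = s + of_int n" by blast
  have "- 1 < (of_int n :: real)" "(of_int n :: real) < 1" using n q s \<open>fst q = k\<close> by auto
  then have "n = 0" by linarith
  then show "q = (k, s)" using n \<open>fst q = k\<close> by (simp add: prod_eq_iff)
 qed
 have nk: "\<not> crossed k s" by (rule over_not_crossed[OF i k(1) over])
 have oa: "over_arc D i j = (k, arc_index m K b k s)" by (simp add: D_def projection_diagram_def op)
 have xo: "x (over_arc D i j) = col k s" unfolding oa by (rule x_arc_index(1)[OF k(1) s nk])
 show "over_arc D i j \<in> arcs D"
  using x_arc_index(2)[OF k(1) s nk] k(1) unfolding oa arcs_def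
  by (simp add: D_def projection_diagram_def us(4)[OF k(1)])
 have cs: "crossing_sign D i j = (if Im (cnj (d k s) * d i t) > 0 then 1 else -1)"
  by (simp add: D_def projection_diagram_def op d_def tu)
 then show "crossing_sign D i j = 1 \<or> crossing_sign D i j = -1" by simp
 obtain e a a' where e: "e > 0" "!!s. t - e < s ==> s < t ==> \<not> crossed i s \<and> col i s = a"
  "!!s. t < s ==> s < t + e ==> \<not> crossed i s \<and> col i s = a'"
  "a' = (if Im (cnj (d k s) * d i t) > 0 then - col k s + a + col k s else col k s + a - col k s)"
  by (rule crossing_relation[OF i k(1) over]) (rule that)
 have a: "a = arc_col i (j - 1)"
 proof -
  have end_t: "arc_end i (j - 1) = t" using jr(1) by (simp add: arc_end_def t_def)
  define u where "u = max (t - e / 2) ((arc_start i (j - 1) + t) / 2)"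
  have "arc_start i (j - 1) < t" using arc_nonempty[OF i, of "j - 1"] jr end_t by simp
  then have u: "arc_start i (j - 1) < u" "u < t" "t - e < u" using e(1) by (auto simp: u_def max_def)
  show ?thesis using arc_col_eq[OF i _ u(1)] e(2)[OF u(3,2)] u(2) end_t jr by simp
 qed
 have a': "a' = arc_col i j"
 proof -
  have start_t: "arc_start i j = t" using j(1) by (simp add: arc_start_def t_def)
  define u where "u = min (t + e / 2) ((arc_end i j + t) / 2)"
  have "t < arc_end i j" using arc_nonempty[OF i jr(2)] start_t by simp
  then have u: "t < u" "u < arc_end i j" "u < t + e" using e(1) by (auto simp: u_def min_def)
  show ?thesis using arc_col_eq[OF i jr(2) _ u(2)] e(3)[OF u(1,3)] u(1) start_t by simp
 qed
 have "arc_col i (j mod length (us i)) = arc_col i j"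
  using jr(2) arc_col_base[OF i] by (cases "j = length (us i)") (auto simp: mod_if)
 then show "x (i, j mod under_crossings D i + 1) =
   (if crossing_sign D i j = 1 then - x (over_arc D i j) + x (i, j) + x (over_arc D i j)
   else x (over_arc D i j) + x (i, j) - x (over_arc D i j))"
  using e(4) a a' unfolding xo cs r by (simp add: x_def)
qed

end

end

text \<open>In the first half of the time every point is raised to a height \<open>M\<close> above
  the whole link, in the second half it moves straight to the point at height \<open>M\<close> over
  the origin. Raising never leaves \<open>above\<close>, and above the link any motion is
  free.\<close>

lemma (in projection) above_contractible:
 obtains F :: "real => complex \<times> real => complex \<times> real" and c where
  "continuous_on ({0..1} \<times> above) (\<lambda>(s, x). F s x)" "!!s x. s \<in> {0..1} ==> x \<in> above ==> F s x \<in> above"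
  "!!x. x \<in> above ==> F 0 x = x" "!!x. x \<in> above ==> F 1 x = c"
proof -
 obtain M where M: "!!i t. i \<in> {1..m} ==> \<bar>z i t\<bar> < M" by (rule height_bound) blast
 define \<alpha> \<beta> where "\<alpha> s = min 1 (2 * s)" and "\<beta> s = max 0 (2 * s - 1)" for s :: real
 define F :: "real => complex \<times> real => complex \<times> real" where
  "F s x = ((1 - \<beta> s) *\<^sub>R fst x, (1 - \<beta> s) * ((1 - \<alpha> s) * snd x + \<alpha> s * max (snd x) M) + \<beta> s * M)" for s x
 have "continuous_on ({0..1} \<times> above) (\<lambda>(s, x). F s x)"
  unfolding F_def \<alpha>_def \<beta>_def case_prod_unfold by (intro continuous_intros)
 moreover have "F s x \<in> above" if s: "s \<in> {0..1}" and x: "x \<in> above" for s x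
 proof (cases "s \<le> 1/2")
  case True
  then have b: "\<beta> s = 0" and a: "0 \<le> \<alpha> s" "\<alpha> s \<le> 1" using s by (auto simp: \<alpha>_def \<beta>_def)
  have "\<alpha> s * snd x \<le> \<alpha> s * max (snd x) M" using a(1) by (intro mult_left_mono) auto
  then have "snd x \<le> snd (F s x)" using b by (simp add: F_def algebra_simps)
  moreover have "fst (F s x) = fst x" using b by (simp add: F_def)
  ultimately show ?thesis using x unfolding above_def by (auto intro: less_le_trans)
 next
  case False
  then have a: "\<alpha> s = 1" and b: "0 \<le> \<beta> s" "\<beta> s \<le> 1" using s by (auto simp: \<alpha>_def \<beta>_def)
  have "(1 - \<beta> s) * M \<le> (1 - \<beta> s) * max (snd x) M" using b(2) by (intro mult_left_mono) auto
  then have "M \<le> snd (F s x)" using a by (simp add: F_def algebra_simps)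
  then have "z j u < snd (F s x)" if "j \<in> {1..m}" for j u using M[OF that, of u] by linarith
  then show ?thesis unfolding above_def by blast
 qed
 moreover have "F 0 x = x" for x by (simp add: F_def \<alpha>_def \<beta>_def)
 moreover have "F 1 x = (0, M)" for x by (simp add: F_def \<alpha>_def \<beta>_def)
 ultimately show ?thesis by (rule that)
qed

text \<open>The gauge that makes the cocycle vanish on the contractible set \<open>above\<close>
  brings it into the form that \<open>colouring\<close> assumes.\<close>

lemma (in meridian_data) diagram_colouring:
 assumes reg: "regular_projection m K" and rep: "link_rep UNIV m (\<lambda>i. range (K i)) \<tau>"
  and base: "!!i. i \<in> {1..m} ==> b i \<notin> under_params m K b i"
 defines "D \<equiv> projection_diagram m K b"
 obtains x :: "nat \<times> nat => 'g" where
  "!!i. i \<in> {1..m} ==> x (i, 1) \<in> conj_class i" "!!i. i \<in> {1..m} ==> \<theta> i (x (i, 1)) = 1"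
  "!!i j. i \<in> {1..m} ==> 1 \<le> j ==> j \<le> under_crossings D i ==> over_arc D i j \<in> arcs D"
  "!!i j. i \<in> {1..m} ==> 1 \<le> j ==> j \<le> under_crossings D i ==> crossing_sign D i j = 1 \<or> crossing_sign D i j = -1"
  "!!i j. i \<in> {1..m} ==> 1 \<le> j ==> j \<le> under_crossings D i ==> x (i, j mod under_crossings D i + 1) =
   (if crossing_sign D i j = 1 then - x (over_arc D i j) + x (i, j) + x (over_arc D i j)
   else x (over_arc D i j) + x (i, j) - x (over_arc D i j))"
proof -
 interpret P: projection m K by unfold_locales (rule reg)
 obtain F :: "real => complex \<times> real => complex \<times> real" and c where F: "continuous_on ({0..1} \<times> P.above) (\<lambda>(s, x). F s x)"
  "!!s x. s \<in> {0..1} ==> x \<in> P.above ==> F s x \<in> P.above"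
  "!!x. x \<in> P.above ==> F 0 x = x" "!!x. x \<in> P.above ==> F 1 x = c"
  by (rule P.above_contractible) (rule that)
 have sub: "P.above \<subseteq> UNIV - (\<Union>i\<in>{1..m}. range (K i))" by (force simp: P.above_def P.K_eq)
 have "local_cocycle (UNIV - (\<Union>i\<in>{1..m}. range (K i))) \<tau>" using rep by (simp add: link_rep_def)
 note coc = local_cocycle_subset[OF this sub]
 have "\<exists>h. locally2 P.above (\<lambda>y z. \<tau> y z = - h y + h z)"
  by (rule contractible_coboundary[OF coc F])
 then obtain h where h: "locally2 P.above (\<lambda>y z. \<tau> y z = - h y + h z)" by (elim exE) (rule that)
 define \<sigma> where "\<sigma> y z = h y + \<tau> y z - h z" for y z
 interpret C: colouring m K H \<theta> \<sigma>
 proof unfold_locales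
  show "link_rep UNIV m (\<lambda>i. range (K i)) \<sigma>" unfolding \<sigma>_def[abs_def] by (rule link_rep_gauge[OF rep])
  show "locally2 P.above (\<lambda>y z. \<sigma> y z = 0)"
   by (rule locally2_mono[OF h subset_refl]) (simp add: \<sigma>_def gnorm del: add_uminus_conv_diff)
 qed
 show ?thesis
 proof (rule that[of "C.x b"])
  show "C.x b (i, 1) \<in> conj_class i" if "i \<in> {1..m}" for i
   by (rule C.x_meridian(1)[OF base that])
  show "\<theta> i (C.x b (i, 1)) = 1" if "i \<in> {1..m}" for i
   by (rule C.x_meridian(2)[OF base that])
  show "over_arc D i j \<in> arcs D" if "i \<in> {1..m}" "1 \<le> j" "j \<le> under_crossings D i" for i j
   unfolding D_def by (rule C.x_crossing(1)[OF base that[unfolded D_def]])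
  show "crossing_sign D i j = 1 \<or> crossing_sign D i j = -1" if "i \<in> {1..m}" "1 \<le> j" "j \<le> under_crossings D i" for i j
   unfolding D_def by (rule C.x_crossing(2)[OF base that[unfolded D_def]])
  show "C.x b (i, j mod under_crossings D i + 1) =
   (if crossing_sign D i j = 1 then - C.x b (over_arc D i j) + C.x b (i, j) + C.x b (over_arc D i j)
   else C.x b (over_arc D i j) + C.x b (i, j) - C.x b (over_arc D i j))"
   if "i \<in> {1..m}" "1 \<le> j" "j \<le> under_crossings D i" for i j
   unfolding D_def by (rule C.x_crossing(3)[OF base that[unfolded D_def]])
 qed
qed

section \<open>Power series in non-commuting variables over the integers modulo 2\<close>

text \<open>A type of its own lets series form a ring in the sense of the type classes. In
  characteristic 2 the negative of a series is the series itself.\<close>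

typedef ncs = "UNIV :: nc_series set" morphisms coeff Ncs by simp

lemma coeff_Ncs [simp]: "coeff (Ncs f) = f"
 by (simp add: Ncs_inverse)

lemma ncs_eqI: "(!!w. coeff f w = coeff g w) ==> f = g"
 by (metis coeff_inject ext)

lemma bit_add_self: "a + a = 0" for a :: bit
 by (cases a) simp_all

lemma bit_add_self_left: "a + (a + b) = b" for a b :: bit
 by (cases a; cases b) simp_all

lemma bit_mult_self: "a * a = a" for a :: bit
 by (cases a) simp_all

lemma bit_mult_self_left: "a * (a * b) = a * b" for a b :: bit
 by (cases a; cases b) simp_all

lemma bit_solve: "a + (b + c) = b + (d + e) ==> c = e + d + a" for a b c d e :: bit
 by (cases a; cases b; cases c; cases d; cases e) simp_all

lemma bit_cancel: "a + b = b ==> a = 0" "b + a = b ==> a = 0" for a b :: bit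
 by (cases a; cases b; simp)+

lemma bit_add_eq_0: "a + b = 0 \<longleftrightarrow> a = b" for a b :: bit
 by (cases a; cases b) simp_all

lemmas bit_ring = bit_add_self bit_add_self_left bit_mult_self bit_mult_self_left
 distrib_left distrib_right add.assoc mult.assoc add.commute mult.commute add.left_commute mult.left_commute
 add_0_left add_0_right mult_zero_left mult_zero_right mult_1_left mult_1_right

instantiation ncs :: ring_1
begin

definition "0 = Ncs (\<lambda>_. 0)"
definition "1 = Ncs nc_one"
definition "f + g = Ncs (\<lambda>w. coeff f w + coeff g w)"
definition "f - g = Ncs (\<lambda>w. coeff f w + coeff g w)" for f g :: ncs
definition "- f = f" for f :: ncs
definition "f * g = Ncs (nc_mult (coeff f) (coeff g))"

lemma coeff_simps:
 "coeff 0 w = 0" "coeff 1 w = (if w = [] then 1 else 0)" "coeff (f + g) w = coeff f w + coeff g w"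
 "coeff (f - g) w = coeff f w + coeff g w" "coeff (- f) w = coeff f w"
 by (simp_all only: zero_ncs_def one_ncs_def plus_ncs_def minus_ncs_def uminus_ncs_def coeff_Ncs nc_one_def)

lemma coeff_times: "coeff (f * g) w = (\<Sum>k\<le>length w. coeff f (take k w) * coeff g (drop k w))"
 by (simp only: times_ncs_def coeff_Ncs nc_mult_def)

instance
proof
 fix a b c :: ncs
 show "a + b + c = a + (b + c)" "a + b = b + a" "0 + a = a" "- a + a = 0" "a - b = a + - b"
  by (rule ncs_eqI, simp only: coeff_simps bit_ring)+
 show "a * b * c = a * (b * c)" by (simp only: times_ncs_def coeff_Ncs nc_mult_assoc)
 show "(a + b) * c = a * c + b * c" "a * (b + c) = a * b + a * c"
  by (rule ncs_eqI, simp only: coeff_times coeff_simps distrib_left distrib_right sum.distrib)+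
 show "1 * a = a" by (rule ncs_eqI) (simp only: times_ncs_def one_ncs_def coeff_Ncs nc_mult_one_left)
 show "a * 1 = a"
 proof (rule ncs_eqI)
  fix w
  have "coeff (a * 1) w = (\<Sum>k\<in>{length w}. coeff a (take k w) * coeff 1 (drop k w))"
   unfolding coeff_times by (rule sum.mono_neutral_right) (auto simp: coeff_simps)
  then show "coeff (a * 1) w = coeff a w" by (simp add: coeff_simps)
 qed
 show "(0::ncs) \<noteq> 1"
 proof
  assume "(0::ncs) = 1"
  then have "coeff 0 [] = coeff 1 []" by simp
  then show False by (simp add: coeff_simps)
 qed
qed

end

lemma ncs_add_self: "f + f = 0" "f + (f + g) = g" for f g :: ncs
 by (rule ncs_eqI, simp only: coeff_simps bit_ring)+

lemmas coeff_expand = coeff_times list.size add_0_right add_Suc_right sum.atMost_Suc atMost_0 sum.empty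
 sum.insert finite.emptyI empty_iff not_False_eq_True take_Suc_Cons take_0 drop_Suc_Cons drop_0 take_Nil drop_Nil

lemma coeff_mult:
 "coeff (f * g) [] = coeff f [] * coeff g []"
 "coeff (f * g) [x] = coeff f [] * coeff g [x] + coeff f [x] * coeff g []"
 "coeff (f * g) [x, y] = coeff f [] * coeff g [x, y] + coeff f [x] * coeff g [y] + coeff f [x, y] * coeff g []"
 "coeff (f * g) [x, y, z] = coeff f [] * coeff g [x, y, z] + coeff f [x] * coeff g [y, z]
  + coeff f [x, y] * coeff g [z] + coeff f [x, y, z] * coeff g []"
 "coeff (f * g) [x, y, z, t] = coeff f [] * coeff g [x, y, z, t] + coeff f [x] * coeff g [y, z, t]
  + coeff f [x, y] * coeff g [z, t] + coeff f [x, y, z] * coeff g [t] + coeff f [x, y, z, t] * coeff g []"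
 by (simp_all only: coeff_expand)

subsection \<open>Units with constant term 1\<close>

text \<open>The left inverse of a series with constant term 1, solved degree by degree; no sign
  appears modulo 2.\<close>

function ncinv :: "nc_series => nc_series" where
 "ncinv f w = (if w = [] then 1 else (\<Sum>k<length w. ncinv f (take k w) * f (drop k w)))"
 by auto
termination by (relation "Wellfounded.measure (\<lambda>(f, w). length w)") auto

declare ncinv.simps [simp del]

typedef mag = "{f. coeff f [] = 1}" morphisms ser Mag
 by (rule exI[of _ 1]) (simp add: coeff_simps)

lemma ser_Nil [simp]: "coeff (ser f) [] = 1"
 using ser[of f] by simp

lemma mag_eqI: "ser f = ser g ==> f = g"
 by (simp add: ser_inject)

instantiation mag :: group_add
begin

definition "0 = Mag 1"
definition "f + g = Mag (ser f * ser g)"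
definition "- f = Mag (Ncs (ncinv (coeff (ser f))))"
definition "f - g = f + - g" for f g :: mag

lemma ser_zero: "ser 0 = 1"
 by (simp add: zero_mag_def Mag_inverse coeff_simps)

lemma ser_plus: "ser (f + g) = ser f * ser g"
 by (simp add: plus_mag_def Mag_inverse coeff_mult)

lemma ser_uminus: "ser (- f) * ser f = 1"
proof -
 have s: "ser (- f) = Ncs (ncinv (coeff (ser f)))"
  by (simp add: uminus_mag_def Mag_inverse ncinv.simps)
 show ?thesis
 proof (rule ncs_eqI)
  fix w
  show "coeff (ser (- f) * ser f) w = coeff 1 w"
  proof (cases "w = []")
   case True
   then show ?thesis by (simp only: coeff_mult coeff_simps ser_Nil) simp
  next
   case False
   have "coeff (ser (- f) * ser f) w = (\<Sum>k<length w. ncinv (coeff (ser f)) (take k w) * coeff (ser f) (drop k w))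
     + ncinv (coeff (ser f)) w"
    unfolding s coeff_times coeff_Ncs lessThan_Suc_atMost[symmetric] sum.lessThan_Suc by simp
   also have "\<dots> = 0" using False by (subst (2) ncinv.simps) (simp only: bit_ring if_False)
   finally show ?thesis using False by (simp only: coeff_simps if_False)
  qed
 qed
qed

instance
proof
 fix a b c :: mag
 show "a + b + c = a + (b + c)" "0 + a = a" "a + 0 = a" "- a + a = 0"
  by (rule mag_eqI, simp add: ser_plus ser_zero ser_uminus mult.assoc)+
 show "a + - b = a - b" by (simp add: minus_mag_def)
qed

end

subsection \<open>The normal subgroup\<close>

text \<open>The coefficients \<open>[k, l, l, k]\<close> are unconstrained. The subgroup is normal, although its
 members minus 1 do not form an ideal.\<close>

definition good_coeffs :: "nc_series => bool" where
 "good_coeffs c \<longleftrightarrow>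
  (\<forall>k. c [k, k] = 0 \<and> c [k, k, k] = 0 \<and> c [k, k, k, k] = 0) \<and>
  (\<forall>k l. k \<noteq> l --> c [k, l, k] = 0 \<and> c [k, l, l] = c [l, k, k] \<and> c [l, k, k] = c [k, k, l] \<and> c [k, k, l] = c [l, l, k]) \<and>
  (\<forall>k l. k \<noteq> l --> c [k, l, k, l] = c [l, k, l, k] \<and> c [k, k, l, l] = c [l, l, k, k] \<and>
    c [k, k, k, l] = c [k, k, l, k] \<and> c [k, k, l, k] = c [k, l, k, k] \<and> c [k, l, k, k] = c [l, k, k, k]) \<and>
  (\<forall>k l j. distinct [k, l, j] --> c [k, l, k, j] = 0 \<and> c [k, l, j, k] = 0 \<and> c [l, k, j, k] = 0)"

definition repeated :: "ncs set" where
 "repeated = {f. \<forall>w. distinct w --> coeff f w = 0}"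

lemma repeated_add: "f \<in> repeated ==> g \<in> repeated ==> f + g \<in> repeated"
 by (simp add: repeated_def coeff_simps)

lemma repeated_zero: "0 \<in> repeated"
 by (simp add: repeated_def coeff_simps)

text \<open>A two-sided ideal: the two parts of a word with distinct letters have distinct
  letters.\<close>

lemma repeated_mult:
 assumes "f \<in> repeated" shows "f * g \<in> repeated" "g * f \<in> repeated"
proof -
 have 0: "coeff f (take k w) = 0" "coeff f (drop k w) = 0" if "distinct w" for w k
  using assms that by (simp_all add: repeated_def)
 show "f * g \<in> repeated" "g * f \<in> repeated"
  unfolding repeated_def mem_Collect_eq coeff_times
  by (intro allI impI sum.neutral ballI; simp only: 0 mult_zero_left mult_zero_right)+
qed

definition magN :: "mag set" where
 "magN = {f. ser f + 1 \<in> repeated \<and> good_coeffs (coeff (ser f))}"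

lemma magN_distinct:
 assumes "f \<in> magN" "w \<noteq> []" "distinct w" shows "coeff (ser f) w = 0"
 using assms by (auto simp: magN_def repeated_def coeff_simps)

text \<open>Words with two distinct letters are excluded by \<open>repeated\<close>, squares by
  \<open>good_coeffs\<close>. So the members of \<open>magN\<close> begin in degree 3, and the
  calculations up to degree 4 become linear.\<close>

lemma magN_low:
 assumes "f \<in> magN"
 shows "coeff (ser f) [x] = 0" "coeff (ser f) [x, y] = 0"
proof -
 have r: "w \<noteq> [] ==> distinct w ==> coeff (ser f) w = 0" for w
  using assms by (auto simp: magN_def repeated_def coeff_simps)
 show "coeff (ser f) [x] = 0" by (rule r) simp_all
 show "coeff (ser f) [x, y] = 0"
  using assms r[of "[x, y]"] by (cases "x = y") (auto simp: magN_def good_coeffs_def)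
qed

lemma magN_zero: "0 \<in> magN"
 by (simp add: magN_def ser_zero good_coeffs_def coeff_simps ncs_add_self repeated_zero)

lemma good_coeffsD:
 assumes "good_coeffs c"
 shows "c [k, k] = 0" "c [k, k, k] = 0" "c [k, k, k, k] = 0"
  "k \<noteq> l ==> c [k, l, k] = 0" "k \<noteq> l ==> c [k, l, l] = c [l, k, k]" "k \<noteq> l ==> c [l, k, k] = c [k, k, l]"
  "k \<noteq> l ==> c [k, k, l] = c [l, l, k]"
  "k \<noteq> l ==> c [k, l, k, l] = c [l, k, l, k]" "k \<noteq> l ==> c [k, k, l, l] = c [l, l, k, k]"
  "k \<noteq> l ==> c [k, k, k, l] = c [k, k, l, k]" "k \<noteq> l ==> c [k, k, l, k] = c [k, l, k, k]"
  "k \<noteq> l ==> c [k, l, k, k] = c [l, k, k, k]"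
  "distinct [k, l, j] ==> c [k, l, k, j] = 0" "distinct [k, l, j] ==> c [k, l, j, k] = 0"
  "distinct [k, l, j] ==> c [l, k, j, k] = 0"
proof -
 note P = assms[unfolded good_coeffs_def]
 show "c [k, k] = 0" "c [k, k, k] = 0" "c [k, k, k, k] = 0"
  using P[THEN conjunct1, rule_format, of k] by blast+
 assume kl: "k \<noteq> l"
 show "c [k, l, k] = 0" "c [k, l, l] = c [l, k, k]" "c [l, k, k] = c [k, k, l]" "c [k, k, l] = c [l, l, k]"
  using P[THEN conjunct2, THEN conjunct1, rule_format, OF kl] by blast+
 show "c [k, l, k, l] = c [l, k, l, k]" "c [k, k, l, l] = c [l, l, k, k]"
  "c [k, k, k, l] = c [k, k, l, k]" "c [k, k, l, k] = c [k, l, k, k]" "c [k, l, k, k] = c [l, k, k, k]"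
  using P[THEN conjunct2, THEN conjunct2, THEN conjunct1, rule_format, OF kl] by blast+
next
 assume klj: "distinct [k, l, j]"
 show "c [k, l, k, j] = 0" "c [k, l, j, k] = 0" "c [l, k, j, k] = 0"
  using assms[unfolded good_coeffs_def, THEN conjunct2, THEN conjunct2, THEN conjunct2, rule_format, OF klj] by blast+
qed

lemma good_coeffsI:
 assumes "!!k. c [k, k] = 0 \<and> c [k, k, k] = 0 \<and> c [k, k, k, k] = 0"
  "!!k l. k \<noteq> l ==> c [k, l, k] = 0 \<and> c [k, l, l] = c [l, k, k] \<and> c [l, k, k] = c [k, k, l] \<and> c [k, k, l] = c [l, l, k]"
  "!!k l. k \<noteq> l ==> c [k, l, k, l] = c [l, k, l, k] \<and> c [k, k, l, l] = c [l, l, k, k] \<and>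
    c [k, k, k, l] = c [k, k, l, k] \<and> c [k, k, l, k] = c [k, l, k, k] \<and> c [k, l, k, k] = c [l, k, k, k]"
  "!!k l j. distinct [k, l, j] ==> c [k, l, k, j] = 0 \<and> c [k, l, j, k] = 0 \<and> c [l, k, j, k] = 0"
 shows "good_coeffs c"
 unfolding good_coeffs_def
 by (rule conjI[OF _ conjI[OF _ conjI]]; intro allI impI; rule assms; assumption?)

lemma good_coeffs_cong:
 assumes "good_coeffs c" "!!x y. d [x, y] = c [x, y]" "!!x y z. d [x, y, z] = c [x, y, z]"
  "!!x y z t. d [x, y, z, t] = c [x, y, z, t]"
 shows "good_coeffs d"
 using assms(1) unfolding good_coeffs_def assms(2-4) .

lemma good_coeffs_add:
 assumes "good_coeffs c" "good_coeffs d"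
 shows "good_coeffs (\<lambda>w. c w + d w)"
proof (rule good_coeffsI, goal_cases)
 case (1 k)
 then show ?case by (simp only: good_coeffsD(1-3)[OF assms(1)] good_coeffsD(1-3)[OF assms(2)]) simp
next
 case (2 k l)
 then show ?case
  by (simp only: good_coeffsD(4)[OF assms(1) 2] good_coeffsD(4)[OF assms(2) 2] good_coeffsD(5-7)[OF assms(1) 2]
    good_coeffsD(5-7)[OF assms(2) 2]) simp
next
 case (3 k l)
 then show ?case
  by (simp only: good_coeffsD(8-12)[OF assms(1) 3] good_coeffsD(8-12)[OF assms(2) 3])
next
 case (4 k l j)
 then show ?case
  by (simp only: good_coeffsD(13-15)[OF assms(1) 4] good_coeffsD(13-15)[OF assms(2) 4]) simp
qed

lemma magN_add:
 assumes "f \<in> magN" "g \<in> magN" shows "f + g \<in> magN"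
proof -
 have "ser (f + g) + 1 = (ser f + 1) * ser g + (ser g + 1)"
  by (simp add: ser_plus algebra_simps ncs_add_self)
 moreover have "(ser f + 1) * ser g + (ser g + 1) \<in> repeated"
  by (rule repeated_add[OF repeated_mult(1)]) (use assms in \<open>simp_all add: magN_def\<close>)
 ultimately have "ser (f + g) + 1 \<in> repeated" by (simp only:)
 moreover have "good_coeffs (coeff (ser (f + g)))"
 proof (rule good_coeffs_cong[OF good_coeffs_add])
  show "good_coeffs (coeff (ser f))" "good_coeffs (coeff (ser g))" using assms by (simp_all add: magN_def)
 qed (simp_all only: ser_plus coeff_mult magN_low[OF assms(1)] magN_low[OF assms(2)] ser_Nil bit_ring)
 ultimately show ?thesis by (simp add: magN_def)
qed

text \<open>For a series 1 + h with h beginning in degree 3, the inverse is 1 + h up to degree 5 in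
  characteristic 2.\<close>

lemma magN_minus:
 assumes f: "f \<in> magN" shows "- f \<in> magN"
proof -
 let ?g = "ser (- f)"
 have m: "?g * ser f = 1" by (rule ser_uminus)
 have "?g + 1 = ?g * (ser f + 1)"
  by (simp add: algebra_simps m)
 then have r: "?g + 1 \<in> repeated" using f by (simp add: magN_def repeated_mult)
 have e: "coeff (?g * ser f) w = coeff 1 w" for w by (simp add: m)
 have 1: "coeff ?g [x] = 0" for x
  using e[of "[x]"] by (simp only: coeff_mult coeff_simps magN_low[OF f] ser_Nil bit_ring) simp
 have 2: "coeff ?g [x, y] = 0" for x y
  using e[of "[x, y]"] by (simp only: coeff_mult coeff_simps magN_low[OF f] ser_Nil 1 bit_ring) simp
 have "good_coeffs (coeff ?g)"
 proof (rule good_coeffs_cong[of "coeff (ser f)"])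
  show "good_coeffs (coeff (ser f))" using f by (simp add: magN_def)
  fix x y z t
  show "coeff ?g [x, y] = coeff (ser f) [x, y]" by (simp only: 2 magN_low[OF f])
  show "coeff ?g [x, y, z] = coeff (ser f) [x, y, z]"
   using e[of "[x, y, z]"] by (simp only: coeff_mult coeff_simps magN_low[OF f] 1 2 ser_Nil bit_ring)
    (simp only: list.simps if_False bit_add_eq_0)
  show "coeff ?g [x, y, z, t] = coeff (ser f) [x, y, z, t]"
   using e[of "[x, y, z, t]"] by (simp only: coeff_mult coeff_simps magN_low[OF f] 1 2 ser_Nil bit_ring)
    (simp only: list.simps if_False bit_add_eq_0)
 qed
 then show ?thesis using r by (simp add: magN_def)
qed

text \<open>Conjugation leaves degree 3 alone and changes degree 4 by the products of a coefficient
  of degree 3 with one of degree 1 on either side. The relations of degree 3, among them the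
  vanishing of \<open>[k, l, k]\<close>, ensure that these corrections obey the relations of degree
  4.\<close>

lemma magN_conj:
 assumes f: "f \<in> magN" shows "- u + f + u \<in> magN"
proof -
 define g where "g = ser (- u + f + u)"
 have "g + 1 = ser (- u) * (ser f + 1) * ser u"
  by (simp add: g_def ser_plus algebra_simps ser_uminus)
 then have r: "g + 1 \<in> repeated" using f by (simp add: magN_def repeated_mult)
 have "u + (- u + f + u) = f + u" by (simp add: add.assoc)
 then have m: "ser u * g = ser f * ser u" by (metis ser_plus g_def)
 have e: "coeff (ser u * g) w = coeff (ser f * ser u) w" for w by (simp add: m)
 have g0: "coeff g [] = 1" by (simp add: g_def)
 have low: "w \<noteq> [] ==> distinct w ==> coeff g w = 0" for w
  using r by (auto simp: repeated_def coeff_simps)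
 have g1: "coeff g [x] = 0" for x by (rule low) simp_all
 have g2: "coeff g [x, y] = 0" for x y
  using e[of "[x, y]"] by (simp only: coeff_mult magN_low[OF f] g1 ser_Nil g0 bit_ring) (erule bit_cancel)
 have g3: "coeff g [x, y, z] = coeff (ser f) [x, y, z]" for x y z
  using e[of "[x, y, z]"] by (simp only: coeff_mult magN_low[OF f] g1 g2 ser_Nil g0 bit_ring) (metis add_right_cancel)
 \<comment> \<open>Obtained by comparing coefficients in u g = f u, which avoids the coefficients of
   the inverse of \<open>u\<close>.\<close>
 have g4: "coeff g [x, y, z, t] = coeff (ser f) [x, y, z, t] + coeff (ser f) [x, y, z] * coeff (ser u) [t]
  + coeff (ser u) [x] * coeff (ser f) [y, z, t]" for x y z t
 proof -
  have "coeff (ser u) [x] * coeff (ser f) [y, z, t] + (coeff (ser u) [x, y, z, t] + coeff g [x, y, z, t]) =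
   coeff (ser u) [x, y, z, t] + (coeff (ser f) [x, y, z] * coeff (ser u) [t] + coeff (ser f) [x, y, z, t])"
   using e[of "[x, y, z, t]"] by (simp only: coeff_mult magN_low[OF f] g1 g2 g3 ser_Nil g0 bit_ring)
  then show ?thesis by (rule bit_solve)
 qed
 have d3: "coeff (ser f) [x, y, z] = 0" if "distinct [x, y, z]" for x y z
  by (rule magN_distinct[OF f _ that]) simp
 have gf: "good_coeffs (coeff (ser f))" using f by (simp add: magN_def)
 have "good_coeffs (coeff g)"
 proof (rule good_coeffsI, goal_cases)
  case (1 k)
  then show ?case by (simp only: g2 g3 g4 good_coeffsD(1-3)[OF gf] bit_ring simp_thms)
 next
  case (2 k l)
  then show ?case by (simp only: g3 good_coeffsD(4)[OF gf 2] good_coeffsD(5-7)[OF gf 2] simp_thms)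
 next
  case (3 k l)
  then show ?case
   by (simp only: g4 good_coeffsD(2)[OF gf] good_coeffsD(4)[OF gf 3] good_coeffsD(4)[OF gf 3[symmetric]]
     good_coeffsD(5-12)[OF gf 3] bit_ring simp_thms)
 next
  case (4 k l j)
  then have d: "k \<noteq> l" "l \<noteq> k" "k \<noteq> j" "j \<noteq> k" "distinct [l, k, j]" "distinct [l, j, k]" "distinct [k, l, j]" "distinct [k, j, l]" by auto
  show ?case
   by (simp only: g4 good_coeffsD(13-15)[OF gf 4] good_coeffsD(4)[OF gf d(1)] good_coeffsD(4)[OF gf d(2)]
     good_coeffsD(4)[OF gf d(3)] good_coeffsD(4)[OF gf d(4)] d3[OF d(5)] d3[OF d(6)] d3[OF d(7)] d3[OF d(8)] bit_ring simp_thms)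
 qed
 then show ?thesis using r by (simp add: magN_def g_def)
qed

subsection \<open>The quotient group\<close>

lemma magN_rel_equivp: "equivp (\<lambda>f g :: mag. - f + g \<in> magN)"
proof (rule equivpI)
 show "reflp (\<lambda>f g :: mag. - f + g \<in> magN)" by (rule reflpI) (simp add: magN_zero)
 show "symp (\<lambda>f g :: mag. - f + g \<in> magN)"
  by (rule sympI) (metis magN_minus minus_add minus_minus)
 show "transp (\<lambda>f g :: mag. - f + g \<in> magN)"
 proof (rule transpI)
  fix f g h :: mag assume "- f + g \<in> magN" "- g + h \<in> magN"
  from magN_add[OF this] show "- f + h \<in> magN" by (simp add: add.assoc)
 qed
qed

quotient_type mq = mag / "\<lambda>f g :: mag. - f + g \<in> magN"
 by (rule magN_rel_equivp)

instantiation mq :: group_add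
begin

lift_definition zero_mq :: mq is 0 .

lift_definition plus_mq :: "mq => mq => mq" is "(+)"
proof -
 fix f f' g g' :: mag assume n: "- f + f' \<in> magN" "- g + g' \<in> magN"
 from magN_add[OF magN_conj[OF n(1), of g] n(2)]
 show "- (f + g) + (f' + g') \<in> magN" by (simp add: minus_add add.assoc del: add_uminus_conv_diff uminus_add_conv_diff)
qed

lift_definition uminus_mq :: "mq => mq" is uminus
proof -
 fix f f' :: mag assume n: "- f + f' \<in> magN"
 from magN_conj[OF magN_minus[OF n], of "- f"]
 show "- (- f) + - f' \<in> magN" by (simp add: minus_add add.assoc del: add_uminus_conv_diff)
qed

definition "a - b = a + - b" for a b :: mq

instance
proof
 fix a b c :: mq
 show "a + b + c = a + (b + c)" by transfer (simp add: add.assoc magN_zero)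
 show "0 + a = a" "a + 0 = a" "- a + a = 0" by (transfer, simp add: magN_zero)+
 show "a + - b = a - b" by (simp add: minus_mq_def)
qed

end

lift_definition proj :: "mag => mq" is "\<lambda>f. f" .

lemma proj_eq_iff: "proj f = proj g \<longleftrightarrow> - f + g \<in> magN"
 by transfer simp

lemma proj_simps: "proj 0 = 0" "proj (f + g) = proj f + proj g" "proj (- f) = - proj f"
 by (transfer, simp add: magN_zero)+

lemma proj_surj: "\<exists>f. proj f = a"
proof transfer
 show "\<exists>f. - f + a \<in> magN" for a :: mag by (rule exI[of _ a]) (simp add: magN_zero)
qed

text \<open>The coefficient of degree 1 passes to the quotient since members of \<open>magN\<close>
  have none. It is additive because constant terms are 1.\<close>

lift_definition mq_theta :: "nat => mq => bit" is "\<lambda>i f. coeff (ser f) [i]"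
proof -
 fix i and f g :: mag assume n: "- f + g \<in> magN"
 have "coeff (ser (f + (- f + g))) [i] = coeff (ser f) [i]"
  using magN_low(1)[OF n, of i] by (simp only: ser_plus coeff_mult ser_Nil mult_1_left mult_1_right) simp
 then show "coeff (ser f) [i] = coeff (ser g) [i]" by simp
qed

lemma mq_theta_proj: "mq_theta i (proj f) = coeff (ser f) [i]"
 by transfer (rule refl)

section \<open>Meridians in the quotient group and their commutation\<close>

definition single :: "nat => mag set" where
 "single i = {f. \<forall>w. coeff (ser f) w \<noteq> 0 --> set w \<subseteq> {i}}"

lemma single_zero: "0 \<in> single i"
 by (simp add: single_def ser_zero coeff_simps)

lemma coeff_times_nonzero:
 assumes "coeff (f * g) w \<noteq> 0"
 obtains k where "coeff f (take k w) \<noteq> 0" "coeff g (drop k w) \<noteq> 0"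
 using assms unfolding coeff_times by (metis (no_types, lifting) mult_not_zero sum.not_neutral_contains_not_neutral)

lemma single_add: assumes "f \<in> single i" "g \<in> single i" shows "f + g \<in> single i"
proof -
 have "set w \<subseteq> {i}" if w: "coeff (ser f * ser g) w \<noteq> 0" for w
 proof -
  obtain k where "coeff (ser f) (take k w) \<noteq> 0" "coeff (ser g) (drop k w) \<noteq> 0" by (rule coeff_times_nonzero[OF w])
  then have "set (take k w) \<subseteq> {i}" "set (drop k w) \<subseteq> {i}" using assms by (auto simp: single_def)
  then have "set (take k w @ drop k w) \<subseteq> {i}" unfolding set_append by blast
  then show ?thesis by (simp only: append_take_drop_id)
 qed
 then show ?thesis by (simp add: single_def ser_plus)
qed

lemma single_minus: assumes f: "f \<in> single i" shows "- f \<in> single i"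
proof -
 have "set w \<subseteq> {i}" if w: "coeff (ser (- f)) w \<noteq> 0" for w using w
 proof (induction "length w" arbitrary: w rule: less_induct)
  case (less w)
  show ?case
  proof (cases "w = []")
   case False
   have "coeff (ser (- f) * ser f) w = 0" using False by (simp add: ser_uminus coeff_simps)
   moreover have "coeff (ser (- f) * ser f) w = (\<Sum>k<length w. coeff (ser (- f)) (take k w) * coeff (ser f) (drop k w)) + coeff (ser (- f)) w"
    unfolding coeff_times by (simp only: lessThan_Suc_atMost[symmetric] sum.lessThan_Suc take_all drop_all order_refl ser_Nil mult_1_right)
   ultimately have "(\<Sum>k<length w. coeff (ser (- f)) (take k w) * coeff (ser f) (drop k w)) \<noteq> 0"
    using less.prems by auto
   then obtain k where k: "k < length w" "coeff (ser (- f)) (take k w) * coeff (ser f) (drop k w) \<noteq> 0"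
    by (metis (no_types, lifting) lessThan_iff sum.not_neutral_contains_not_neutral)
   then have "set (take k w) \<subseteq> {i}" "set (drop k w) \<subseteq> {i}"
    using less.hyps[of "take k w"] f by (auto simp: single_def)
   then have "set (take k w @ drop k w) \<subseteq> {i}" unfolding set_append by blast
   then show ?thesis by (simp only: append_take_drop_id)
  qed simp
 qed
 then show ?thesis by (simp add: single_def)
qed

definition mq_H :: "nat => mq set" where
 "mq_H i = proj ` single i"

text \<open>The two-sided ideal of series all of whose terms with distinct letters involve the
  letter \<open>i\<close>. It contains u f v for f in the variable \<open>i\<close> alone without
  constant term, and the product of two of its members always repeats a letter.\<close>

definition meets :: "nat => ncs set" where
 "meets i = {f. \<forall>w. coeff f w \<noteq> 0 --> distinct w --> i \<in> set w}"

lemma meets_mult: assumes "f \<in> meets i" shows "f * g \<in> meets i" "g * f \<in> meets i"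
proof -
 have "i \<in> set w" if "coeff (f * g) w \<noteq> 0 \<or> coeff (g * f) w \<noteq> 0" "distinct w" for w
 proof -
  have d: "distinct (take k w)" "distinct (drop k w)" for k using that(2) by auto
  show ?thesis using that(1)
  proof
   assume "coeff (f * g) w \<noteq> 0"
   then obtain k where "coeff f (take k w) \<noteq> 0" by (rule coeff_times_nonzero)
   then show ?thesis using assms d in_set_takeD unfolding meets_def by fast
  next
   assume "coeff (g * f) w \<noteq> 0"
   then obtain k where "coeff f (drop k w) \<noteq> 0" by (rule coeff_times_nonzero)
   then show ?thesis using assms d in_set_dropD unfolding meets_def by fast
  qed
 qed
 then show "f * g \<in> meets i" "g * f \<in> meets i" unfolding meets_def by blast+
qed

lemma meets_repeated: assumes "f \<in> meets i" "g \<in> meets i" shows "f * g \<in> repeated"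
 unfolding repeated_def
proof (intro CollectI allI impI)
 fix w :: "nat list" assume d: "distinct w"
 show "coeff (f * g) w = 0"
 proof (rule ccontr)
  assume "coeff (f * g) w \<noteq> 0"
  then obtain k where k: "coeff f (take k w) \<noteq> 0" "coeff g (drop k w) \<noteq> 0" by (rule coeff_times_nonzero)
  have "distinct (take k w @ drop k w)" using d by (simp only: append_take_drop_id)
  then have "distinct (take k w)" "distinct (drop k w)" "set (take k w) Int set (drop k w) = {}"
   unfolding distinct_append by blast+
  then show False using k assms unfolding meets_def by blast
 qed
qed

text \<open>The linear term of \<open>f\<close> survives conjugation. The quadratic one receives the
  products of the linear terms of \<open>f\<close> and \<open>u\<close> in both orders. Both follow
  from u a = f u.\<close>

lemma single_conj:
 fixes u :: mag
 assumes f: "f \<in> single i"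
 defines "a \<equiv> ser (- u + f + u)"
 shows "a + 1 \<in> meets i" "coeff a [x] = (if x = i then coeff (ser f) [i] else 0)"
  "coeff a [x, y] = (if x = i \<and> y = i then coeff (ser f) [i, i] else 0) +
   (if x = i then coeff (ser f) [i] else 0) * coeff (ser u) [y] + coeff (ser u) [x] * (if y = i then coeff (ser f) [i] else 0)"
proof -
 have ff: "coeff (ser f) [x] = (if x = i then coeff (ser f) [i] else 0)"
  "coeff (ser f) [x, y] = (if x = i \<and> y = i then coeff (ser f) [i, i] else 0)" for x y
  using f by (auto simp: single_def)
 have a: "a = ser (- u) * (ser f * ser u)" by (simp add: a_def ser_plus mult.assoc)
 have inv: "ser (- u) * ser u = 1" "ser u * ser (- u) = 1"
  using ser_uminus[of u] ser_uminus[of "- u"] by simp_all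
 have "ser f + 1 \<in> meets i"
 proof -
  have "i \<in> set w" if w: "coeff (ser f + 1) w \<noteq> 0" for w
  proof -
   have "w \<noteq> []" using w by (auto simp: coeff_simps)
   moreover from this have "set w \<subseteq> {i}" using w f by (simp add: coeff_simps single_def)
   ultimately show ?thesis by (cases w) auto
  qed
  then show ?thesis by (simp add: meets_def)
 qed
 moreover have "a + 1 = ser (- u) * (ser f + 1) * ser u"
  by (simp add: a distrib_left distrib_right inv mult.assoc)
 ultimately show "a + 1 \<in> meets i" using meets_mult by simp
 have "ser u * a = ser f * ser u" by (simp add: a inv mult.assoc[symmetric])
 then have eq: "coeff (ser u * a) w = coeff (ser f * ser u) w" for w by simp
 have a0: "coeff a [] = 1" by (simp add: a_def)
 have a1: "coeff a [x] = coeff (ser f) [x]" for x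
 proof -
  have "coeff (ser u) [x] + coeff a [x] = coeff (ser u) [x] + coeff (ser f) [x]"
   using eq[of "[x]"] a0 unfolding coeff_mult ser_Nil by (simp only: mult_1_left mult_1_right add.commute)
  then show ?thesis by (rule add_left_imp_eq)
 qed
 then show "coeff a [x] = (if x = i then coeff (ser f) [i] else 0)" using ff(1) by simp
 have "coeff a [x, y] = coeff (ser f) [x, y] + coeff (ser f) [x] * coeff (ser u) [y] + coeff (ser u) [x] * coeff (ser f) [y]"
 proof -
  have "coeff (ser u) [x, y] + (coeff (ser u) [x] * coeff a [y] + coeff a [x, y])
   = coeff (ser u) [x, y] + (coeff (ser f) [x] * coeff (ser u) [y] + coeff (ser f) [x, y])"
   using eq[of "[x, y]"] a0 unfolding coeff_mult ser_Nil by (simp only: bit_ring)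
  then have "coeff (ser u) [x] * coeff a [y] + coeff a [x, y] = coeff (ser f) [x] * coeff (ser u) [y] + coeff (ser f) [x, y]"
   by (rule add_left_imp_eq)
  then have "coeff (ser u) [x] * coeff a [y] + (coeff (ser u) [x] * coeff a [y] + coeff a [x, y])
   = coeff (ser u) [x] * coeff a [y] + (coeff (ser f) [x] * coeff (ser u) [y] + coeff (ser f) [x, y])" by (simp only:)
  then show ?thesis unfolding a1 bit_add_self_left by (simp only: bit_ring)
 qed
 then show "coeff a [x, y] = (if x = i \<and> y = i then coeff (ser f) [i, i] else 0) +
   (if x = i then coeff (ser f) [i] else 0) * coeff (ser u) [y] + coeff (ser u) [x] * (if y = i then coeff (ser f) [i] else 0)"
  by (simp only: ff(2)[of x y] ff(1)[of x] ff(1)[of y])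
qed

text \<open>With a = 1 + \<alpha> and b = 1 + \<beta>, every product that contains \<alpha> twice or
  \<beta> twice lies in \<open>repeated\<close>. Modulo these the two sides agree.\<close>

lemma four_commute_repeated:
 fixes a b :: ncs
 assumes "a + 1 \<in> meets i" "b + 1 \<in> meets j"
 shows "a * b * a * b * a + a * (a * b * a * b) \<in> repeated"
proof -
 define \<alpha> \<beta> where "\<alpha> = a + 1" and "\<beta> = b + 1"
 have ab: "a = \<alpha> + 1" "b = \<beta> + 1" by (simp_all add: \<alpha>_def \<beta>_def add.assoc ncs_add_self)
 have sq: "\<alpha> * x * \<alpha> \<in> repeated" "\<beta> * x * \<beta> \<in> repeated" for x
  unfolding \<alpha>_def \<beta>_def
  by (rule meets_repeated[OF meets_mult(1)[OF assms(1)] assms(1)], rule meets_repeated[OF meets_mult(1)[OF assms(2)] assms(2)])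
 \<comment> \<open>The difference, sorted into multiples of \<alpha> x \<alpha> and \<beta> x
   \<beta>; the identity is checked by expanding in characteristic 2.\<close>
 have "a * b * a * b * a + a * (a * b * a * b) =
   \<alpha> * 1 * \<alpha> + a * (\<beta> * 1 * \<beta>) * a + (\<alpha> * b * \<alpha>) * b + b * (\<alpha> * b * \<alpha>) + (\<alpha> * b * \<alpha>) * b * \<alpha> +
   (\<alpha> * 1 * \<alpha>) * (b * a * b) + \<beta> * 1 * \<beta>"
  unfolding ab by (simp add: algebra_simps ncs_add_self)
 then show ?thesis by (simp only:) (intro repeated_add sq repeated_mult)
qed

text \<open>The series \<open>c\<close> is the commutator of \<open>a\<close> with p = (a b)^2. As p
  begins with a square in degree 2, \<open>c\<close> begins in degree 3 with the bracket of the
  linear part of \<open>a\<close> and the quadratic part of p. Its terms of degree 3 and 4 involve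
  only the linear and quadratic parts of \<open>a\<close> and \<open>b\<close>, so the relations
  become a finite calculation.\<close>

lemma good_coeffs_commutator:
 fixes a b c :: ncs
 assumes a0: "coeff a [] = 1" and b0: "coeff b [] = 1" and c0: "coeff c [] = 1"
  and a1: "!!x. coeff a [x] = (if x = i then e else 0)"
  and a2: "!!x y. coeff a [x, y] = (if x = i \<and> y = i then f else 0) + (if x = i then e else 0) * u y + u x * (if y = i then e else 0)"
  and b1: "!!x. coeff b [x] = (if x = j then e' else 0)"
  and b2: "!!x y. coeff b [x, y] = (if x = j \<and> y = j then f' else 0) + (if x = j then e' else 0) * u' y + u' x * (if y = j then e' else 0)"
  and eq: "a * (a * b * a * b) * c = a * b * a * b * a"
 shows "good_coeffs (coeff c)"
proof -
 define p where "p = (a * b) * (a * b)"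
 define M where "M = a * b + 1"
 have M0: "coeff M [] = 0" by (simp add: M_def coeff_simps coeff_mult a0 b0)
 have M1: "coeff M [x] = coeff a [x] + coeff b [x]" for x
  by (simp only: M_def coeff_simps coeff_mult a0 b0 list.simps if_False mult_1_left mult_1_right add_0_right add_0_left add.commute)
 have M2: "coeff M [x, y] = coeff b [x, y] + coeff a [x] * coeff b [y] + coeff a [x, y]" for x y
  by (simp add: M_def coeff_simps coeff_mult a0 b0)
 have ab: "a * b = M + 1" by (simp add: M_def add.assoc ncs_add_self)
 \<comment> \<open>Characteristic 2: the square of 1 + M has no middle term.\<close>
 have p: "p = 1 + M * M" unfolding p_def ab by (simp add: algebra_simps ncs_add_self)
 have p0: "coeff p [] = 1" and p1: "coeff p [x] = 0" and p2: "coeff p [x, y] = coeff M [x] * coeff M [y]"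
  and p3: "coeff p [x, y, z] = coeff M [x] * coeff M [y, z] + coeff M [x, y] * coeff M [z]" for x y z
  by (simp_all only: p coeff_simps coeff_mult M0 list.simps if_False if_True mult_zero_left mult_zero_right add_0_left add_0_right not_Cons_self2 list.distinct simp_thms)
 have eq': "a * p * c = p * a" using eq by (simp add: p_def mult.assoc)
 have E: "coeff (a * p * c) w = coeff (p * a) w" for w by (simp only: eq')
 have c1: "coeff c [x] = 0" for x
  using E[of "[x]"] by (simp only: coeff_mult a0 p0 c0 p1 mult_1_left mult_1_right add_0_left add_0_right mult_zero_left mult_zero_right)
   (metis bit_cancel(1) bit_cancel(2) add.commute)
 have c2: "coeff c [x, y] = 0" for x y
  using E[of "[x, y]"] by (simp only: coeff_mult a0 p0 c0 p1 c1 mult_1_left mult_1_right add_0_left add_0_right mult_zero_left mult_zero_right)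
   (metis bit_cancel add.commute)
 have c3: "coeff c [x, y, z] = coeff a [x] * coeff p [y, z] + coeff p [x, y] * coeff a [z]" for x y z
 proof -
  have "coeff c [x, y, z] = coeff (a * p * c) [x, y, z] + (coeff p [x, y, z] + coeff a [x] * coeff p [y, z] + coeff a [x, y, z])"
   by (simp only: coeff_mult a0 p0 c0 p1 c1 c2 bit_ring)
  also have "\<dots> = coeff a [x] * coeff p [y, z] + coeff p [x, y] * coeff a [z]"
   unfolding E by (simp only: coeff_mult a0 p0 p1 bit_ring)
  finally show ?thesis .
 qed
 have c4: "coeff c [x, y, z, t] = coeff a [x] * coeff c [y, z, t] + coeff a [x] * coeff p [y, z, t] + coeff p [x, y, z] * coeff a [t]
   + coeff a [x, y] * coeff p [z, t] + coeff p [x, y] * coeff a [z, t]" for x y z t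
 proof -
  have "coeff c [x, y, z, t] = coeff (a * p * c) [x, y, z, t] + (coeff a [x] * coeff c [y, z, t] + coeff p [x, y, z, t]
    + coeff a [x] * coeff p [y, z, t] + coeff a [x, y] * coeff p [z, t] + coeff a [x, y, z, t])"
   by (simp only: coeff_mult a0 p0 c0 p1 c1 c2 bit_ring)
  also have "\<dots> = coeff a [x] * coeff c [y, z, t] + coeff a [x] * coeff p [y, z, t] + coeff p [x, y, z] * coeff a [t]
   + coeff a [x, y] * coeff p [z, t] + coeff p [x, y] * coeff a [z, t]"
   unfolding E by (simp only: coeff_mult a0 p0 p1 bit_ring)
  finally show ?thesis .
 qed
 define \<alpha> where "\<alpha> x = (if x = i then e else 0)" for x
 define \<beta> where "\<beta> x = (if x = j then e' else 0)" for x
 define A2 where "A2 x y = (if x = i \<and> y = i then f else 0)" for x y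
 define B2 where "B2 x y = (if x = j \<and> y = j then f' else 0)" for x y
 note unf = c4 c3 p2 p3 M1 M2 a1[folded \<alpha>_def] b1[folded \<beta>_def] a2[folded \<alpha>_def A2_def] b2[folded \<beta>_def B2_def]
 have \<alpha>0: "\<alpha> x = 0 \<and> A2 x y = 0 \<and> A2 y x = 0" if "x \<noteq> i" for x y using that by (auto simp: \<alpha>_def A2_def)
 have \<beta>0: "\<beta> x = 0 \<and> B2 x y = 0 \<and> B2 y x = 0" if "x \<noteq> j" for x y using that by (auto simp: \<beta>_def B2_def)
 show ?thesis
 proof (rule good_coeffsI)
  fix k
  show "coeff c [k, k] = 0 \<and> coeff c [k, k, k] = 0 \<and> coeff c [k, k, k, k] = 0"
   unfolding c2 unf by (intro conjI; simp only: bit_ring)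
 next
  fix k l :: nat assume kl: "k \<noteq> l"
  \<comment> \<open>Of two different letters at most one is \<open>i\<close>, and likewise for
    \<open>j\<close>. This leaves four cases, each a polynomial identity.\<close>
  consider "\<alpha> k = 0" "A2 k l = 0" "A2 l k = 0" "A2 k k = 0" | "\<alpha> l = 0" "A2 k l = 0" "A2 l k = 0" "A2 l l = 0"
   using \<alpha>0 kl by metis
  note ca = this
  consider "\<beta> k = 0" "B2 k l = 0" "B2 l k = 0" "B2 k k = 0" | "\<beta> l = 0" "B2 k l = 0" "B2 l k = 0" "B2 l l = 0"
   using \<beta>0 kl by metis
  note cb = this
  show "coeff c [k, l, k] = 0 \<and> coeff c [k, l, l] = coeff c [l, k, k] \<and> coeff c [l, k, k] = coeff c [k, k, l] \<and> coeff c [k, k, l] = coeff c [l, l, k]"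
   unfolding unf by (rule ca; rule cb; simp only: bit_ring simp_thms)
  show "coeff c [k, l, k, l] = coeff c [l, k, l, k] \<and> coeff c [k, k, l, l] = coeff c [l, l, k, k] \<and>
    coeff c [k, k, k, l] = coeff c [k, k, l, k] \<and> coeff c [k, k, l, k] = coeff c [k, l, k, k] \<and> coeff c [k, l, k, k] = coeff c [l, k, k, k]"
   unfolding unf by (rule ca; rule cb; simp only: bit_ring simp_thms)
 next
  fix k l j' :: nat assume d: "distinct [k, l, j']"
  consider "k \<noteq> i \<and> l \<noteq> i" | "k \<noteq> i \<and> j' \<noteq> i" | "l \<noteq> i \<and> j' \<noteq> i" using d by auto
  note ca = this
  consider "k \<noteq> j \<and> l \<noteq> j" | "k \<noteq> j \<and> j' \<noteq> j" | "l \<noteq> j \<and> j' \<noteq> j" using d by auto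
  note cb = this
  have A2: "A2 x y = 0" "B2 x y = 0" if "x \<noteq> y" for x y using that by (auto simp: A2_def B2_def)
  show "coeff c [k, l, k, j'] = 0 \<and> coeff c [k, l, j', k] = 0 \<and> coeff c [l, k, j', k] = 0"
   unfolding unf by (rule ca; rule cb; simp only: \<alpha>0 \<beta>0 bit_ring simp_thms)
 qed
qed

lemma four_commute_magN:
 fixes f g u v :: mag
 assumes f: "f \<in> single i" and g: "g \<in> single j"
 defines "a \<equiv> - u + f + u" and "b \<equiv> - v + g + v"
 shows "- (a + (a + b + a + b)) + (a + b + a + b + a) \<in> magN"
proof -
 define n where "n = - (a + (a + b + a + b)) + (a + b + a + b + a)"
 define L where "L = ser a * (ser a * ser b * ser a * ser b)"
 define R where "R = ser a * ser b * ser a * ser b * ser a"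
 have LR: "ser (a + (a + b + a + b)) = L" "ser (a + b + a + b + a) = R"
  by (simp_all add: L_def R_def ser_plus)
 have "(a + (a + b + a + b)) + n = a + b + a + b + a" by (simp add: n_def)
 then have Ln: "L * ser n = R" by (metis LR ser_plus)
 have a: "ser a + 1 \<in> meets i" "ser b + 1 \<in> meets j"
  unfolding a_def b_def by (rule single_conj(1)[OF f], rule single_conj(1)[OF g])
 have "ser n = ser (- (a + (a + b + a + b))) * R" by (simp add: n_def ser_plus LR(2)[symmetric])
 moreover have "ser (- (a + (a + b + a + b))) * L = 1" unfolding LR(1)[symmetric] by (rule ser_uminus)
 ultimately have "ser n + 1 = ser (- (a + (a + b + a + b))) * (R + L)" by (simp add: distrib_left)
 moreover have "R + L \<in> repeated" unfolding R_def L_def by (rule four_commute_repeated[OF a])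
 ultimately have "ser n + 1 \<in> repeated" using repeated_mult by simp
 moreover have "good_coeffs (coeff (ser n))"
  by (rule good_coeffs_commutator[OF _ _ _ single_conj(2,3)[OF f, where u = u, folded a_def] single_conj(2,3)[OF g, where u = v, folded b_def] Ln[unfolded L_def R_def]]) simp_all
 ultimately show ?thesis unfolding n_def[symmetric] magN_def by blast
qed

interpretation mq: meridian_data mq_H mq_theta
proof
 show "0 \<in> mq_H i" for i unfolding mq_H_def using single_zero proj_simps(1) by force
 show "x + y \<in> mq_H i" if xy: "x \<in> mq_H i" "y \<in> mq_H i" for x y i
 proof -
  obtain f g where "x = proj f" "f \<in> single i" "y = proj g" "g \<in> single i" using xy unfolding mq_H_def by blast
  then have "x + y = proj (f + g)" "f + g \<in> single i" by (simp_all add: proj_simps single_add)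
  then show ?thesis unfolding mq_H_def by (rule image_eqI)
 qed
 show "- x \<in> mq_H i" if xy: "x \<in> mq_H i" for x i
 proof -
  obtain f where "x = proj f" "f \<in> single i" using xy unfolding mq_H_def by blast
  then have "- x = proj (- f)" "- f \<in> single i" by (simp_all add: proj_simps single_minus)
  then show ?thesis unfolding mq_H_def by (rule image_eqI)
 qed
 show "mq_theta i (x + y) = mq_theta i x + mq_theta i y" for i x y
 proof -
  obtain f g where "proj f = x" "proj g = y" using proj_surj by metis
  then have "mq_theta i (x + y) = coeff (ser (f + g)) [i]" by (metis mq_theta_proj proj_simps(2))
  also have "\<dots> = coeff (ser f) [i] + coeff (ser g) [i]"
   by (simp only: ser_plus coeff_mult ser_Nil mult_1_left mult_1_right add.commute)
  also have "\<dots> = mq_theta i x + mq_theta i y"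
   by (simp only: mq_theta_proj[symmetric] \<open>proj f = x\<close> \<open>proj g = y\<close>)
  finally show ?thesis .
 qed
 show "\<exists>g\<in>mq_H i. mq_theta i g = 1" for i
 proof -
  define s where "s = Ncs (\<lambda>w. if w = [] \<or> w = [i] then 1 else 0)"
  have "ser (Mag s) = s" by (rule Mag_inverse) (simp add: s_def)
  then have "Mag s \<in> single i" "mq_theta i (proj (Mag s)) = 1"
   by (auto simp: single_def s_def mq_theta_proj)
  then show ?thesis unfolding mq_H_def by blast
 qed
 show "(- x + a + x) + (- y + b + y) + (- x + a + x) + (- y + b + y) + (- x + a + x) =
   (- x + a + x) + ((- x + a + x) + (- y + b + y) + (- x + a + x) + (- y + b + y))"
  if ab: "a \<in> mq_H i" "b \<in> mq_H j" for a b x y i j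
 proof -
  obtain f g where f: "f \<in> single i" "a = proj f" and g: "g \<in> single j" "b = proj g"
   using ab unfolding mq_H_def by blast
  obtain u v where "proj u = x" "proj v = y" using proj_surj by metis
  then show ?thesis
   using four_commute_magN[OF f(1) g(1), of u v] unfolding proj_eq_iff[symmetric] f(2) g(2)
   by (simp only: proj_simps)
 qed
qed

section \<open>Evaluating words in a group\<close>

text \<open>The lift of free groups expects a group with a carrier; this one is the bridge from the
  type class.\<close>

definition add_group :: "'g::group_add monoid" where
 "add_group = \<lparr>carrier = UNIV, mult = (+), one = 0\<rparr>"

lemma add_group_simps [simp]:
 "carrier add_group = UNIV" "x \<otimes>\<^bsub>add_group\<^esub> y = x + y" "\<one>\<^bsub>add_group\<^esub> = 0"
 by (simp_all add: add_group_def)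

lemma group_add_group: "group (add_group :: 'g::group_add monoid)"
proof (rule groupI)
 fix x :: 'g
 show "\<exists>y\<in>carrier add_group. y \<otimes>\<^bsub>add_group\<^esub> x = \<one>\<^bsub>add_group\<^esub>" by (auto intro: exI[of _ "- x"])
qed (simp_all add: add.assoc)

lemma inv_add_group [simp]: "inv\<^bsub>add_group\<^esub> x = - x"
proof -
 have "- x \<otimes>\<^bsub>add_group\<^esub> x = \<one>\<^bsub>add_group\<^esub>" by simp
 from group.inv_equality[OF group_add_group this] show ?thesis by simp
qed

definition ev :: "('a => 'g::group_add) => 'a letter list => 'g" where
 "ev f = free_lift add_group f"

lemma ev_Nil [simp]: "ev f [] = 0"
 by (simp add: ev_def free_lift_def)

lemma ev_Cons: "ev f ((a, e) # w) = (if e then f a else - f a) + ev f w"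
 by (simp add: ev_def free_lift_def)

lemma ev_mult: "ev f (u \<otimes>\<^bsub>free_group X\<^esub> v) = ev f u + ev f v"
proof -
 have "ev f (reduce (u @ v)) = ev f (u @ v)"
  unfolding ev_def by (rule free_lift_reduce[OF group_add_group, of _ UNIV]) auto
 also have "\<dots> = ev f u + ev f v"
  unfolding ev_def using free_lift_append[OF group_add_group, of f UNIV u v] by simp
 finally show ?thesis by (simp add: free_group_def)
qed

lemma ev_one: "ev f \<one>\<^bsub>free_group X\<^esub> = 0"
 by (simp add: free_group_def)

lemma ev_inv: assumes w: "w \<in> carrier (free_group X)" shows "ev f (inv\<^bsub>free_group X\<^esub> w) = - ev f w"
proof -
 have "ev f (inv\<^bsub>free_group X\<^esub> w) + ev f w = 0"
  using group.l_inv[OF group_free_group w] ev_mult[of f X "inv\<^bsub>free_group X\<^esub> w" w] ev_one[of f X] by simp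
 then show ?thesis by (simp add: eq_neg_iff_add_eq_0)
qed

lemma gen_carrier: "a \<in> X ==> gen a \<in> carrier (free_group X)"
 by (simp add: free_group_def gen_def reduced_def)

lemma ev_gen: "ev f (gen a) = f a"
 by (simp add: gen_def ev_Cons)

lemma ev_gen_pow:
 assumes "a \<in> X" "e = 1 \<or> e = (-1 :: int)"
 shows "ev f (gen a [^]\<^bsub>free_group X\<^esub> e) = (if e = 1 then f a else - f a)"
proof -
 interpret group "free_group X" by (rule group_free_group)
 note a = gen_carrier[OF assms(1)]
 have "gen a [^]\<^bsub>free_group X\<^esub> (- 1 :: int) = inv\<^bsub>free_group X\<^esub> (gen a [^]\<^bsub>free_group X\<^esub> (1 :: int))"
  by (rule int_pow_neg[OF a])
 then show ?thesis using assms(2) int_pow_1[OF a] ev_inv[OF a] by (auto simp: ev_gen)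
qed

lemma ev_free_lift:
 assumes \<phi>: "\<phi> \<in> X \<rightarrow> carrier (free_group A)" and w: "fst ` set w \<subseteq> X"
 shows "ev y (free_lift (free_group A) \<phi> w) = ev (\<lambda>a. ev y (\<phi> a)) w"
 using w
proof (induction w)
 case Nil
 then show ?case by (simp add: free_lift_def ev_one)
next
 case (Cons l w)
 obtain a e where l: "l = (a, e)" by (cases l)
 have "\<phi> a \<in> carrier (free_group A)" using \<phi> Cons.prems l by auto
 then have "ev y (if e then \<phi> a else inv\<^bsub>free_group A\<^esub> (\<phi> a)) = (if e then ev y (\<phi> a) else - ev y (\<phi> a))"
  by (simp add: ev_inv)
 moreover have "free_lift (free_group A) \<phi> (l # w) =
  (if e then \<phi> a else inv\<^bsub>free_group A\<^esub> (\<phi> a)) \<otimes>\<^bsub>free_group A\<^esub> free_lift (free_group A) \<phi> w"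
  by (simp add: free_lift_def l)
 ultimately show ?case using Cons by (simp add: ev_mult ev_Cons l)
qed

section \<open>Milnor's congruences\<close>

definition agree :: "nat => ncs => ncs => bool" where
 "agree q s t \<longleftrightarrow> (\<forall>w. length w < q --> coeff s w = coeff t w)"

lemma agree_mult:
 assumes "agree q s t" "agree q s' t'"
 shows "agree q (s * s') (t * t')"
 unfolding agree_def coeff_times
proof (intro allI impI sum.cong refl)
 fix w :: "nat list" and k assume "length w < q" "k \<in> {..length w}"
 then show "coeff s (take k w) * coeff s' (drop k w) = coeff t (take k w) * coeff t' (drop k w)"
  using assms by (simp add: agree_def)
qed

text \<open>A factor without constant term pairs its own coefficients of degree at most
  \<open>q\<close> with coefficients of degree below \<open>q\<close> of the other factor. This
  gains one degree.\<close>

lemma agree_mult_nilpotent: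
 assumes "agree q s t" "agree (Suc q) r r'" "coeff r [] = 0" "coeff r' [] = 0"
 shows "agree (Suc q) (s * r) (t * r')" "agree (Suc q) (r * s) (r' * t)"
 unfolding agree_def coeff_times
proof -
 show "\<forall>w :: nat list. length w < Suc q --> (\<Sum>k\<le>length w. coeff s (take k w) * coeff r (drop k w)) = (\<Sum>k\<le>length w. coeff t (take k w) * coeff r' (drop k w))"
 proof (intro allI impI sum.cong refl)
  fix w :: "nat list" and k assume w: "length w < Suc q" "k \<in> {..length w}"
  show "coeff s (take k w) * coeff r (drop k w) = coeff t (take k w) * coeff r' (drop k w)"
  proof (cases "k = length w")
   case False
   then have "length (take k w) < q" "length (drop k w) < Suc q" using w by auto
   then show ?thesis using assms(1,2) unfolding agree_def by metis
  qed (simp add: assms)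
 qed
 show "\<forall>w :: nat list. length w < Suc q --> (\<Sum>k\<le>length w. coeff r (take k w) * coeff s (drop k w)) = (\<Sum>k\<le>length w. coeff r' (take k w) * coeff t (drop k w))"
 proof (intro allI impI sum.cong refl)
  fix w :: "nat list" and k assume w: "length w < Suc q" "k \<in> {..length w}"
  show "coeff r (take k w) * coeff s (drop k w) = coeff r' (take k w) * coeff t (drop k w)"
  proof (cases "k = 0")
   case False
   then have "length (take k w) < Suc q" "length (drop k w) < q" using w by auto
   then show ?thesis using assms(1,2) unfolding agree_def by metis
  qed (simp add: assms)
 qed
qed

lemma agree_uminus: assumes "agree q (ser f) (ser g)" shows "agree q (ser (- f)) (ser (- g))"
proof -
 have inv: "ser f * ser (- f) = 1" "ser (- g) * ser g = 1" using ser_uminus[of "- f"] ser_uminus[of g] by simp_all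
 have "agree q (ser (- g) * ser g * ser (- f)) (ser (- g) * ser f * ser (- f))"
  by (intro agree_mult) (use assms in \<open>simp_all add: agree_def\<close>)
 then show ?thesis unfolding mult.assoc inv(1) unfolding mult.assoc[symmetric] inv(2) by simp
qed

text \<open>The gain of one degree on which Milnor's induction rests: y - 1 has no constant term, so
  a conjugator is needed only to one degree less than the conjugate.\<close>

lemma agree_conj:
 assumes "agree q (ser f) (ser g)"
 shows "agree (Suc q) (ser (- f + y + f)) (ser (- g + y + g))"
proof -
 define \<eta> where "\<eta> = ser y + 1"
 have y: "ser y = \<eta> + 1" by (simp add: \<eta>_def add.assoc ncs_add_self)
 have \<eta>: "coeff \<eta> [] = 0" by (simp add: \<eta>_def coeff_simps)
 have conj: "ser (- h + y + h) = ser (- h) * \<eta> * ser h + 1" for h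
  using ser_uminus[of h] by (simp add: ser_plus y algebra_simps)
 have "agree (Suc q) (ser (- f) * \<eta> * ser f) (ser (- g) * \<eta> * ser g)"
  by (intro agree_mult_nilpotent agree_uminus assms) (simp_all add: agree_def coeff_mult \<eta>)
 then show ?thesis unfolding conj by (simp add: agree_def coeff_simps)
qed

text \<open>Congruence modulo the image of the series that begin, after the constant term 1, in
  degree \<open>q\<close> or later. It is stated by representatives because coefficients are not
  defined on the quotient.\<close>

definition mq_cong :: "nat => mq => mq => bool" where
 "mq_cong q a b \<longleftrightarrow> (\<exists>f g. proj f = a \<and> proj g = b \<and> agree q (ser f) (ser g))"

lemma mq_cong_refl: "mq_cong q a a"
 using proj_surj[of a] by (auto simp: mq_cong_def agree_def)

lemma mq_cong_add: assumes "mq_cong q a b" "mq_cong q a' b'" shows "mq_cong q (a + a') (b + b')"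
 using assms unfolding mq_cong_def by (metis agree_mult proj_simps(2) ser_plus)

lemma mq_cong_minus: assumes "mq_cong q a b" shows "mq_cong q (- a) (- b)"
 using assms unfolding mq_cong_def by (metis agree_uminus proj_simps(3))

lemma mq_cong_conj: assumes "mq_cong q a b" shows "mq_cong (Suc q) (- a + y + a) (- b + y + b)"
proof -
 obtain f g where "proj f = a" "proj g = b" "agree q (ser f) (ser g)" using assms by (auto simp: mq_cong_def)
 moreover obtain h where "proj h = y" using proj_surj by metis
 ultimately show ?thesis unfolding mq_cong_def
  by (intro exI[of _ "- f + h + f"] exI[of _ "- g + h + g"]) (simp add: proj_simps agree_conj)
qed

text \<open>All constant terms are 1, so the induction starts with no condition at all.\<close>

lemma mq_cong_1: "mq_cong (Suc 0) a b"
 using proj_surj[of a] proj_surj[of b] by (auto simp: mq_cong_def agree_def)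

lemma mq_cong_ev:
 assumes "!!a. a \<in> X ==> mq_cong q (f a) (g a)" "fst ` set w \<subseteq> X"
 shows "mq_cong q (ev f w) (ev g w)"
 using assms(2)
proof (induction w)
 case (Cons l w)
 then show ?case using assms(1)[of "fst l"]
  by (cases l) (auto simp: ev_Cons intro!: mq_cong_add mq_cong_minus)
qed (simp add: mq_cong_refl)

text \<open>The recursion of \<open>eta\<close> carried out in the target group, with each \<alpha>
  replaced by its value under \<open>y\<close>. The value at 0 is a dummy.\<close>

fun eta_value :: "link_diagram => (nat => 'g::group_add) => nat => nat \<times> nat => 'g" where
 "eta_value D y 0 = (\<lambda>_. 0)"
| "eta_value D y (Suc 0) = (\<lambda>(i, j). y i)"
| "eta_value D y (Suc (Suc q)) = (\<lambda>(i, j). - ev (eta_value D y (Suc q)) (partial_longitude D i (j - 1)) + y i +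
  ev (eta_value D y (Suc q)) (partial_longitude D i (j - 1)))"

locale coloured_diagram =
 fixes D :: link_diagram and x :: "nat \<times> nat => mq"
 assumes over: "!!i j. i \<in> {1..components D} ==> 1 \<le> j ==> j \<le> under_crossings D i ==> over_arc D i j \<in> arcs D"
  and sign: "!!i j. i \<in> {1..components D} ==> 1 \<le> j ==> j \<le> under_crossings D i ==> crossing_sign D i j = 1 \<or> crossing_sign D i j = -1"
  and crossing: "!!i j. i \<in> {1..components D} ==> 1 \<le> j ==> j \<le> under_crossings D i ==> x (i, j mod under_crossings D i + 1) =
   (if crossing_sign D i j = 1 then - x (over_arc D i j) + x (i, j) + x (over_arc D i j)
   else x (over_arc D i j) + x (i, j) - x (over_arc D i j))"
begin

lemma partial_longitude_carrier:
 assumes i: "i \<in> {1..components D}" and j: "j \<le> under_crossings D i"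
 shows "partial_longitude D i j \<in> carrier (free_group (arcs D))"
 using j
proof (induction j)
 case 0
 show ?case unfolding partial_longitude.simps
  by (rule monoid.one_closed[OF group.is_monoid[OF group_free_group]])
next
 case (Suc j)
 interpret group "free_group (arcs D)" by (rule group_free_group)
 have o: "over_arc D i (Suc j) \<in> arcs D" using over[OF i, of "Suc j"] Suc.prems by simp
 show ?case unfolding partial_longitude.simps
  by (rule m_closed[OF Suc.IH int_pow_closed[OF gen_carrier[OF o]]]) (use Suc.prems in simp)
qed

lemma carrier_letters: "w \<in> carrier (free_group X) ==> fst ` set w \<subseteq> X"
 by (simp add: free_group_def)

text \<open>Each under-crossing conjugates by the colour of the over-passing arc to the power of its
  sign, so the colours along a component are conjugates of the first by the partial longitudes.
  After a full turn the first arc returns, and its colour commutes with the longitude.\<close>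

lemma x_conj:
 assumes i: "i \<in> {1..components D}"
 shows "j < under_crossings D i ==> x (i, Suc j) = - ev x (partial_longitude D i j) + x (i, 1) + ev x (partial_longitude D i j)"
  and "- ev x (longitude D i) + x (i, 1) + ev x (longitude D i) = x (i, 1)"
proof -
 have step: "ev x (partial_longitude D i (Suc j)) = ev x (partial_longitude D i j) +
   (if crossing_sign D i (Suc j) = 1 then x (over_arc D i (Suc j)) else - x (over_arc D i (Suc j)))" if "j < under_crossings D i" for j
  using ev_gen_pow[OF over[OF i] sign[OF i], of "Suc j" "Suc j" x] that by (simp add: ev_mult)
 have next_arc: "x (i, Suc j mod under_crossings D i + 1) = - ev x (partial_longitude D i (Suc j)) + x (i, 1) + ev x (partial_longitude D i (Suc j))"
  if j: "j < under_crossings D i" and IH: "x (i, Suc j) = - ev x (partial_longitude D i j) + x (i, 1) + ev x (partial_longitude D i j)" for j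
  using crossing[OF i, of "Suc j"] j unfolding step[OF j] IH by (auto simp: gnorm simp del: add_uminus_conv_diff)
 show conj: "x (i, Suc j) = - ev x (partial_longitude D i j) + x (i, 1) + ev x (partial_longitude D i j)" if "j < under_crossings D i" for j
  using that
 proof (induction j)
  case 0
  show ?case by (simp add: ev_one)
 next
  case (Suc j)
  then show ?case using next_arc[of j] by simp
 qed
 show "- ev x (longitude D i) + x (i, 1) + ev x (longitude D i) = x (i, 1)"
 proof (cases "under_crossings D i")
  case 0
  then show ?thesis by (simp add: longitude_def ev_one)
 next
  case (Suc r)
  then show ?thesis using next_arc[of r] conj[of r] by (simp add: longitude_def)
 qed
qed

lemma arc_pred: "(i, j) \<in> arcs D ==> i \<in> {1..components D} \<and> j - 1 \<le> under_crossings D i"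
 by (auto simp: arcs_def)

text \<open>Evaluation is compatible with lifting, so no reduced word has to be computed. Membership
  in the carrier belongs to the same induction: a lift can be evaluated only if its values on
  generators are group elements.\<close>

lemma eta_ev:
 assumes "q \<ge> 1" "fst ` set w \<subseteq> arcs D"
 shows "ev y (eta D q w) = ev (eta_value D y q) w \<and> eta D q w \<in> carrier (meridian_group D)"
 using assms
proof (induction q arbitrary: w)
 case 0
 then show ?case by simp
next
 case (Suc q)
 note w = Suc.prems(2)
 show ?case
 proof (cases q)
  case 0
  have g: "(\<lambda>(i, j). gen i) \<in> arcs D \<rightarrow> carrier (meridian_group D)" by (auto simp: arcs_def gen_carrier)
  have "(\<lambda>a. ev y ((\<lambda>(i, j). gen i) a)) = (\<lambda>(i, j). y i)" by (auto simp: ev_gen)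
  note e = ev_free_lift[OF g w, of y, unfolded this]
  show ?thesis unfolding 0 eta.simps eta_value.simps
   using e free_lift_closed[OF group_free_group g w] by (rule conjI)
 next
  case (Suc q')
  interpret M: group "meridian_group D" by (rule group_free_group)
  interpret A: group "free_group (arcs D)" by (rule group_free_group)
  define \<phi> where "\<phi> = (\<lambda>(i, j). eta D q (inv\<^bsub>free_group (arcs D)\<^esub> partial_longitude D i (j - 1)) \<otimes>\<^bsub>meridian_group D\<^esub>
   gen i \<otimes>\<^bsub>meridian_group D\<^esub> eta D q (partial_longitude D i (j - 1)))"
  have q1: "1 \<le> q" using Suc by simp
  have \<phi>: "\<phi> (i, j) \<in> carrier (meridian_group D) \<and> ev y (\<phi> (i, j)) = eta_value D y (Suc q) (i, j)" if ij: "(i, j) \<in> arcs D" for i j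
  proof -
   define l where "l = partial_longitude D i (j - 1)"
   have i: "i \<in> {1..components D}" and l: "l \<in> carrier (free_group (arcs D))"
    using arc_pred[OF ij] partial_longitude_carrier[of i "j - 1"] by (simp_all add: l_def)
   define l' where "l' = inv\<^bsub>free_group (arcs D)\<^esub> l"
   have l': "l' \<in> carrier (free_group (arcs D))" unfolding l'_def by (rule A.inv_closed[OF l])
   have e: "ev y (eta D q l) = ev (eta_value D y q) l" "eta D q l \<in> carrier (meridian_group D)"
    "ev y (eta D q l') = ev (eta_value D y q) l'" "eta D q l' \<in> carrier (meridian_group D)"
    using Suc.IH[OF q1 carrier_letters[OF l]] Suc.IH[OF q1 carrier_letters[OF l']] by blast+
   have \<phi>_eq: "\<phi> (i, j) = eta D q l' \<otimes>\<^bsub>meridian_group D\<^esub> gen i \<otimes>\<^bsub>meridian_group D\<^esub> eta D q l"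
    by (simp only: \<phi>_def l'_def l_def prod.case)
   have "\<phi> (i, j) \<in> carrier (meridian_group D)"
    unfolding \<phi>_eq by (intro M.m_closed e gen_carrier i)
   moreover have "ev y (\<phi> (i, j)) = eta_value D y (Suc q) (i, j)"
   proof -
    have "ev y (\<phi> (i, j)) = ev (eta_value D y q) l' + y i + ev (eta_value D y q) l"
     by (simp only: \<phi>_eq ev_mult ev_gen e(1,3))
    also have "\<dots> = - ev (eta_value D y q) l + y i + ev (eta_value D y q) l"
     by (simp only: l'_def ev_inv[OF l])
    finally show ?thesis by (simp only: \<open>q = Suc q'\<close> eta_value.simps prod.case l_def)
   qed
   ultimately show ?thesis by blast
  qed
  have \<phi>': "\<phi> \<in> arcs D \<rightarrow> carrier (meridian_group D)" using \<phi> by auto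
  have "ev (\<lambda>a. ev y (\<phi> a)) w = ev (eta_value D y (Suc q)) w"
   using w
  proof (induction w)
   case (Cons a w)
   then show ?case using \<phi>[of "fst (fst a)" "snd (fst a)"] by (cases a) (simp add: ev_Cons)
  qed simp
  moreover have "eta D (Suc q) = free_lift (meridian_group D) \<phi>"
   unfolding \<phi>_def \<open>q = Suc q'\<close> by (simp only: eta.simps)
  ultimately show ?thesis
   using ev_free_lift[OF \<phi>' w, of y] free_lift_closed[OF group_free_group \<phi>' w] by (simp only:)
 qed
qed

text \<open>Milnor's induction. The true colour and \<open>eta_value\<close> are conjugates of the
  same element, the colour of the first arc, by words that are congruent in degrees below
  \<open>q\<close>. By \<open>mq_cong_conj\<close> the conjugates are congruent one degree
  further.\<close>

lemma x_eta:
 assumes "q \<ge> 1" "a \<in> arcs D"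
 shows "mq_cong q (x a) (eta_value D (\<lambda>i. x (i, 1)) q a)"
 using assms
proof (induction q arbitrary: a)
 case (Suc q)
 show ?case
 proof (cases q)
  case 0
  then show ?thesis by (simp add: mq_cong_1)
 next
  case (Suc q')
  obtain i j where a: "a = (i, j)" by (cases a)
  have i: "i \<in> {1..components D}" and j: "1 \<le> j" "j \<le> max 1 (under_crossings D i)"
   using Suc.prems(2) a by (auto simp: arcs_def)
  define l where "l = partial_longitude D i (j - 1)"
  have l: "l \<in> carrier (free_group (arcs D))"
   using partial_longitude_carrier[OF i, of "j - 1"] j by (simp add: l_def)
  have "x (i, j) = - ev x l + x (i, 1) + ev x l"
  proof (cases "j - 1 < under_crossings D i")
   case True
   then show ?thesis using x_conj(1)[OF i True] j by (simp add: l_def)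
  next
   case False
   then have "j = 1" using j by auto
   then show ?thesis by (simp add: l_def ev_one)
  qed
  moreover have "mq_cong q (ev x l) (ev (eta_value D (\<lambda>i. x (i, 1)) q) l)"
   by (rule mq_cong_ev[OF Suc.IH carrier_letters[OF l]]) (simp add: Suc)
  ultimately show ?thesis
   using mq_cong_conj[of q "ev x l" _ "x (i, 1)"] by (simp add: a Suc l_def)
 qed
qed simp

text \<open>The longitude evaluated on the actual colours commutes with the meridian. Replacing the
  colours by \<open>eta_value\<close> changes it only in degrees from \<open>q\<close> on.\<close>

lemma commutator_trivial:
 assumes i: "i \<in> {1..components D}" and q: "q \<ge> 1"
 shows "mq_cong q (ev (\<lambda>i. x (i, 1)) (commutator (meridian_group D) (gen i) (eta D q (longitude D i)))) 0"
proof -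
 let ?y = "\<lambda>i. x (i, 1)"
 have l: "longitude D i \<in> carrier (free_group (arcs D))"
  unfolding longitude_def by (rule partial_longitude_carrier[OF i order_refl])
 define E where "E = ev (eta_value D ?y q) (longitude D i)"
 define V where "V = ev x (longitude D i)"
 have e: "ev ?y (eta D q (longitude D i)) = E" "eta D q (longitude D i) \<in> carrier (meridian_group D)"
  using eta_ev[OF q carrier_letters[OF l], of ?y] by (simp_all add: E_def)
 have "ev ?y (commutator (meridian_group D) (gen i) (eta D q (longitude D i))) = - ?y i + - E + ?y i + E"
  unfolding commutator_def ev_mult ev_inv[OF gen_carrier[OF i]] ev_inv[OF e(2)] ev_gen e(1) ..
 moreover have "mq_cong q (- ?y i + - V + ?y i + V) (- ?y i + - E + ?y i + E)"
  unfolding V_def E_def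
  by (intro mq_cong_add mq_cong_minus mq_cong_refl mq_cong_ev[OF x_eta[OF q] carrier_letters[OF l]])
 moreover have "- ?y i + - V + ?y i + V = 0"
  using x_conj(2)[OF i] unfolding V_def[symmetric] by (metis add.assoc left_minus)
 moreover have "mq_cong q b a" if "mq_cong q a b" for a b using that unfolding mq_cong_def agree_def by metis
 ultimately show ?thesis by simp
qed

end

section \<open>Substituting meridians into the Magnus expansion\<close>

definition words :: "nat set => nat => nat list set" where
 "words A n = {w. set w \<subseteq> A \<and> length w \<le> n}"

lemma finite_words: "finite A ==> finite (words A n)"
 unfolding words_def by (rule finite_lists_length_le)

primrec monomial :: "(nat => ncs) => nat list => ncs" where
 "monomial Y [] = 1"
| "monomial Y (k # w) = Y k * monomial Y w"

text \<open>The monomials in the \<open>Y k\<close> of length greater than \<open>length v\<close> do not contribute to the coefficient of \<open>v\<close>.\<close>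

definition subst :: "nat set => (nat => ncs) => nc_series => ncs" where
 "subst A Y c = Ncs (\<lambda>v. \<Sum>w\<in>words A (length v). c w * coeff (monomial Y w) v)"

text \<open>Every factor begins in degree 1 at the earliest. This makes substitution a finite sum in
  each degree.\<close>

lemma monomial_low:
 assumes "!!k. coeff (Y k) [] = 0"
 shows "length v < length w ==> coeff (monomial Y w) v = 0"
proof (induction w arbitrary: v)
 case (Cons k w)
 have "coeff (Y k) (take n v) * coeff (monomial Y w) (drop n v) = 0" if "n \<le> length v" for n
 proof (cases "n = 0")
  case True
  then show ?thesis using assms by simp
 next
  case False
  then have "length (drop n v) < length w" using that Cons.prems by auto
  then show ?thesis using Cons.IH by simp
 qed
 then show ?case unfolding monomial.simps coeff_times by (intro sum.neutral ballI) simp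
qed simp

lemma coeff_subst:
 assumes Y: "!!k. coeff (Y k) [] = 0" and A: "finite A" and n: "length v \<le> n"
 shows "coeff (subst A Y c) v = (\<Sum>w\<in>words A n. c w * coeff (monomial Y w) v)"
 unfolding subst_def coeff_Ncs
proof (rule sum.mono_neutral_left)
 show "finite (words A n)" by (rule finite_words[OF A])
 show "words A (length v) \<subseteq> words A n" using n by (auto simp: words_def)
 show "\<forall>w\<in>words A n - words A (length v). c w * coeff (monomial Y w) v = 0"
 proof
  fix w assume "w \<in> words A n - words A (length v)"
  then have "length v < length w" by (auto simp: words_def)
  from monomial_low[of Y, OF Y this] show "c w * coeff (monomial Y w) v = 0" by (simp only: mult_zero_right)
 qed
qed

text \<open>Multiplicativity of substitution, only for a first factor 1 + X_i. This is enough for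
  words, as an inverse letter can be cancelled by multiplying with its generator.\<close>

lemma subst_gen_mult:
 assumes Y: "!!k. coeff (Y k) [] = 0" and A: "finite A" and i: "i \<in> A"
 shows "subst A Y (nc_mult (magnus_letter (i, True)) c) = (1 + Y i) * subst A Y c"
proof (rule ncs_eqI)
 fix v :: "nat list"
 let ?m = "nc_mult (magnus_letter (i, True)) c"
 define n where "n = length v"
 have m: "?m w = c w + (if w \<noteq> [] \<and> hd w = i then c (tl w) else 0)" for w
 proof (cases w)
  case Nil
  then show ?thesis by (simp add: nc_mult_def magnus_letter_def)
 next
  case (Cons a w')
  have "?m w = (\<Sum>k\<in>{0, 1}. magnus_letter (i, True) (take k w) * c (drop k w))"
   unfolding nc_mult_def
   by (rule sum.mono_neutral_right) (auto simp: Cons magnus_letter_def take_Cons split: nat.splits)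
  also have "\<dots> = magnus_letter (i, True) (take 0 w) * c (drop 0 w) + magnus_letter (i, True) (take 1 w) * c (drop 1 w)"
   by (rule sum_two) simp
  finally show ?thesis by (auto simp: Cons magnus_letter_def)
 qed
 \<comment> \<open>Prefixing the letter \<open>i\<close> lengthens a word by one, hence the bound
   \<open>Suc n\<close> on the left.\<close>
 have shift: "(\<Sum>w\<in>words A (Suc n). (if w \<noteq> [] \<and> hd w = i then c (tl w) else 0) * coeff (monomial Y w) v)
  = (\<Sum>w\<in>words A n. c w * coeff (Y i * monomial Y w) v)"
 proof -
  have "(\<Sum>w\<in>words A (Suc n). (if w \<noteq> [] \<and> hd w = i then c (tl w) else 0) * coeff (monomial Y w) v)
   = (\<Sum>w\<in>(#) i ` words A n. (if w \<noteq> [] \<and> hd w = i then c (tl w) else 0) * coeff (monomial Y w) v)"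
  proof (rule sum.mono_neutral_right[OF finite_words[OF A]])
   show "(#) i ` words A n \<subseteq> words A (Suc n)" using i by (auto simp: words_def)
   show "\<forall>w\<in>words A (Suc n) - (#) i ` words A n. (if w \<noteq> [] \<and> hd w = i then c (tl w) else 0) * coeff (monomial Y w) v = 0"
   proof
    fix w assume w: "w \<in> words A (Suc n) - (#) i ` words A n"
    have "\<not> (w \<noteq> [] \<and> hd w = i)"
    proof
     assume a: "w \<noteq> [] \<and> hd w = i"
     then have "w = i # tl w" by (metis list.collapse)
     moreover from this have "tl w \<in> words A n" using w a by (cases w) (auto simp: words_def)
     ultimately show False using w by (metis DiffD2 imageI)
    qed
    then show "(if w \<noteq> [] \<and> hd w = i then c (tl w) else 0) * coeff (monomial Y w) v = 0"
     by (simp only: if_False mult_zero_left)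
   qed
  qed
  also have "\<dots> = (\<Sum>w\<in>words A n. c w * coeff (Y i * monomial Y w) v)"
   by (subst sum.reindex) (auto simp: inj_on_def)
  finally show ?thesis .
 qed
 have Ys: "coeff (Y i * subst A Y c) v = (\<Sum>w\<in>words A n. c w * coeff (Y i * monomial Y w) v)"
 proof -
  have "coeff (Y i * subst A Y c) v = (\<Sum>k\<le>n. \<Sum>w\<in>words A n. c w * (coeff (Y i) (take k v) * coeff (monomial Y w) (drop k v)))"
   unfolding coeff_times n_def
  proof (intro sum.cong refl)
   fix k
   have "coeff (subst A Y c) (drop k v) = (\<Sum>w\<in>words A (length v). c w * coeff (monomial Y w) (drop k v))"
    by (rule coeff_subst[of Y, OF Y A]) simp
   then show "coeff (Y i) (take k v) * coeff (subst A Y c) (drop k v) =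
     (\<Sum>w\<in>words A (length v). c w * (coeff (Y i) (take k v) * coeff (monomial Y w) (drop k v)))"
    by (simp only: sum_distrib_left mult.left_commute)
  qed
  also have "\<dots> = (\<Sum>w\<in>words A n. \<Sum>k\<le>n. c w * (coeff (Y i) (take k v) * coeff (monomial Y w) (drop k v)))"
   by (rule sum.swap)
  finally show ?thesis by (simp only: coeff_times n_def sum_distrib_left)
 qed
 have "coeff (subst A Y ?m) v = (\<Sum>w\<in>words A (Suc n). ?m w * coeff (monomial Y w) v)"
  by (rule coeff_subst[of Y, OF Y A]) (simp add: n_def)
 also have "\<dots> = (\<Sum>w\<in>words A (Suc n). c w * coeff (monomial Y w) v) +
   (\<Sum>w\<in>words A (Suc n). (if w \<noteq> [] \<and> hd w = i then c (tl w) else 0) * coeff (monomial Y w) v)"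
  unfolding m distrib_right by (rule sum.distrib)
 also have "(\<Sum>w\<in>words A (Suc n). c w * coeff (monomial Y w) v) = coeff (subst A Y c) v"
  by (rule coeff_subst[of Y, OF Y A, symmetric]) (simp add: n_def)
 finally show "coeff (subst A Y ?m) v = coeff ((1 + Y i) * subst A Y c) v"
  unfolding shift Ys[symmetric] by (simp only: distrib_right mult_1_left coeff_simps)
qed

lemma subst_magnus:
 fixes g :: "nat => mag"
 assumes A: "finite A" and w: "fst ` set w \<subseteq> A"
 shows "subst A (\<lambda>k. ser (g k) + 1) (magnus2 w) = ser (ev g w)"
 using w
proof (induction w)
 case Nil
 show ?case
 proof (rule ncs_eqI)
  fix v :: "nat list"
  have "(\<Sum>w\<in>words A (length v). nc_one w * coeff (monomial (\<lambda>k. ser (g k) + 1) w) v) =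
   (\<Sum>w\<in>{[]}. nc_one w * coeff (monomial (\<lambda>k. ser (g k) + 1) w) v)"
   by (rule sum.mono_neutral_right[OF finite_words[OF A]]) (auto simp: words_def nc_one_def)
  then show "coeff (subst A (\<lambda>k. ser (g k) + 1) (magnus2 [])) v = coeff (ser (ev g [])) v"
   by (simp add: subst_def magnus2_def ser_zero nc_one_def)
 qed
next
 case (Cons l w)
 obtain i e where l: "l = (i, e)" by (cases l)
 have i: "i \<in> A" using Cons.prems l by auto
 have Y0: "coeff (ser (g k) + 1) [] = 0" for k by (simp add: coeff_simps)
 have Y1: "1 + (ser (g i) + 1) = ser (g i)" by (metis add.commute add.assoc ncs_add_self(1) add_0_right)
 have IH: "subst A (\<lambda>k. ser (g k) + 1) (magnus2 w) = ser (ev g w)" using Cons by simp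
 have cons: "magnus2 (l # w) = nc_mult (magnus_letter l) (magnus2 w)" by (simp add: magnus2_def)
 show ?case
 proof (cases e)
  case True
  then have m: "magnus2 (l # w) = nc_mult (magnus_letter (i, True)) (magnus2 w)" using cons l by simp
  show ?thesis
   unfolding m subst_gen_mult[of "\<lambda>k. ser (g k) + 1", OF Y0 A i] IH Y1
   using True by (simp add: l ev_Cons ser_plus)
 next
  case False
  then have m: "magnus2 (l # w) = nc_mult (magnus_letter (i, False)) (magnus2 w)" using cons l by simp
  have inv: "nc_mult (magnus_letter (i, True)) (magnus_letter (i, False)) = nc_one"
   using magnus_letter_inverse[of "(i, True)"] by (simp add: letter_inv_def)
  \<comment> \<open>Multiplying by 1 + X_i removes the inverse letter; the factor is then inverted
    on the side of the values.\<close>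
  have "nc_mult (magnus_letter (i, True)) (magnus2 (l # w)) = magnus2 w"
   unfolding m nc_mult_assoc[symmetric] inv by (rule nc_mult_one_left)
  then have "ser (g i) * subst A (\<lambda>k. ser (g k) + 1) (magnus2 (l # w)) = ser (ev g w)"
   using subst_gen_mult[of "\<lambda>k. ser (g k) + 1", OF Y0 A i, where c = "magnus2 (l # w)"] IH by (simp add: Y1)
  then have "ser (- g i) * ser (g i) * subst A (\<lambda>k. ser (g k) + 1) (magnus2 (l # w)) = ser (- g i) * ser (ev g w)"
   by (simp add: mult.assoc)
  then show ?thesis unfolding ser_uminus using False by (simp add: l ev_Cons ser_plus[symmetric])
 qed
qed

text \<open>As \<open>Y k\<close> begins with the variable \<open>k\<close>, the lowest part of a
  monomial in the \<open>Y k\<close> is the word itself.\<close>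

lemma monomial_leading:
 assumes Y0: "!!k. coeff (Y k) [] = 0" and Y1: "!!k x. coeff (Y k) [x] = (if x = k then 1 else 0)"
 shows "length v = length w ==> coeff (monomial Y w) v = (if v = w then 1 else 0)"
proof (induction w arbitrary: v)
 case Nil
 then show ?case by (simp add: coeff_simps)
next
 case (Cons k w)
 then obtain x v' where v: "v = x # v'" "length v' = length w" by (cases v) auto
 have "coeff (Y k * monomial Y w) v = (\<Sum>n\<in>{1}. coeff (Y k) (take n v) * coeff (monomial Y w) (drop n v))"
  unfolding coeff_times
 proof (rule sum.mono_neutral_right)
  show "\<forall>n\<in>{..length v} - {1}. coeff (Y k) (take n v) * coeff (monomial Y w) (drop n v) = 0"
  proof
   fix n assume n: "n \<in> {..length v} - {1}"
   show "coeff (Y k) (take n v) * coeff (monomial Y w) (drop n v) = 0"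
   proof (cases "n = 0")
    case True
    then show ?thesis using Y0 by simp
   next
    case False
    then have "length (drop n v) < length w" using n v by auto
    then show ?thesis using monomial_low[of Y, OF Y0] by simp
   qed
  qed
 qed (use v in auto)
 also have "\<dots> = (if v = k # w then 1 else 0)" using Cons.IH[OF v(2)] by (simp add: v(1) Y1)
 finally show ?case by simp
qed

text \<open>The parts of \<open>v\<close> contributed by the factors share no letter, and each
  contains the letter of its factor.\<close>

lemma monomial_distinct:
 assumes Y: "!!k. Y k \<in> meets k"
 shows "coeff (monomial Y w) v \<noteq> 0 ==> distinct v ==> distinct w \<and> set w \<subseteq> set v"
proof (induction w arbitrary: v)
 case (Cons k w)
 have "coeff (Y k * monomial Y w) v \<noteq> 0" using Cons.prems(1) by simp
 then obtain n where n: "coeff (Y k) (take n v) \<noteq> 0" "coeff (monomial Y w) (drop n v) \<noteq> 0" by (rule coeff_times_nonzero)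
 have d: "distinct (take n v @ drop n v)" using Cons.prems(2) by (simp only: append_take_drop_id)
 then have "distinct (take n v)" "distinct (drop n v)" "set (take n v) Int set (drop n v) = {}"
  unfolding distinct_append by blast+
 moreover from this have "k \<in> set (take n v)" using n(1) Y unfolding meets_def by blast
 ultimately show ?case using Cons.IH[OF n(2)] set_take_subset[of n v] set_drop_subset[of n v] by auto
qed simp

section \<open>Comparison of coefficients under substitution\<close>

lemma sum_pick:
 fixes h g :: "nat => bit"
 assumes "finite A" "x \<notin> A ==> h x = 0"
 shows "(\<Sum>a\<in>A. h a * (if x = a then g a else 0)) = h x * g x"
proof -
 have "(\<Sum>a\<in>A. h a * (if x = a then g a else 0)) = (\<Sum>a\<in>A. if x = a then h a * g a else 0)"
  by (intro sum.cong) auto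
 also have "\<dots> = (if x \<in> A then h x * g x else 0)" using assms(1) by (rule sum.delta')
 finally show ?thesis using assms(2) by auto
qed

text \<open>The terms of degree 4 that come from monomials of degree 3, one line for each of the
  three factors that may contribute its quadratic part. That part is F_k X_k^2 plus the products of
  X_k with the linear part of the conjugator \<open>u k\<close> in both orders.\<close>

definition quartic :: "(nat => nat => nat => bit) => (nat => nat => bit) => (nat => bit) => nat => nat => nat => nat => bit" where
 "quartic c u F x y z t =
  c x z t * ((if x = y then F x else 0) + u x y) + c y z t * u y x
 + (c x y t * ((if y = z then F y else 0) + u y z) + c x z t * u z y)
 + (c x y z * ((if z = t then F z else 0) + u z t) + c x y t * u t z)"

text \<open>By the relations of degree 3, on two letters all coefficients equal one value
  \<open>s\<close> or vanish, and on three distinct letters they vanish. The corrections are then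
  symmetric enough for the relations of degree 4.\<close>

lemma good_coeffs_quartic:
 assumes c: "good_coeffs c" "!!k l j. distinct [k, l, j] ==> c [k, l, j] = 0"
 shows "good_coeffs (\<lambda>w. case w of [x, y, z, t] => quartic (\<lambda>x y z. c [x, y, z]) u F x y z t | _ => 0)"
proof (rule good_coeffsI)
 fix k
 show "(case [k, k] of [x, y, z, t] => quartic (\<lambda>x y z. c [x, y, z]) u F x y z t | _ => 0) = 0 \<and>
  (case [k, k, k] of [x, y, z, t] => quartic (\<lambda>x y z. c [x, y, z]) u F x y z t | _ => 0) = 0 \<and>
  (case [k, k, k, k] of [x, y, z, t] => quartic (\<lambda>x y z. c [x, y, z]) u F x y z t | _ => 0) = 0"
  using good_coeffsD(2)[OF c(1), of k] by (simp add: quartic_def)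
next
 fix k l :: nat assume kl: "k \<noteq> l"
 have lk: "l \<noteq> k" using kl by simp
 define s where "s = c [k, k, l]"
 have e: "c [k, k, k] = 0" "c [l, l, l] = 0" "c [k, l, k] = 0" "c [l, k, l] = 0" "c [k, l, l] = s" "c [l, k, k] = s"
  "c [k, k, l] = s" "c [l, l, k] = s"
  using good_coeffsD(2,4-7)[OF c(1)] kl lk unfolding s_def by metis+
 show "(case [k, l, k] of [x, y, z, t] => quartic (\<lambda>x y z. c [x, y, z]) u F x y z t | _ => 0) = 0 \<and>
  (case [k, l, l] of [x, y, z, t] => quartic (\<lambda>x y z. c [x, y, z]) u F x y z t | _ => 0) =
  (case [l, k, k] of [x, y, z, t] => quartic (\<lambda>x y z. c [x, y, z]) u F x y z t | _ => 0) \<and>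
  (case [l, k, k] of [x, y, z, t] => quartic (\<lambda>x y z. c [x, y, z]) u F x y z t | _ => 0) =
  (case [k, k, l] of [x, y, z, t] => quartic (\<lambda>x y z. c [x, y, z]) u F x y z t | _ => 0) \<and>
  (case [k, k, l] of [x, y, z, t] => quartic (\<lambda>x y z. c [x, y, z]) u F x y z t | _ => 0) =
  (case [l, l, k] of [x, y, z, t] => quartic (\<lambda>x y z. c [x, y, z]) u F x y z t | _ => 0)"
  by simp
 show "(case [k, l, k, l] of [x, y, z, t] => quartic (\<lambda>x y z. c [x, y, z]) u F x y z t | _ => 0) =
   (case [l, k, l, k] of [x, y, z, t] => quartic (\<lambda>x y z. c [x, y, z]) u F x y z t | _ => 0) \<and>
  (case [k, k, l, l] of [x, y, z, t] => quartic (\<lambda>x y z. c [x, y, z]) u F x y z t | _ => 0) =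
   (case [l, l, k, k] of [x, y, z, t] => quartic (\<lambda>x y z. c [x, y, z]) u F x y z t | _ => 0) \<and>
  (case [k, k, k, l] of [x, y, z, t] => quartic (\<lambda>x y z. c [x, y, z]) u F x y z t | _ => 0) =
   (case [k, k, l, k] of [x, y, z, t] => quartic (\<lambda>x y z. c [x, y, z]) u F x y z t | _ => 0) \<and>
  (case [k, k, l, k] of [x, y, z, t] => quartic (\<lambda>x y z. c [x, y, z]) u F x y z t | _ => 0) =
   (case [k, l, k, k] of [x, y, z, t] => quartic (\<lambda>x y z. c [x, y, z]) u F x y z t | _ => 0) \<and>
  (case [k, l, k, k] of [x, y, z, t] => quartic (\<lambda>x y z. c [x, y, z]) u F x y z t | _ => 0) =
   (case [l, k, k, k] of [x, y, z, t] => quartic (\<lambda>x y z. c [x, y, z]) u F x y z t | _ => 0)"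
  by (simp only: list.case quartic_def e kl lk if_True if_False bit_ring simp_thms)
next
 fix k l j :: nat assume d: "distinct [k, l, j]"
 then have ne: "k \<noteq> l" "l \<noteq> k" "k \<noteq> j" "j \<noteq> k" "l \<noteq> j" "j \<noteq> l" by auto
 have e: "c [k, l, j] = 0" "c [l, k, j] = 0" "c [l, j, k] = 0" "c [k, j, l] = 0" "c [j, k, l] = 0" "c [j, l, k] = 0"
  "c [k, l, k] = 0" "c [k, j, k] = 0" "c [l, k, l] = 0"
  using c(2) good_coeffsD(4)[OF c(1)] ne by simp_all
 show "(case [k, l, k, j] of [x, y, z, t] => quartic (\<lambda>x y z. c [x, y, z]) u F x y z t | _ => 0) = 0 \<and>
  (case [k, l, j, k] of [x, y, z, t] => quartic (\<lambda>x y z. c [x, y, z]) u F x y z t | _ => 0) = 0 \<and>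
  (case [l, k, j, k] of [x, y, z, t] => quartic (\<lambda>x y z. c [x, y, z]) u F x y z t | _ => 0) = 0"
  by (simp only: list.case quartic_def e ne if_True if_False bit_ring simp_thms)
qed

text \<open>Since each \<open>Y k\<close> begins with its variable, \<open>c\<close> can be
  recovered degree by degree from the substituted series, which agrees with a member of
  \<open>magN\<close> below degree \<open>q\<close>. Degrees 1 and 2 vanish, degree 3 is that of
  \<open>n\<close>, and degree 4 differs by \<open>quartic\<close>. Words with distinct letters
  receive contributions only from shorter such words, so they vanish by induction. The bound on
  \<open>q\<close> makes degree 4 visible.\<close>

lemma subst_coefficients:
 fixes c :: nc_series and u f :: "nat => mag"
 defines "Y \<equiv> \<lambda>k. ser (- u k + f k + u k) + 1"
 assumes A: "finite A" and f: "!!k. f k \<in> single k" "!!k. coeff (ser (f k)) [k] = 1"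
  and n: "n \<in> magN" and ag: "agree q (subst A Y c) (ser n)" and q: "q \<ge> 5"
  and c: "!!w. \<not> set w \<subseteq> A ==> c w = 0"
 shows "good_coeffs c" "!!v. distinct v ==> v \<noteq> [] ==> length v < q ==> c v = 0"
proof -
 have Y0: "coeff (Y k) [] = 0" for k by (simp add: Y_def coeff_simps)
 have Y1: "coeff (Y k) [x] = (if x = k then 1 else 0)" for k x
  unfolding Y_def coeff_simps single_conj(2)[OF f(1)] f(2) by simp
 have Y2: "coeff (Y k) [x, y] = (if x = k \<and> y = k then coeff (ser (f k)) [k, k] else 0) +
   (if x = k then 1 else 0) * coeff (ser (u k)) [y] + coeff (ser (u k)) [x] * (if y = k then 1 else 0)" for k x y
  unfolding Y_def coeff_simps single_conj(3)[OF f(1)] f(2) by simp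
 have Ym: "Y k \<in> meets k" for k unfolding Y_def by (rule single_conj(1)[OF f(1)])
 \<comment> \<open>The monomials of the length of \<open>v\<close> contribute the coefficient of
   \<open>v\<close> itself. What remains comes from shorter words.\<close>
 have split: "coeff (subst A Y c) v = c v + (\<Sum>w\<in>{w \<in> words A (length v). length w < length v}. c w * coeff (monomial Y w) v)" for v
 proof -
  have "coeff (subst A Y c) v = (\<Sum>w\<in>words A (length v). c w * coeff (monomial Y w) v)"
   by (rule coeff_subst[of Y, OF Y0 A order_refl])
  also have "words A (length v) = {w \<in> words A (length v). length w = length v} \<union> {w \<in> words A (length v). length w < length v}"
   by (auto simp: words_def)
  also have "(\<Sum>w\<in>{w \<in> words A (length v). length w = length v} \<union> {w \<in> words A (length v). length w < length v}. c w * coeff (monomial Y w) v) =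
   (\<Sum>w\<in>{w \<in> words A (length v). length w = length v}. c w * coeff (monomial Y w) v) +
   (\<Sum>w\<in>{w \<in> words A (length v). length w < length v}. c w * coeff (monomial Y w) v)"
   by (rule sum.union_disjoint) (use finite_words[OF A] in auto)
  also have "(\<Sum>w\<in>{w \<in> words A (length v). length w = length v}. c w * coeff (monomial Y w) v) = c v"
  proof -
   have lead: "coeff (monomial Y w) v = (if v = w then 1 else 0)" if "length v = length w" for w
    by (rule monomial_leading[of Y v w, OF Y0 Y1 that])
   have one: "(\<Sum>w\<in>{v}. h w) = h v" for h :: "nat list => bit" by simp
   have zero: "c w * coeff (monomial Y w) v = 0" if "length w = length v" "v \<noteq> w" for w
    unfolding lead[OF that(1)[symmetric]] if_not_P[OF that(2)] by (rule mult_zero_right)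
   show ?thesis
   proof (cases "set v \<subseteq> A")
    case True
    have "(\<Sum>w\<in>{w \<in> words A (length v). length w = length v}. c w * coeff (monomial Y w) v) =
     (\<Sum>w\<in>{v}. c w * coeff (monomial Y w) v)"
    proof (rule sum.mono_neutral_right)
     show "finite {w \<in> words A (length v). length w = length v}"
      by (rule finite_subset[OF _ finite_words[OF A]]) auto
     show "{v} \<subseteq> {w \<in> words A (length v). length w = length v}" using True by (simp add: words_def)
     show "\<forall>w\<in>{w \<in> words A (length v). length w = length v} - {v}. c w * coeff (monomial Y w) v = 0"
      using zero by blast
    qed
    also have "\<dots> = c v" unfolding one lead[OF refl] by (simp only: simp_thms if_True mult_1_right)
    finally show ?thesis .
   next
    case False
    have "(\<Sum>w\<in>{w \<in> words A (length v). length w = length v}. c w * coeff (monomial Y w) v) = 0"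
    proof (rule sum.neutral, rule ballI)
     fix w assume "w \<in> {w \<in> words A (length v). length w = length v}"
     then have "length w = length v" "v \<noteq> w" using False by (auto simp: words_def)
     then show "c w * coeff (monomial Y w) v = 0" by (rule zero)
    qed
    then show ?thesis using c[OF False] by (simp only:)
   qed
  qed
  finally show ?thesis .
 qed
 have split0: "coeff (subst A Y c) v = c v" if "!!w. length w < length v ==> c w * coeff (monomial Y w) v = 0" for v
 proof -
  have "(\<Sum>w\<in>{w \<in> words A (length v). length w < length v}. c w * coeff (monomial Y w) v) = 0"
   by (rule sum.neutral) (use that in blast)
  then show ?thesis unfolding split by (simp only: add_0_right)
 qed
 have agn: "coeff (subst A Y c) v = coeff (ser n) v" if "length v < q" for v
  using ag that by (simp add: agree_def)
 show dist: "c v = 0" if "distinct v" "v \<noteq> []" "length v < q" for v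
  using that
 proof (induction "length v" arbitrary: v rule: less_induct)
  case (less v)
  have "c w * coeff (monomial Y w) v = 0" if w: "length w < length v" for w
  proof (cases "w = [] \<or> coeff (monomial Y w) v = 0")
   case True
   then show ?thesis using less.prems(2) by (auto simp: coeff_simps)
  next
   case False
   then have "distinct w" using monomial_distinct[of Y w v, OF Ym] less.prems(1) by blast
   then have "c w = 0" using less.hyps[OF w] False w less.prems(3) by simp
   then show ?thesis by simp
  qed
  then have "coeff (subst A Y c) v = c v" by (rule split0)
  then show ?case using agn[OF less.prems(3)] magN_distinct[OF n less.prems(2,1)] by simp
 qed
 have c1: "c [x] = 0" for x by (rule dist) (use q in auto)
 have eq1: "c v = coeff (ser n) v" if v: "v \<noteq> []" "length v < q" "!!w. w \<noteq> [] ==> length w < length v ==> c w = 0" for v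
 proof -
  have "c w * coeff (monomial Y w) v = 0" if w: "length w < length v" for w
   using v(1) v(3)[OF _ w] by (cases "w = []") (auto simp: coeff_simps)
  then have "coeff (subst A Y c) v = c v" by (rule split0)
  then show ?thesis using agn[OF v(2)] by simp
 qed
 have c2: "c [x, y] = 0" for x y
 proof -
  have "c [x, y] = coeff (ser n) [x, y]"
  proof (rule eq1)
   fix w :: "nat list" assume "w \<noteq> []" "length w < length [x, y]"
   then obtain a where "w = [a]" by (cases w) auto
   then show "c w = 0" using c1 by simp
  qed (use q in auto)
  then show ?thesis using magN_low(2)[OF n] by simp
 qed
 have c12: "c w = 0" if "w \<noteq> []" "length w < 3" for w
 proof -
  have "length w \<noteq> 0" using that(1) by simp
  then have "length w = 1 \<or> length w = 2" using that(2) by linarith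
  then show ?thesis using c1 c2 by (auto simp: length_Suc_conv numeral_2_eq_2)
 qed
 have c3: "c [x, y, z] = coeff (ser n) [x, y, z]" for x y z
  by (rule eq1) (use q c12 in auto)
 define U where "U k x = coeff (ser (u k)) [x]" for k x
 define F where "F k = coeff (ser (f k)) [k, k]" for k
 have Y2': "coeff (Y k) [x, y] = (if x = k then (if k = y then F k else 0) + U k y else 0) + (if y = k then U k x else 0)" for k x y
  by (cases "x = k"; cases "y = k") (simp_all add: Y2 U_def F_def)
 have c4: "c [x, y, z, t] = coeff (ser n) [x, y, z, t] + quartic (\<lambda>x y z. c [x, y, z]) U F x y z t" for x y z t
 proof -
  let ?v = "[x, y, z, t]"
  \<comment> \<open>Four letters distributed over three factors: exactly one factor takes two of
    them.\<close>
  have mono: "coeff (monomial Y [a, b, d]) ?v = coeff (Y a) [x, y] * ((if z = b then 1 else 0) * (if t = d then 1 else 0))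
   + (if x = a then 1 else 0) * (coeff (Y b) [y, z] * (if t = d then 1 else 0))
   + (if x = a then 1 else 0) * ((if y = b then 1 else 0) * coeff (Y d) [z, t])" for a b d
   by (simp only: monomial.simps mult_1_right[where 'a = ncs] coeff_mult Y0 Y1 bit_ring)
  have "(\<Sum>w\<in>{w \<in> words A (length ?v). length w < length ?v}. c w * coeff (monomial Y w) ?v)
   = (\<Sum>w\<in>(\<lambda>(a, b, d). [a, b, d]) ` (A \<times> A \<times> A). c w * coeff (monomial Y w) ?v)"
  proof (rule sum.mono_neutral_right)
   show "finite {w \<in> words A (length ?v). length w < length ?v}" using finite_words[OF A] by simp
   show "(\<lambda>(a, b, d). [a, b, d]) ` (A \<times> A \<times> A) \<subseteq> {w \<in> words A (length ?v). length w < length ?v}"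
    by (auto simp: words_def)
   show "\<forall>w\<in>{w \<in> words A (length ?v). length w < length ?v} - (\<lambda>(a, b, d). [a, b, d]) ` (A \<times> A \<times> A).
     c w * coeff (monomial Y w) ?v = 0"
   proof
    fix w assume w: "w \<in> {w \<in> words A (length ?v). length w < length ?v} - (\<lambda>(a, b, d). [a, b, d]) ` (A \<times> A \<times> A)"
    have "length w \<noteq> 3"
    proof
     assume "length w = 3"
     then obtain a b d where abd: "w = [a, b, d]" by (auto simp: length_Suc_conv numeral_3_eq_3)
     have "w = (\<lambda>(a, b, d). [a, b, d]) (a, b, d)" "(a, b, d) \<in> A \<times> A \<times> A" using w abd by (auto simp: words_def)
     then show False using w by blast
    qed
    then have "length w < 3" using w by auto
    then show "c w * coeff (monomial Y w) ?v = 0"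
     using c12[of w] by (cases "w = []") (auto simp: coeff_simps)
   qed
  qed
  also have "\<dots> = (\<Sum>(a, b, d)\<in>A \<times> A \<times> A. c [a, b, d] * coeff (monomial Y [a, b, d]) ?v)"
  proof -
   have inj: "inj_on (\<lambda>(a, b, d). [a, b, d]) (A \<times> A \<times> A)" by (auto simp: inj_on_def)
   show ?thesis unfolding sum.reindex[OF inj] by (simp only: comp_def case_prod_unfold)
  qed
  also have "\<dots> = (\<Sum>a\<in>A. \<Sum>b\<in>A. \<Sum>d\<in>A. c [a, b, d] * coeff (monomial Y [a, b, d]) ?v)"
   by (simp only: sum.cartesian_product case_prod_unfold fst_conv snd_conv)
  also have "\<dots> = (\<Sum>a\<in>A. \<Sum>b\<in>A. \<Sum>d\<in>A. coeff (Y a) [x, y] * ((if z = b then 1 else 0) * (c [a, b, d] * (if t = d then 1 else 0))))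
   + (\<Sum>a\<in>A. \<Sum>b\<in>A. \<Sum>d\<in>A. (if x = a then 1 else 0) * (coeff (Y b) [y, z] * (c [a, b, d] * (if t = d then 1 else 0))))
   + (\<Sum>a\<in>A. \<Sum>b\<in>A. \<Sum>d\<in>A. (if x = a then 1 else 0) * ((if y = b then 1 else 0) * (c [a, b, d] * coeff (Y d) [z, t])))"
   unfolding mono distrib_left sum.distrib by (simp only: mult.assoc mult.commute mult.left_commute)
  also have "\<dots> = (\<Sum>a\<in>A. c [a, z, t] * coeff (Y a) [x, y]) + (\<Sum>b\<in>A. c [x, b, t] * coeff (Y b) [y, z]) + (\<Sum>d\<in>A. c [x, y, d] * coeff (Y d) [z, t])"
  proof -
   have out: "c [a, b, d] = 0" if "a \<notin> A \<or> b \<notin> A \<or> d \<notin> A" for a b d using c[of "[a, b, d]"] that by auto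
   have p: "(\<Sum>a\<in>A. (if x0 = a then 1 else 0) * G a) = G x0" if G: "x0 \<notin> A ==> G x0 = 0" for x0 and G :: "nat => bit"
   proof -
    have "(\<Sum>a\<in>A. G a * (if x0 = a then 1 else 0)) = G x0 * 1" by (rule sum_pick[OF A]) (erule G)
    then show ?thesis by (simp only: mult_1_left mult_1_right mult.commute)
   qed
   have p3: "(\<Sum>d\<in>A. c [a, b, d] * (if t = d then 1 else 0)) = c [a, b, t]" for a b
   proof -
    have "(\<Sum>d\<in>A. c [a, b, d] * (if t = d then 1 else 0)) = c [a, b, t] * 1"
     by (rule sum_pick[OF A]) (use out in blast)
    then show ?thesis by (simp only: mult_1_right)
   qed
   have pz: "(\<Sum>b\<in>A. (if z = b then 1 else 0) * c [a, b, t]) = c [a, z, t]" for a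
    by (rule p) (use out in blast)
   have px: "(\<Sum>a\<in>A. (if x = a then 1 else 0) * (\<Sum>b\<in>A. coeff (Y b) [y, z] * c [a, b, t])) = (\<Sum>b\<in>A. coeff (Y b) [y, z] * c [x, b, t])"
   proof (rule p)
    assume "x \<notin> A"
    then have "c [x, b, t] = 0" for b using out by blast
    then show "(\<Sum>b\<in>A. coeff (Y b) [y, z] * c [x, b, t]) = 0" by (simp only: mult_zero_right sum.neutral_const)
   qed
   have py: "(\<Sum>b\<in>A. (if y = b then 1 else 0) * (\<Sum>d\<in>A. c [a, b, d] * coeff (Y d) [z, t])) = (\<Sum>d\<in>A. c [a, y, d] * coeff (Y d) [z, t])" for a
   proof (rule p)
    assume "y \<notin> A"
    then have "c [a, y, d] = 0" for d using out by blast
    then show "(\<Sum>d\<in>A. c [a, y, d] * coeff (Y d) [z, t]) = 0" by (simp only: mult_zero_left sum.neutral_const)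
   qed
   have pxy: "(\<Sum>a\<in>A. (if x = a then 1 else 0) * (\<Sum>d\<in>A. c [a, y, d] * coeff (Y d) [z, t])) = (\<Sum>d\<in>A. c [x, y, d] * coeff (Y d) [z, t])"
   proof (rule p)
    assume "x \<notin> A"
    then have "c [x, y, d] = 0" for d using out by blast
    then show "(\<Sum>d\<in>A. c [x, y, d] * coeff (Y d) [z, t]) = 0" by (simp only: mult_zero_left sum.neutral_const)
   qed
   have "(\<Sum>a\<in>A. \<Sum>b\<in>A. \<Sum>d\<in>A. coeff (Y a) [x, y] * ((if z = b then 1 else 0) * (c [a, b, d] * (if t = d then 1 else 0))))
    = (\<Sum>a\<in>A. c [a, z, t] * coeff (Y a) [x, y])"
    unfolding sum_distrib_left[symmetric] p3 pz by (simp only: mult.commute)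
   moreover have "(\<Sum>a\<in>A. \<Sum>b\<in>A. \<Sum>d\<in>A. (if x = a then 1 else 0) * (coeff (Y b) [y, z] * (c [a, b, d] * (if t = d then 1 else 0))))
    = (\<Sum>b\<in>A. c [x, b, t] * coeff (Y b) [y, z])"
    unfolding sum_distrib_left[symmetric] p3 px by (simp only: mult.commute)
   moreover have "(\<Sum>a\<in>A. \<Sum>b\<in>A. \<Sum>d\<in>A. (if x = a then 1 else 0) * ((if y = b then 1 else 0) * (c [a, b, d] * coeff (Y d) [z, t])))
    = (\<Sum>d\<in>A. c [x, y, d] * coeff (Y d) [z, t])"
    unfolding sum_distrib_left[symmetric] py pxy ..
   ultimately show ?thesis by (simp only:)
  qed
  also have "\<dots> = quartic (\<lambda>x y z. c [x, y, z]) U F x y z t"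
  proof -
   have pick: "(\<Sum>a\<in>A. h a * coeff (Y a) [x', y']) = h x' * ((if x' = y' then F x' else 0) + U x' y') + h y' * U y' x'"
    if h: "!!a. a \<notin> A ==> h a = 0" for h x' y'
   proof -
    have "(\<Sum>a\<in>A. h a * coeff (Y a) [x', y']) =
     (\<Sum>a\<in>A. h a * (if x' = a then (if a = y' then F a else 0) + U a y' else 0) + h a * (if y' = a then U a x' else 0))"
     by (intro sum.cong refl) (simp only: Y2' distrib_left)
    also have "\<dots> = (\<Sum>a\<in>A. h a * (if x' = a then (if a = y' then F a else 0) + U a y' else 0)) + (\<Sum>a\<in>A. h a * (if y' = a then U a x' else 0))"
     by (rule sum.distrib)
    also have "(\<Sum>a\<in>A. h a * (if x' = a then (if a = y' then F a else 0) + U a y' else 0)) = h x' * ((if x' = y' then F x' else 0) + U x' y')"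
     by (rule sum_pick[where x = x' and h = h, OF A h])
    also have "(\<Sum>a\<in>A. h a * (if y' = a then U a x' else 0)) = h y' * U y' x'"
     by (rule sum_pick[where x = y' and h = h, OF A h])
    finally show ?thesis .
   qed
   have out: "c [a, b, d] = 0" if "a \<notin> A \<or> b \<notin> A \<or> d \<notin> A" for a b d using c[of "[a, b, d]"] that by auto
   show ?thesis unfolding quartic_def
    using pick[of "\<lambda>a. c [a, z, t]" x y] pick[of "\<lambda>b. c [x, b, t]" y z] pick[of "\<lambda>d. c [x, y, d]" z t] out
    by (simp only: simp_thms)
  qed
  finally have "coeff (subst A Y c) ?v = c ?v + quartic (\<lambda>x y z. c [x, y, z]) U F x y z t" unfolding split by (simp only:)
  moreover have "coeff (subst A Y c) ?v = coeff (ser n) ?v" by (rule agn) (use q in simp)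
  ultimately have e: "coeff (ser n) ?v = c ?v + quartic (\<lambda>x y z. c [x, y, z]) U F x y z t" by (simp only:)
  show ?thesis unfolding e by (simp only: bit_ring)
 qed
 have ng: "good_coeffs (coeff (ser n))" using n by (simp add: magN_def)
 have "good_coeffs (\<lambda>w. case w of [x, y, z, t] => quartic (\<lambda>x y z. coeff (ser n) [x, y, z]) U F x y z t | _ => 0)"
  by (rule good_coeffs_quartic[OF ng]) (rule magN_distinct[OF n], auto)
 from good_coeffs_add[OF ng this] show "good_coeffs c"
  by (rule good_coeffs_cong) (use c2 magN_low(2)[OF n] c3 c4 in simp_all)
qed

theorem theorem3p1:
 fixes n q m i :: nat
  and L :: "nat \<Rightarrow> real \<Rightarrow> complex \<times> complex"
  and D :: link_diagram
  and c :: "nat list \<Rightarrow> bit"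
 assumes n: "n \<ge> 8" "\<exists>e. n = 2 ^ e"
  and q: "q \<ge> 5"
  and link: "is_link S3 m L"
  and diagram: "is_diagram_of D m L"
  and i: "i \<in> {1..m}"
  and c_def: "c = magnus2 (commutator (free_group {1..m}) (gen i) (eta D q (longitude D i)))"
  and equiv: "four_equivalent m L trivial_link"
 shows "(\<forall>k\<in>{1..m}. c [k] = 0 \<and> c [k, k] = 0 \<and> c [k, k, k] = 0 \<and> c [k, k, k, k] = 0) \<and>
  (\<forall>k\<in>{1..m}. \<forall>l\<in>{1..m}. k \<noteq> l \<longrightarrow>
   c [k, l, l] = c [l, k, k] \<and> c [l, k, k] = c [k, k, l] \<and> c [k, k, l] = c [l, l, k]) \<and>
  (\<forall>k\<in>{1..m}. \<forall>l\<in>{1..m}. k \<noteq> l \<longrightarrow>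
   c [k, l, k, l] = c [l, k, l, k] \<and>
   c [k, k, l, l] = c [l, l, k, k] \<and>
   c [k, k, k, l] = c [k, k, l, k] \<and> c [k, k, l, k] = c [k, l, k, k] \<and>
   c [k, l, k, k] = c [l, k, k, k]) \<and>
  (\<forall>k1\<in>{1..m}. \<forall>k2\<in>{1..m}. \<forall>k3\<in>{1..m}. \<forall>k4\<in>{1..m}.
   c [k1, k2, k3, k4] \<noteq> 0 \<and> card {k1, k2, k3, k4} = 3 \<longrightarrow> k1 = k2 \<or> k2 = k3 \<or> k3 = k4) \<and>
  (\<forall>ks. ks \<noteq> [] \<and> set ks \<subseteq> {1..m} \<and> distinct ks \<and> length ks < min n q \<longrightarrow> c ks = 0)"
proof -
 obtain K b where K: "regular_projection m K" "isotopic_links m (\<lambda>i t. inv_stereographic (K i t)) L"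
  "\<forall>i\<in>{1..m}. b i \<notin> under_params m K b i" "D = projection_diagram m K b"
  using diagram unfolding is_diagram_of_def by (elim exE conjE) (rule that)
 have comp: "components D = m" by (simp add: K(4) projection_diagram_def)
 obtain \<tau> where "mq.link_rep UNIV m (\<lambda>i. range (K i)) \<tau>"
  using mq.regular_projection_rep[OF K(1) K(2) link equiv] by (elim exE) (rule that)
 then obtain x where x: "!!i. i \<in> {1..m} ==> x (i, 1) \<in> mq.conj_class i" "!!i. i \<in> {1..m} ==> mq_theta i (x (i, 1)) = 1"
  and col: "coloured_diagram D x"
 proof (rule meridian_data.diagram_colouring[OF mq.meridian_data_axioms K(1), of \<tau> b])
  show "b i \<notin> under_params m K b i" if "i \<in> {1..m}" for i using K(3) that by blast
  fix x assume x: "!!i. i \<in> {1..m} ==> x (i, 1) \<in> mq.conj_class i" "!!i. i \<in> {1..m} ==> mq_theta i (x (i, 1)) = 1"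
   "!!i j. i \<in> {1..m} ==> 1 \<le> j ==> j \<le> under_crossings (projection_diagram m K b) i ==>
    over_arc (projection_diagram m K b) i j \<in> arcs (projection_diagram m K b)"
   "!!i j. i \<in> {1..m} ==> 1 \<le> j ==> j \<le> under_crossings (projection_diagram m K b) i ==>
    crossing_sign (projection_diagram m K b) i j = 1 \<or> crossing_sign (projection_diagram m K b) i j = -1"
   "!!i j. i \<in> {1..m} ==> 1 \<le> j ==> j \<le> under_crossings (projection_diagram m K b) i ==>
    x (i, j mod under_crossings (projection_diagram m K b) i + 1) =
    (if crossing_sign (projection_diagram m K b) i j = 1
    then - x (over_arc (projection_diagram m K b) i j) + x (i, j) + x (over_arc (projection_diagram m K b) i j)
    else x (over_arc (projection_diagram m K b) i j) + x (i, j) - x (over_arc (projection_diagram m K b) i j))"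
  have "coloured_diagram D x"
   by unfold_locales (unfold comp K(4)[symmetric], (rule x(3-5)[folded K(4)]; assumption)+)
  with x(1,2) show thesis by (rule that)
 qed
 interpret coloured_diagram D x by (rule col)
 define y where "y i = x (i, 1)" for i
 define W where "W = commutator (free_group {1..m}) (gen i) (eta D q (longitude D i))"
 have q1: "1 \<le> q" using q by simp
 have triv: "mq_cong q (ev y W) 0"
  using commutator_trivial[of i q] i q1 unfolding comp W_def y_def[abs_def] by blast
 have W: "fst ` set W \<subseteq> {1..m}"
 proof (rule carrier_letters)
  interpret M: group "free_group {1..m}" by (rule group_free_group)
  have "longitude D i \<in> carrier (free_group (arcs D))"
   unfolding longitude_def by (rule partial_longitude_carrier) (use i comp in auto)
  then have eta: "eta D q (longitude D i) \<in> carrier (free_group {1..m})"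
   using eta_ev[OF q1 carrier_letters, of "longitude D i" y] comp by simp
  then show "W \<in> carrier (free_group {1..m})"
   unfolding W_def commutator_def by (intro M.m_closed M.inv_closed eta gen_carrier[OF i])
 qed
 \<comment> \<open>Lifts of the meridians to conjugates of series in one variable with linear
   coefficient 1. Indices that belong to no component get an arbitrary meridian, so that
   \<open>u\<close> and \<open>f\<close> are total functions.\<close>
 have "\<exists>u f. f \<in> single k \<and> coeff (ser f) [k] = 1 \<and> (k \<in> {1..m} --> proj (- u + f + u) = y k)" for k
 proof (cases "k \<in> {1..m}")
  case True
  obtain a h where h: "y k = - a + h + a" "h \<in> mq_H k" using x(1)[OF True] by (auto simp: mq.conj_class_def y_def)
  obtain f where f: "f \<in> single k" "h = proj f" using h(2) by (auto simp: mq_H_def)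
  obtain u where u: "proj u = a" using proj_surj by metis
  have "mq_theta k (y k) = mq_theta k h"
   unfolding h(1) mq.\<theta>_add mq.\<theta>_minus by (simp only: bit_ring)
  then have "coeff (ser f) [k] = 1" using x(2)[OF True] by (simp add: y_def f(2) mq_theta_proj)
  then show ?thesis using f h(1) u by (intro exI[of _ u] exI[of _ f]) (simp add: proj_simps)
 next
  case False
  obtain h where "h \<in> mq_H k" "mq_theta k h = 1" using mq.ex_meridian by blast
  then obtain f where "f \<in> single k" "coeff (ser f) [k] = 1" by (auto simp: mq_H_def mq_theta_proj)
  then show ?thesis using False by blast
 qed
 then obtain u f where f: "!!k. f k \<in> single k" "!!k. coeff (ser (f k)) [k] = 1"
  and uf: "!!k. k \<in> {1..m} ==> proj (- u k + f k + u k) = y k" by metis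
 define g where "g k = - u k + f k + u k" for k
 have "proj (ev g w) = ev y w" if "fst ` set w \<subseteq> {1..m}" for w
  using that
 proof (induction w)
  case (Cons l w)
  then show ?case using uf[of "fst l"] by (cases l) (auto simp: ev_Cons proj_simps g_def)
 qed (simp add: proj_simps)
 then have pF: "proj (ev g W) = ev y W" using W by blast
 \<comment> \<open>The representative \<open>F\<close> need not be the lift \<open>ev g W\<close>
   obtained from the chosen meridians. They differ by \<open>r\<close> in \<open>magN\<close>, which
   is absorbed into the comparison series \<open>n' + r\<close>.\<close>
 obtain F n' where F: "proj F = ev y W" "proj n' = 0" "agree q (ser F) (ser n')"
  using triv unfolding mq_cong_def by blast
 have n': "n' \<in> magN" using F(2) proj_eq_iff[of 0 n'] by (simp add: proj_simps)
 define r where "r = - F + ev g W"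
 have r: "r \<in> magN" using pF F(1) unfolding r_def proj_eq_iff[symmetric] by simp
 have "ev g W = F + r" by (simp add: r_def)
 then have "agree q (ser (ev g W)) (ser (n' + r))"
  using agree_mult[OF F(3), of "ser r" "ser r"] by (simp add: ser_plus agree_def)
 then have ag: "agree q (subst {1..m} (\<lambda>k. ser (- u k + f k + u k) + 1) (magnus2 W)) (ser (n' + r))"
  using subst_magnus[OF _ W, of g] by (simp add: g_def)
 \<comment> \<open>Substitution sees only words in the letters up to \<open>m\<close>. Cutting off
   the other coefficients lets the comparison apply to all words.\<close>
 define c' where "c' w = (if set w \<subseteq> {1..m} then c w else 0)" for w
 have "subst {1..m} Y c' = subst {1..m} Y (magnus2 W)" for Y
  unfolding subst_def c'_def c_def W_def by (intro arg_cong[of _ _ Ncs] ext sum.cong) (auto simp: words_def)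
 then have ag': "agree q (subst {1..m} (\<lambda>k. ser (- u k + f k + u k) + 1) c') (ser (n' + r))" using ag by simp
 have out: "\<not> set w \<subseteq> {1..m} ==> c' w = 0" for w by (simp add: c'_def)
 have good: "good_coeffs c'"
  by (rule subst_coefficients(1)[OF _ f magN_add[OF n' r] ag' q out]) simp
 have dist: "c' v = 0" if "distinct v" "v \<noteq> []" "length v < q" for v
  by (rule subst_coefficients(2)[OF _ f magN_add[OF n' r] ag' q out that]) simp
 have cc: "c w = c' w" if "set w \<subseteq> {1..m}" for w using that by (simp add: c'_def)
 show ?thesis
 proof (intro conjI)
  show "\<forall>k\<in>{1..m}. c [k] = 0 \<and> c [k, k] = 0 \<and> c [k, k, k] = 0 \<and> c [k, k, k, k] = 0"
  proof
   fix k assume k: "k \<in> {1..m}"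
   have "c' [k] = 0" by (rule dist) (use q in auto)
   then show "c [k] = 0 \<and> c [k, k] = 0 \<and> c [k, k, k] = 0 \<and> c [k, k, k, k] = 0"
    using good_coeffsD(1-3)[OF good, of k] cc[of "[k]"] cc[of "[k, k]"] cc[of "[k, k, k]"] cc[of "[k, k, k, k]"] k by simp
  qed
  show "\<forall>k\<in>{1..m}. \<forall>l\<in>{1..m}. k \<noteq> l --> c [k, l, l] = c [l, k, k] \<and> c [l, k, k] = c [k, k, l] \<and> c [k, k, l] = c [l, l, k]"
  proof (intro ballI impI)
   fix k l assume "k \<in> {1..m}" "l \<in> {1..m}" and kl: "k \<noteq> l"
   then have "c [a, b, d] = c' [a, b, d]" if "{a, b, d} \<subseteq> {k, l}" for a b d using cc[of "[a, b, d]"] that by auto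
   then show "c [k, l, l] = c [l, k, k] \<and> c [l, k, k] = c [k, k, l] \<and> c [k, k, l] = c [l, l, k]"
    using good_coeffsD(5-7)[OF good kl] by simp
  qed
  show "\<forall>k\<in>{1..m}. \<forall>l\<in>{1..m}. k \<noteq> l --> c [k, l, k, l] = c [l, k, l, k] \<and> c [k, k, l, l] = c [l, l, k, k] \<and>
   c [k, k, k, l] = c [k, k, l, k] \<and> c [k, k, l, k] = c [k, l, k, k] \<and> c [k, l, k, k] = c [l, k, k, k]"
  proof (intro ballI impI)
   fix k l assume "k \<in> {1..m}" "l \<in> {1..m}" and kl: "k \<noteq> l"
   then have "c [a, b, d, e] = c' [a, b, d, e]" if "{a, b, d, e} \<subseteq> {k, l}" for a b d e using cc[of "[a, b, d, e]"] that by auto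
   then show "c [k, l, k, l] = c [l, k, l, k] \<and> c [k, k, l, l] = c [l, l, k, k] \<and>
   c [k, k, k, l] = c [k, k, l, k] \<and> c [k, k, l, k] = c [k, l, k, k] \<and> c [k, l, k, k] = c [l, k, k, k]"
    using good_coeffsD(8-12)[OF good kl] by simp
  qed
  show "\<forall>k1\<in>{1..m}. \<forall>k2\<in>{1..m}. \<forall>k3\<in>{1..m}. \<forall>k4\<in>{1..m}.
   c [k1, k2, k3, k4] \<noteq> 0 \<and> card {k1, k2, k3, k4} = 3 --> k1 = k2 \<or> k2 = k3 \<or> k3 = k4"
  proof (intro ballI impI, rule ccontr)
   fix k1 k2 k3 k4
   assume k: "k1 \<in> {1..m}" "k2 \<in> {1..m}" "k3 \<in> {1..m}" "k4 \<in> {1..m}"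
    and a: "c [k1, k2, k3, k4] \<noteq> 0 \<and> card {k1, k2, k3, k4} = 3" and ne: "\<not> (k1 = k2 \<or> k2 = k3 \<or> k3 = k4)"
   have nz: "c' [k1, k2, k3, k4] \<noteq> 0" using a cc[of "[k1, k2, k3, k4]"] k by simp
   \<comment> \<open>Three letters in four places with no equal neighbours leave exactly one
     coincidence, at distance two or three.\<close>
   consider "k1 = k3" "distinct [k1, k2, k4]" | "k1 = k4" "distinct [k1, k2, k3]" | "k2 = k4" "distinct [k2, k1, k3]"
    using a ne by (auto simp: card_insert_if split: if_splits)
   then show False
    using nz good_coeffsD(13)[OF good, of k1 k2 k4] good_coeffsD(14)[OF good, of k1 k2 k3] good_coeffsD(15)[OF good, of k2 k1 k3]
    by cases auto
  qed
  show "\<forall>ks. ks \<noteq> [] \<and> set ks \<subseteq> {1..m} \<and> distinct ks \<and> length ks < min n q --> c ks = 0"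
   using dist cc by auto
 qed
qed

end
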